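(* Let $k$ be an arbitrary field and let $R$ be a Noetherian $\mathbb{N}$-graded $k$-algebra with $R_0=k$. Let $\mathfrak{m}$ be the unique homogeneous maximal ideal and $n=\dim R$. If $H^r_{\mathfrak{m}}(R)=\big[H^r_{\mathfrak{m}}(R)\big]_0$ for every $r<n$, then $\big[H^r(\underline{x},R)\big]_0\cong H^r_{\mathfrak{m}}(R)$ for every $r<n$ and every homogeneous system of parameters $\underline{x}=x_1,\dots,x_n$ of $R$, where $H^r(\underline{x},R)$ denotes the $r$-th Koszul cohomology of $\underline{x}$.
   Context: $[M]_0$ denotes the degree $0$ part of a graded module $M$. Koszul cohomology is graded as the cohomology of the Koszul cocomplex $0\to R\to\bigoplus_i R(d_i)\to\cdots\to R(d_1+\cdots+d_n)\to 0$, placed in cohomological degrees $0,\dots,n$, where $d_i=\deg x_i>0$. *)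

theory Defs
  imports "HOL-Algebra.Module" "HOL-Algebra.Ideal_Product" "HOL-Algebra.Ring_Divisibility" "HOL-Library.Extended_Nat"
begin

section \<open>Commutative algebra\<close>

definition krull_dim :: "('a, 'm) ring_scheme \<Rightarrow> enat" where
  "krull_dim R = (SUP l \<in> {l. \<exists>P. (\<forall>i\<le>l. primeideal (P i) R) \<and> (\<forall>i<l. P i \<subset> P (Suc i))}. enat l)"

definition ideal_radical :: "('a, 'm) ring_scheme \<Rightarrow> 'a set \<Rightarrow> 'a set" where
  "ideal_radical R J = {a \<in> carrier R. \<exists>t::nat. a [^]\<^bsub>R\<^esub> t \<in> J}"

primrec ideal_power :: "('a, 'm) ring_scheme \<Rightarrow> 'a set \<Rightarrow> nat \<Rightarrow> 'a set" where
  "ideal_power R J 0 = carrier R"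
| "ideal_power R J (Suc t) = ideal_prod R J (ideal_power R J t)"


section \<open>Graded rings and graded modules\<close>

definition direct_sum_decomp :: "('a, 'm) ring_scheme \<Rightarrow> ('i \<Rightarrow> 'a set) \<Rightarrow> bool" where
  "direct_sum_decomp G D \<longleftrightarrow>
     (\<forall>i. additive_subgroup (D i) G) \<and>
     (\<forall>v \<in> carrier G. \<exists>!f. (\<forall>i. f i \<in> D i) \<and> finite {i. f i \<noteq> \<zero>\<^bsub>G\<^esub>} \<and>
        v = (\<Oplus>\<^bsub>G\<^esub>i \<in> {i. f i \<noteq> \<zero>\<^bsub>G\<^esub>}. f i))"

definition nat_graded_ring :: "('a, 'm) ring_scheme \<Rightarrow> (nat \<Rightarrow> 'a set) \<Rightarrow> bool" where
  "nat_graded_ring R A \<longleftrightarrow>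
     cring R \<and> direct_sum_decomp R A \<and>
     (\<forall>i j. \<forall>a \<in> A i. \<forall>b \<in> A j. a \<otimes>\<^bsub>R\<^esub> b \<in> A (i + j))"

definition homogeneous_ideal :: "('a, 'm) ring_scheme \<Rightarrow> (nat \<Rightarrow> 'a set) \<Rightarrow> 'a set \<Rightarrow> bool" where
  "homogeneous_ideal R A J \<longleftrightarrow> ideal J R \<and> J = Idl\<^bsub>R\<^esub> (J \<inter> (\<Union>i. A i))"

text \<open>Modules are graded by the integers.  The fields \<open>mult\<close> and \<open>one\<close> that the library's record
  of modules inherits from rings play no role below.\<close>

record ('a, 'b) graded_module = "('a, 'b) module" +
  piece :: "int \<Rightarrow> 'b set"

definition is_graded_module ::
    "('a, 'm) ring_scheme \<Rightarrow> (nat \<Rightarrow> 'a set) \<Rightarrow> ('a, 'b) graded_module \<Rightarrow> bool" where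
  "is_graded_module R A M \<longleftrightarrow>
     module R M \<and> direct_sum_decomp M (piece M) \<and>
     (\<forall>i j. \<forall>a \<in> A i. \<forall>v \<in> piece M j. a \<odot>\<^bsub>M\<^esub> v \<in> piece M (int i + j))"

definition int_piece :: "('a, 'm) ring_scheme \<Rightarrow> (nat \<Rightarrow> 'a set) \<Rightarrow> int \<Rightarrow> 'a set" where
  "int_piece R A j = (if j < 0 then {\<zero>\<^bsub>R\<^esub>} else A (nat j))"

definition regular_module ::
    "('a, 'm) ring_scheme \<Rightarrow> (nat \<Rightarrow> 'a set) \<Rightarrow> ('a, 'a) graded_module" where
  "regular_module R A =
     \<lparr>carrier = carrier R, monoid.mult = (\<lambda>a b. a \<otimes>\<^bsub>R\<^esub> b), monoid.one = \<one>\<^bsub>R\<^esub>,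
      ring.zero = \<zero>\<^bsub>R\<^esub>, ring.add = ring.add R,
      smult = (\<lambda>a b. a \<otimes>\<^bsub>R\<^esub> b), piece = int_piece R A\<rparr>"

definition graded_hom ::
    "('a, 'm) ring_scheme \<Rightarrow> ('a, 'b) graded_module \<Rightarrow> ('a, 'c) graded_module \<Rightarrow> ('b \<Rightarrow> 'c) set" where
  "graded_hom R M N =
     {f \<in> carrier M \<rightarrow> carrier N.
        (\<forall>u \<in> carrier M. \<forall>v \<in> carrier M. f (u \<oplus>\<^bsub>M\<^esub> v) = f u \<oplus>\<^bsub>N\<^esub> f v) \<and>
        (\<forall>a \<in> carrier R. \<forall>v \<in> carrier M. f (a \<odot>\<^bsub>M\<^esub> v) = a \<odot>\<^bsub>N\<^esub> f v) \<and>
        (\<forall>j. f ` piece M j \<subseteq> piece N j)}"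

definition quotient_module :: "('a, 'b) graded_module \<Rightarrow> 'b set \<Rightarrow> ('a, 'b set) graded_module" where
  "quotient_module M B =
     \<lparr>carrier = a_rcosets\<^bsub>M\<^esub> B, monoid.mult = (\<lambda>_ _. B), monoid.one = B,
      ring.zero = B, ring.add = set_add M,
      smult = (\<lambda>a V. \<Union>v\<in>V. B +>\<^bsub>M\<^esub> (a \<odot>\<^bsub>M\<^esub> v)),
      piece = (\<lambda>j. (\<lambda>v. B +>\<^bsub>M\<^esub> v) ` piece M j)\<rparr>"


section \<open>Cohomology of a graded cochain complex\<close>

definition cocycles :: "(nat \<Rightarrow> ('a, 'b) graded_module) \<Rightarrow> (nat \<Rightarrow> 'b \<Rightarrow> 'b) \<Rightarrow> nat \<Rightarrow> 'b set" where
  "cocycles C \<delta> r = {v \<in> carrier (C r). \<delta> r v = \<zero>\<^bsub>C (Suc r)\<^esub>}"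

primrec coboundaries :: "(nat \<Rightarrow> ('a, 'b) graded_module) \<Rightarrow> (nat \<Rightarrow> 'b \<Rightarrow> 'b) \<Rightarrow> nat \<Rightarrow> 'b set" where
  "coboundaries C \<delta> 0 = {\<zero>\<^bsub>C 0\<^esub>}"
| "coboundaries C \<delta> (Suc r) = \<delta> r ` carrier (C r)"

definition graded_submodule :: "('a, 'b) graded_module \<Rightarrow> 'b set \<Rightarrow> ('a, 'b) graded_module" where
  "graded_submodule M S = M\<lparr>carrier := S, piece := (\<lambda>j. piece M j \<inter> S)\<rparr>"

definition cohomology ::
    "(nat \<Rightarrow> ('a, 'b) graded_module) \<Rightarrow> (nat \<Rightarrow> 'b \<Rightarrow> 'b) \<Rightarrow> nat \<Rightarrow> ('a, 'b set) graded_module" where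
  "cohomology C \<delta> r =
     quotient_module (graded_submodule (C r) (cocycles C \<delta> r)) (coboundaries C \<delta> r)"


section \<open>Local cohomology\<close>

text \<open>Local cohomology is the right derived functor of \<open>\<Gamma>\<^sub>m\<close> on the category of graded modules with
  degree-preserving homomorphisms; this is what puts a grading on it.  Injectivity is tested
  against all graded modules whose carriers lie in the type \<open>'c\<close> of the module itself.  For the
  modules of a resolution of \<open>R\<close> this is no restriction: \<open>R\<close> embeds into the resolution, so
  (copies of) the shifts of \<open>R\<close> and of its homogeneous ideals are among the test modules, and
  these suffice by the graded form of Baer's criterion.\<close>

definition graded_injective ::
    "('a, 'm) ring_scheme \<Rightarrow> (nat \<Rightarrow> 'a set) \<Rightarrow> ('a, 'c) graded_module \<Rightarrow> bool" where
  "graded_injective R A E \<longleftrightarrow>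
     is_graded_module R A E \<and>
     (\<forall>(M :: ('a, 'c) graded_module) (N :: ('a, 'c) graded_module) \<iota> f.
        is_graded_module R A M \<and> is_graded_module R A N \<and>
        \<iota> \<in> graded_hom R M N \<and> inj_on \<iota> (carrier M) \<and> f \<in> graded_hom R M E \<longrightarrow>
        (\<exists>g \<in> graded_hom R N E. \<forall>v \<in> carrier M. g (\<iota> v) = f v))"

definition graded_injective_resolution ::
    "('a, 'm) ring_scheme \<Rightarrow> (nat \<Rightarrow> 'a set) \<Rightarrow> ('a, 'b) graded_module \<Rightarrow> ('b \<Rightarrow> 'c) \<Rightarrow>
     (nat \<Rightarrow> ('a, 'c) graded_module) \<Rightarrow> (nat \<Rightarrow> 'c \<Rightarrow> 'c) \<Rightarrow> bool" where
  "graded_injective_resolution R A M \<epsilon> I \<delta> \<longleftrightarrow>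
     (\<forall>p. graded_injective R A (I p)) \<and>
     \<epsilon> \<in> graded_hom R M (I 0) \<and> inj_on \<epsilon> (carrier M) \<and>
     (\<forall>p. \<delta> p \<in> graded_hom R (I p) (I (Suc p))) \<and>
     \<epsilon> ` carrier M = cocycles I \<delta> 0 \<and>
     (\<forall>p. \<delta> p ` carrier (I p) = cocycles I \<delta> (Suc p))"

definition torsion_functor ::
    "('a, 'm) ring_scheme \<Rightarrow> 'a set \<Rightarrow> ('a, 'b) graded_module \<Rightarrow> ('a, 'b) graded_module" where
  "torsion_functor R J M =
     graded_submodule M {v \<in> carrier M. \<exists>t. \<forall>a \<in> ideal_power R J t. a \<odot>\<^bsub>M\<^esub> v = \<zero>\<^bsub>M\<^esub>}"

text \<open>The \<open>r\<close>-th local cohomology with support in \<open>J\<close> of the module resolved by \<open>(I, \<delta>)\<close>.\<close>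

definition local_cohomology ::
    "('a, 'm) ring_scheme \<Rightarrow> 'a set \<Rightarrow> (nat \<Rightarrow> ('a, 'c) graded_module) \<Rightarrow> (nat \<Rightarrow> 'c \<Rightarrow> 'c) \<Rightarrow>
     nat \<Rightarrow> ('a, 'c set) graded_module" where
  "local_cohomology R J I \<delta> r = cohomology (\<lambda>p. torsion_functor R J (I p)) \<delta> r"


section \<open>Koszul cohomology and systems of parameters\<close>

definition koszul_index :: "nat \<Rightarrow> nat \<Rightarrow> nat set set" where
  "koszul_index n q = {S. S \<subseteq> {..<n} \<and> card S = q}"

text \<open>The sequence is \<open>x 0, \<dots>, x (n - 1)\<close>, with \<open>x i\<close> of degree \<open>d i\<close>.  In cohomological degree \<open>q\<close> the
  cocomplex is the direct sum, over the \<open>q\<close>-element subsets \<open>S\<close> of the index set, of the shifts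
  \<open>R(d\<^sub>S)\<close> with \<open>d\<^sub>S = (\<Sum>i\<in>S. d i)\<close>, where \<open>R(e)\<close> has \<open>R\<^bsub>e + j\<^esub>\<close> as its part of degree \<open>j\<close>.\<close>

definition koszul_module ::
    "('a, 'm) ring_scheme \<Rightarrow> (nat \<Rightarrow> 'a set) \<Rightarrow> nat \<Rightarrow> (nat \<Rightarrow> nat) \<Rightarrow> nat \<Rightarrow>
     ('a, nat set \<Rightarrow> 'a) graded_module" where
  "koszul_module R A n d q =
     \<lparr>carrier = (\<Pi>\<^sub>E S \<in> koszul_index n q. carrier R),
      monoid.mult = (\<lambda>z w. \<lambda>S \<in> koszul_index n q. z S \<otimes>\<^bsub>R\<^esub> w S),
      monoid.one = (\<lambda>S \<in> koszul_index n q. \<one>\<^bsub>R\<^esub>),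
      ring.zero = (\<lambda>S \<in> koszul_index n q. \<zero>\<^bsub>R\<^esub>),
      ring.add = (\<lambda>z w. \<lambda>S \<in> koszul_index n q. z S \<oplus>\<^bsub>R\<^esub> w S),
      smult = (\<lambda>a z. \<lambda>S \<in> koszul_index n q. a \<otimes>\<^bsub>R\<^esub> z S),
      piece = (\<lambda>j. \<Pi>\<^sub>E S \<in> koszul_index n q. int_piece R A (int (\<Sum>i\<in>S. d i) + j))\<rparr>"

definition koszul_diff ::
    "('a, 'm) ring_scheme \<Rightarrow> nat \<Rightarrow> (nat \<Rightarrow> 'a) \<Rightarrow> nat \<Rightarrow> (nat set \<Rightarrow> 'a) \<Rightarrow> (nat set \<Rightarrow> 'a)" where
  "koszul_diff R n x q z =
     (\<lambda>T \<in> koszul_index n (Suc q).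
        \<Oplus>\<^bsub>R\<^esub>i \<in> T. if even (card {j \<in> T. j < i})
                 then x i \<otimes>\<^bsub>R\<^esub> z (T - {i}) else \<ominus>\<^bsub>R\<^esub> (x i \<otimes>\<^bsub>R\<^esub> z (T - {i})))"

definition koszul_cohomology ::
    "('a, 'm) ring_scheme \<Rightarrow> (nat \<Rightarrow> 'a set) \<Rightarrow> nat \<Rightarrow> (nat \<Rightarrow> 'a) \<Rightarrow> (nat \<Rightarrow> nat) \<Rightarrow> nat \<Rightarrow>
     ('a, (nat set \<Rightarrow> 'a) set) graded_module" where
  "koszul_cohomology R A n x d r = cohomology (koszul_module R A n d) (koszul_diff R n x) r"

definition homogeneous_sop ::
    "('a, 'm) ring_scheme \<Rightarrow> (nat \<Rightarrow> 'a set) \<Rightarrow> 'a set \<Rightarrow> nat \<Rightarrow> (nat \<Rightarrow> 'a) \<Rightarrow> (nat \<Rightarrow> nat) \<Rightarrow> bool" where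
  "homogeneous_sop R A J n x d \<longleftrightarrow>
     krull_dim R = enat n \<and>
     (\<forall>i<n. 0 < d i \<and> x i \<in> A (d i)) \<and>
     ideal_radical R (Idl\<^bsub>R\<^esub> (x ` {..<n})) = J"


section \<open>Vector spaces over the ground field\<close>

text \<open>The part of degree \<open>j\<close> of a graded \<open>R\<close>-module, as a module over \<open>K\<close>, where \<open>R\<close> is a graded
  \<open>K\<close>-algebra with \<open>K\<close> in degree 0.\<close>

definition degree_part ::
    "('k, 'a, 'm) module_scheme \<Rightarrow> ('a, 'b) graded_module \<Rightarrow> int \<Rightarrow> ('k, 'b) module" where
  "degree_part R M j =
     \<lparr>carrier = piece M j, monoid.mult = monoid.mult M, monoid.one = \<one>\<^bsub>M\<^esub>,
      ring.zero = \<zero>\<^bsub>M\<^esub>, ring.add = ring.add M,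
      smult = (\<lambda>c v. (c \<odot>\<^bsub>R\<^esub> \<one>\<^bsub>R\<^esub>) \<odot>\<^bsub>M\<^esub> v)\<rparr>"

definition restrict_scalars ::
    "('k, 'a, 'm) module_scheme \<Rightarrow> ('a, 'b) graded_module \<Rightarrow> ('k, 'b) module" where
  "restrict_scalars R M =
     \<lparr>carrier = carrier M, monoid.mult = monoid.mult M, monoid.one = \<one>\<^bsub>M\<^esub>,
      ring.zero = \<zero>\<^bsub>M\<^esub>, ring.add = ring.add M,
      smult = (\<lambda>c v. (c \<odot>\<^bsub>R\<^esub> \<one>\<^bsub>R\<^esub>) \<odot>\<^bsub>M\<^esub> v)\<rparr>"

definition module_isomorphic ::
    "('k, 'p) ring_scheme \<Rightarrow> ('k, 'b) module \<Rightarrow> ('k, 'c) module \<Rightarrow> bool" where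
  "module_isomorphic K V W \<longleftrightarrow>
     module K V \<and> module K W \<and>
     (\<exists>\<phi>. bij_betw \<phi> (carrier V) (carrier W) \<and>
        (\<forall>u \<in> carrier V. \<forall>v \<in> carrier V. \<phi> (u \<oplus>\<^bsub>V\<^esub> v) = \<phi> u \<oplus>\<^bsub>W\<^esub> \<phi> v) \<and>
        (\<forall>c \<in> carrier K. \<forall>v \<in> carrier V. \<phi> (c \<odot>\<^bsub>V\<^esub> v) = c \<odot>\<^bsub>W\<^esub> \<phi> v))"

end

theory Submission
  imports Defs
begin

text \<open>Let \<open>\<Gamma>\<close> be the torsion functor.  If \<open>E\<close> is injective, then every Koszul cochain over \<open>E\<close> whose
  differential has values in \<open>\<Gamma> E\<close> is a coboundary up to a cochain with values in \<open>\<Gamma> E\<close>.  Therefore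
  \<open>K(x, \<Gamma> I)\<close> and \<open>K(x, I)\<close> have total complexes with the same cohomology, which is the Koszul
  cohomology of \<open>R\<close> because \<open>I\<close> resolves \<open>R\<close>.  Filter the part of degree 0 of the total complex of
  \<open>K(x, \<Gamma> I)\<close> by the size of the index set \<open>S\<close>: the summand at \<open>S\<close> contributes the part of degree
  \<open>d\<^sub>S\<close> of local cohomology, and \<open>d\<^sub>S > 0\<close> for nonempty \<open>S\<close>, so below \<open>n\<close> only the empty index set
  survives, with the part of degree 0 of local cohomology.\<close>

text \<open>The textbook route to acyclicity modulo torsion splits an injective module into its
  torsion part and a torsion-free injective. Here \<open>graded_injective\<close> speaks only of
  test modules with carrier in \<open>'c\<close>, so the one tool drawn from it is Baer's property
  for homogeneous ideals of \<open>R\<close>, carried along \<epsilon> into \<open>I 0\<close>. It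
  solves consistent systems of linear equations in finitely many unknowns, one unknown at a time. To
  hit a cochain up to torsion it is enough to hit it after multiplication by homogeneous scalars of
  large degree, so the system contains equations of large degree only. Consistency then has to be
  checked on Koszul cycles over \<open>R\<close> of large degree. By the Noetherian hypothesis these
  are combinations, with coefficients of large degree, of cycles of bounded degree, and such
  coefficients kill the pairing of a cycle with the cochain because each parameter is null-homotopic
  on the Koszul complex. The bound \<open>r < n\<close> enters through surjectivity: the obstruction
  to extending a local cohomology class to a total cocycle lies in total degree
  \<open>r + 1\<close>, and at nonempty index sets this only involves local cohomology in degrees at
  most \<open>r\<close>.\<close>

lemma additive_subgroup_iff:
  assumes "abelian_group G"
  shows "additive_subgroup H G \<longleftrightarrow> H \<subseteq> carrier G \<and> \<zero>\<^bsub>G\<^esub> \<in> H \<and>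
    (\<forall>u\<in>H. \<forall>v\<in>H. u \<oplus>\<^bsub>G\<^esub> v \<in> H) \<and> (\<forall>u\<in>H. \<ominus>\<^bsub>G\<^esub> u \<in> H)"
  by (auto simp: additive_subgroup_def subgroup_def a_inv_def)

lemma additive_subgroupD:
  assumes "abelian_group G" "additive_subgroup H G"
  shows "H \<subseteq> carrier G" "\<zero>\<^bsub>G\<^esub> \<in> H" "\<And>u v. u \<in> H \<Longrightarrow> v \<in> H \<Longrightarrow> u \<oplus>\<^bsub>G\<^esub> v \<in> H"
    "\<And>u. u \<in> H \<Longrightarrow> \<ominus>\<^bsub>G\<^esub> u \<in> H" "\<And>u v. u \<in> H \<Longrightarrow> v \<in> H \<Longrightarrow> u \<ominus>\<^bsub>G\<^esub> v \<in> H"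
  using assms(2) unfolding additive_subgroup_iff[OF assms(1)] a_minus_def by auto

lemma (in abelian_group) finsum_mem:
  assumes "H \<subseteq> carrier G" "\<zero> \<in> H" "\<And>u v. u \<in> H \<Longrightarrow> v \<in> H \<Longrightarrow> u \<oplus> v \<in> H"
    and "\<And>i. i \<in> S \<Longrightarrow> f i \<in> H"
  shows "finsum G f S \<in> H"
proof (cases "finite S")
  case True
  then show ?thesis using assms(4)
  proof (induction S)
    case (insert s S)
    then have "f \<in> S \<rightarrow> carrier G" "f s \<in> carrier G" using assms(1) by auto
    with insert assms(3) show ?case by simp
  qed (use assms in simp)
qed (use assms in \<open>simp add: finsum_infinite\<close>)

lemma (in abelian_group) finsum_neg:
  assumes "\<And>i. i \<in> S \<Longrightarrow> f i \<in> carrier G"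
  shows "finsum G (\<lambda>i. \<ominus> f i) S = \<ominus> finsum G f S"
proof (cases "finite S")
  case True
  then show ?thesis using assms
  proof (induction S)
    case (insert s S)
    then have "f \<in> S \<rightarrow> carrier G" "(\<lambda>i. \<ominus> f i) \<in> S \<rightarrow> carrier G" "f s \<in> carrier G" by auto
    with insert show ?case by (simp add: minus_add)
  qed (simp add: a_inv_def)
qed (simp add: finsum_infinite a_inv_def)

section \<open>Additive maps between abelian groups\<close>

lemma additive_zero:
  assumes "abelian_group G" "abelian_group H" "h \<in> carrier G \<rightarrow> carrier H"
    and "\<And>u v. u \<in> carrier G \<Longrightarrow> v \<in> carrier G \<Longrightarrow> h (u \<oplus>\<^bsub>G\<^esub> v) = h u \<oplus>\<^bsub>H\<^esub> h v"
  shows "h \<zero>\<^bsub>G\<^esub> = \<zero>\<^bsub>H\<^esub>"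
proof -
  interpret G: abelian_group G by fact
  interpret H: abelian_group H by fact
  have "h \<zero>\<^bsub>G\<^esub> \<oplus>\<^bsub>H\<^esub> h \<zero>\<^bsub>G\<^esub> = h \<zero>\<^bsub>G\<^esub>" using assms(4)[of "\<zero>\<^bsub>G\<^esub>" "\<zero>\<^bsub>G\<^esub>"] by simp
  then show ?thesis using assms(3) by (metis G.zero_closed H.add.r_cancel_one' PiE)
qed

lemma additive_neg:
  assumes "abelian_group G" "abelian_group H" "h \<in> carrier G \<rightarrow> carrier H"
    and add: "\<And>u v. u \<in> carrier G \<Longrightarrow> v \<in> carrier G \<Longrightarrow> h (u \<oplus>\<^bsub>G\<^esub> v) = h u \<oplus>\<^bsub>H\<^esub> h v"
    and "u \<in> carrier G"
  shows "h (\<ominus>\<^bsub>G\<^esub> u) = \<ominus>\<^bsub>H\<^esub> h u"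
proof -
  interpret G: abelian_group G by fact
  interpret H: abelian_group H by fact
  have "h (\<ominus>\<^bsub>G\<^esub> u) \<oplus>\<^bsub>H\<^esub> h u = \<zero>\<^bsub>H\<^esub>"
    using add[of "\<ominus>\<^bsub>G\<^esub> u" u] additive_zero[OF assms(1-4)] assms(5) by (simp add: G.l_neg)
  then show ?thesis using assms(3,5) by (intro H.minus_equality[symmetric]) auto
qed

lemma additive_minus:
  assumes "abelian_group G" "abelian_group H" "h \<in> carrier G \<rightarrow> carrier H"
    and add: "\<And>u v. u \<in> carrier G \<Longrightarrow> v \<in> carrier G \<Longrightarrow> h (u \<oplus>\<^bsub>G\<^esub> v) = h u \<oplus>\<^bsub>H\<^esub> h v"
    and "u \<in> carrier G" "v \<in> carrier G"
  shows "h (u \<ominus>\<^bsub>G\<^esub> v) = h u \<ominus>\<^bsub>H\<^esub> h v"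
proof -
  interpret G: abelian_group G by fact
  show ?thesis using assms additive_neg[OF assms(1-4)] by (simp add: a_minus_def)
qed

lemma additive_finsum:
  assumes "abelian_group G" "abelian_group H" "h \<in> carrier G \<rightarrow> carrier H"
    and add: "\<And>u v. u \<in> carrier G \<Longrightarrow> v \<in> carrier G \<Longrightarrow> h (u \<oplus>\<^bsub>G\<^esub> v) = h u \<oplus>\<^bsub>H\<^esub> h v"
    and f: "\<And>i. i \<in> S \<Longrightarrow> f i \<in> carrier G"
  shows "h (finsum G f S) = finsum H (\<lambda>i. h (f i)) S"
proof -
  interpret G: abelian_group G by fact
  interpret H: abelian_group H by fact
  show ?thesis
  proof (cases "finite S")
    case True
    then show ?thesis using f
    proof (induction S)
      case (insert s S)
      then have "f \<in> S \<rightarrow> carrier G" "f s \<in> carrier G" by auto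
      moreover from this assms(3) have "(\<lambda>i. h (f i)) \<in> S \<rightarrow> carrier H" "h (f s) \<in> carrier H" by auto
      ultimately show ?case using insert by (simp add: add)
    qed (use additive_zero[OF assms(1-4)] in simp)
  qed (use additive_zero[OF assms(1-4)] in \<open>simp add: G.finsum_infinite H.finsum_infinite\<close>)
qed

section \<open>Homogeneous components\<close>

text \<open>The whole family is chosen by \<open>THE\<close> and only then evaluated at
  \<open>i\<close>, so the uniqueness in \<open>direct_sum_decomp\<close> applies as it
  stands.\<close>

definition hcomp :: "('a, 'm) ring_scheme \<Rightarrow> ('i \<Rightarrow> 'a set) \<Rightarrow> 'i \<Rightarrow> 'a \<Rightarrow> 'a" where
  "hcomp G D i v = (THE f. (\<forall>i. f i \<in> D i) \<and> finite {i. f i \<noteq> \<zero>\<^bsub>G\<^esub>} \<and>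
        v = (\<Oplus>\<^bsub>G\<^esub>i \<in> {i. f i \<noteq> \<zero>\<^bsub>G\<^esub>}. f i)) i"

locale decomposed_group = abelian_group G for G (structure) +
  fixes D :: "'i \<Rightarrow> 'a set"
  assumes decomp: "direct_sum_decomp G D"
begin

lemma D_sub: "additive_subgroup (D i) G"
  using decomp by (simp add: direct_sum_decomp_def)

lemmas D_rules = additive_subgroupD[OF abelian_group_axioms D_sub]

lemma D_carrier [simp]: "v \<in> D i \<Longrightarrow> v \<in> carrier G"
  using D_rules(1) by blast

lemma hcomp_props:
  assumes "v \<in> carrier G"
  shows "hcomp G D i v \<in> D i" "finite {i. hcomp G D i v \<noteq> \<zero>}"
    "v = (\<Oplus>i \<in> {i. hcomp G D i v \<noteq> \<zero>}. hcomp G D i v)"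
proof -
  have "\<exists>!f. (\<forall>i. f i \<in> D i) \<and> finite {i. f i \<noteq> \<zero>} \<and> v = (\<Oplus>i \<in> {i. f i \<noteq> \<zero>}. f i)"
    using decomp assms by (simp add: direct_sum_decomp_def)
  from theI'[OF this] show "hcomp G D i v \<in> D i" "finite {i. hcomp G D i v \<noteq> \<zero>}"
    "v = (\<Oplus>i \<in> {i. hcomp G D i v \<noteq> \<zero>}. hcomp G D i v)"
    unfolding hcomp_def by auto
qed

lemma hcomp_closed [simp]: "v \<in> carrier G \<Longrightarrow> hcomp G D i v \<in> carrier G"
  using hcomp_props(1) D_carrier by blast

text \<open>Any finite \<open>F\<close> containing the support is allowed, so that sums over unions
  of supports need not be trimmed first.\<close>

lemma hcomp_unique:
  assumes f: "\<And>i. f i \<in> D i" and F: "finite F" "\<And>i. i \<notin> F \<Longrightarrow> f i = \<zero>"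
    and v: "v = finsum G f F"
  shows "hcomp G D i v = f i"
proof -
  have v': "v \<in> carrier G" unfolding v using D_carrier[OF f] by (intro finsum_closed) auto
  have "{i. f i \<noteq> \<zero>} \<subseteq> F" using F by auto
  moreover from this have "v = (\<Oplus>i \<in> {i. f i \<noteq> \<zero>}. f i)"
    unfolding v using F D_carrier[OF f] by (intro add.finprod_mono_neutral_cong_right) auto
  moreover have ex: "\<exists>!f. (\<forall>i. f i \<in> D i) \<and> finite {i. f i \<noteq> \<zero>} \<and> v = (\<Oplus>i \<in> {i. f i \<noteq> \<zero>}. f i)"
    using decomp v' by (simp add: direct_sum_decomp_def)
  ultimately have "(THE f. (\<forall>i. f i \<in> D i) \<and> finite {i. f i \<noteq> \<zero>} \<and> v = (\<Oplus>i \<in> {i. f i \<noteq> \<zero>}. f i)) = f"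
    using f F(1) finite_subset by (intro the1_equality[OF ex]) auto
  then show ?thesis by (simp add: hcomp_def)
qed

lemma hcomp_sum:
  assumes "v \<in> carrier G" "finite F" "\<And>i. i \<notin> F \<Longrightarrow> hcomp G D i v = \<zero>"
  shows "finsum G (\<lambda>i. hcomp G D i v) F = v"
proof -
  have "finsum G (\<lambda>i. hcomp G D i v) F = (\<Oplus>i \<in> {i. hcomp G D i v \<noteq> \<zero>}. hcomp G D i v)"
    using assms by (intro add.finprod_mono_neutral_cong_right) auto
  then show ?thesis using hcomp_props(3)[OF assms(1)] by simp
qed

lemma hcomp_homogeneous:
  assumes "v \<in> D j"
  shows "hcomp G D i v = (if i = j then v else \<zero>)"
proof (rule hcomp_unique[where F = "{j}" and f = "\<lambda>i. if i = j then v else \<zero>"])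
  show "v = (\<Oplus>i\<in>{j}. if i = j then v else \<zero>)" using assms by simp
qed (use assms D_rules(2) in auto)

lemma hcomp_add:
  assumes "u \<in> carrier G" "v \<in> carrier G"
  shows "hcomp G D i (u \<oplus> v) = hcomp G D i u \<oplus> hcomp G D i v"
proof -
  define F where "F = {i. hcomp G D i u \<noteq> \<zero>} \<union> {i. hcomp G D i v \<noteq> \<zero>}"
  have F: "finite F" using hcomp_props assms by (simp add: F_def)
  show ?thesis
  proof (rule hcomp_unique[where F = F])
    show "u \<oplus> v = (\<Oplus>i\<in>F. hcomp G D i u \<oplus> hcomp G D i v)"
    proof -
      have "finsum G (\<lambda>i. hcomp G D i u) F = u" "finsum G (\<lambda>i. hcomp G D i v) F = v"
        using assms F by (auto intro!: hcomp_sum simp: F_def)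
      then show ?thesis using assms by (simp add: finsum_addf Pi_def)
    qed
  qed (use assms F hcomp_props(1) D_rules(3) in \<open>auto simp: F_def\<close>)
qed

lemma hcomp_neg: "u \<in> carrier G \<Longrightarrow> hcomp G D i (\<ominus> u) = \<ominus> hcomp G D i u"
  by (rule additive_neg[where h = "hcomp G D i"]) (simp_all add: hcomp_add abelian_group_axioms)

lemma hcomp_zero [simp]: "hcomp G D i \<zero> = \<zero>"
  by (rule additive_zero[where h = "hcomp G D i"]) (simp_all add: hcomp_add abelian_group_axioms)

lemma hcomp_eqI:
  assumes "u \<in> carrier G" "v \<in> carrier G" "\<And>i. hcomp G D i u = hcomp G D i v"
  shows "u = v"
  using hcomp_props(3)[OF assms(1)] hcomp_props(3)[OF assms(2)] assms(3) by simp

end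

text \<open>The image of the decomposition of \<open>v\<close>, reindexed along \<sigma>, is the
  decomposition of \<open>h v\<close>. Graded homomorphisms use the identity for \<sigma>;
  multiplication by a homogeneous scalar uses a translation.\<close>

lemma hcomp_map:
  assumes "decomposed_group G D" "decomposed_group H D'" "h \<in> carrier G \<rightarrow> carrier H"
    and add: "\<And>u v. u \<in> carrier G \<Longrightarrow> v \<in> carrier G \<Longrightarrow> h (u \<oplus>\<^bsub>G\<^esub> v) = h u \<oplus>\<^bsub>H\<^esub> h v"
    and \<sigma>: "bij \<sigma>" and hD: "\<And>j v. v \<in> D j \<Longrightarrow> h v \<in> D' (\<sigma> j)"
    and v: "v \<in> carrier G"
  shows "hcomp H D' (\<sigma> j) (h v) = h (hcomp G D j v)"
proof -
  interpret G: decomposed_group G D by fact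
  interpret H: decomposed_group H D' by fact
  define F where "F = {i. hcomp G D i v \<noteq> \<zero>\<^bsub>G\<^esub>}"
  have F: "finite F" using G.hcomp_props v by (simp add: F_def)
  have h0: "h \<zero>\<^bsub>G\<^esub> = \<zero>\<^bsub>H\<^esub>"
    by (rule additive_zero) (use assms G.abelian_group_axioms H.abelian_group_axioms in auto)
  define \<tau> where "\<tau> = inv_into UNIV \<sigma>"
  have \<tau>: "\<And>i. \<tau> (\<sigma> i) = i" "\<And>i. \<sigma> (\<tau> i) = i"
    using \<sigma> by (auto simp: \<tau>_def bij_is_inj bij_is_surj surj_f_inv_f)
  have inj: "inj \<sigma>" using \<sigma> by (simp add: bij_def)
  have "h v = h (finsum G (\<lambda>i. hcomp G D i v) F)" using G.hcomp_sum[OF v F] by (simp add: F_def)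
  also have "\<dots> = finsum H (\<lambda>i. h (hcomp G D i v)) F"
    by (rule additive_finsum) (use assms v G.abelian_group_axioms H.abelian_group_axioms in auto)
  also have "\<dots> = finsum H (\<lambda>i. h (hcomp G D (\<tau> (\<sigma> i)) v)) F" by (simp add: \<tau>)
  also have "\<dots> = finsum H (\<lambda>i. h (hcomp G D (\<tau> i) v)) (\<sigma> ` F)"
    by (rule H.finsum_reindex[symmetric]) (use assms v inj in \<open>auto intro: inj_on_subset\<close>)
  finally have "h v = finsum H (\<lambda>i. h (hcomp G D (\<tau> i) v)) (\<sigma> ` F)" .
  then have "hcomp H D' (\<sigma> j) (h v) = h (hcomp G D (\<tau> (\<sigma> j)) v)"
  proof (rule H.hcomp_unique[rotated -1])
    show "h (hcomp G D (\<tau> i) v) \<in> D' i" for i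
      using hD[of "hcomp G D (\<tau> i) v" "\<tau> i"] G.hcomp_props(1)[OF v] by (simp add: \<tau>)
    show "h (hcomp G D (\<tau> i) v) = \<zero>\<^bsub>H\<^esub>" if "i \<notin> \<sigma> ` F" for i
    proof -
      have "\<tau> i \<notin> F" using that \<tau> by (metis image_eqI)
      then show ?thesis using h0 by (simp add: F_def)
    qed
  qed (use F in auto)
  then show ?thesis by (simp add: \<tau>)
qed

text \<open>Uniqueness comes from the projections: applied to any decomposition of \<open>v\<close>,
  the map \<open>\<pi> i\<close> is additive, kills all terms but the one of index \<open>i\<close>,
  and so returns that term.\<close>

lemma direct_sum_decompI:
  assumes G: "abelian_group G" and D: "\<And>i. additive_subgroup (D i) G"
    and \<pi>: "\<And>i v. v \<in> carrier G \<Longrightarrow> \<pi> i v \<in> D i"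
    and add: "\<And>i u v. u \<in> carrier G \<Longrightarrow> v \<in> carrier G \<Longrightarrow> \<pi> i (u \<oplus>\<^bsub>G\<^esub> v) = \<pi> i u \<oplus>\<^bsub>G\<^esub> \<pi> i v"
    and hom: "\<And>i j v. v \<in> D j \<Longrightarrow> \<pi> i v = (if i = j then v else \<zero>\<^bsub>G\<^esub>)"
    and sum: "\<And>v. v \<in> carrier G \<Longrightarrow> \<exists>F. finite F \<and> (\<forall>i. i \<notin> F \<longrightarrow> \<pi> i v = \<zero>\<^bsub>G\<^esub>) \<and> v = finsum G (\<lambda>i. \<pi> i v) F"
  shows "direct_sum_decomp G D"
  unfolding direct_sum_decomp_def
proof (intro conjI allI ballI D)
  interpret abelian_group G by fact
  note Dr = additive_subgroupD[OF G D]
  fix v assume v: "v \<in> carrier G"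
  have \<pi>c: "\<pi> i u \<in> carrier G" if "u \<in> carrier G" for i u using that \<pi> Dr(1) by blast
  obtain F where F: "finite F" "\<And>i. i \<notin> F \<Longrightarrow> \<pi> i v = \<zero>\<^bsub>G\<^esub>" "v = finsum G (\<lambda>i. \<pi> i v) F"
    using sum[OF v] by auto
  show "\<exists>!f. (\<forall>i. f i \<in> D i) \<and> finite {i. f i \<noteq> \<zero>\<^bsub>G\<^esub>} \<and> v = (\<Oplus>\<^bsub>G\<^esub>i \<in> {i. f i \<noteq> \<zero>\<^bsub>G\<^esub>}. f i)"
  proof (rule ex1I[of _ "\<lambda>i. \<pi> i v"], intro conjI allI)
    have sub: "{i. \<pi> i v \<noteq> \<zero>\<^bsub>G\<^esub>} \<subseteq> F" using F(2) by auto
    then show "finite {i. \<pi> i v \<noteq> \<zero>\<^bsub>G\<^esub>}" using F(1) finite_subset by blast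
    show "v = (\<Oplus>\<^bsub>G\<^esub>i \<in> {i. \<pi> i v \<noteq> \<zero>\<^bsub>G\<^esub>}. \<pi> i v)"
      by (subst F(3), rule add.finprod_mono_neutral_cong_right) (use F(1) sub \<pi>c v in auto)
    show "\<pi> i v \<in> D i" for i using \<pi> v .
  next
    fix f assume f: "(\<forall>i. f i \<in> D i) \<and> finite {i. f i \<noteq> \<zero>\<^bsub>G\<^esub>} \<and> v = (\<Oplus>\<^bsub>G\<^esub>i \<in> {i. f i \<noteq> \<zero>\<^bsub>G\<^esub>}. f i)"
    show "f = (\<lambda>i. \<pi> i v)"
    proof
      fix i
      have fc: "f i \<in> carrier G" for i using f Dr(1) by blast
      have "\<pi> i v = (\<Oplus>\<^bsub>G\<^esub>j \<in> {i. f i \<noteq> \<zero>\<^bsub>G\<^esub>}. \<pi> i (f j))"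
        using additive_finsum[of G G "\<pi> i" "{i. f i \<noteq> \<zero>\<^bsub>G\<^esub>}" f, OF G G _ add fc] \<pi>c f by auto
      also have "\<dots> = (\<Oplus>\<^bsub>G\<^esub>j \<in> {i. f i \<noteq> \<zero>\<^bsub>G\<^esub>}. if i = j then f j else \<zero>\<^bsub>G\<^esub>)"
        by (rule finsum_cong') (use f fc hom in auto)
      also have "\<dots> = f i"
      proof (cases "f i = \<zero>\<^bsub>G\<^esub>")
        case True then show ?thesis by (intro trans[OF add.finprod_one_eqI]) auto
      next
        case False then show ?thesis using f fc finsum_singleton[of i "{i. f i \<noteq> \<zero>\<^bsub>G\<^esub>}" f] by auto
      qed
      finally show "f i = \<pi> i v" by simp
    qed
  qed
qed

section \<open>Graded modules\<close>

text \<open>\<open>R\<close> and \<open>regular_module R A\<close> are records of different types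
  with the same additive part, so sums and inverses have to be carried over.\<close>

lemma finsum_record_cong:
  assumes "carrier G = carrier H" "add G = add H" "zero G = zero H"
  shows "finsum G f S = finsum H f S"
  by (simp add: finsum_def finprod_def assms)

lemma a_inv_record_cong:
  assumes "carrier G = carrier H" "add G = add H" "zero G = zero H"
  shows "a_inv G v = a_inv H v"
  by (simp add: a_inv_def m_inv_def assms)

lemma regular_module_simps [simp]:
  "carrier (regular_module R A) = carrier R" "zero (regular_module R A) = zero R"
  "add (regular_module R A) = add R" "a \<odot>\<^bsub>regular_module R A\<^esub> b = a \<otimes>\<^bsub>R\<^esub> b"
  "piece (regular_module R A) = int_piece R A"
  by (simp_all add: regular_module_def)

lemma regular_module_finsum [simp]: "finsum (regular_module R A) f S = finsum R f S"
  by (rule finsum_record_cong) simp_all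

lemma regular_module_a_inv [simp]: "a_inv (regular_module R A) v = a_inv R v"
  by (rule a_inv_record_cong) simp_all

abbreviation dcomp :: "('a, 'b) graded_module \<Rightarrow> int \<Rightarrow> 'b \<Rightarrow> 'b" where
  "dcomp M \<equiv> hcomp M (piece M)"

lemma graded_homD:
  assumes "f \<in> graded_hom R M N"
  shows "\<And>v. v \<in> carrier M \<Longrightarrow> f v \<in> carrier N" "f \<in> carrier M \<rightarrow> carrier N"
    "\<And>u v. u \<in> carrier M \<Longrightarrow> v \<in> carrier M \<Longrightarrow> f (u \<oplus>\<^bsub>M\<^esub> v) = f u \<oplus>\<^bsub>N\<^esub> f v"
    "\<And>a v. a \<in> carrier R \<Longrightarrow> v \<in> carrier M \<Longrightarrow> f (a \<odot>\<^bsub>M\<^esub> v) = a \<odot>\<^bsub>N\<^esub> f v"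
    "\<And>j v. v \<in> piece M j \<Longrightarrow> f v \<in> piece N j"
  using assms unfolding graded_hom_def by (simp_all add: Pi_def image_subset_iff)

text \<open>The degree of \<one> is recorded because it puts \<open>\<ominus> \<one>\<close> into
  \<open>A 0\<close>: families closed under homogeneous scalars are then closed under
  negation.\<close>

locale graded_ring = cring R for R :: "('a, 'm) ring_scheme" (structure) +
  fixes A :: "nat \<Rightarrow> 'a set"
  assumes graded: "nat_graded_ring R A" and one_degree_0: "\<one> \<in> A 0"
begin

lemma R_decomp: "decomposed_group R A"
  using graded abelian_group_axioms unfolding nat_graded_ring_def
  by (simp add: decomposed_group_def decomposed_group_axioms_def)

sublocale RD: decomposed_group R A by (rule R_decomp)

lemma A_mult: "a \<in> A i \<Longrightarrow> b \<in> A j \<Longrightarrow> a \<otimes> b \<in> A (i + j)"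
  using graded unfolding nat_graded_ring_def by blast

lemma A_carrier: "a \<in> A i \<Longrightarrow> a \<in> carrier R"
  by (rule RD.D_carrier)

abbreviation "RR \<equiv> regular_module R A"

lemma int_piece_sub: "int_piece R A j \<subseteq> carrier R"
  using A_carrier by (auto simp: int_piece_def)

lemma int_pieceD: "a \<in> int_piece R A j \<Longrightarrow> a \<in> carrier R"
  using int_piece_sub by blast

lemma int_piece_int [simp]: "int_piece R A (int i) = A i"
  by (simp add: int_piece_def)

lemma RR_abelian_group: "abelian_group RR"
proof (rule abelian_groupI)
  show "\<exists>y\<in>carrier RR. y \<oplus>\<^bsub>RR\<^esub> a = \<zero>\<^bsub>RR\<^esub>" if "a \<in> carrier RR" for a
    using that by (intro bexI[of _ "\<ominus> a"]) (auto simp: l_neg)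
qed (simp_all add: a_ac)

lemma RR_module: "module R RR"
  by (rule moduleI[OF is_cring RR_abelian_group]) (simp_all add: l_distr r_distr m_assoc)

lemma RR_graded: "is_graded_module R A RR"
  unfolding is_graded_module_def
proof (intro conjI RR_module allI ballI)
  show "direct_sum_decomp RR (piece RR)"
  proof (rule direct_sum_decompI[where \<pi> = "\<lambda>j a. if j < 0 then \<zero> else hcomp R A (nat j) a", OF RR_abelian_group])
    show "additive_subgroup (piece RR i) RR" for i
      using int_piece_sub RD.D_rules unfolding additive_subgroup_iff[OF RR_abelian_group]
      by (auto simp: int_piece_def)
  next
    fix v assume v: "v \<in> carrier RR"
    define F where "F = {i. hcomp R A i v \<noteq> \<zero>}"
    have F: "finite F" using RD.hcomp_props v by (simp add: F_def)
    have "v = finsum R (\<lambda>i. hcomp R A i v) F" using v F by (intro RD.hcomp_sum[symmetric]) (auto simp: F_def)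
    also have "\<dots> = finsum R (\<lambda>i. if i < 0 then \<zero> else hcomp R A (nat i) v) (int ` F)"
      using v by (subst finsum_reindex) (auto simp: inj_on_def)
    finally have "v = finsum R (\<lambda>i. if i < 0 then \<zero> else hcomp R A (nat i) v) (int ` F)" .
    moreover have "(if i < 0 then \<zero> else hcomp R A (nat i) v) = \<zero>" if "i \<notin> int ` F" for i
      using that by (cases i) (auto simp: F_def)
    ultimately show "\<exists>F. finite F \<and> (\<forall>i. i \<notin> F \<longrightarrow> (if i < 0 then \<zero> else hcomp R A (nat i) v) = \<zero>\<^bsub>RR\<^esub>) \<and>
      v = (\<Oplus>\<^bsub>RR\<^esub>i\<in>F. if i < 0 then \<zero> else hcomp R A (nat i) v)"
      using F by (intro exI[of _ "int ` F"]) auto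
  next
    fix i j v assume "v \<in> piece RR j"
    then show "(if i < 0 then \<zero> else hcomp R A (nat i) v) = (if i = j then v else \<zero>\<^bsub>RR\<^esub>)"
      by (auto simp: int_piece_def RD.hcomp_homogeneous split: if_splits)
  qed (use RD.hcomp_props in \<open>auto simp: int_piece_def RD.hcomp_add\<close>)
  show "a \<odot>\<^bsub>RR\<^esub> v \<in> piece RR (int i + j)" if "a \<in> A i" "v \<in> piece RR j" for i j a v
    using that A_mult A_carrier RD.D_rules(2)
    by (auto simp: int_piece_def nat_add_distrib split: if_splits)
qed

abbreviation "gm \<equiv> is_graded_module R A"

lemma gm_module: "gm M \<Longrightarrow> module R M"
  and gm_abelian: "gm M \<Longrightarrow> abelian_group M"
  and gm_decomp: "gm M \<Longrightarrow> decomposed_group M (piece M)"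
  unfolding is_graded_module_def decomposed_group_def decomposed_group_axioms_def
  by (auto simp: module_def)

lemma piece_sub: "gm M \<Longrightarrow> v \<in> piece M j \<Longrightarrow> v \<in> carrier M"
  using decomposed_group.D_carrier[OF gm_decomp] .

lemmas piece_rules = decomposed_group.D_rules[OF gm_decomp]

text \<open>The scalar may have any integer degree: a scalar of negative degree is zero, and zero
  lies in every piece.\<close>

lemma smult_piece:
  assumes "gm M" "a \<in> int_piece R A i" "v \<in> piece M j"
  shows "a \<odot>\<^bsub>M\<^esub> v \<in> piece M (i + j)"
proof (cases "i < 0")
  case True
  then show ?thesis using assms piece_rules(2)[OF assms(1)] module.smult_l_null[OF gm_module[OF assms(1)]] piece_sub[OF assms(1)]
    by (auto simp: int_piece_def)
next
  case False
  then have "a \<in> A (nat i)" "i = int (nat i)" using assms by (auto simp: int_piece_def)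
  then show ?thesis using assms(1,3) unfolding is_graded_module_def by metis
qed

lemma smult_A_piece:
  assumes "gm M" "a \<in> A i" "v \<in> piece M j"
  shows "a \<odot>\<^bsub>M\<^esub> v \<in> piece M (int i + j)"
  using smult_piece[OF assms(1) _ assms(3), of a "int i"] assms(2) by simp

lemma dcomp_hom:
  assumes "gm M" "gm N" "f \<in> graded_hom R M N" "v \<in> carrier M"
  shows "dcomp N j (f v) = f (dcomp M j v)"
  using hcomp_map[OF gm_decomp[OF assms(1)] gm_decomp[OF assms(2)], where \<sigma> = id and h = f]
    graded_homD[OF assms(3)] assms(4) by auto

lemma bij_plus_int: "bij ((+) (i::int))"
  by (auto simp: bij_def inj_on_def surj_def algebra_simps intro: exI[of _ "_ - i"])

lemma dcomp_smult:
  assumes "gm M" "a \<in> A i" "v \<in> carrier M"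
  shows "dcomp M (int i + j) (a \<odot>\<^bsub>M\<^esub> v) = a \<odot>\<^bsub>M\<^esub> dcomp M j v"
  using hcomp_map[OF gm_decomp[OF assms(1)] gm_decomp[OF assms(1)], where \<sigma> = "(+) (int i)" and h = "\<lambda>v. a \<odot>\<^bsub>M\<^esub> v" and v = v]
    assms bij_plus_int smult_A_piece[OF assms(1,2)] A_carrier[OF assms(2)]
    module.smult_closed[OF gm_module[OF assms(1)]] module.smult_r_distr[OF gm_module[OF assms(1)]] by auto

lemma dcomp_RR_mem:
  assumes "a \<in> carrier R" shows "dcomp RR i a \<in> int_piece R A i" "dcomp RR i a \<in> carrier R"
  using decomposed_group.hcomp_props(1)[OF gm_decomp[OF RR_graded]] assms int_pieceD by auto

lemma smult_sum_dcomp: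
  assumes "gm M" "a \<in> carrier R" "v \<in> carrier M" "\<And>i. dcomp RR i a \<odot>\<^bsub>M\<^esub> v = \<zero>\<^bsub>M\<^esub>"
  shows "a \<odot>\<^bsub>M\<^esub> v = \<zero>\<^bsub>M\<^esub>"
proof -
  interpret M: module R M using gm_module assms(1) .
  interpret RR: decomposed_group RR "piece RR" using gm_decomp RR_graded .
  have "a \<odot>\<^bsub>M\<^esub> v = finsum RR (\<lambda>i. dcomp RR i a) {i. dcomp RR i a \<noteq> \<zero>} \<odot>\<^bsub>M\<^esub> v"
    using RR.hcomp_props(3)[of a] assms(2) by simp
  also have "\<dots> = finsum M (\<lambda>i. dcomp RR i a \<odot>\<^bsub>M\<^esub> v) {i. dcomp RR i a \<noteq> \<zero>}"
    by (rule additive_finsum) (use assms RR_abelian_group M.abelian_group_axioms dcomp_RR_mem M.smult_l_distr in auto)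
  also have "\<dots> = \<zero>\<^bsub>M\<^esub>" using assms(4) by simp
  finally show ?thesis .
qed

subsection \<open>Homogeneous torsion\<close>

text \<open>This is torsion with respect to \<mm>, tested on homogeneous scalars of large degree
  instead of powers of \<mm>; \<open>tors_eq\<close> identifies the two. In this form it passes to
  homogeneous components at once.\<close>

definition tors :: "('a, 'b) graded_module \<Rightarrow> 'b set" where
  "tors M = {v \<in> carrier M. \<exists>N. \<forall>j\<ge>N. \<forall>a\<in>A j. a \<odot>\<^bsub>M\<^esub> v = \<zero>\<^bsub>M\<^esub>}"

lemma tors_carrier: "v \<in> tors M \<Longrightarrow> v \<in> carrier M"
  by (simp add: tors_def)

lemma tors_zero: "gm M \<Longrightarrow> \<zero>\<^bsub>M\<^esub> \<in> tors M"
proof -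
  assume "gm M"
  then interpret M: module R M by (rule gm_module)
  show ?thesis using A_carrier by (auto simp: tors_def)
qed

lemma tors_add:
  assumes "gm M" "u \<in> tors M" "v \<in> tors M" shows "u \<oplus>\<^bsub>M\<^esub> v \<in> tors M"
proof -
  interpret M: module R M using gm_module assms(1) .
  obtain N N' where "\<forall>j\<ge>N. \<forall>a\<in>A j. a \<odot>\<^bsub>M\<^esub> u = \<zero>\<^bsub>M\<^esub>" "\<forall>j\<ge>N'. \<forall>a\<in>A j. a \<odot>\<^bsub>M\<^esub> v = \<zero>\<^bsub>M\<^esub>"
    using assms by (auto simp: tors_def)
  then have "\<forall>j\<ge>max N N'. \<forall>a\<in>A j. a \<odot>\<^bsub>M\<^esub> (u \<oplus>\<^bsub>M\<^esub> v) = \<zero>\<^bsub>M\<^esub>"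
    using assms(2,3) A_carrier by (auto simp: tors_def M.smult_r_distr)
  then show ?thesis using assms tors_carrier[of u M] tors_carrier[of v M]
    unfolding tors_def[of M] by blast
qed

lemma tors_smult:
  assumes "gm M" "b \<in> carrier R" "v \<in> tors M" shows "b \<odot>\<^bsub>M\<^esub> v \<in> tors M"
proof -
  interpret M: module R M using gm_module assms(1) .
  obtain N where N: "\<forall>j\<ge>N. \<forall>a\<in>A j. a \<odot>\<^bsub>M\<^esub> v = \<zero>\<^bsub>M\<^esub>" using assms by (auto simp: tors_def)
  have v: "v \<in> carrier M" using assms by (simp add: tors_carrier)
  have "a \<odot>\<^bsub>M\<^esub> (b \<odot>\<^bsub>M\<^esub> v) = \<zero>\<^bsub>M\<^esub>" if "j \<ge> N" "a \<in> A j" for a j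
  proof -
    have "a \<odot>\<^bsub>M\<^esub> (b \<odot>\<^bsub>M\<^esub> v) = b \<odot>\<^bsub>M\<^esub> (a \<odot>\<^bsub>M\<^esub> v)"
      using that A_carrier assms(2) v by (metis M.smult_assoc1 m_comm)
    then show ?thesis using that N assms(2) by simp
  qed
  then show ?thesis using v assms(2) by (auto simp: tors_def)
qed

lemma tors_neg:
  assumes "gm M" "v \<in> tors M" shows "\<ominus>\<^bsub>M\<^esub> v \<in> tors M"
proof -
  interpret M: module R M using gm_module assms(1) .
  have "\<ominus>\<^bsub>M\<^esub> v = (\<ominus> \<one>) \<odot>\<^bsub>M\<^esub> v" using assms(2) tors_carrier[of v M] by (simp add: M.smult_l_minus)
  then show ?thesis using tors_smult[OF assms(1) _ assms(2), of "\<ominus> \<one>"] by simp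
qed

lemma tors_submodule: "gm M \<Longrightarrow> submodule (tors M) R M"
  by (intro module.submoduleI gm_module)
    (auto simp: tors_carrier tors_zero tors_add tors_smult tors_neg)

lemma tors_additive_subgroup: "gm M \<Longrightarrow> additive_subgroup (tors M) M"
  using submodule.axioms(1)[OF tors_submodule] by (simp add: additive_subgroup_def)

lemmas tors_rules = additive_subgroupD[OF gm_abelian tors_additive_subgroup]

lemma tors_hom:
  assumes "gm M" "gm N" "f \<in> graded_hom R M N" "v \<in> tors M" shows "f v \<in> tors N"
proof -
  note f = graded_homD[OF assms(3)]
  have "f \<zero>\<^bsub>M\<^esub> = \<zero>\<^bsub>N\<^esub>" using additive_zero[OF gm_abelian gm_abelian f(2,3)] assms by simp
  then have "a \<odot>\<^bsub>M\<^esub> v = \<zero>\<^bsub>M\<^esub> \<longrightarrow> a \<odot>\<^bsub>N\<^esub> f v = \<zero>\<^bsub>N\<^esub>" if "a \<in> carrier R" for a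
    using f(4)[OF that] assms(4) tors_carrier by metis
  then show ?thesis using assms(4) f(1) A_carrier unfolding tors_def by blast
qed

text \<open>A scalar of degree \<open>i\<close> sends the component of \<open>v\<close> in degree
  \<open>j\<close> to the component of the product in degree \<open>i + j\<close>, so a scalar that
  kills \<open>v\<close> kills each component.\<close>

lemma tors_dcomp:
  assumes "gm M" "v \<in> tors M" shows "dcomp M j v \<in> tors M"
proof -
  interpret M: decomposed_group M "piece M" using gm_decomp assms(1) .
  obtain N where N: "\<forall>j\<ge>N. \<forall>a\<in>A j. a \<odot>\<^bsub>M\<^esub> v = \<zero>\<^bsub>M\<^esub>" using assms by (auto simp: tors_def)
  have v: "v \<in> carrier M" using assms by (simp add: tors_carrier)
  have "a \<odot>\<^bsub>M\<^esub> dcomp M j v = \<zero>\<^bsub>M\<^esub>" if "i \<ge> N" "a \<in> A i" for a i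
    using dcomp_smult[OF assms(1) that(2) v, of j] N that by simp
  then show ?thesis using v by (auto simp: tors_def)
qed

end

lemma (in abelian_group) minus_eq_zero_iff:
  assumes "u \<in> carrier G" "v \<in> carrier G" shows "u \<ominus> v = \<zero> \<longleftrightarrow> u = v"
  using assms r_neg minus_equality[of u "\<ominus> v"] by (auto simp: a_minus_def)

section \<open>Injective modules\<close>

context graded_ring begin

lemma smult_decomp:
  assumes "module R M" "a \<in> carrier R" "v \<in> carrier M"
  shows "a \<odot>\<^bsub>M\<^esub> v = finsum M (\<lambda>i. hcomp R A i a \<odot>\<^bsub>M\<^esub> v) {i. hcomp R A i a \<noteq> \<zero>}"
proof -
  interpret M: module R M by fact
  have "a \<odot>\<^bsub>M\<^esub> v = finsum R (\<lambda>i. hcomp R A i a) {i. hcomp R A i a \<noteq> \<zero>} \<odot>\<^bsub>M\<^esub> v"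
    using RD.hcomp_props(3)[of a] assms(2) by simp
  also have "\<dots> = finsum M (\<lambda>i. hcomp R A i a \<odot>\<^bsub>M\<^esub> v) {i. hcomp R A i a \<noteq> \<zero>}"
    by (rule additive_finsum)
      (use assms is_abelian_group M.abelian_group_axioms M.smult_l_distr in auto)
  finally show ?thesis .
qed

text \<open>Every scalar is a finite sum of homogeneous ones, and \<open>f\<close> is
  additive.\<close>

lemma linear_if_homogeneous:
  assumes "module R M" "module R N" "f \<in> carrier M \<rightarrow> carrier N"
    and add: "\<And>u v. u \<in> carrier M \<Longrightarrow> v \<in> carrier M \<Longrightarrow> f (u \<oplus>\<^bsub>M\<^esub> v) = f u \<oplus>\<^bsub>N\<^esub> f v"
    and hom: "\<And>i a v. a \<in> A i \<Longrightarrow> v \<in> carrier M \<Longrightarrow> f (a \<odot>\<^bsub>M\<^esub> v) = a \<odot>\<^bsub>N\<^esub> f v"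
    and a: "a \<in> carrier R" and v: "v \<in> carrier M"
  shows "f (a \<odot>\<^bsub>M\<^esub> v) = a \<odot>\<^bsub>N\<^esub> f v"
proof -
  interpret M: module R M by fact
  interpret N: module R N by fact
  have "f (a \<odot>\<^bsub>M\<^esub> v) = f (finsum M (\<lambda>i. hcomp R A i a \<odot>\<^bsub>M\<^esub> v) {i. hcomp R A i a \<noteq> \<zero>})"
    using smult_decomp[OF assms(1) a v] by simp
  also have "\<dots> = finsum N (\<lambda>i. f (hcomp R A i a \<odot>\<^bsub>M\<^esub> v)) {i. hcomp R A i a \<noteq> \<zero>}"
    by (rule additive_finsum) (use assms M.abelian_group_axioms N.abelian_group_axioms in auto)
  also have "\<dots> = finsum N (\<lambda>i. hcomp R A i a \<odot>\<^bsub>N\<^esub> f v) {i. hcomp R A i a \<noteq> \<zero>}"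
    using hom[OF RD.hcomp_props(1)[OF a] v] by simp
  also have "\<dots> = a \<odot>\<^bsub>N\<^esub> f v"
    using smult_decomp[OF assms(2) a, of "f v"] v assms(3) by (metis PiE)
  finally show ?thesis .
qed

text \<open>The shift by \<open>e\<close> of the graded submodule of \<open>M\<close> with part \<open>J j\<close> in degree \<open>j\<close>.\<close>

definition shifted_submodule :: "('a, 'b) graded_module \<Rightarrow> int \<Rightarrow> (int \<Rightarrow> 'b set) \<Rightarrow> ('a, 'b) graded_module" where
  "shifted_submodule M e J = M\<lparr>carrier := {v \<in> carrier M. \<forall>j. dcomp M (j - e) v \<in> J j}, piece := J\<rparr>"

lemma shifted_submodule_simps [simp]:
  "carrier (shifted_submodule M e J) = {v \<in> carrier M. \<forall>j. dcomp M (j - e) v \<in> J j}"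
  "piece (shifted_submodule M e J) = J" "zero (shifted_submodule M e J) = zero M"
  "add (shifted_submodule M e J) = add M" "smult (shifted_submodule M e J) = smult M"
  by (simp_all add: shifted_submodule_def)

text \<open>Membership in the carrier is tested on components, so homogeneous scalars preserve it by
  \<open>AJ\<close>, and an arbitrary scalar is split into homogeneous ones.\<close>

lemma shifted_submodule_graded:
  assumes M: "gm M" and J: "\<And>j. additive_subgroup (J j) M" "\<And>j. J j \<subseteq> piece M (j - e)"
    and AJ: "\<And>i j a v. a \<in> A i \<Longrightarrow> v \<in> J j \<Longrightarrow> a \<odot>\<^bsub>M\<^esub> v \<in> J (int i + j)"
  shows "gm (shifted_submodule M e J)"
proof -
  interpret M: module R M using gm_module M .
  interpret MD: decomposed_group M "piece M" using gm_decomp M .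
  note Jr = additive_subgroupD[OF gm_abelian[OF M] J(1)]
  define S where "S = {v \<in> carrier M. \<forall>j. dcomp M (j - e) v \<in> J j}"
  have JS: "v \<in> S" if "v \<in> J j" for v j
    using that Jr J(2)[of j] by (auto simp: S_def MD.hcomp_homogeneous)
  have AS: "a \<odot>\<^bsub>M\<^esub> v \<in> S" if "a \<in> A i" "v \<in> S" for a i v
  proof -
    have "dcomp M (j - e) (a \<odot>\<^bsub>M\<^esub> v) \<in> J j" for j
      using dcomp_smult[OF M that(1), of v "j - int i - e"] AJ[OF that(1), of "dcomp M (j - int i - e) v" "j - int i"] that
      by (auto simp: S_def)
    then show ?thesis using that A_carrier by (auto simp: S_def)
  qed
  have Sadd: "u \<oplus>\<^bsub>M\<^esub> v \<in> S" if "u \<in> S" "v \<in> S" for u v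
    using that Jr by (auto simp: S_def MD.hcomp_add)
  have Szero: "\<zero>\<^bsub>M\<^esub> \<in> S" using Jr by (auto simp: S_def)
  have sub: "submodule S R M"
  proof (rule M.submoduleI)
    show "\<ominus>\<^bsub>M\<^esub> v \<in> S" if "v \<in> S" for v using that Jr by (auto simp: S_def MD.hcomp_neg)
    show "a \<odot>\<^bsub>M\<^esub> v \<in> S" if "a \<in> carrier R" "v \<in> S" for a v
    proof -
      have "a \<odot>\<^bsub>M\<^esub> v = finsum M (\<lambda>i. hcomp R A i a \<odot>\<^bsub>M\<^esub> v) {i. hcomp R A i a \<noteq> \<zero>}"
        using smult_decomp that M.module_axioms by (auto simp: S_def)
      also have "\<dots> \<in> S"
      proof (rule M.finsum_mem)
        show "hcomp R A i a \<odot>\<^bsub>M\<^esub> v \<in> S" for i by (rule AS[OF RD.hcomp_props(1)[OF that(1)] that(2)])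
      qed (use Sadd Szero in \<open>auto simp: S_def\<close>)
      finally show ?thesis .
    qed
  qed (use Sadd Szero in \<open>auto simp: S_def\<close>)
  let ?N = "shifted_submodule M e J"
  have carr: "carrier ?N = S" by (simp add: S_def)
  have mod0: "module R (M\<lparr>carrier := S\<rparr>)"
    using submodule.submodule_is_module[OF sub M.module_axioms] .
  then have ab: "abelian_group ?N"
    by (simp add: module_def abelian_group_def abelian_monoid_def abelian_group_axioms_def S_def)
  have mod: "module R ?N"
    by (rule moduleI[OF is_cring ab]) (use module.smult_closed[OF mod0] in
      \<open>auto simp: M.smult_l_distr M.smult_r_distr M.smult_assoc1 S_def\<close>)
  \<comment> \<open>The inclusion of the smaller carrier is additive, so sums formed in either
    record agree.\<close>
  have fs: "finsum M f F = finsum ?N f F" if "\<And>i. i \<in> F \<Longrightarrow> f i \<in> S" for f and F :: "int set"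
    using additive_finsum[OF ab gm_abelian[OF M], of "\<lambda>x. x" F f] that by (auto simp: S_def)
  have "direct_sum_decomp ?N J"
  proof (rule direct_sum_decompI[OF ab, where \<pi> = "\<lambda>j. dcomp M (j - e)"])
    show "additive_subgroup (J j) ?N" for j
    proof -
      have "\<ominus>\<^bsub>?N\<^esub> v = \<ominus>\<^bsub>M\<^esub> v" if "v \<in> S" for v
        using additive_neg[OF ab gm_abelian[OF M], of "\<lambda>x. x" v] that by (auto simp: S_def)
      then show ?thesis
        unfolding additive_subgroup_iff[OF ab] carr using JS Jr by auto
    qed
    show "dcomp M (i - e) v = (if i = j then v else \<zero>\<^bsub>?N\<^esub>)" if "v \<in> J j" for i j v
      using that J(2)[of j] MD.hcomp_homogeneous[of v "j - e" "i - e"] by auto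
    show "\<exists>F. finite F \<and> (\<forall>i. i \<notin> F \<longrightarrow> dcomp M (i - e) v = \<zero>\<^bsub>?N\<^esub>) \<and> v = (\<Oplus>\<^bsub>?N\<^esub>i\<in>F. dcomp M (i - e) v)"
      if "v \<in> carrier ?N" for v
    proof -
      have v: "v \<in> carrier M" using that by simp
      define F where "F = {i. dcomp M i v \<noteq> \<zero>\<^bsub>M\<^esub>}"
      have F: "finite F" using MD.hcomp_props v by (simp add: F_def)
      have "v = finsum M (\<lambda>i. dcomp M i v) F" using v F by (intro MD.hcomp_sum[symmetric]) (auto simp: F_def)
      also have "\<dots> = finsum M (\<lambda>i. dcomp M (i - e) v) ((\<lambda>i. i + e) ` F)"
        using v by (subst M.finsum_reindex) (auto simp: inj_on_def)
      also have "\<dots> = finsum ?N (\<lambda>i. dcomp M (i - e) v) ((\<lambda>i. i + e) ` F)"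
        by (rule fs) (use that JS in auto)
      finally have "v = finsum ?N (\<lambda>i. dcomp M (i - e) v) ((\<lambda>i. i + e) ` F)" .
      moreover have "dcomp M (i - e) v = \<zero>\<^bsub>M\<^esub>" if "i \<notin> (\<lambda>i. i + e) ` F" for i
      proof -
        have "i - e \<notin> F" using that by (metis diff_add_cancel imageI)
        then show ?thesis by (simp add: F_def)
      qed
      ultimately show ?thesis using F by (intro exI[of _ "(\<lambda>i. i + e) ` F"]) auto
    qed
  qed (auto simp: MD.hcomp_add)
  then show ?thesis using mod AJ unfolding is_graded_module_def by simp
qed

text \<open>A homomorphism into an injective module is handled through its graph \<open>P\<close>, given degree by degree.\<close>

lemma injective_extension:
  fixes E N :: "('a, 'c) graded_module"
  assumes E: "graded_injective R A E" and N: "gm N"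
    and P: "\<And>j v w. (v, w) \<in> P j \<Longrightarrow> v \<in> piece N (j - e) \<and> w \<in> piece E j"
    and P0: "\<And>j. (\<zero>\<^bsub>N\<^esub>, \<zero>\<^bsub>E\<^esub>) \<in> P j"
    and Padd: "\<And>j v w v' w'. (v, w) \<in> P j \<Longrightarrow> (v', w') \<in> P j \<Longrightarrow> (v \<oplus>\<^bsub>N\<^esub> v', w \<oplus>\<^bsub>E\<^esub> w') \<in> P j"
    and Psm: "\<And>i j a v w. a \<in> A i \<Longrightarrow> (v, w) \<in> P j \<Longrightarrow> (a \<odot>\<^bsub>N\<^esub> v, a \<odot>\<^bsub>E\<^esub> w) \<in> P (int i + j)"
    and Pfun: "\<And>j w. (\<zero>\<^bsub>N\<^esub>, w) \<in> P j \<Longrightarrow> w = \<zero>\<^bsub>E\<^esub>"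
  shows "\<exists>g \<in> carrier N \<rightarrow> carrier E.
    (\<forall>a\<in>carrier R. \<forall>v\<in>carrier N. g (a \<odot>\<^bsub>N\<^esub> v) = a \<odot>\<^bsub>E\<^esub> g v) \<and>
    (\<forall>j. \<forall>v\<in>piece N (j - e). g v \<in> piece E j) \<and> (\<forall>j v w. (v, w) \<in> P j \<longrightarrow> g v = w)"
proof -
  have gE: "gm E" using E by (simp add: graded_injective_def)
  interpret E: module R E using gm_module gE .
  interpret ED: decomposed_group E "piece E" using gm_decomp gE .
  interpret N: module R N using gm_module N .
  interpret ND: decomposed_group N "piece N" using gm_decomp N .
  define J where "J j = fst ` P j" for j
  define \<phi> where "\<phi> j v = (THE w. (v, w) \<in> P j)" for j v
  have Pneg: "(\<ominus>\<^bsub>N\<^esub> v, \<ominus>\<^bsub>E\<^esub> w) \<in> P j" if "(v, w) \<in> P j" for v w j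
  proof -
    have "\<ominus> \<one> \<in> A 0" using one_degree_0 RD.D_rules(4) by blast
    moreover have "v \<in> carrier N" "w \<in> carrier E" using P[OF that] by auto
    ultimately show ?thesis
      using Psm[of "\<ominus> \<one>" 0 v w j] that by (simp add: N.smult_l_minus E.smult_l_minus)
  qed
  \<comment> \<open>Subtracting two pairs with the same first entry reduces single-valuedness to the
    first entry zero, which is \<open>Pfun\<close>.\<close>
  have Puniq: "w = w'" if "(v, w) \<in> P j" "(v, w') \<in> P j" for v w w' j
  proof -
    have "v \<in> carrier N" using P[OF that(1)] by auto
    then have "(\<zero>\<^bsub>N\<^esub>, w \<ominus>\<^bsub>E\<^esub> w') \<in> P j"
      using Padd[OF that(1) Pneg[OF that(2)]] by (simp add: N.r_neg a_minus_def)
    then show ?thesis using Pfun P that by (metis ED.D_carrier E.minus_eq_zero_iff)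
  qed
  have \<phi>: "\<phi> j v = w" if "(v, w) \<in> P j" for j v w
    unfolding \<phi>_def using that Puniq by blast
  have \<phi>P: "(v, \<phi> j v) \<in> P j" if "v \<in> J j" for j v
    using that \<phi> by (auto simp: J_def)
  have JI: "v \<in> J j" if "(v, w) \<in> P j" for v w j using that by (force simp: J_def)
  have Jsub: "additive_subgroup (J j) N" for j
    unfolding additive_subgroup_iff[OF gm_abelian[OF N]]
  proof (intro conjI ballI)
    show "J j \<subseteq> carrier N" using P[OF \<phi>P] ND.D_carrier by blast
    show "\<zero>\<^bsub>N\<^esub> \<in> J j" using JI[OF P0] .
    show "u \<oplus>\<^bsub>N\<^esub> v \<in> J j" if "u \<in> J j" "v \<in> J j" for u v
      using JI[OF Padd[OF \<phi>P[OF that(1)] \<phi>P[OF that(2)]]] .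
    show "\<ominus>\<^bsub>N\<^esub> u \<in> J j" if "u \<in> J j" for u using JI[OF Pneg[OF \<phi>P[OF that]]] .
  qed
  have "J j \<subseteq> piece N (j - e)" for j using P by (auto simp: J_def)
  moreover have "a \<odot>\<^bsub>N\<^esub> v \<in> J (int i + j)" if "a \<in> A i" "v \<in> J j" for a i v j
    using Psm[OF that(1) \<phi>P[OF that(2)]] by (force simp: J_def)
  ultimately have gM: "gm (shifted_submodule N e J)"
    by (intro shifted_submodule_graded[OF N Jsub])
  let ?M = "shifted_submodule N e J"
  \<comment> \<open>This is \<open>N\<close> itself with degrees moved by \<open>e\<close>: a map
    that shifts degrees becomes degree preserving, as \<open>graded_injective\<close>
    requires.\<close>
  have gN: "gm (shifted_submodule N e (\<lambda>j. piece N (j - e)))"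
    by (rule shifted_submodule_graded[OF N ND.D_sub]) (use smult_A_piece[OF N] in \<open>auto simp flip: add_diff_eq\<close>)
  let ?N = "shifted_submodule N e (\<lambda>j. piece N (j - e))"
  have carN: "carrier ?N = carrier N" using ND.hcomp_props(1) by auto
  \<comment> \<open>The relation prescribes values on homogeneous elements only; the value on a
    general element is the sum of the values on its components.\<close>
  have "\<exists>w \<in> carrier E. \<forall>j. dcomp E j w = \<phi> j (dcomp N (j - e) v)" if "v \<in> carrier ?M" for v
  proof -
    define F where "F = {i. dcomp N i v \<noteq> \<zero>\<^bsub>N\<^esub>}"
    have F: "finite F" using ND.hcomp_props that by (simp add: F_def)
    have m: "\<phi> j (dcomp N (j - e) v) \<in> piece E j" for j using that \<phi>P P by fastforce
    have "\<phi> j (dcomp N (j - e) v) = \<zero>\<^bsub>E\<^esub>" if "j \<notin> (\<lambda>i. i + e) ` F" for j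
    proof -
      have "j - e \<notin> F" using that by (metis diff_add_cancel imageI)
      then show ?thesis using \<phi>[OF P0] by (simp add: F_def)
    qed
    then have "dcomp E j (finsum E (\<lambda>j. \<phi> j (dcomp N (j - e) v)) ((\<lambda>i. i + e) ` F)) = \<phi> j (dcomp N (j - e) v)" for j
      by (intro ED.hcomp_unique[OF m _ _ refl]) (use F in auto)
    moreover have "finsum E (\<lambda>j. \<phi> j (dcomp N (j - e) v)) ((\<lambda>i. i + e) ` F) \<in> carrier E"
      using ED.D_carrier[OF m] by (intro E.finsum_closed) blast
    ultimately show ?thesis by blast
  qed
  then obtain f where f: "\<And>v. v \<in> carrier ?M \<Longrightarrow> f v \<in> carrier E"
    "\<And>v j. v \<in> carrier ?M \<Longrightarrow> dcomp E j (f v) = \<phi> j (dcomp N (j - e) v)" by metis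
  have fP: "f v = w" if "(v, w) \<in> P j" for v w j
  proof (rule ED.hcomp_eqI)
    have v: "v \<in> piece N (j - e)" "w \<in> piece E j" using P that by auto
    then have vM: "v \<in> carrier ?M"
      using JI[OF that] JI[OF P0] by (auto simp: ND.hcomp_homogeneous)
    show "dcomp E i (f v) = dcomp E i w" for i
      using f(2)[OF vM, of i] v \<phi>[OF that] \<phi>[OF P0] by (auto simp: ND.hcomp_homogeneous ED.hcomp_homogeneous)
    show "f v \<in> carrier E" "w \<in> carrier E" using f(1)[OF vM] v by auto
  qed
  have fM: "f \<in> graded_hom R ?M E"
  proof -
    have fadd: "f (u \<oplus>\<^bsub>?M\<^esub> v) = f u \<oplus>\<^bsub>E\<^esub> f v" if "u \<in> carrier ?M" "v \<in> carrier ?M" for u v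
    proof (rule ED.hcomp_eqI)
      have uv: "u \<oplus>\<^bsub>?M\<^esub> v \<in> carrier ?M"
        by (rule abelian_monoid.a_closed[OF abelian_group.axioms(1)[OF gm_abelian[OF gM]] that])
      then show "f (u \<oplus>\<^bsub>?M\<^esub> v) \<in> carrier E" "f u \<oplus>\<^bsub>E\<^esub> f v \<in> carrier E"
        using f(1)[OF that(1)] f(1)[OF that(2)] f(1)[of "u \<oplus>\<^bsub>?M\<^esub> v"] by simp_all
      show "dcomp E i (f (u \<oplus>\<^bsub>?M\<^esub> v)) = dcomp E i (f u \<oplus>\<^bsub>E\<^esub> f v)" for i
      proof -
        have "(dcomp N (i - e) (u \<oplus>\<^bsub>N\<^esub> v), \<phi> i (dcomp N (i - e) u) \<oplus>\<^bsub>E\<^esub> \<phi> i (dcomp N (i - e) v)) \<in> P i"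
          using that Padd \<phi>P by (auto simp: ND.hcomp_add)
        from \<phi>[OF this] show ?thesis
          using f(2)[OF uv, of i] f(2)[OF that(1), of i] f(2)[OF that(2), of i] f(1) that by (simp add: ED.hcomp_add)
      qed
    qed
    have fsm: "f (a \<odot>\<^bsub>?M\<^esub> v) = a \<odot>\<^bsub>E\<^esub> f v" if "a \<in> A i" "v \<in> carrier ?M" for a i v
    proof (rule ED.hcomp_eqI)
      have av: "a \<odot>\<^bsub>?M\<^esub> v \<in> carrier ?M"
        by (rule module.smult_closed[OF gm_module[OF gM] A_carrier[OF that(1)] that(2)])
      then show "f (a \<odot>\<^bsub>?M\<^esub> v) \<in> carrier E" "a \<odot>\<^bsub>E\<^esub> f v \<in> carrier E"
        using f(1)[OF that(2)] f(1)[of "a \<odot>\<^bsub>?M\<^esub> v"] A_carrier[OF that(1)] by simp_all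
      show "dcomp E j (f (a \<odot>\<^bsub>?M\<^esub> v)) = dcomp E j (a \<odot>\<^bsub>E\<^esub> f v)" for j
      proof -
        have v: "v \<in> carrier N" using that by simp
        have eq: "int i + (j - int i - e) = j - e" "int i + (j - int i) = j" by auto
        have "dcomp N (j - int i - e) v \<in> J (j - int i)" using that(2) by simp
        from Psm[OF that(1) \<phi>P[OF this]]
        have "(dcomp N (j - e) (a \<odot>\<^bsub>N\<^esub> v), a \<odot>\<^bsub>E\<^esub> \<phi> (j - int i) (dcomp N (j - int i - e) v)) \<in> P j"
          using dcomp_smult[OF N that(1) v, of "j - int i - e"] unfolding eq by simp
        from \<phi>[OF this] show ?thesis
          using f(2)[OF av, of j] f(2)[OF that(2), of "j - int i"] dcomp_smult[OF gE that(1) f(1)[OF that(2)], of "j - int i"]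
          unfolding eq by simp
      qed
    qed
    have "f (a \<odot>\<^bsub>?M\<^esub> v) = a \<odot>\<^bsub>E\<^esub> f v" if "a \<in> carrier R" "v \<in> carrier ?M" for a v
      by (rule linear_if_homogeneous[OF gm_module[OF gM] E.module_axioms Pi_I[OF f(1)] fadd fsm that])
    moreover have "f v \<in> piece E j" if "v \<in> piece ?M j" for v j
      using fP[OF \<phi>P, of v j] P[OF \<phi>P, of v j] that by simp
    ultimately show ?thesis using f(1) fadd unfolding graded_hom_def by blast
  qed
  have incl: "(\<lambda>v. v) \<in> graded_hom R ?M ?N"
    using carN P unfolding graded_hom_def by (auto simp: J_def)
  obtain g where g: "g \<in> graded_hom R ?N E" "\<And>v. v \<in> carrier ?M \<Longrightarrow> g v = f v"
  proof -
    have "\<exists>g\<in>graded_hom R ?N E. \<forall>v\<in>carrier ?M. g ((\<lambda>v. v) v) = f v"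
      by (rule conjunct2[OF E[unfolded graded_injective_def], rule_format, of ?M ?N "\<lambda>v. v" f])
        (intro conjI gM gN fM incl inj_on_id2)
    then show thesis using that by blast
  qed
  have "g v = w" if "(v, w) \<in> P j" for v w j
  proof -
    have "v \<in> carrier ?M"
      using P[OF that] JI[OF that] JI[OF P0] by (auto simp: ND.hcomp_homogeneous)
    then show ?thesis using g(2) fP[OF that] by simp
  qed
  then show ?thesis using graded_homD[OF g(1)] carN by (intro bexI[of _ g]) (auto simp del: shifted_submodule_simps(1))
qed

text \<open>This is Baer's property, with \<open>P\<close> as the graph of a map from a homogeneous
  ideal of \<open>R\<close> to \<open>E\<close>. Injectivity is tested on carriers in
  \<open>'c\<close>, so the ideal is first moved into \<open>N\<close> along \<epsilon>; the element
  \<open>b\<close> is the value of the extension at \<open>\<epsilon> \<one>\<close>.\<close>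

lemma injective_divide:
  fixes E N :: "('a, 'c) graded_module"
  assumes E: "graded_injective R A E" and N: "gm N" "\<epsilon> \<in> graded_hom R RR N" "inj_on \<epsilon> (carrier R)"
    and P: "\<And>j v w. (v, w) \<in> P j \<Longrightarrow> v \<in> int_piece R A (j - e) \<and> w \<in> piece E j"
    and P0: "\<And>j. (\<zero>, \<zero>\<^bsub>E\<^esub>) \<in> P j"
    and Padd: "\<And>j v w v' w'. (v, w) \<in> P j \<Longrightarrow> (v', w') \<in> P j \<Longrightarrow> (v \<oplus> v', w \<oplus>\<^bsub>E\<^esub> w') \<in> P j"
    and Psm: "\<And>i j a v w. a \<in> A i \<Longrightarrow> (v, w) \<in> P j \<Longrightarrow> (a \<otimes> v, a \<odot>\<^bsub>E\<^esub> w) \<in> P (int i + j)"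
    and Pfun: "\<And>j w. (\<zero>, w) \<in> P j \<Longrightarrow> w = \<zero>\<^bsub>E\<^esub>"
  shows "\<exists>b \<in> piece E e. \<forall>j v w. (v, w) \<in> P j \<longrightarrow> v \<odot>\<^bsub>E\<^esub> b = w"
proof -
  note \<epsilon> = graded_homD[OF N(2), simplified]
  have \<epsilon>0: "\<epsilon> \<zero> = \<zero>\<^bsub>N\<^esub>" using additive_zero[OF RR_abelian_group gm_abelian[OF N(1)]] \<epsilon> by simp
  define Q where "Q j = (\<lambda>(v, w). (\<epsilon> v, w)) ` P j" for j
  have QI: "(\<epsilon> v, w) \<in> Q j" if "(v, w) \<in> P j" for v w j using that by (force simp: Q_def)
  have QE: "\<exists>v. (v, w) \<in> P j \<and> u = \<epsilon> v \<and> v \<in> carrier R" if "(u, w) \<in> Q j" for u w j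
    using that P int_pieceD by (fastforce simp: Q_def)
  have "\<exists>g \<in> carrier N \<rightarrow> carrier E.
    (\<forall>a\<in>carrier R. \<forall>v\<in>carrier N. g (a \<odot>\<^bsub>N\<^esub> v) = a \<odot>\<^bsub>E\<^esub> g v) \<and>
    (\<forall>j. \<forall>v\<in>piece N (j - e). g v \<in> piece E j) \<and> (\<forall>j v w. (v, w) \<in> Q j \<longrightarrow> g v = w)"
  proof (rule injective_extension[OF E N(1)])
    show "v \<in> piece N (j - e) \<and> w \<in> piece E j" if "(v, w) \<in> Q j" for v w j
      using QE[OF that] P \<epsilon>(5) by metis
    show "(\<zero>\<^bsub>N\<^esub>, \<zero>\<^bsub>E\<^esub>) \<in> Q j" for j using QI[OF P0] \<epsilon>0 by simp
    show "(v \<oplus>\<^bsub>N\<^esub> v', w \<oplus>\<^bsub>E\<^esub> w') \<in> Q j" if "(v, w) \<in> Q j" "(v', w') \<in> Q j" for v w v' w' j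
      using QE[OF that(1)] QE[OF that(2)] QI[OF Padd] \<epsilon>(3) by metis
    show "(a \<odot>\<^bsub>N\<^esub> v, a \<odot>\<^bsub>E\<^esub> w) \<in> Q (int i + j)" if "a \<in> A i" "(v, w) \<in> Q j" for a i v w j
      using QE[OF that(2)] QI[OF Psm[OF that(1)]] \<epsilon>(4) A_carrier[OF that(1)] by metis
    show "w = \<zero>\<^bsub>E\<^esub>" if "(\<zero>\<^bsub>N\<^esub>, w) \<in> Q j" for w j
      using QE[OF that] Pfun \<epsilon>0 N(3) zero_closed by (metis inj_onD)
  qed
  then obtain g where g: "g \<in> carrier N \<rightarrow> carrier E"
    "\<And>a v. a \<in> carrier R \<Longrightarrow> v \<in> carrier N \<Longrightarrow> g (a \<odot>\<^bsub>N\<^esub> v) = a \<odot>\<^bsub>E\<^esub> g v"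
    "\<And>j v. v \<in> piece N (j - e) \<Longrightarrow> g v \<in> piece E j" "\<And>j v w. (v, w) \<in> Q j \<Longrightarrow> g v = w"
    by blast
  \<comment> \<open>Written as \<open>e - e\<close>, the degree 0 of \<one> matches the shift in
    \<open>g(3)\<close> and puts the value into degree \<open>e\<close>.\<close>
  have "\<epsilon> \<one> \<in> piece N (e - e)" using \<epsilon>(5)[of \<one> 0] one_degree_0 by (simp add: int_piece_def)
  from g(3)[OF this] have "g (\<epsilon> \<one>) \<in> piece E e" .
  moreover have "v \<odot>\<^bsub>E\<^esub> g (\<epsilon> \<one>) = w" if "(v, w) \<in> P j" for v w j
  proof -
    have v: "v \<in> carrier R" using P[OF that] int_pieceD by blast
    have "v \<odot>\<^bsub>E\<^esub> g (\<epsilon> \<one>) = g (\<epsilon> v)" using g(2)[of v "\<epsilon> \<one>"] \<epsilon>(4)[of v \<one>] \<epsilon>(1) v by simp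
    then show ?thesis using g(4)[OF QI[OF that]] by simp
  qed
  ultimately show ?thesis by blast
qed

text \<open>\<open>M j\<close> lists the linear equations of degree \<open>j\<close>, as pairs of coefficients and right-hand side.\<close>

lemma injective_linear_system:
  fixes E N :: "('a, 'c) graded_module"
  assumes E: "graded_injective R A E" and N: "gm N" "\<epsilon> \<in> graded_hom R RR N" "inj_on \<epsilon> (carrier R)"
    and "finite F"
    and M: "\<And>j u w. (u, w) \<in> M j \<Longrightarrow> (\<forall>T\<in>F. u T \<in> int_piece R A (j - e T)) \<and> w \<in> piece E j"
    and M0: "\<And>j. (\<lambda>_. \<zero>, \<zero>\<^bsub>E\<^esub>) \<in> M j"
    and Madd: "\<And>j u w u' w'. (u, w) \<in> M j \<Longrightarrow> (u', w') \<in> M j \<Longrightarrow> (\<lambda>T. u T \<oplus> u' T, w \<oplus>\<^bsub>E\<^esub> w') \<in> M j"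
    and Msm: "\<And>i j a u w. a \<in> A i \<Longrightarrow> (u, w) \<in> M j \<Longrightarrow> (\<lambda>T. a \<otimes> u T, a \<odot>\<^bsub>E\<^esub> w) \<in> M (int i + j)"
    and Mfun: "\<And>j u w. (u, w) \<in> M j \<Longrightarrow> (\<forall>T\<in>F. u T = \<zero>) \<Longrightarrow> w = \<zero>\<^bsub>E\<^esub>"
  shows "\<exists>b. (\<forall>T\<in>F. b T \<in> piece E (e T)) \<and>
    (\<forall>j u w. (u, w) \<in> M j \<longrightarrow> finsum E (\<lambda>T. u T \<odot>\<^bsub>E\<^esub> b T) F = w)"
  using \<open>finite F\<close> M M0 Madd Msm Mfun
proof (induction F arbitrary: M)
  case empty
  have "abelian_group E" by (rule gm_abelian) (use E in \<open>simp add: graded_injective_def\<close>)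
  then interpret E: abelian_group E .
  show ?case using empty(5) by simp
next
  case (insert t F)
  have gE: "gm E" using E by (simp add: graded_injective_def)
  interpret E: module R E using gm_module gE .
  interpret ED: decomposed_group E "piece E" using gm_decomp gE .
  note M = insert.prems(1) and M0 = insert.prems(2) and Madd = insert.prems(3)
    and Msm = insert.prems(4) and Mfun = insert.prems(5)
  \<comment> \<open>These are the equations in which \<open>t\<close> is the only remaining unknown.
    \<open>Mfun\<close> makes them consistent, so Baer's property yields a value for
    \<open>t\<close>.\<close>
  define P where "P j = {(u t, w) | u w. (u, w) \<in> M j \<and> (\<forall>T\<in>F. u T = \<zero>)}" for j
  have PI: "(u t, w) \<in> P j" if "(u, w) \<in> M j" "\<And>T. T \<in> F \<Longrightarrow> u T = \<zero>" for u w j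
    using that by (auto simp: P_def)
  have PE: "\<exists>u. (u, w) \<in> M j \<and> (\<forall>T\<in>F. u T = \<zero>) \<and> v = u t" if "(v, w) \<in> P j" for v w j
    using that by (auto simp: P_def)
  have "\<exists>b \<in> piece E (e t). \<forall>j v w. (v, w) \<in> P j \<longrightarrow> v \<odot>\<^bsub>E\<^esub> b = w"
  proof (rule injective_divide[OF E N])
    show "v \<in> int_piece R A (j - e t) \<and> w \<in> piece E j" if vw: "(v, w) \<in> P j" for v w j
    proof -
      obtain u where "(u, w) \<in> M j" "v = u t" using PE[OF vw] by blast
      then show ?thesis using M[of u w j] by simp
    qed
    show "(\<zero>, \<zero>\<^bsub>E\<^esub>) \<in> P j" for j using PI[OF M0] by simp
    show "(v \<oplus> v', w \<oplus>\<^bsub>E\<^esub> w') \<in> P j" if vw: "(v, w) \<in> P j" "(v', w') \<in> P j" for v w v' w' j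
    proof -
      obtain u where u: "(u, w) \<in> M j" "\<forall>T\<in>F. u T = \<zero>" "v = u t" using PE[OF vw(1)] by blast
      obtain u' where u': "(u', w') \<in> M j" "\<forall>T\<in>F. u' T = \<zero>" "v' = u' t" using PE[OF vw(2)] by blast
      show ?thesis using PI[OF Madd[OF u(1) u'(1)]] u u' by simp
    qed
    show "(a \<otimes> v, a \<odot>\<^bsub>E\<^esub> w) \<in> P (int i + j)" if a: "a \<in> A i" and vw: "(v, w) \<in> P j" for a i v w j
    proof -
      obtain u where u: "(u, w) \<in> M j" "\<forall>T\<in>F. u T = \<zero>" "v = u t" using PE[OF vw] by blast
      then show ?thesis using PI[OF Msm[OF a u(1)]] A_carrier[OF a] by simp
    qed
    show "w = \<zero>\<^bsub>E\<^esub>" if zw: "(\<zero>, w) \<in> P j" for w j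
    proof -
      obtain u where "(u, w) \<in> M j" "\<forall>T\<in>F. u T = \<zero>" "\<zero> = u t" using PE[OF zw] by blast
      then show ?thesis using Mfun[of u w j] by simp
    qed
  qed
  then obtain bt where bt: "bt \<in> piece E (e t)" "\<And>j v w. (v, w) \<in> P j \<Longrightarrow> v \<odot>\<^bsub>E\<^esub> bt = w" by blast
  \<comment> \<open>The value \<open>bt\<close> is substituted and its contribution moved to the
    right-hand side, which leaves a system in the unknowns over \<open>F\<close>.\<close>
  define M' where "M' j = {(u, w \<ominus>\<^bsub>E\<^esub> u t \<odot>\<^bsub>E\<^esub> bt) | u w. (u, w) \<in> M j}" for j
  have M'I: "(u, w \<ominus>\<^bsub>E\<^esub> u t \<odot>\<^bsub>E\<^esub> bt) \<in> M' j" if "(u, w) \<in> M j" for u w j using that by (auto simp: M'_def)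
  have M'E: "\<exists>w. (u, w) \<in> M j \<and> w' = w \<ominus>\<^bsub>E\<^esub> u t \<odot>\<^bsub>E\<^esub> bt \<and> u t \<in> carrier R \<and> w \<in> carrier E \<and> u t \<odot>\<^bsub>E\<^esub> bt \<in> piece E j"
    if uw: "(u, w') \<in> M' j" for u w' j
  proof -
    obtain w where w: "(u, w) \<in> M j" "w' = w \<ominus>\<^bsub>E\<^esub> u t \<odot>\<^bsub>E\<^esub> bt" using uw by (auto simp: M'_def)
    then have "u t \<in> int_piece R A (j - e t)" "w \<in> carrier E" using M[OF w(1)] by auto
    moreover from this have "u t \<odot>\<^bsub>E\<^esub> bt \<in> piece E j"
      using smult_piece[OF gE _ bt(1), of "u t" "j - e t"] by simp
    ultimately show ?thesis using w int_pieceD by blast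
  qed
  have btc: "bt \<in> carrier E" using bt(1) by auto
  have "\<exists>b. (\<forall>T\<in>F. b T \<in> piece E (e T)) \<and>
    (\<forall>j u w. (u, w) \<in> M' j \<longrightarrow> finsum E (\<lambda>T. u T \<odot>\<^bsub>E\<^esub> b T) F = w)"
  proof (rule insert.IH)
    show "(\<forall>T\<in>F. u T \<in> int_piece R A (j - e T)) \<and> w \<in> piece E j" if "(u, w) \<in> M' j" for u w j
      using M'E[OF that] M ED.D_rules(5) by blast
    show "(\<lambda>_. \<zero>, \<zero>\<^bsub>E\<^esub>) \<in> M' j" for j using M'I[OF M0, of j] btc by (simp add: a_minus_def E.r_neg)
    show "(\<lambda>T. u T \<oplus> u' T, w \<oplus>\<^bsub>E\<^esub> w') \<in> M' j" if uw: "(u, w) \<in> M' j" "(u', w') \<in> M' j" for u w u' w' j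
    proof -
      obtain v where v: "(u, v) \<in> M j" "w = v \<ominus>\<^bsub>E\<^esub> u t \<odot>\<^bsub>E\<^esub> bt" "u t \<in> carrier R" "v \<in> carrier E"
        using M'E[OF uw(1)] by blast
      obtain v' where v': "(u', v') \<in> M j" "w' = v' \<ominus>\<^bsub>E\<^esub> u' t \<odot>\<^bsub>E\<^esub> bt" "u' t \<in> carrier R" "v' \<in> carrier E"
        using M'E[OF uw(2)] by blast
      have "v \<oplus>\<^bsub>E\<^esub> v' \<ominus>\<^bsub>E\<^esub> (u t \<oplus> u' t) \<odot>\<^bsub>E\<^esub> bt = w \<oplus>\<^bsub>E\<^esub> w'"
        using v v' btc by (simp add: a_minus_def E.smult_l_distr E.minus_add E.a_ac)
      then show ?thesis using M'I[OF Madd[OF v(1) v'(1)]] by simp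
    qed
    show "(\<lambda>T. a \<otimes> u T, a \<odot>\<^bsub>E\<^esub> w) \<in> M' (int i + j)" if a: "a \<in> A i" and uw: "(u, w) \<in> M' j" for a i u w j
    proof -
      obtain v where v: "(u, v) \<in> M j" "w = v \<ominus>\<^bsub>E\<^esub> u t \<odot>\<^bsub>E\<^esub> bt" "u t \<in> carrier R" "v \<in> carrier E"
        using M'E[OF uw] by blast
      have "a \<odot>\<^bsub>E\<^esub> v \<ominus>\<^bsub>E\<^esub> (a \<otimes> u t) \<odot>\<^bsub>E\<^esub> bt = a \<odot>\<^bsub>E\<^esub> w"
        using v A_carrier[OF a] btc by (simp add: a_minus_def E.smult_r_distr E.smult_r_minus E.smult_assoc1)
      then show ?thesis using M'I[OF Msm[OF a v(1)]] by simp
    qed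
    show "w = \<zero>\<^bsub>E\<^esub>" if uw: "(u, w) \<in> M' j" "\<forall>T\<in>F. u T = \<zero>" for u w j
    proof -
      obtain v where v: "(u, v) \<in> M j" "w = v \<ominus>\<^bsub>E\<^esub> u t \<odot>\<^bsub>E\<^esub> bt" "u t \<in> carrier R" "v \<in> carrier E"
        using M'E[OF uw(1)] by blast
      \<comment> \<open>An equation without coefficients over \<open>F\<close> belongs to
        \<open>P\<close>, and \<open>bt\<close> was chosen to satisfy all of those.\<close>
      then show ?thesis using bt(2)[OF PI[OF v(1)]] uw(2) by (simp add: E.minus_eq_zero_iff)
    qed
  qed
  then obtain b where b: "\<And>T. T \<in> F \<Longrightarrow> b T \<in> piece E (e T)"
    "\<And>j u w. (u, w) \<in> M' j \<Longrightarrow> finsum E (\<lambda>T. u T \<odot>\<^bsub>E\<^esub> b T) F = w" by blast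
  define b' where "b' = b(t := bt)"
  have "finsum E (\<lambda>T. u T \<odot>\<^bsub>E\<^esub> b' T) (insert t F) = w" if "(u, w) \<in> M j" for u w j
  proof -
    have u: "u T \<in> carrier R" if "T \<in> insert t F" for T using M[OF \<open>(u, w) \<in> M j\<close>] that int_pieceD by blast
    have w: "w \<in> carrier E" using M[OF that] by auto
    have ne: "T \<noteq> t" if "T \<in> F" for T using insert.hyps that by auto
    have bc: "b T \<in> carrier E" if "T \<in> F" for T using b(1)[OF that] by auto
    then have "finsum E (\<lambda>T. u T \<odot>\<^bsub>E\<^esub> b' T) (insert t F) = u t \<odot>\<^bsub>E\<^esub> bt \<oplus>\<^bsub>E\<^esub> finsum E (\<lambda>T. u T \<odot>\<^bsub>E\<^esub> b' T) F"
      using insert.hyps u btc ne by (subst E.finsum_insert) (auto simp: b'_def)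
    also have "finsum E (\<lambda>T. u T \<odot>\<^bsub>E\<^esub> b' T) F = finsum E (\<lambda>T. u T \<odot>\<^bsub>E\<^esub> b T) F"
      using bc u ne by (intro E.finsum_cong') (auto simp: b'_def)
    also have "\<dots> = w \<ominus>\<^bsub>E\<^esub> u t \<odot>\<^bsub>E\<^esub> bt" by (rule b(2)[OF M'I[OF that]])
    also have "u t \<odot>\<^bsub>E\<^esub> bt \<oplus>\<^bsub>E\<^esub> (w \<ominus>\<^bsub>E\<^esub> u t \<odot>\<^bsub>E\<^esub> bt) = w"
      using u w btc by (simp add: a_minus_def E.r_neg E.a_lcomm)
    finally show ?thesis .
  qed
  moreover have "\<forall>T\<in>insert t F. b' T \<in> piece E (e T)" using b(1) bt(1) by (simp add: b'_def)
  ultimately show ?case by blast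
qed

end

section \<open>Noetherian graded rings\<close>

lemma (in abelian_group) add_diff_cancel:
  assumes "u \<in> carrier G" "v \<in> carrier G" shows "u \<oplus> (v \<ominus> u) = v"
  using assms by (simp add: a_minus_def a_lcomm[of u v] r_neg)

section \<open>Powers of ideals and radicals\<close>

lemma (in ring) ideal_power_ideal: "ideal J R \<Longrightarrow> ideal (ideal_power R J t) R"
  by (induction t) (simp_all add: oneideal ideal_prod_is_ideal)

lemma (in cring) ideal_power_add:
  assumes "ideal J R"
  shows "ideal_power R J (s + t) = ideal_prod R (ideal_power R J s) (ideal_power R J t)"
proof (induction s)
  case 0
  have "ideal_prod R (carrier R) (ideal_power R J t) = ideal_power R J t"
    using ideal_power_ideal[OF assms] ideal_prod_one[of "ideal_power R J t"]
      ideal_prod_commute[OF oneideal, of "ideal_power R J t"] by simp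
  then show ?case by simp
next
  case (Suc s)
  then show ?case using assms ideal_power_ideal[OF assms] by (simp add: ideal_prod_assoc)
qed

lemma (in ring) ideal_prod_subset:
  assumes "ideal Q R" "\<And>a b. a \<in> I \<Longrightarrow> b \<in> J \<Longrightarrow> a \<otimes> b \<in> Q"
  shows "ideal_prod R I J \<subseteq> Q"
proof
  fix s assume "s \<in> ideal_prod R I J"
  then show "s \<in> Q"
    by (induction s rule: ideal_prod.induct)
      (use assms additive_subgroup.a_closed[OF ideal.axioms(1)[OF assms(1)]] in auto)
qed

lemma (in cring) insert_ideal:
  assumes Q: "ideal Q R" and s: "s \<in> carrier R"
  shows "ideal {q \<oplus> r \<otimes> s | q r. q \<in> Q \<and> r \<in> carrier R} R" (is "ideal ?L R")
proof (rule idealI[OF ring_axioms])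
  note Qr = additive_subgroupD[OF is_abelian_group ideal.axioms(1)[OF Q]]
  have L: "additive_subgroup ?L R"
    unfolding additive_subgroup_iff[OF is_abelian_group]
  proof (intro conjI ballI)
    show "?L \<subseteq> carrier R" using Qr(1) s by auto
    show "\<zero> \<in> ?L" using Qr(2) s by (intro CollectI exI[of _ \<zero>]) auto
    show "u \<oplus> v \<in> ?L" if uv: "u \<in> ?L" "v \<in> ?L" for u v
    proof -
      obtain q r q' r' where "u = q \<oplus> r \<otimes> s" "v = q' \<oplus> r' \<otimes> s" "q \<in> Q" "q' \<in> Q" "r \<in> carrier R" "r' \<in> carrier R"
        using uv by auto
      moreover from this have "q \<oplus> r \<otimes> s \<oplus> (q' \<oplus> r' \<otimes> s) = (q \<oplus> q') \<oplus> (r \<oplus> r') \<otimes> s"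
        using Qr(1) s by (simp add: subset_iff l_distr a_ac)
      ultimately show ?thesis using Qr(3) by blast
    qed
    show "\<ominus> u \<in> ?L" if u: "u \<in> ?L" for u
    proof -
      obtain q r where "u = q \<oplus> r \<otimes> s" "q \<in> Q" "r \<in> carrier R" using u by auto
      moreover from this have "\<ominus> (q \<oplus> r \<otimes> s) = \<ominus> q \<oplus> (\<ominus> r) \<otimes> s"
        using Qr(1) s by (simp add: subset_iff minus_add l_minus)
      ultimately show ?thesis using Qr(4) by blast
    qed
  qed
  then show "subgroup ?L (add_monoid R)" by (rule additive_subgroup.a_subgroup)
  show "b \<otimes> u \<in> ?L" if u: "u \<in> ?L" and b: "b \<in> carrier R" for u b
  proof -
    obtain q r where "u = q \<oplus> r \<otimes> s" "q \<in> Q" "r \<in> carrier R" using u by auto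
    moreover from this have "b \<otimes> (q \<oplus> r \<otimes> s) = b \<otimes> q \<oplus> (b \<otimes> r) \<otimes> s"
      using Qr(1) s b by (simp add: subset_iff r_distr m_assoc)
    ultimately show ?thesis using ideal.I_l_closed[OF Q _ b] b by blast
  qed
  then show "u \<otimes> b \<in> ?L" if u: "u \<in> ?L" and b: "b \<in> carrier R" for u b
    using u b m_comm[of u b] additive_subgroupD(1)[OF is_abelian_group L] by (metis (no_types, lifting) subsetD)
qed

text \<open>Modulo \<open>Q\<close> every element of the power \<open>t\<close> is a multiple of
  \<open>s\<close>, so every element of the power \<open>t * k\<close> is a multiple of
  \<open>s [^] k\<close>, and this lies in \<open>Q\<close>.\<close>

lemma (in cring) ideal_power_insert:
  assumes J: "ideal J R" and Q: "ideal Q R" and s: "s \<in> carrier R" "s [^] (k::nat) \<in> Q"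
    and sub: "ideal_power R J t \<subseteq> {q \<oplus> r \<otimes> s | q r. q \<in> Q \<and> r \<in> carrier R}"
  shows "ideal_power R J (t * k) \<subseteq> Q"
proof -
  note Qc = additive_subgroupD(1)[OF is_abelian_group ideal.axioms(1)[OF Q]]
    and Qadd = additive_subgroupD(3)[OF is_abelian_group ideal.axioms(1)[OF Q]]
  have *: "ideal_power R J (t * k) \<subseteq> {q \<oplus> r \<otimes> s [^] k | q r. q \<in> Q \<and> r \<in> carrier R}" for k :: nat
  proof (induction k)
    case 0
    show ?case
    proof
      fix a assume "a \<in> ideal_power R J (t * 0)"
      then have "a \<in> carrier R" "a = \<zero> \<oplus> a \<otimes> s [^] (0::nat)" by auto
      then show "a \<in> {q \<oplus> r \<otimes> s [^] (0::nat) | q r. q \<in> Q \<and> r \<in> carrier R}"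
        using additive_subgroup.zero_closed[OF ideal.axioms(1)[OF Q]] by blast
    qed
  next
    case (Suc k)
    have "ideal_prod R (ideal_power R J t) (ideal_power R J (t * k)) \<subseteq> {q \<oplus> r \<otimes> s [^] Suc k | q r. q \<in> Q \<and> r \<in> carrier R}"
    proof (rule ideal_prod_subset)
      show "ideal {q \<oplus> r \<otimes> s [^] Suc k | q r. q \<in> Q \<and> r \<in> carrier R} R"
        using s by (intro insert_ideal Q) auto
    next
      fix a b assume ab: "a \<in> ideal_power R J t" "b \<in> ideal_power R J (t * k)"
      obtain q r where a: "a = q \<oplus> r \<otimes> s" "q \<in> Q" "r \<in> carrier R" using sub ab(1) by auto
      obtain q' r' where b: "b = q' \<oplus> r' \<otimes> s [^] k" "q' \<in> Q" "r' \<in> carrier R" using Suc.IH ab(2) by auto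
      have bc: "b \<in> carrier R" and q: "q \<in> carrier R" "q' \<in> carrier R" using a b Qc s by auto
      have "a \<otimes> b = (q \<otimes> b \<oplus> (r \<otimes> s) \<otimes> q') \<oplus> (r \<otimes> r') \<otimes> s [^] Suc k"
      proof -
        have "a \<otimes> b = q \<otimes> b \<oplus> (r \<otimes> s) \<otimes> b" using a q bc s by (simp add: l_distr)
        also have "(r \<otimes> s) \<otimes> b = (r \<otimes> s) \<otimes> q' \<oplus> (r \<otimes> r') \<otimes> s [^] Suc k"
          using a b q s by (simp add: r_distr m_ac)
        finally show ?thesis using a b q bc s by (simp add: a_assoc)
      qed
      moreover have "q \<otimes> b \<oplus> (r \<otimes> s) \<otimes> q' \<in> Q"
        using ideal.I_r_closed[OF Q a(2) bc] ideal.I_l_closed[OF Q b(2), of "r \<otimes> s"] a s Qadd by simp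
      ultimately show "a \<otimes> b \<in> {q \<oplus> r \<otimes> s [^] Suc k | q r. q \<in> Q \<and> r \<in> carrier R}"
        using a b by blast
    qed
    then show ?case using ideal_power_add[OF J, of t "t * k"] by simp
  qed
  show ?thesis
  proof
    fix a assume "a \<in> ideal_power R J (t * k)"
    then obtain q r where "a = q \<oplus> r \<otimes> s [^] k" "q \<in> Q" "r \<in> carrier R" using * by blast
    then show "a \<in> Q" using ideal.I_l_closed[OF Q s(2)] Qadd by simp
  qed
qed

text \<open>Generators are removed one at a time: the induction hypothesis for the ideal generated
  by \<open>Q\<close> and \<open>s\<close> gives a power inside that ideal, and
  \<open>ideal_power_insert\<close> then gets rid of \<open>s\<close>. This is why \<open>Q\<close>
  varies in the induction.\<close>

lemma (in cring) finite_radical: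
  assumes J: "ideal J R" and "finite S" and Q: "ideal Q R"
    and "\<And>s. s \<in> S \<Longrightarrow> s \<in> carrier R \<and> (\<exists>k::nat. s [^] k \<in> Q)"
    and "ideal_power R J t \<subseteq> Idl (S \<union> Q)"
  shows "\<exists>t'. ideal_power R J t' \<subseteq> Q"
  using assms(2-)
proof (induction S arbitrary: Q)
  case empty
  then show ?case using genideal_minimal[of Q Q] by auto
next
  case (insert s S)
  let ?L = "{q \<oplus> r \<otimes> s | q r. q \<in> Q \<and> r \<in> carrier R}"
  have s: "s \<in> carrier R" and S: "S \<subseteq> carrier R" using insert.prems by auto
  have Qc: "Q \<subseteq> carrier R" using additive_subgroupD(1)[OF is_abelian_group ideal.axioms(1)] insert.prems by blast
  have L: "ideal ?L R" by (rule insert_ideal) (use insert.prems s in auto)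
  have "q \<in> ?L" if "q \<in> Q" for q
    using that Qc s by (intro CollectI exI[of _ q] exI[of _ \<zero>]) auto
  then have QL: "Q \<subseteq> ?L" by blast
  have "s \<in> ?L"
    using s additive_subgroup.zero_closed[OF ideal.axioms(1)[OF insert.prems(1)]]
    by (intro CollectI exI[of _ \<zero>] exI[of _ \<one>]) auto
  moreover have "S \<union> ?L \<subseteq> Idl (S \<union> ?L)"
    by (rule genideal_self) (use S additive_subgroupD(1)[OF is_abelian_group ideal.axioms(1)[OF L]] in auto)
  moreover have Lc: "?L \<subseteq> carrier R" using additive_subgroupD(1)[OF is_abelian_group ideal.axioms(1)[OF L]] .
  ultimately have "insert s S \<union> Q \<subseteq> Idl (S \<union> ?L)" using QL by blast
  then have "Idl (insert s S \<union> Q) \<subseteq> Idl (S \<union> ?L)"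
    using S Lc by (intro genideal_minimal genideal_ideal) auto
  then have "\<exists>t'. ideal_power R J t' \<subseteq> ?L"
  proof (intro insert.IH[OF L])
    fix s' assume "s' \<in> S"
    then obtain k :: nat where "s' [^] k \<in> Q" "s' \<in> carrier R" using insert.prems(2)[of s'] by auto
    then show "s' \<in> carrier R \<and> (\<exists>k::nat. s' [^] k \<in> ?L)" using QL by (intro conjI exI[of _ k]) auto
  qed (use insert.prems(3) in auto)
  then obtain t' where "ideal_power R J t' \<subseteq> ?L" by blast
  moreover obtain k :: nat where "s [^] k \<in> Q" using insert.prems(2)[of s] by auto
  ultimately have "ideal_power R J (t' * k) \<subseteq> Q" by (intro ideal_power_insert[OF J insert.prems(1) s])
  then show ?case by blast
qed

text \<open>Each of the finitely many generators of \<open>J\<close> has a power in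
  \<open>Q\<close>, and \<open>finite_radical\<close> can start at exponent 1 because the first
  power of \<open>J\<close> is \<open>J\<close>.\<close>

lemma (in noetherian_ring) power_subset_if_radical:
  assumes "cring R" "ideal J R" "ideal Q R" "\<And>s. s \<in> J \<Longrightarrow> \<exists>k::nat. s [^] k \<in> Q"
  shows "\<exists>t. ideal_power R J t \<subseteq> Q"
proof -
  interpret cring R by fact
  have Jc: "J \<subseteq> carrier R" using additive_subgroupD(1)[OF is_abelian_group ideal.axioms(1)[OF assms(2)]] .
  obtain S where S: "S \<subseteq> carrier R" "finite S" "J = Idl S" using finetely_gen assms(2) by blast
  have Qc: "Q \<subseteq> carrier R" using additive_subgroupD(1)[OF is_abelian_group ideal.axioms(1)[OF assms(3)]] .
  have "J \<subseteq> Idl (S \<union> Q)"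
    unfolding S(3) using S Qc genideal_self[of "S \<union> Q"] by (intro genideal_minimal genideal_ideal) auto
  moreover have "ideal_prod R J (carrier R) = J" using ideal_prod_one[OF assms(2)] ideal_prod_commute[OF assms(2) oneideal] by simp
  ultimately have "ideal_power R J 1 \<subseteq> Idl (S \<union> Q)" by simp
  then show ?thesis
    using finite_radical[OF assms(2) S(2) assms(3), of 1] assms(4) genideal_self[OF S(1)] S by blast
qed

section \<open>Graded submodules of free modules and generation in bounded degrees\<close>

context graded_ring begin

text \<open>The homogeneous parts of a graded submodule of the free module with basis
  \<open>F\<close>, the basis vector at \<open>T\<close> having degree \<open>e T\<close>. Vectors
  vanish off \<open>F\<close>, so equality of vectors is equality of functions.\<close>

definition graded_family :: "'x set \<Rightarrow> ('x \<Rightarrow> int) \<Rightarrow> (int \<Rightarrow> ('x \<Rightarrow> 'a) set) \<Rightarrow> bool" where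
  "graded_family F e M \<longleftrightarrow>
    (\<forall>j. \<forall>u\<in>M j. \<forall>T. u T \<in> (if T \<in> F then int_piece R A (j - e T) else {\<zero>})) \<and>
    (\<forall>j. (\<lambda>_. \<zero>) \<in> M j) \<and> (\<forall>j. \<forall>u\<in>M j. \<forall>v\<in>M j. (\<lambda>T. u T \<oplus> v T) \<in> M j) \<and>
    (\<forall>i j. \<forall>a\<in>A i. \<forall>u\<in>M j. (\<lambda>T. a \<otimes> u T) \<in> M (int i + j))"

lemma graded_familyD:
  assumes "graded_family F e M"
  shows "\<And>j u T. u \<in> M j \<Longrightarrow> T \<in> F \<Longrightarrow> u T \<in> int_piece R A (j - e T)"
    "\<And>j u T. u \<in> M j \<Longrightarrow> T \<notin> F \<Longrightarrow> u T = \<zero>"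
    "\<And>j. (\<lambda>_. \<zero>) \<in> M j" "\<And>j u v. u \<in> M j \<Longrightarrow> v \<in> M j \<Longrightarrow> (\<lambda>T. u T \<oplus> v T) \<in> M j"
    "\<And>i j a u. a \<in> A i \<Longrightarrow> u \<in> M j \<Longrightarrow> (\<lambda>T. a \<otimes> u T) \<in> M (int i + j)"
    "\<And>j u T. u \<in> M j \<Longrightarrow> u T \<in> carrier R"
proof -
  note d = assms[unfolded graded_family_def]
  show c1: "u T \<in> int_piece R A (j - e T)" if "u \<in> M j" "T \<in> F" for u j T
    using d that by (metis (full_types))
  show c2: "u T = \<zero>" if "u \<in> M j" "T \<notin> F" for u j T
    using d that by (metis (full_types) singletonD)
  show "u T \<in> carrier R" if "u \<in> M j" for u j T
    using c1[OF that] c2[OF that] int_pieceD by (cases "T \<in> F") auto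
qed (use assms in \<open>auto simp: graded_family_def\<close>)

lemma graded_family_minus:
  assumes "graded_family F e M" "u \<in> M j" "v \<in> M j"
  shows "(\<lambda>T. u T \<ominus> v T) \<in> M j"
proof -
  note d = graded_familyD[OF assms(1)]
  have "\<ominus> \<one> \<in> A 0" using one_degree_0 RD.D_rules(4) by blast
  from d(5)[OF this assms(3)] have "(\<lambda>T. (\<ominus> \<one>) \<otimes> v T) \<in> M j" by simp
  moreover have "(\<lambda>T. (\<ominus> \<one>) \<otimes> v T) = (\<lambda>T. \<ominus> v T)" using d(6)[OF assms(3)] by (simp add: l_minus)
  ultimately show ?thesis using d(4)[OF assms(2)] by (simp add: a_minus_def)
qed

text \<open>The homogeneous ideal whose part in degree \<open>j - e\<close> of \<open>R\<close> is
  \<open>J j\<close>.\<close>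

definition component_ideal :: "int \<Rightarrow> (int \<Rightarrow> 'a set) \<Rightarrow> 'a set" where
  "component_ideal e J = {a \<in> carrier R. \<forall>j. dcomp RR (j - e) a \<in> J j}"

lemma component_ideal:
  assumes J: "\<And>j. J j \<subseteq> int_piece R A (j - e)" "\<And>j. \<zero> \<in> J j"
    "\<And>j u v. u \<in> J j \<Longrightarrow> v \<in> J j \<Longrightarrow> u \<oplus> v \<in> J j"
    "\<And>i j a u. a \<in> A i \<Longrightarrow> u \<in> J j \<Longrightarrow> a \<otimes> u \<in> J (int i + j)"
  shows "ideal (component_ideal e J) R" "\<And>j a. a \<in> J j \<Longrightarrow> a \<in> component_ideal e J"
proof -
  interpret RR: decomposed_group RR "piece RR" using gm_decomp RR_graded .
  have Jc: "u \<in> carrier R" if "u \<in> J j" for u j using J(1) that int_pieceD by blast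
  have Jneg: "\<ominus> u \<in> J j" if "u \<in> J j" for u j
  proof -
    have "\<ominus> \<one> \<in> A 0" using one_degree_0 RD.D_rules(4) by blast
    from J(4)[OF this that] show ?thesis using Jc[OF that] by (simp add: l_minus)
  qed
  have g: "gm (shifted_submodule RR e J)"
    by (rule shifted_submodule_graded[OF RR_graded])
      (use J Jneg Jc in \<open>auto simp: additive_subgroup_iff[OF RR_abelian_group]\<close>)
  have c: "carrier (shifted_submodule RR e J) = component_ideal e J"
    by (simp add: component_ideal_def)
  interpret S: module R "shifted_submodule RR e J" using gm_module[OF g] .
  have l: "b \<otimes> u \<in> component_ideal e J" if "u \<in> component_ideal e J" "b \<in> carrier R" for b u
    using S.smult_closed[of b u] that unfolding c by simp
  have sub: "component_ideal e J \<subseteq> carrier R" by (auto simp: component_ideal_def)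
  show "ideal (component_ideal e J) R"
  proof (rule idealI[OF ring_axioms])
    have "additive_subgroup (component_ideal e J) R"
      unfolding additive_subgroup_iff[OF is_abelian_group]
    proof (intro conjI ballI sub)
      show "\<zero> \<in> component_ideal e J" using S.M.zero_closed unfolding c by simp
      show "u \<oplus> v \<in> component_ideal e J" if "u \<in> component_ideal e J" "v \<in> component_ideal e J" for u v
        using S.M.a_closed[of u v] that unfolding c by simp
      show "\<ominus> u \<in> component_ideal e J" if "u \<in> component_ideal e J" for u
      proof -
        have "\<ominus> u = (\<ominus> \<one>) \<otimes> u" using that sub by (auto simp: l_minus)
        then show ?thesis using l[OF that, of "\<ominus> \<one>"] by simp
      qed
    qed
    then show "subgroup (component_ideal e J) (add_monoid R)" by (rule additive_subgroup.a_subgroup)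
    show "u \<otimes> b \<in> component_ideal e J" if "u \<in> component_ideal e J" "b \<in> carrier R" for b u
      using l[OF that] that sub m_comm[of u b] by auto
  qed (use l in auto)
  show "a \<in> component_ideal e J" if "a \<in> J j" for a j
  proof -
    have "a \<in> piece RR (j - e)" using J(1) that by auto
    then have "dcomp RR (i - e) a \<in> J i" for i
      using RR.hcomp_homogeneous[of a "j - e" "i - e"] that J(2) by auto
    then show ?thesis using Jc[OF that] by (simp add: component_ideal_def)
  qed
qed

text \<open>A finite generating set has components in boundedly many degrees. A subfamily that
  agrees with \<open>J\<close> up to that bound therefore contains the generators.\<close>

lemma ideal_family_bounded:
  assumes noeth: "noetherian_ring R" and J: "\<And>j. J j \<subseteq> int_piece R A (j - e)" "\<And>j. \<zero> \<in> J j"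
    "\<And>j u v. u \<in> J j \<Longrightarrow> v \<in> J j \<Longrightarrow> u \<oplus> v \<in> J j"
    "\<And>i j a u. a \<in> A i \<Longrightarrow> u \<in> J j \<Longrightarrow> a \<otimes> u \<in> J (int i + j)"
  shows "\<exists>D. \<forall>J'. (\<forall>j. J' j \<subseteq> J j \<and> \<zero> \<in> J' j \<and> (\<forall>u\<in>J' j. \<forall>v\<in>J' j. u \<oplus> v \<in> J' j)) \<longrightarrow>
    (\<forall>i j. \<forall>a\<in>A i. \<forall>u\<in>J' j. a \<otimes> u \<in> J' (int i + j)) \<longrightarrow> (\<forall>j\<le>D. J' j = J j) \<longrightarrow> (\<forall>j. J' j = J j)"
proof -
  interpret RR: decomposed_group RR "piece RR" using gm_decomp RR_graded .
  have ideal: "ideal (component_ideal e J) R" "\<And>j a. a \<in> J j \<Longrightarrow> a \<in> component_ideal e J"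
    by (rule component_ideal; use J in blast)+
  obtain S where S: "S \<subseteq> carrier R" "finite S" "component_ideal e J = Idl S"
    using noetherian_ring.finetely_gen[OF noeth ideal(1)] by blast
  have "finite {i. dcomp RR i s \<noteq> \<zero>}" if "s \<in> S" for s
    using RR.hcomp_props(2)[of s] S that by auto
  then have "bdd_above (\<Union>s\<in>S. {i. dcomp RR i s \<noteq> \<zero>})" using S(2) by simp
  then obtain D where D: "\<And>i s. s \<in> S \<Longrightarrow> dcomp RR i s \<noteq> \<zero> \<Longrightarrow> i \<le> D"
    unfolding bdd_above_def by auto
  \<comment> \<open>The set \<open>J j\<close> sits in degree \<open>j - e\<close> of
    \<open>R\<close>, so a bound \<open>D\<close> on degrees in \<open>R\<close> is the bound
    \<open>D + e\<close> on indices.\<close>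
  show ?thesis
  proof (intro exI[of _ "D + e"] allI impI)
    fix J' j
    assume J': "\<forall>j. J' j \<subseteq> J j \<and> \<zero> \<in> J' j \<and> (\<forall>u\<in>J' j. \<forall>v\<in>J' j. u \<oplus> v \<in> J' j)"
      "\<forall>i j. \<forall>a\<in>A i. \<forall>u\<in>J' j. a \<otimes> u \<in> J' (int i + j)" "\<forall>j\<le>D + e. J' j = J j"
    have ideal': "ideal (component_ideal e J') R"
      by (rule component_ideal(1)) (use J' J(1) in blast)+
    have "S \<subseteq> component_ideal e J'"
    proof
      fix s assume s: "s \<in> S"
      then have sJ: "s \<in> component_ideal e J" using S genideal_self by blast
      have "dcomp RR (i - e) s \<in> J' i" for i
      proof (cases "i \<le> D + e")
        case True then show ?thesis using sJ J'(3) by (simp add: component_ideal_def)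
      next
        case False then have "dcomp RR (i - e) s = \<zero>" using D[OF s, of "i - e"] by force
        then show ?thesis using J'(1) by simp
      qed
      then show "s \<in> component_ideal e J'" using s S by (auto simp: component_ideal_def)
    qed
    then have sub: "component_ideal e J \<subseteq> component_ideal e J'" using genideal_minimal[OF ideal'] S(3) by simp
    have "J j \<subseteq> J' j"
    proof
      fix a assume a: "a \<in> J j"
      then have "dcomp RR (j - e) a \<in> J' j" using ideal(2)[OF a] sub by (auto simp: component_ideal_def)
      moreover have "dcomp RR (j - e) a = a" using J(1)[of j] a RR.hcomp_homogeneous[of a "j - e" "j - e"] by auto
      ultimately show "a \<in> J' j" by simp
    qed
    then show "J' j = J j" using J'(1) by blast
  qed
qed

text \<open>Induction on the rank, as for submodules of free modules over a Noetherian ring: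
  \<open>J\<close> is the image under the coordinate \<open>t\<close>, \<open>K\<close> the kernel.
  Comparing subfamilies instead of listing generators avoids choosing preimages of the generators of
  \<open>J\<close>.\<close>

lemma graded_family_bounded:
  fixes e :: "'x \<Rightarrow> int"
  assumes noeth: "noetherian_ring R" and "finite F" "graded_family F e M"
  shows "\<exists>D. \<forall>M'. graded_family F e M' \<longrightarrow> (\<forall>j. M' j \<subseteq> M j) \<longrightarrow> (\<forall>j\<le>D. M' j = M j) \<longrightarrow> (\<forall>j. M' j = M j)"
  using assms(2,3)
proof (induction F arbitrary: M)
  case empty
  have "M' j = M j" if "graded_family {} e M'" for M' j
  proof -
    have "u = (\<lambda>_. \<zero>)" if "graded_family {} e N" "u \<in> N j" for u N
      using graded_familyD(2)[OF that] by auto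
    then show ?thesis using graded_familyD(3) that empty by blast
  qed
  then show ?case by blast
next
  case (insert t F)
  define J where "J N j = (\<lambda>u. u t) ` N j" for N :: "int \<Rightarrow> ('x \<Rightarrow> 'a) set" and j
  define K where "K N j = {u \<in> N j. u t = \<zero>}" for N :: "int \<Rightarrow> ('x \<Rightarrow> 'a) set" and j
  have JI: "u t \<in> J N j" if "u \<in> N j" for u N j using that by (auto simp: J_def)
  have J: "J N j \<subseteq> int_piece R A (j - e t)" "\<zero> \<in> J N j"
    "\<And>u v. u \<in> J N j \<Longrightarrow> v \<in> J N j \<Longrightarrow> u \<oplus> v \<in> J N j"
    "\<And>i a u. a \<in> A i \<Longrightarrow> u \<in> J N j \<Longrightarrow> a \<otimes> u \<in> J N (int i + j)"
    if "graded_family (insert t F) e N" for N j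
  proof -
    note d = graded_familyD[OF that]
    show "J N j \<subseteq> int_piece R A (j - e t)" using d(1) by (auto simp: J_def)
    show "\<zero> \<in> J N j" using JI[OF d(3)] .
    show "u \<oplus> v \<in> J N j" if uv: "u \<in> J N j" "v \<in> J N j" for u v
    proof -
      obtain u' v' where "u' \<in> N j" "v' \<in> N j" "u = u' t" "v = v' t" using uv by (auto simp: J_def)
      then show ?thesis using JI[of "\<lambda>T. u' T \<oplus> v' T" N j] d(4) by simp
    qed
    show "a \<otimes> u \<in> J N (int i + j)" if a: "a \<in> A i" and u: "u \<in> J N j" for i a u
    proof -
      obtain u' where "u' \<in> N j" "u = u' t" using u by (auto simp: J_def)
      then show ?thesis using JI[of "\<lambda>T. a \<otimes> u' T" N "int i + j"] d(5)[OF a] by simp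
    qed
  qed
  have K: "graded_family F e (K N)" if N: "graded_family (insert t F) e N" for N
  proof -
    note d = graded_familyD[OF N]
    have "u T \<in> (if T \<in> F then int_piece R A (j - e T) else {\<zero>})" if "u \<in> K N j" for j u T
      using that d(1,2)[of u j T] by (auto simp: K_def)
    moreover have "(\<lambda>T. u T \<oplus> v T) \<in> K N j" if "u \<in> K N j" "v \<in> K N j" for j u v
      using that d(4)[of u j v] by (simp add: K_def)
    moreover have "(\<lambda>T. a \<otimes> u T) \<in> K N (int i + j)" if "a \<in> A i" "u \<in> K N j" for i j a u
      using that d(5)[of a i u j] A_carrier[of a i] by (simp add: K_def)
    ultimately show ?thesis using d(3) unfolding graded_family_def K_def by blast
  qed
  obtain D1 where D1: "\<And>J'. (\<forall>j. J' j \<subseteq> J M j \<and> \<zero> \<in> J' j \<and> (\<forall>u\<in>J' j. \<forall>v\<in>J' j. u \<oplus> v \<in> J' j)) \<Longrightarrow>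
    (\<forall>i j. \<forall>a\<in>A i. \<forall>u\<in>J' j. a \<otimes> u \<in> J' (int i + j)) \<Longrightarrow> (\<forall>j\<le>D1. J' j = J M j) \<Longrightarrow> (\<forall>j. J' j = J M j)"
    using ideal_family_bounded[OF noeth J[OF insert.prems]] by blast
  obtain D2 where D2: "\<And>M'. graded_family F e M' \<Longrightarrow> (\<forall>j. M' j \<subseteq> K M j) \<Longrightarrow>
    (\<forall>j\<le>D2. M' j = K M j) \<Longrightarrow> (\<forall>j. M' j = K M j)"
    using insert.IH[OF K[OF insert.prems]] by blast
  show ?case
  proof (intro exI[of _ "max D1 D2"] allI impI)
    fix M' j
    assume M': "graded_family (insert t F) e M'" "\<forall>j. M' j \<subseteq> M j" "\<forall>j\<le>max D1 D2. M' j = M j"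
    have J': "J M' j = J M j" for j
    proof -
      have "\<forall>j. J M' j = J M j"
      proof (rule D1)
        have "J M' j \<subseteq> J M j" for j using M'(2) unfolding J_def by blast
        then show "\<forall>j. J M' j \<subseteq> J M j \<and> \<zero> \<in> J M' j \<and> (\<forall>u\<in>J M' j. \<forall>v\<in>J M' j. u \<oplus> v \<in> J M' j)"
          using J(2,3)[OF M'(1)] by blast
        show "\<forall>i j. \<forall>a\<in>A i. \<forall>u\<in>J M' j. a \<otimes> u \<in> J M' (int i + j)" using J(4)[OF M'(1)] by blast
        show "\<forall>j\<le>D1. J M' j = J M j" using M'(3) by (simp add: J_def)
      qed
      then show ?thesis by simp
    qed
    have K': "K M' j = K M j" for j
    proof -
      have "\<forall>j. K M' j = K M j"
      proof (rule D2[OF K[OF M'(1)]])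
        show "\<forall>j. K M' j \<subseteq> K M j" using M'(2) unfolding K_def by blast
        show "\<forall>j\<le>D2. K M' j = K M j" using M'(3) by (simp add: K_def)
      qed
      then show ?thesis by simp
    qed
    have "u \<in> M' j" if u: "u \<in> M j" for u
    proof -
      \<comment> \<open>Some \<open>u'\<close> in \<open>M'\<close> has the same coordinate at
        \<open>t\<close>; the difference lies in the kernel, where the two families are known to
        agree.\<close>
      have "u t \<in> J M' j" using JI[of u M j, OF u] J' by simp
      then obtain u' where u': "u' \<in> M' j" "u' t = u t" unfolding J_def by force
      have "(\<lambda>T. u T \<ominus> u' T) \<in> K M j"
        using graded_family_minus[OF insert.prems u, of u'] u' M'(2) graded_familyD(6)[OF insert.prems u, of t]
        by (auto simp: K_def a_minus_def r_neg)
      then have "(\<lambda>T. u T \<ominus> u' T) \<in> M' j" using K' by (auto simp: K_def)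
      from graded_familyD(4)[OF M'(1) u'(1) this] have "(\<lambda>T. u' T \<oplus> (u T \<ominus> u' T)) \<in> M' j" .
      moreover have "(\<lambda>T. u' T \<oplus> (u T \<ominus> u' T)) = u"
        using graded_familyD(6)[OF insert.prems u] graded_familyD(6)[OF M'(1) u'(1)]
        by (intro ext) (simp add: add_diff_cancel)
      ultimately show ?thesis by simp
    qed
    then show "M' j = M j" using M'(2) by blast
  qed
qed

text \<open>Generation in degrees up to \<open>D\<close>, phrased as an induction principle with
  \<open>W\<close> as the property to be proved. The elements lying in every such \<open>W\<close>
  form a graded subfamily that agrees with \<open>M\<close> up to degree \<open>D\<close>, hence
  everywhere.\<close>

lemma graded_family_generated:
  assumes noeth: "noetherian_ring R" and "finite F" and M: "graded_family F e M"
  shows "\<exists>D. \<forall>j W. (\<lambda>_. \<zero>) \<in> W \<longrightarrow> (\<forall>u\<in>W. \<forall>v\<in>W. (\<lambda>T. u T \<oplus> v T) \<in> W) \<longrightarrow>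
    (\<forall>l i a u. l \<le> D \<longrightarrow> int i + l = j \<longrightarrow> a \<in> A i \<longrightarrow> u \<in> M l \<longrightarrow> (\<lambda>T. a \<otimes> u T) \<in> W) \<longrightarrow> M j \<subseteq> W"
proof -
  obtain D where D: "\<And>M'. graded_family F e M' \<Longrightarrow> (\<forall>j. M' j \<subseteq> M j) \<Longrightarrow> (\<forall>j\<le>D. M' j = M j) \<Longrightarrow> (\<forall>j. M' j = M j)"
    using graded_family_bounded[OF assms] by blast
  note d = graded_familyD[OF M]
  define P where "P j W \<longleftrightarrow> (\<lambda>_. \<zero>) \<in> W \<and> (\<forall>u\<in>W. \<forall>v\<in>W. (\<lambda>T. u T \<oplus> v T) \<in> W) \<and>
    (\<forall>l i a u. l \<le> D \<longrightarrow> int i + l = j \<longrightarrow> a \<in> A i \<longrightarrow> u \<in> M l \<longrightarrow> (\<lambda>T. a \<otimes> u T) \<in> W)" for j W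
  define M' where "M' j = {u \<in> M j. \<forall>W. P j W \<longrightarrow> u \<in> W}" for j
  have "(\<lambda>T. a \<otimes> u T) \<in> M' (int i + j)" if a: "a \<in> A i" and u: "u \<in> M' j" for a i u j
  proof -
    have "(\<lambda>T. a \<otimes> u T) \<in> W" if W: "P (int i + j) W" for W
    proof -
      \<comment> \<open>The preimage of \<open>W\<close> under multiplication by \<open>a\<close>;
        entries are confined to \<open>R\<close> so that the ring laws apply. Testing
        \<open>u\<close> against it shows that the subfamily is closed under homogeneous
        scalars.\<close>
      define W' where "W' = {u. (\<forall>T. u T \<in> carrier R) \<and> (\<lambda>T. a \<otimes> u T) \<in> W}"
      have "P j W'"
        unfolding P_def
      proof (intro conjI ballI allI impI)
        show "(\<lambda>_. \<zero>) \<in> W'" using W A_carrier[OF a] by (simp add: W'_def P_def)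
        show "(\<lambda>T. u T \<oplus> v T) \<in> W'" if "u \<in> W'" "v \<in> W'" for u v
        proof -
          have "(\<lambda>T. a \<otimes> u T \<oplus> a \<otimes> v T) \<in> W" using that W by (simp add: W'_def P_def)
          moreover have "(\<lambda>T. a \<otimes> (u T \<oplus> v T)) = (\<lambda>T. a \<otimes> u T \<oplus> a \<otimes> v T)"
            using that A_carrier[OF a] by (auto simp: W'_def r_distr)
          ultimately show ?thesis using that by (simp add: W'_def)
        qed
        show "(\<lambda>T. b \<otimes> v T) \<in> W'" if "l \<le> D" "int k + l = j" "b \<in> A k" "v \<in> M l" for l k b v
        proof -
          have "int (i + k) + l = int i + j" using that by simp
          then have "(\<lambda>T. (a \<otimes> b) \<otimes> v T) \<in> W" using W that A_mult[OF a that(3)] unfolding P_def by blast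
          moreover have "(\<lambda>T. (a \<otimes> b) \<otimes> v T) = (\<lambda>T. a \<otimes> (b \<otimes> v T))"
            using that A_carrier[OF a] A_carrier[OF that(3)] d(6)[OF that(4)] by (simp add: m_assoc)
          ultimately show ?thesis using A_carrier[OF that(3)] d(6)[OF that(4)] by (simp add: W'_def)
        qed
      qed
      then show ?thesis using u by (auto simp: M'_def W'_def)
    qed
    then show ?thesis using u d(5)[OF a] by (simp add: M'_def)
  qed
  moreover have "(\<lambda>T. u T \<oplus> v T) \<in> M' j" if "u \<in> M' j" "v \<in> M' j" for j u v
    using that d(4) by (auto simp: M'_def P_def)
  moreover have "(\<lambda>_. \<zero>) \<in> M' j" for j using d(3) by (simp add: M'_def P_def)
  moreover have "u T \<in> (if T \<in> F then int_piece R A (j - e T) else {\<zero>})" if "u \<in> M' j" for j u T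
    using that d(1,2)[of u j T] by (simp add: M'_def)
  ultimately have "graded_family F e M'" unfolding graded_family_def by blast
  moreover have "M' j = M j" if j: "j \<le> D" for j
  proof -
    have "u \<in> W" if "P j W" "u \<in> M j" for u W
    proof -
      \<comment> \<open>In degrees up to \<open>D\<close> an element is its own generator, with
        coefficient \<one> of degree 0.\<close>
      have "(\<lambda>T. \<one> \<otimes> u T) \<in> W"
        using that j one_degree_0 unfolding P_def by (metis add_0 of_nat_0)
      then show ?thesis using d(6)[OF that(2)] by simp
    qed
    then show ?thesis by (auto simp: M'_def)
  qed
  moreover have "\<forall>j. M' j \<subseteq> M j" unfolding M'_def by blast
  ultimately have "\<forall>j. M' j = M j" by (intro D allI impI) blast+
  then have W: "M j \<subseteq> W" if "P j W" for j W using that unfolding M'_def by (metis (no_types, lifting) mem_Collect_eq subsetI)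
  show ?thesis
    by (intro exI[of _ D] allI impI W) (simp only: P_def simp_thms)
qed

section \<open>The ideals of elements without components below degree N\<close>

definition degree_ideal :: "nat \<Rightarrow> 'a set" where
  "degree_ideal N = component_ideal 0 (\<lambda>j. if j < int N then {\<zero>} else int_piece R A j)"

lemma int_piece_rules:
  "\<zero> \<in> int_piece R A j" "u \<in> int_piece R A j \<Longrightarrow> v \<in> int_piece R A j \<Longrightarrow> u \<oplus> v \<in> int_piece R A j"
  "a \<in> int_piece R A i \<Longrightarrow> u \<in> int_piece R A j \<Longrightarrow> a \<otimes> u \<in> int_piece R A (i + j)"
  using piece_rules(2,3)[OF RR_graded] smult_piece[OF RR_graded] by auto

lemma degree_ideal:
  shows "ideal (degree_ideal N) R"
    and "\<And>j a. a \<in> A j \<Longrightarrow> N \<le> j \<Longrightarrow> a \<in> degree_ideal N"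
proof -
  let ?J = "\<lambda>j. if j < int N then {\<zero>} else int_piece R A j"
  have J: "\<And>j. ?J j \<subseteq> int_piece R A (j - 0)" "\<And>j. \<zero> \<in> ?J j"
    "\<And>j u v. u \<in> ?J j \<Longrightarrow> v \<in> ?J j \<Longrightarrow> u \<oplus> v \<in> ?J j"
    "\<And>i j a u. a \<in> A i \<Longrightarrow> u \<in> ?J j \<Longrightarrow> a \<otimes> u \<in> ?J (int i + j)"
    using int_piece_rules(1,2) int_piece_rules(3)[of _ "int _"] A_carrier
    by (auto split: if_splits)
  show "ideal (degree_ideal N) R" unfolding degree_ideal_def by (rule component_ideal(1)[OF J])
  show "a \<in> degree_ideal N" if "a \<in> A j" "N \<le> j" for a j
    unfolding degree_ideal_def by (rule component_ideal(2)[where J = ?J and j = "int j", OF J]) (use that in auto)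
qed

lemma degree_ideal_mem: "a \<in> degree_ideal N \<longleftrightarrow> a \<in> carrier R \<and> (\<forall>j<int N. dcomp RR j a = \<zero>)"
  using dcomp_RR_mem(1) by (auto simp: degree_ideal_def component_ideal_def)

text \<open>The regular module is graded by integers and the ring by naturals. Taking the component
  of degree \<open>int i\<close> of the decomposition in \<open>A\<close> leaves exactly one
  term.\<close>

lemma dcomp_RR_int:
  assumes b: "b \<in> carrier R"
  shows "dcomp RR (int i) b = hcomp R A i b"
proof -
  interpret RR: decomposed_group RR "piece RR" using gm_decomp RR_graded .
  let ?S = "insert i {i. hcomp R A i b \<noteq> \<zero>}"
  have S: "finite ?S" using RD.hcomp_props(2)[OF b] by simp
  have bc: "hcomp R A k b \<in> carrier R" for k using b by simp
  have "dcomp RR (int i) b = dcomp RR (int i) (finsum RR (\<lambda>i. hcomp R A i b) ?S)"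
    using RD.hcomp_sum[OF b S] by simp
  also have "\<dots> = finsum RR (\<lambda>k. dcomp RR (int i) (hcomp R A k b)) ?S"
    by (rule additive_finsum[OF RR_abelian_group RR_abelian_group _ RR.hcomp_add]) (use bc RR.hcomp_closed in auto)
  also have "\<dots> = finsum R (\<lambda>k. if i = k then hcomp R A k b else \<zero>) ?S"
  proof (subst regular_module_finsum, rule finsum_cong'[OF refl])
    show "dcomp RR (int i) (hcomp R A k b) = (if i = k then hcomp R A k b else \<zero>)" for k
      using RR.hcomp_homogeneous[of "hcomp R A k b" "int k" "int i"] RD.hcomp_props(1)[OF b, of k] by simp
  qed (use bc in auto)
  also have "\<dots> = hcomp R A i b"
    using finsum_singleton[of i ?S "\<lambda>i. hcomp R A i b"] S bc by simp
  finally show ?thesis .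
qed

text \<open>Each component of \<open>b\<close> has degree at least \<open>N\<close> and moves the
  components of \<open>a\<close>, all of positive degree, above \<open>N\<close>.\<close>

lemma degree_ideal_mult:
  assumes "a \<in> degree_ideal 1" "b \<in> degree_ideal N"
  shows "a \<otimes> b \<in> degree_ideal (Suc N)"
proof -
  have a: "a \<in> carrier R" and b: "b \<in> carrier R" using assms by (auto simp: degree_ideal_mem)
  let ?S = "{i. hcomp R A i b \<noteq> \<zero>}"
  have "a \<otimes> b = b \<otimes> a" using a b by (rule m_comm)
  also have "\<dots> = finsum R (\<lambda>i. hcomp R A i b \<otimes> a) ?S"
    using smult_decomp[OF RR_module b, of a] a by simp
  also have "\<dots> \<in> degree_ideal (Suc N)"
  proof (rule finsum_mem)
    note r = additive_subgroupD[OF is_abelian_group ideal.axioms(1)[OF degree_ideal(1)]]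
    show "degree_ideal (Suc N) \<subseteq> carrier R" "\<zero> \<in> degree_ideal (Suc N)"
      "\<And>u v. u \<in> degree_ideal (Suc N) \<Longrightarrow> v \<in> degree_ideal (Suc N) \<Longrightarrow> u \<oplus> v \<in> degree_ideal (Suc N)"
      using r by auto
    fix i assume "i \<in> ?S"
    have bi: "hcomp R A i b \<in> A i" using RD.hcomp_props(1) b .
    have "N \<le> i"
    proof (rule ccontr)
      assume "\<not> N \<le> i"
      then have "dcomp RR (int i) b = \<zero>" using assms(2) by (simp add: degree_ideal_mem)
      then show False using \<open>i \<in> ?S\<close> dcomp_RR_int[OF b, of i] by simp
    qed
    have "dcomp RR j (hcomp R A i b \<otimes> a) = \<zero>" if "j < int (Suc N)" for j
    proof -
      have "dcomp RR (int i + (j - int i)) (hcomp R A i b \<odot>\<^bsub>RR\<^esub> a) = hcomp R A i b \<odot>\<^bsub>RR\<^esub> dcomp RR (j - int i) a"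
        using dcomp_smult[OF RR_graded bi, of a "j - int i"] a by simp
      moreover have "dcomp RR (j - int i) a = \<zero>"
        using that \<open>N \<le> i\<close> assms(1) by (simp add: degree_ideal_mem)
      ultimately show ?thesis using bi A_carrier by simp
    qed
    then show "hcomp R A i b \<otimes> a \<in> degree_ideal (Suc N)" using a b by (simp add: degree_ideal_mem)
  qed
  finally show ?thesis .
qed

lemma degree_ideal_annihilates:
  assumes "gm M" "a \<in> degree_ideal N" "v \<in> carrier M" "\<And>j b. N \<le> j \<Longrightarrow> b \<in> A j \<Longrightarrow> b \<odot>\<^bsub>M\<^esub> v = \<zero>\<^bsub>M\<^esub>"
  shows "a \<odot>\<^bsub>M\<^esub> v = \<zero>\<^bsub>M\<^esub>"
proof (rule smult_sum_dcomp[OF assms(1) _ assms(3)])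
  interpret M: module R M using gm_module assms(1) .
  show a: "a \<in> carrier R" using assms(2) by (simp add: degree_ideal_mem)
  show "dcomp RR i a \<odot>\<^bsub>M\<^esub> v = \<zero>\<^bsub>M\<^esub>" for i
  proof (cases "i < int N")
    case True then show ?thesis using assms(2,3) by (simp add: degree_ideal_mem)
  next
    case False
    then have "dcomp RR i a \<in> A (nat i)" "N \<le> nat i" using dcomp_RR_mem(1)[OF a, of i] by (auto simp: int_piece_def)
    then show ?thesis using assms(4) by blast
  qed
qed

end

section \<open>The homogeneous maximal ideal and torsion for its powers\<close>

locale graded_local_ring = graded_ring R A for R :: "('a, 'm) ring_scheme" (structure) and A +
  fixes \<mm> :: "'a set"
  assumes noetherian: "noetherian_ring R" and maximal: "maximalideal \<mm> R"
    and homogeneous: "homogeneous_ideal R A \<mm>"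
    and degree_0_units: "\<And>a. a \<in> A 0 \<Longrightarrow> a \<noteq> \<zero> \<Longrightarrow> a \<in> Units R"
begin

lemma m_ideal: "ideal \<mm> R" using maximal by (simp add: maximalideal_def)

text \<open>Nonzero elements of degree 0 are units, so the homogeneous elements of \<mm> lie in the
  ideal of elements of positive order, and they generate \<mm>. That ideal is proper, so maximality
  gives equality.\<close>

lemma m_eq: "\<mm> = degree_ideal 1"
proof -
  interpret m: maximalideal \<mm> R by (rule maximal)
  interpret RR: decomposed_group RR "piece RR" using gm_decomp RR_graded .
  have "\<mm> \<inter> (\<Union>i. A i) \<subseteq> degree_ideal 1"
  proof
    fix a assume "a \<in> \<mm> \<inter> (\<Union>i. A i)"
    then obtain i where a: "a \<in> \<mm>" "a \<in> A i" by auto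
    show "a \<in> degree_ideal 1"
    proof (cases "i = 0")
      case True
      have "a \<notin> Units R"
      proof
        assume "a \<in> Units R"
        then have "\<one> \<in> \<mm>" using ideal.I_l_closed[OF m_ideal a(1), of "inv a"] by simp
        then show False using m.one_imp_carrier m.I_notcarr by simp
      qed
      then have "a = \<zero>" using degree_0_units a True by blast
      then show ?thesis using additive_subgroup.zero_closed[OF ideal.axioms(1)[OF degree_ideal(1)]] by simp
    next
      case False then show ?thesis using a degree_ideal(2)[of a i 1] by simp
    qed
  qed
  then have sub: "\<mm> \<subseteq> degree_ideal 1"
  proof -
    have "\<mm> = Idl (\<mm> \<inter> (\<Union>i. A i))" using homogeneous by (simp add: homogeneous_ideal_def)
    also assume "\<mm> \<inter> (\<Union>i. A i) \<subseteq> degree_ideal 1"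
    then have "Idl (\<mm> \<inter> (\<Union>i. A i)) \<subseteq> degree_ideal 1" by (rule genideal_minimal[OF degree_ideal(1)])
    finally show ?thesis .
  qed
  have "degree_ideal 1 \<noteq> carrier R"
  proof
    assume "degree_ideal 1 = carrier R"
    then have "\<one> \<in> degree_ideal 1" by simp
    then have "\<one> = \<zero>" using RR.hcomp_homogeneous[of \<one> 0 0] one_degree_0 int_piece_int[of 0]
      by (auto simp: degree_ideal_mem simp del: int_piece_int)
    then have "\<one> \<in> \<mm>" using m.zero_closed by simp
    then show False using m.one_imp_carrier m.I_notcarr by simp
  qed
  moreover have "degree_ideal 1 = \<mm> \<or> degree_ideal 1 = carrier R"
    using degree_ideal_mem by (intro m.I_maximal[OF degree_ideal(1) sub]) blast
  ultimately show ?thesis by simp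
qed

lemma m_power_degree: "ideal_power R \<mm> N \<subseteq> degree_ideal N"
proof (induction N)
  case (Suc N)
  have "ideal_prod R \<mm> (ideal_power R \<mm> N) \<subseteq> degree_ideal (Suc N)"
    by (rule ideal_prod_subset[OF degree_ideal(1)]) (use Suc m_eq in \<open>simp add: degree_ideal_mult subset_iff\<close>)
  then show ?case by simp
next
  case 0
  have "dcomp RR j a = \<zero>" if "a \<in> carrier R" "j < 0" for j a
    using dcomp_RR_mem(1)[OF that(1), of j] that(2) by (simp add: int_piece_def)
  then show ?case by (auto simp: degree_ideal_mem)
qed

text \<open>\<mm> is generated in degrees up to some \<open>D\<close>. An element of very large
  degree is a sum of products of a generator with a coefficient of still large degree, and by
  induction that coefficient lies in the power \<open>t\<close>.\<close>

lemma degree_m_power: "\<exists>N. \<forall>j\<ge>N. A j \<subseteq> ideal_power R \<mm> t"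
proof -
  \<comment> \<open>The ideal \<mm> as a graded submodule of a free module of rank one, with
    \<open>()\<close> as the only index.\<close>
  define M where "M j = {u. (u :: unit \<Rightarrow> 'a) () \<in> (if j < 1 then {\<zero>} else int_piece R A j)}" for j
  have fam: "graded_family UNIV (\<lambda>_. 0) M"
    using int_piece_rules(1,2) int_piece_rules(3)[of _ "int _"] A_carrier
    unfolding graded_family_def M_def by (auto split: if_splits)
  obtain D where D: "\<And>j W. (\<lambda>_. \<zero>) \<in> W \<Longrightarrow> (\<forall>u\<in>W. \<forall>v\<in>W. (\<lambda>T. u T \<oplus> v T) \<in> W) \<Longrightarrow>
    (\<forall>l i a u. l \<le> D \<longrightarrow> int i + l = j \<longrightarrow> a \<in> A i \<longrightarrow> u \<in> M l \<longrightarrow> (\<lambda>T. a \<otimes> u T) \<in> W) \<Longrightarrow> M j \<subseteq> W"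
    using graded_family_generated[OF noetherian finite fam] by blast
  show ?thesis
  proof (induction t)
    case 0
    then show ?case using A_carrier by auto
  next
    case (Suc t)
    then obtain N where N: "\<And>j. N \<le> j \<Longrightarrow> A j \<subseteq> ideal_power R \<mm> t" by blast
    \<comment> \<open>\<open>D\<close> is an integer and may be negative, hence
      \<open>nat D\<close>; the summand 1 makes \<open>j\<close> positive, so that
      \<open>A j\<close> is part of \<open>M\<close>.\<close>
    have "A j \<subseteq> ideal_power R \<mm> (Suc t)" if j: "N + nat D + 1 \<le> j" for j
    proof -
      define W where "W = {u. (u :: unit \<Rightarrow> 'a) () \<in> ideal_power R \<mm> (Suc t)}"
      note r = additive_subgroupD[OF is_abelian_group ideal.axioms(1)[OF ideal_power_ideal[OF m_ideal, of "Suc t"]]]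
      have "M (int j) \<subseteq> W"
      proof (rule D)
        show "(\<lambda>_. \<zero>) \<in> W" "\<forall>u\<in>W. \<forall>v\<in>W. (\<lambda>T. u T \<oplus> v T) \<in> W"
          using r(2,3) unfolding W_def by blast+
        show "\<forall>l i a u. l \<le> D \<longrightarrow> int i + l = int j \<longrightarrow> a \<in> A i \<longrightarrow> u \<in> M l \<longrightarrow> (\<lambda>T. a \<otimes> u T) \<in> W"
        proof (intro allI impI)
          fix l i a u assume h: "l \<le> D" "int i + l = int j" "a \<in> A i" "u \<in> M l"
          have "u () \<in> degree_ideal 1"
          proof (cases "l < 1")
            case True
            then show ?thesis using h(4) additive_subgroup.zero_closed[OF ideal.axioms(1)[OF degree_ideal(1)]] by (simp add: M_def)
          next
            case False
            then have "u () \<in> A (nat l)" using h(4) by (simp add: M_def int_piece_def)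
            then show ?thesis using degree_ideal(2)[of "u ()" "nat l" 1] False by simp
          qed
          then have u: "u () \<in> \<mm>" using m_eq by simp
          moreover have "a \<in> ideal_power R \<mm> t" using N[of i] h j by (smt (verit) int_nat_eq nat_int_comparison(3) of_nat_1 of_nat_add subsetD)
          ultimately have "u () \<otimes> a \<in> ideal_power R \<mm> (Suc t)" by (simp add: ideal_prod.prod)
          moreover have "u () \<in> carrier R" using u additive_subgroupD(1)[OF is_abelian_group ideal.axioms(1)[OF m_ideal]] by blast
          ultimately show "(\<lambda>T. a \<otimes> u T) \<in> W" using A_carrier[OF h(3)] by (simp add: W_def m_comm)
        qed
      qed
      moreover have "(\<lambda>_. a) \<in> M (int j)" if "a \<in> A j" for a using that j by (simp add: M_def)
      ultimately show ?thesis by (auto simp: W_def)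
    qed
    then show ?case by blast
  qed
qed

text \<open>The powers of \<mm> and the ideals of elements of large order are cofinal, by
  \<open>m_power_degree\<close> and \<open>degree_m_power\<close>.\<close>

lemma tors_eq:
  assumes M: "gm M"
  shows "tors M = {v \<in> carrier M. \<exists>t. \<forall>a \<in> ideal_power R \<mm> t. a \<odot>\<^bsub>M\<^esub> v = \<zero>\<^bsub>M\<^esub>}"
proof (intro equalityI subsetI)
  fix v assume "v \<in> tors M"
  then obtain N where v: "v \<in> carrier M" "\<And>j b. N \<le> j \<Longrightarrow> b \<in> A j \<Longrightarrow> b \<odot>\<^bsub>M\<^esub> v = \<zero>\<^bsub>M\<^esub>" by (auto simp: tors_def)
  have "a \<odot>\<^bsub>M\<^esub> v = \<zero>\<^bsub>M\<^esub>" if "a \<in> ideal_power R \<mm> N" for a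
    by (rule degree_ideal_annihilates[OF M subsetD[OF m_power_degree that] v])
  then show "v \<in> {v \<in> carrier M. \<exists>t. \<forall>a \<in> ideal_power R \<mm> t. a \<odot>\<^bsub>M\<^esub> v = \<zero>\<^bsub>M\<^esub>}" using v(1) by blast
next
  fix v assume "v \<in> {v \<in> carrier M. \<exists>t. \<forall>a \<in> ideal_power R \<mm> t. a \<odot>\<^bsub>M\<^esub> v = \<zero>\<^bsub>M\<^esub>}"
  then show "v \<in> tors M" using degree_m_power unfolding tors_def by blast
qed

end

section \<open>The Koszul differential\<close>

text \<open>A new index adds a row and a column that cancel each other. Arguing by induction avoids
  a division by 2.\<close>

lemma (in abelian_group) finsum_antisymmetric:
  assumes "finite T" "\<And>i j. i \<in> T \<Longrightarrow> j \<in> T \<Longrightarrow> i \<noteq> j \<Longrightarrow> f i j \<in> carrier G"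
    "\<And>i j. i \<in> T \<Longrightarrow> j \<in> T \<Longrightarrow> i \<noteq> j \<Longrightarrow> f i j = \<ominus> f j i"
  shows "finsum G (\<lambda>i. finsum G (f i) (T - {i})) T = \<zero>"
  using assms
proof (induction T)
  case (insert t T)
  have ne: "i \<noteq> t" if "i \<in> T" for i using insert.hyps that by auto
  have c: "f i j \<in> carrier G" if "i \<in> insert t T" "j \<in> insert t T" "i \<noteq> j" for i j
    using insert.prems(1) that .
  have inner: "finsum G (f i) (T - {i}) \<in> carrier G" if "i \<in> T" for i
    using c that by (intro finsum_closed) auto
  have row: "finsum G (f i) (insert t T - {i}) = f i t \<oplus> finsum G (f i) (T - {i})" if "i \<in> T" for i
  proof -
    have "insert t T - {i} = insert t (T - {i})" using ne that by auto
    then show ?thesis using insert.hyps c that ne by (subst finsum_insert[symmetric]) auto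
  qed
  have "insert t T - {t} = T" using insert.hyps by auto
  then have "finsum G (\<lambda>i. finsum G (f i) (insert t T - {i})) (insert t T) =
    finsum G (f t) T \<oplus> finsum G (\<lambda>i. finsum G (f i) (insert t T - {i})) T"
    using insert.hyps c row inner ne by (subst finsum_insert) (auto intro!: finsum_closed)
  also have "finsum G (\<lambda>i. finsum G (f i) (insert t T - {i})) T = finsum G (\<lambda>i. f i t \<oplus> finsum G (f i) (T - {i})) T"
    using row c inner ne by (intro finsum_cong') auto
  also have "\<dots> = finsum G (\<lambda>i. f i t) T \<oplus> finsum G (\<lambda>i. finsum G (f i) (T - {i})) T"
    using c inner ne by (intro finsum_addf) auto
  also have "finsum G (\<lambda>i. finsum G (f i) (T - {i})) T = \<zero>"
    by (rule insert.IH) (use insert.prems in blast)+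
  also have "finsum G (\<lambda>i. f i t) T = finsum G (\<lambda>i. \<ominus> f t i) T"
  proof (rule finsum_cong'[OF refl])
    show "f i t = \<ominus> f t i" if "i \<in> T" for i using insert.prems(2)[of i t] that ne by blast
  qed (use c ne in auto)
  also have "\<dots> = \<ominus> finsum G (f t) T" using c ne by (intro finsum_neg) auto
  finally have "finsum G (\<lambda>i. finsum G (f i) (insert t T - {i})) (insert t T) =
    finsum G (f t) T \<oplus> (\<ominus> finsum G (f t) T \<oplus> \<zero>)" .
  moreover have "finsum G (f t) T \<in> carrier G" using c ne by (intro finsum_closed) auto
  ultimately show ?case by (simp add: r_neg)
qed (rule finsum_empty)

lemma (in abelian_group) finsum_Sigma:
  assumes "finite S" "\<And>s. s \<in> S \<Longrightarrow> finite (B s)"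
    "\<And>s b. s \<in> S \<Longrightarrow> b \<in> B s \<Longrightarrow> f s b \<in> carrier G"
  shows "finsum G (\<lambda>s. finsum G (f s) (B s)) S = finsum G (\<lambda>(s, b). f s b) (Sigma S B)"
  using assms
proof (induction S)
  case (insert s S)
  have 1: "finsum G (f s) (B s) = finsum G (\<lambda>(s, b). f s b) ({s} \<times> B s)"
  proof -
    have "{s} \<times> B s = Pair s ` B s" by auto
    moreover have "finsum G (\<lambda>(s, b). f s b) (Pair s ` B s) = finsum G (\<lambda>b. f s b) (B s)"
      using insert.prems by (subst finsum_reindex) (auto simp: inj_on_def)
    ultimately show ?thesis by simp
  qed
  have 2: "Sigma (insert s S) B = ({s} \<times> B s) \<union> Sigma S B" by auto
  have "finsum G (\<lambda>s. finsum G (f s) (B s)) (insert s S) = finsum G (f s) (B s) \<oplus> finsum G (\<lambda>s. finsum G (f s) (B s)) S"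
    using insert.hyps insert.prems by (subst finsum_insert) (auto intro!: finsum_closed)
  also have "\<dots> = finsum G (\<lambda>(s, b). f s b) (Sigma (insert s S) B)"
    unfolding 1 2 using insert by (subst finsum_Un_disjoint) auto
  finally show ?case .
qed simp

locale koszul = graded_ring R A for R :: "('a, 'm) ring_scheme" (structure) and A +
  fixes n :: nat and x :: "nat \<Rightarrow> 'a" and d :: "nat \<Rightarrow> nat"
  assumes x_degree: "\<And>i. i < n \<Longrightarrow> x i \<in> A (d i)"
begin

definition pos :: "nat \<Rightarrow> nat set \<Rightarrow> bool" where
  "pos i T \<longleftrightarrow> even (card {j \<in> T. j < i})"

text \<open>The entry of the Koszul matrix for removing \<open>i\<close> from \<open>T\<close>, sign
  included.\<close>

definition kx :: "nat \<Rightarrow> nat set \<Rightarrow> 'a" where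
  "kx i T = (if pos i T then x i else \<ominus> x i)"

text \<open>The Koszul differential with coefficients in \<open>M\<close>, in all cohomological
  degrees at once: a cochain is a function on all index sets, and only the values at the sets
  \<open>T - {i}\<close> enter.\<close>

definition kd :: "('a, 'b) graded_module \<Rightarrow> (nat set \<Rightarrow> 'b) \<Rightarrow> nat set \<Rightarrow> 'b" where
  "kd M c T = (\<Oplus>\<^bsub>M\<^esub>i\<in>T. kx i T \<odot>\<^bsub>M\<^esub> c (T - {i}))"

definition wt :: "nat set \<Rightarrow> int" where
  "wt T = int (\<Sum>i\<in>T. d i)"

lemma kx_degree: "i < n \<Longrightarrow> kx i T \<in> A (d i)"
  using x_degree RD.D_rules(4) by (simp add: kx_def)

lemma kx_carrier [simp]: "i < n \<Longrightarrow> kx i T \<in> carrier R"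
  using kx_degree A_carrier by blast

lemma x_carrier [simp]: "i < n \<Longrightarrow> x i \<in> carrier R"
  using x_degree A_carrier by blast

lemma pos_remove:
  assumes "finite T" "i \<in> T" "i \<noteq> j"
  shows "pos j (T - {i}) \<longleftrightarrow> (if i < j then \<not> pos j T else pos j T)"
proof (cases "i < j")
  case True
  have "{k \<in> T - {i}. k < j} = {k \<in> T. k < j} - {i}" by auto
  moreover have "card ({k \<in> T. k < j} - {i}) = card {k \<in> T. k < j} - 1"
    using assms True by (intro card_Diff_singleton) auto
  moreover have "card {k \<in> T. k < j} \<noteq> 0" using assms True by (auto simp: card_eq_0_iff)
  then obtain m where "card {k \<in> T. k < j} = Suc m" using not0_implies_Suc by blast
  ultimately show ?thesis using True by (simp add: pos_def del: card_eq_0_iff)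
next
  case False
  then have "{k \<in> T - {i}. k < j} = {k \<in> T. k < j}" using assms by auto
  then show ?thesis using False by (simp add: pos_def)
qed

text \<open>Of two distinct indices, removing the smaller one shifts the position of the larger,
  while removing the larger leaves the position of the smaller unchanged: exactly one sign
  flips.\<close>

lemma kx_anticommute:
  assumes "finite T" "i \<in> T" "j \<in> T" "i \<noteq> j" "i < n" "j < n"
  shows "kx i T \<otimes> kx j (T - {i}) = \<ominus> (kx j T \<otimes> kx i (T - {j}))"
  using assms pos_remove[of T i j] pos_remove[of T j i] x_carrier[of i] x_carrier[of j]
  by (auto simp: kx_def l_minus r_minus m_comm[of "x i" "x j"] split: if_splits)

section \<open>The Koszul complex with coefficients in a graded module\<close>

context
  fixes M :: "('a, 'b) graded_module"
  assumes M: "gm M"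
begin

interpretation M: module R M using gm_module[OF M] .
interpretation MD: decomposed_group M "piece M" using gm_decomp[OF M] .

lemma kd_closed:
  assumes "T \<subseteq> {..<n}" "\<And>i. i \<in> T \<Longrightarrow> c (T - {i}) \<in> carrier M"
  shows "kd M c T \<in> carrier M"
  unfolding kd_def using assms by (intro M.finsum_closed) (auto simp: subset_iff)

lemma kd_cong:
  assumes "T \<subseteq> {..<n}" "\<And>i. i \<in> T \<Longrightarrow> c (T - {i}) \<in> carrier M" "\<And>i. i \<in> T \<Longrightarrow> c (T - {i}) = c' (T - {i})"
  shows "kd M c T = kd M c' T"
  unfolding kd_def using assms by (intro M.finsum_cong') (auto simp: subset_iff)

lemma kd_zero:
  assumes "T \<subseteq> {..<n}" "\<And>i. i \<in> T \<Longrightarrow> c (T - {i}) = \<zero>\<^bsub>M\<^esub>"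
  shows "kd M c T = \<zero>\<^bsub>M\<^esub>"
  unfolding kd_def using assms by (intro M.add.finprod_one_eqI) (auto simp: subset_iff)

lemma kd_add:
  assumes "T \<subseteq> {..<n}" "\<And>i. i \<in> T \<Longrightarrow> c (T - {i}) \<in> carrier M" "\<And>i. i \<in> T \<Longrightarrow> c' (T - {i}) \<in> carrier M"
  shows "kd M (\<lambda>T. c T \<oplus>\<^bsub>M\<^esub> c' T) T = kd M c T \<oplus>\<^bsub>M\<^esub> kd M c' T"
proof -
  have "kd M (\<lambda>T. c T \<oplus>\<^bsub>M\<^esub> c' T) T = (\<Oplus>\<^bsub>M\<^esub>i\<in>T. kx i T \<odot>\<^bsub>M\<^esub> c (T - {i}) \<oplus>\<^bsub>M\<^esub> kx i T \<odot>\<^bsub>M\<^esub> c' (T - {i}))"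
    unfolding kd_def using assms by (intro M.finsum_cong') (auto simp: M.smult_r_distr subset_iff)
  also have "\<dots> = kd M c T \<oplus>\<^bsub>M\<^esub> kd M c' T"
    unfolding kd_def using assms by (intro M.finsum_addf) (auto simp: subset_iff)
  finally show ?thesis .
qed

lemma kd_mem:
  assumes "T \<subseteq> {..<n}" "additive_subgroup H M"
    "\<And>i. i \<in> T \<Longrightarrow> kx i T \<odot>\<^bsub>M\<^esub> c (T - {i}) \<in> H"
  shows "kd M c T \<in> H"
  unfolding kd_def
  by (rule M.finsum_mem) (use additive_subgroupD[OF M.abelian_group_axioms assms(2)] assms(3) in auto)

lemma kd_tors:
  assumes "T \<subseteq> {..<n}" "\<And>i. i \<in> T \<Longrightarrow> c (T - {i}) \<in> tors M"
  shows "kd M c T \<in> tors M"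
  using assms by (intro kd_mem tors_additive_subgroup M) (auto intro!: tors_smult M)

lemma wt_remove: "T \<subseteq> {..<n} \<Longrightarrow> i \<in> T \<Longrightarrow> wt T = int (d i) + wt (T - {i})"
  unfolding wt_def by (subst sum.remove[of T i]) (auto intro: finite_subset)

lemma kd_piece:
  assumes T: "T \<subseteq> {..<n}" and c: "\<And>i. i \<in> T \<Longrightarrow> c (T - {i}) \<in> piece M (k + wt (T - {i}))"
  shows "kd M c T \<in> piece M (k + wt T)"
proof (rule kd_mem[OF T MD.D_sub])
  fix i assume i: "i \<in> T"
  have "kx i T \<odot>\<^bsub>M\<^esub> c (T - {i}) \<in> piece M (int (d i) + (k + wt (T - {i})))"
    using T i by (intro smult_A_piece[OF M kx_degree c]) auto
  then show "kx i T \<odot>\<^bsub>M\<^esub> c (T - {i}) \<in> piece M (k + wt T)"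
    using wt_remove[OF T i] by (simp add: ac_simps)
qed

lemma kd_smult:
  assumes T: "T \<subseteq> {..<n}" and a: "a \<in> carrier R" and c: "\<And>i. i \<in> T \<Longrightarrow> c (T - {i}) \<in> carrier M"
  shows "kd M (\<lambda>T. a \<odot>\<^bsub>M\<^esub> c T) T = a \<odot>\<^bsub>M\<^esub> kd M c T"
proof -
  have fin: "finite T" using T finite_subset by blast
  have "a \<odot>\<^bsub>M\<^esub> kd M c T = (\<Oplus>\<^bsub>M\<^esub>i\<in>T. a \<odot>\<^bsub>M\<^esub> (kx i T \<odot>\<^bsub>M\<^esub> c (T - {i})))"
    unfolding kd_def using T a c fin by (intro M.finsum_smult_ldistr) (auto simp: subset_iff)
  also have "\<dots> = kd M (\<lambda>T. a \<odot>\<^bsub>M\<^esub> c T) T"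
    unfolding kd_def
  proof (rule M.finsum_cong'[OF refl])
    show "a \<odot>\<^bsub>M\<^esub> (kx i T \<odot>\<^bsub>M\<^esub> c (T - {i})) = kx i T \<odot>\<^bsub>M\<^esub> (a \<odot>\<^bsub>M\<^esub> c (T - {i}))" if "i \<in> T" for i
    proof -
      have "kx i T \<in> carrier R" using T that by auto
      then show ?thesis using a c[OF that] m_comm[of a "kx i T"] by (simp flip: M.smult_assoc1)
    qed
  qed (use T a c in auto)
  finally show ?thesis by simp
qed

text \<open>The double sum runs over ordered pairs of removed indices, and its terms are
  antisymmetric by \<open>kx_anticommute\<close>.\<close>

lemma kd_kd:
  assumes T: "T \<subseteq> {..<n}" and c: "\<And>i j. i \<in> T \<Longrightarrow> j \<in> T \<Longrightarrow> i \<noteq> j \<Longrightarrow> c (T - {i} - {j}) \<in> carrier M"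
  shows "kd M (kd M c) T = \<zero>\<^bsub>M\<^esub>"
proof -
  have fin: "finite T" using T finite_subset by blast
  have xc: "kx i U \<in> carrier R" if "i \<in> T" for i U using T that by auto
  have "kd M (kd M c) T = (\<Oplus>\<^bsub>M\<^esub>i\<in>T. \<Oplus>\<^bsub>M\<^esub>j\<in>T - {i}. (kx i T \<otimes> kx j (T - {i})) \<odot>\<^bsub>M\<^esub> c (T - {i} - {j}))"
    unfolding kd_def
  proof (rule M.finsum_cong'[OF refl])
    fix i assume i: "i \<in> T"
    have "kx i T \<odot>\<^bsub>M\<^esub> (\<Oplus>\<^bsub>M\<^esub>j\<in>T - {i}. kx j (T - {i}) \<odot>\<^bsub>M\<^esub> c (T - {i} - {j})) =
      (\<Oplus>\<^bsub>M\<^esub>j\<in>T - {i}. kx i T \<odot>\<^bsub>M\<^esub> (kx j (T - {i}) \<odot>\<^bsub>M\<^esub> c (T - {i} - {j})))"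
      using fin xc i c by (intro M.finsum_smult_ldistr) auto
    also have "\<dots> = (\<Oplus>\<^bsub>M\<^esub>j\<in>T - {i}. (kx i T \<otimes> kx j (T - {i})) \<odot>\<^bsub>M\<^esub> c (T - {i} - {j}))"
      using fin xc i c by (intro M.finsum_cong') (auto simp: M.smult_assoc1)
    finally show "kx i T \<odot>\<^bsub>M\<^esub> (\<Oplus>\<^bsub>M\<^esub>j\<in>T - {i}. kx j (T - {i}) \<odot>\<^bsub>M\<^esub> c (T - {i} - {j})) =
      (\<Oplus>\<^bsub>M\<^esub>j\<in>T - {i}. (kx i T \<otimes> kx j (T - {i})) \<odot>\<^bsub>M\<^esub> c (T - {i} - {j}))" .
  qed (use xc c in \<open>auto intro!: M.finsum_closed\<close>)
  also have "\<dots> = \<zero>\<^bsub>M\<^esub>"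
  proof (rule M.finsum_antisymmetric[OF fin])
    fix i j assume ij: "i \<in> T" "j \<in> T" "i \<noteq> j"
    show "(kx i T \<otimes> kx j (T - {i})) \<odot>\<^bsub>M\<^esub> c (T - {i} - {j}) \<in> carrier M" using ij xc c by auto
    have "T - {i} - {j} = T - {j} - {i}" by auto
    moreover have "kx i T \<otimes> kx j (T - {i}) = \<ominus> (kx j T \<otimes> kx i (T - {j}))"
      using kx_anticommute[OF fin ij] ij T by auto
    ultimately show "(kx i T \<otimes> kx j (T - {i})) \<odot>\<^bsub>M\<^esub> c (T - {i} - {j}) = \<ominus>\<^bsub>M\<^esub> ((kx j T \<otimes> kx i (T - {j})) \<odot>\<^bsub>M\<^esub> c (T - {j} - {i}))"
      using ij xc c[of j i] by (simp add: M.smult_l_minus)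
  qed
  finally show ?thesis .
qed

lemma kd_hom:
  assumes N: "gm N" and f: "f \<in> graded_hom R M N"
    and T: "T \<subseteq> {..<n}" and c: "\<And>i. i \<in> T \<Longrightarrow> c (T - {i}) \<in> carrier M"
  shows "f (kd M c T) = kd N (\<lambda>T. f (c T)) T"
proof -
  note f = graded_homD[OF f]
  interpret N: module R N using gm_module[OF N] .
  have "f (kd M c T) = (\<Oplus>\<^bsub>N\<^esub>i\<in>T. f (kx i T \<odot>\<^bsub>M\<^esub> c (T - {i})))"
    unfolding kd_def using T c
    by (intro additive_finsum f M.abelian_group_axioms N.abelian_group_axioms) auto
  also have "\<dots> = kd N (\<lambda>T. f (c T)) T"
    unfolding kd_def using T c f(1,4) by (intro N.finsum_cong') (auto simp: subset_iff)
  finally show ?thesis .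
qed

text \<open>Contraction with the basis vector \<open>i\<close>, the homotopy between multiplication
  by \<open>x i\<close> and zero.\<close>

definition kh :: "nat \<Rightarrow> (nat set \<Rightarrow> 'b) \<Rightarrow> nat set \<Rightarrow> 'b" where
  "kh i c U = (if i \<in> U then \<zero>\<^bsub>M\<^esub> else if pos i (insert i U) then c (insert i U) else \<ominus>\<^bsub>M\<^esub> c (insert i U))"

text \<open>For \<open>i\<close> in \<open>S\<close> only the removal of \<open>i\<close>
  contributes. Otherwise the terms that remove some \<open>j\<close> in \<open>S\<close> occur in
  both summands with opposite signs, and what survives is the removal of \<open>i\<close> from
  \<open>insert i S\<close>.\<close>

lemma kh_homotopy:
  assumes S: "S \<subseteq> {..<n}" and i: "i < n" and c: "c S \<in> carrier M"
    "\<And>j. i \<notin> S \<Longrightarrow> j \<in> S \<Longrightarrow> c (insert i S - {j}) \<in> carrier M"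
  shows "kd M (kh i c) S \<oplus>\<^bsub>M\<^esub> kh i (kd M c) S = x i \<odot>\<^bsub>M\<^esub> c S"
proof -
  have fin: "finite S" using S finite_subset by blast
  have xc: "kx j U \<in> carrier R" if "j \<in> S" for j U using S that by auto
  show ?thesis
  proof (cases "i \<in> S")
    case True
    have "kd M (kh i c) S = (\<Oplus>\<^bsub>M\<^esub>j\<in>S. if i = j then x i \<odot>\<^bsub>M\<^esub> c S else \<zero>\<^bsub>M\<^esub>)"
      unfolding kd_def
    proof (rule M.finsum_cong'[OF refl])
      show "kx j S \<odot>\<^bsub>M\<^esub> kh i c (S - {j}) = (if i = j then x i \<odot>\<^bsub>M\<^esub> c S else \<zero>\<^bsub>M\<^esub>)" if "j \<in> S" for j
        using True that xc[OF that] i c(1) by (auto simp: kh_def kx_def insert_absorb M.smult_l_minus M.smult_r_minus)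
    qed (use i c in auto)
    also have "\<dots> = x i \<odot>\<^bsub>M\<^esub> c S"
      using True fin i c(1) M.finsum_singleton[of i S "\<lambda>_. x i \<odot>\<^bsub>M\<^esub> c S"] by simp
    finally show ?thesis using True i c(1) by (simp add: kh_def)
  next
    case False
    note c = c(1) c(2)[OF False]
    let ?T = "insert i S"
    let ?s = "\<lambda>v. if pos i ?T then v else \<ominus>\<^bsub>M\<^esub> v"
    have ne: "j \<noteq> i" if "j \<in> S" for j using that False by auto
    have eq: "?T - {i} = S" using False by auto
    have kc: "kd M c ?T = kx i ?T \<odot>\<^bsub>M\<^esub> c S \<oplus>\<^bsub>M\<^esub> (\<Oplus>\<^bsub>M\<^esub>j\<in>S. kx j ?T \<odot>\<^bsub>M\<^esub> c (?T - {j}))"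
      unfolding kd_def using False fin i c xc eq by (subst M.finsum_insert) auto
    have sumc: "(\<Oplus>\<^bsub>M\<^esub>j\<in>S. kx j ?T \<odot>\<^bsub>M\<^esub> c (?T - {j})) \<in> carrier M"
      using c xc by (intro M.finsum_closed) auto
    have "kd M (kh i c) S = (\<Oplus>\<^bsub>M\<^esub>j\<in>S. \<ominus>\<^bsub>M\<^esub> ?s (kx j ?T \<odot>\<^bsub>M\<^esub> c (?T - {j})))"
      unfolding kd_def
    proof (rule M.finsum_cong'[OF refl])
      fix j assume j: "j \<in> S"
      have e1: "insert i (S - {j}) = ?T - {j}" using ne[OF j] by auto
      have p1: "pos i (?T - {j}) \<longleftrightarrow> (if j < i then \<not> pos i ?T else pos i ?T)"
        by (rule pos_remove) (use fin j ne[OF j] in simp_all)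
      have p2: "pos j S \<longleftrightarrow> (if i < j then \<not> pos j ?T else pos j ?T)"
        using pos_remove[OF _ insertI1 ne[OF j, symmetric], of S] fin unfolding eq by simp
      show "kx j S \<odot>\<^bsub>M\<^esub> kh i c (S - {j}) = \<ominus>\<^bsub>M\<^esub> ?s (kx j ?T \<odot>\<^bsub>M\<^esub> c (?T - {j}))"
        using False ne[OF j] c(2)[OF j] x_carrier[of j] S j p1 p2
        by (auto simp: kh_def kx_def e1 M.smult_l_minus M.smult_r_minus subset_iff)
    qed (use c xc in auto)
    also have "\<dots> = \<ominus>\<^bsub>M\<^esub> ?s (\<Oplus>\<^bsub>M\<^esub>j\<in>S. kx j ?T \<odot>\<^bsub>M\<^esub> c (?T - {j}))"
      using c xc by (auto simp: M.finsum_neg Pi_def)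
    finally have 1: "kd M (kh i c) S = \<ominus>\<^bsub>M\<^esub> ?s (\<Oplus>\<^bsub>M\<^esub>j\<in>S. kx j ?T \<odot>\<^bsub>M\<^esub> c (?T - {j}))" .
    have "kh i (kd M c) S = ?s (kx i ?T \<odot>\<^bsub>M\<^esub> c S) \<oplus>\<^bsub>M\<^esub> ?s (\<Oplus>\<^bsub>M\<^esub>j\<in>S. kx j ?T \<odot>\<^bsub>M\<^esub> c (?T - {j}))"
      using False kc sumc i c(1) by (auto simp: kh_def M.minus_add)
    moreover have "?s (kx i ?T \<odot>\<^bsub>M\<^esub> c S) = x i \<odot>\<^bsub>M\<^esub> c S"
      using i c(1) by (auto simp: kx_def M.smult_l_minus)
    ultimately have 2: "kh i (kd M c) S = x i \<odot>\<^bsub>M\<^esub> c S \<oplus>\<^bsub>M\<^esub> ?s (\<Oplus>\<^bsub>M\<^esub>j\<in>S. kx j ?T \<odot>\<^bsub>M\<^esub> c (?T - {j}))" by simp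
    have "\<ominus>\<^bsub>M\<^esub> v \<oplus>\<^bsub>M\<^esub> (w \<oplus>\<^bsub>M\<^esub> v) = w" if "v \<in> carrier M" "w \<in> carrier M" for v w
      using that by (simp add: M.a_lcomm[of "\<ominus>\<^bsub>M\<^esub> v" w v] M.l_neg)
    then show ?thesis unfolding 1 2 using sumc i c(1) by simp
  qed
qed

end

text \<open>The transpose of the Koszul matrix, that is, the boundary map of the Koszul chain
  complex over \<open>R\<close>.\<close>

definition kdual :: "(nat set \<Rightarrow> 'a) \<Rightarrow> nat set \<Rightarrow> 'a" where
  "kdual z U = (\<Oplus>i\<in>{..<n} - U. kx i (insert i U) \<otimes> z (insert i U))"

text \<open>Both sides sum the same terms over the pairs of a set \<open>S\<close> and an element
  \<open>i\<close> removed from it; the right-hand side groups them by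
  \<open>S - {i}\<close>.\<close>

lemma kdual_adjoint:
  fixes M :: "('a, 'b) graded_module"
  assumes M: "gm M" and z: "\<And>S. z S \<in> carrier R"
    and b: "\<And>U. U \<subseteq> {..<n} \<Longrightarrow> Suc (card U) = q \<Longrightarrow> b U \<in> carrier M"
  shows "(\<Oplus>\<^bsub>M\<^esub>S\<in>koszul_index n q. z S \<odot>\<^bsub>M\<^esub> kd M b S) =
    (\<Oplus>\<^bsub>M\<^esub>U\<in>{U. U \<subseteq> {..<n} \<and> Suc (card U) = q}. kdual z U \<odot>\<^bsub>M\<^esub> b U)"
proof -
  interpret M: module R M using gm_module[OF M] .
  \<comment> \<open>The condition \<open>Suc (card U) = q\<close> makes \<open>?F\<close> empty for
    \<open>q = 0\<close>, where truncated subtraction would not.\<close>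
  let ?G = "koszul_index n q" and ?F = "{U. U \<subseteq> {..<n} \<and> Suc (card U) = q}"
  have finG: "finite ?G" by (auto simp: koszul_index_def)
  have finF: "finite ?F" by simp
  have fin: "finite S" if "S \<in> ?G" for S using that finite_subset by (auto simp: koszul_index_def)
  have GF: "S - {i} \<in> ?F" "i < n" if "S \<in> ?G" "i \<in> S" for S i
    using that fin[OF that(1)] card_Suc_Diff1[of S i] by (auto simp: koszul_index_def)
  have FG: "insert i U \<in> ?G" if "U \<in> ?F" "i \<in> {..<n} - U" for U i
    using that finite_subset[of U "{..<n}"] by (auto simp: koszul_index_def)
  have bc: "b (S - {i}) \<in> carrier M" if "S \<in> ?G" "i \<in> S" for S i using b GF[OF that] by auto
  have "(\<Oplus>\<^bsub>M\<^esub>S\<in>?G. z S \<odot>\<^bsub>M\<^esub> kd M b S) = (\<Oplus>\<^bsub>M\<^esub>S\<in>?G. \<Oplus>\<^bsub>M\<^esub>i\<in>S. (kx i S \<otimes> z S) \<odot>\<^bsub>M\<^esub> b (S - {i}))"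
  proof (rule M.finsum_cong'[OF refl])
    fix S assume S: "S \<in> ?G"
    have "z S \<odot>\<^bsub>M\<^esub> kd M b S = (\<Oplus>\<^bsub>M\<^esub>i\<in>S. z S \<odot>\<^bsub>M\<^esub> (kx i S \<odot>\<^bsub>M\<^esub> b (S - {i})))"
      unfolding kd_def using S fin z bc GF by (intro M.finsum_smult_ldistr) auto
    also have "\<dots> = (\<Oplus>\<^bsub>M\<^esub>i\<in>S. (kx i S \<otimes> z S) \<odot>\<^bsub>M\<^esub> b (S - {i}))"
      using S z bc GF by (intro M.finsum_cong') (auto simp: m_comm[of "kx _ _" "z _"] M.smult_assoc1)
    finally show "z S \<odot>\<^bsub>M\<^esub> kd M b S = (\<Oplus>\<^bsub>M\<^esub>i\<in>S. (kx i S \<otimes> z S) \<odot>\<^bsub>M\<^esub> b (S - {i}))" .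
  qed (use z bc GF in \<open>auto intro!: M.finsum_closed\<close>)
  also have "\<dots> = finsum M (\<lambda>(S, i). (kx i S \<otimes> z S) \<odot>\<^bsub>M\<^esub> b (S - {i})) (Sigma ?G (\<lambda>S. S))"
    using finG fin z bc GF by (intro M.finsum_Sigma) auto
  also have "Sigma ?G (\<lambda>S. S) = (\<lambda>(U, i). (insert i U, i)) ` Sigma ?F (\<lambda>U. {..<n} - U)"
  proof (intro equalityI subsetI)
    fix p assume "p \<in> Sigma ?G (\<lambda>S. S)"
    then obtain S i where p: "p = (S, i)" "S \<in> ?G" "i \<in> S" by auto
    then have "(S - {i}, i) \<in> Sigma ?F (\<lambda>U. {..<n} - U)" using GF by auto
    moreover have "p = (\<lambda>(U, i). (insert i U, i)) (S - {i}, i)" using p by auto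
    ultimately show "p \<in> (\<lambda>(U, i). (insert i U, i)) ` Sigma ?F (\<lambda>U. {..<n} - U)" by (rule rev_image_eqI)
  qed (use FG in auto)
  also have "finsum M (\<lambda>(S, i). (kx i S \<otimes> z S) \<odot>\<^bsub>M\<^esub> b (S - {i})) ((\<lambda>(U, i). (insert i U, i)) ` Sigma ?F (\<lambda>U. {..<n} - U)) =
    (\<Oplus>\<^bsub>M\<^esub>p\<in>Sigma ?F (\<lambda>U. {..<n} - U). (\<lambda>(S, i). (kx i S \<otimes> z S) \<odot>\<^bsub>M\<^esub> b (S - {i})) ((\<lambda>(U, i). (insert i U, i)) p))"
  proof (rule M.finsum_reindex)
    show "inj_on (\<lambda>(U, i). (insert i U, i)) (Sigma ?F (\<lambda>U. {..<n} - U))"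
      by (rule inj_onI) (auto, (metis insert_ident)+)
  qed (use z b in auto)
  also have "\<dots> = finsum M (\<lambda>(U, i). (kx i (insert i U) \<otimes> z (insert i U)) \<odot>\<^bsub>M\<^esub> b U) (Sigma ?F (\<lambda>U. {..<n} - U))"
    using z b by (intro M.finsum_cong') auto
  also have "\<dots> = (\<Oplus>\<^bsub>M\<^esub>U\<in>?F. \<Oplus>\<^bsub>M\<^esub>i\<in>{..<n} - U. (kx i (insert i U) \<otimes> z (insert i U)) \<odot>\<^bsub>M\<^esub> b U)"
    using finF z b by (intro M.finsum_Sigma[symmetric]) auto
  also have "\<dots> = (\<Oplus>\<^bsub>M\<^esub>U\<in>?F. kdual z U \<odot>\<^bsub>M\<^esub> b U)"
  proof (rule M.finsum_cong'[OF refl])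
    fix U assume U: "U \<in> ?F"
    show "(\<Oplus>\<^bsub>M\<^esub>i\<in>{..<n} - U. (kx i (insert i U) \<otimes> z (insert i U)) \<odot>\<^bsub>M\<^esub> b U) = kdual z U \<odot>\<^bsub>M\<^esub> b U"
      unfolding kdual_def
      by (rule additive_finsum[symmetric, OF is_abelian_group M.abelian_group_axioms])
        (use z b U in \<open>auto simp: M.smult_l_distr\<close>)
  qed (use z b in \<open>auto simp: kdual_def intro!: finsum_closed\<close>)
  finally show ?thesis .
qed

end

section \<open>Koszul cohomology of injective modules\<close>

locale koszul_parameters = graded_local_ring R A \<mm> + koszul R A n x d
  for R :: "('a, 'm) ring_scheme" (structure) and A \<mm> n x d +
  assumes radical: "ideal_radical R (Idl\<^bsub>R\<^esub> (x ` {..<n})) = \<mm>"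
begin

section \<open>Annihilation by powers of the maximal ideal\<close>

lemma m_power_parameters: "\<exists>t. ideal_power R \<mm> t \<subseteq> Idl (x ` {..<n})"
proof (rule noetherian_ring.power_subset_if_radical[OF noetherian is_cring m_ideal])
  show "ideal (Idl (x ` {..<n})) R" by (rule genideal_ideal) auto
  show "\<exists>k::nat. s [^] k \<in> Idl (x ` {..<n})" if "s \<in> \<mm>" for s
    using that unfolding radical[symmetric] ideal_radical_def by blast
qed

lemma annihilator_ideal:
  assumes "module R M" "v \<in> carrier M"
  shows "ideal {a \<in> carrier R. a \<odot>\<^bsub>M\<^esub> v = \<zero>\<^bsub>M\<^esub>} R"
proof (rule idealI[OF ring_axioms])
  interpret M: module R M by fact
  have "additive_subgroup {a \<in> carrier R. a \<odot>\<^bsub>M\<^esub> v = \<zero>\<^bsub>M\<^esub>} R"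
    using assms(2) unfolding additive_subgroup_iff[OF is_abelian_group]
    by (auto simp: M.smult_l_distr M.smult_l_minus)
  then show "subgroup {a \<in> carrier R. a \<odot>\<^bsub>M\<^esub> v = \<zero>\<^bsub>M\<^esub>} (add_monoid R)" by (rule additive_subgroup.a_subgroup)
  show "b \<otimes> a \<in> {a \<in> carrier R. a \<odot>\<^bsub>M\<^esub> v = \<zero>\<^bsub>M\<^esub>}" if "a \<in> {a \<in> carrier R. a \<odot>\<^bsub>M\<^esub> v = \<zero>\<^bsub>M\<^esub>}" "b \<in> carrier R" for a b
    using that assms(2) by (simp add: M.smult_assoc1)
  then show "a \<otimes> b \<in> {a \<in> carrier R. a \<odot>\<^bsub>M\<^esub> v = \<zero>\<^bsub>M\<^esub>}" if "a \<in> {a \<in> carrier R. a \<odot>\<^bsub>M\<^esub> v = \<zero>\<^bsub>M\<^esub>}" "b \<in> carrier R" for a b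
    using that m_comm[of a b] by auto
qed

text \<open>Finitely many torsion elements share a degree bound \<open>N\<close>, and the power
  \<open>N\<close> of \<mm> has no components below degree \<open>N\<close>.\<close>

lemma finite_torsion:
  assumes M: "gm M" and "finite V" "V \<subseteq> tors M"
  shows "\<exists>t. \<forall>a\<in>ideal_power R \<mm> t. \<forall>v\<in>V. a \<odot>\<^bsub>M\<^esub> v = \<zero>\<^bsub>M\<^esub>"
proof -
  have "\<exists>N. \<forall>v\<in>V. \<forall>j\<ge>N. \<forall>a\<in>A j. a \<odot>\<^bsub>M\<^esub> v = \<zero>\<^bsub>M\<^esub>"
    using assms(2,3)
  proof (induction V)
    case (insert v V)
    then obtain N where N: "\<forall>v\<in>V. \<forall>j\<ge>N. \<forall>a\<in>A j. a \<odot>\<^bsub>M\<^esub> v = \<zero>\<^bsub>M\<^esub>" by auto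
    obtain N' where "\<forall>j\<ge>N'. \<forall>a\<in>A j. a \<odot>\<^bsub>M\<^esub> v = \<zero>\<^bsub>M\<^esub>" using insert.prems by (auto simp: tors_def)
    with N show ?case by (intro exI[of _ "max N N'"]) auto
  qed simp
  then obtain N where N: "\<And>v j a. v \<in> V \<Longrightarrow> N \<le> j \<Longrightarrow> a \<in> A j \<Longrightarrow> a \<odot>\<^bsub>M\<^esub> v = \<zero>\<^bsub>M\<^esub>" by blast
  have "a \<odot>\<^bsub>M\<^esub> v = \<zero>\<^bsub>M\<^esub>" if "a \<in> ideal_power R \<mm> N" "v \<in> V" for a v
    by (rule degree_ideal_annihilates[OF M subsetD[OF m_power_degree that(1)]])
      (use N that(2) tors_carrier[OF subsetD[OF assms(3) that(2)]] in auto)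
  then show ?thesis by blast
qed

text \<open>The pairing of a Koszul chain \<open>z\<close> over \<open>R\<close> with a cochain
  \<open>c\<close> over \<open>M\<close>, for which \<open>kdual\<close> and \<open>kd\<close> are
  adjoint.\<close>

definition kpair :: "nat \<Rightarrow> ('a, 'b) graded_module \<Rightarrow> (nat set \<Rightarrow> 'b) \<Rightarrow> (nat set \<Rightarrow> 'a) \<Rightarrow> 'b" where
  "kpair q M c z = (\<Oplus>\<^bsub>M\<^esub>S\<in>koszul_index n q. z S \<odot>\<^bsub>M\<^esub> c S)"

lemma finite_koszul_index [simp]: "finite (koszul_index n q)"
  by (simp add: koszul_index_def)

context
  fixes M :: "('a, 'b) graded_module" and c :: "nat set \<Rightarrow> 'b" and q :: nat
  assumes M: "gm M" and c: "\<And>S. S \<in> koszul_index n q \<Longrightarrow> c S \<in> carrier M"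
begin

interpretation M: module R M using gm_module[OF M] .

lemma kpair_closed: "(\<And>S. z S \<in> carrier R) \<Longrightarrow> kpair q M c z \<in> carrier M"
  unfolding kpair_def using c by (intro M.finsum_closed) auto

lemma kpair_zero: "(\<And>S. S \<in> koszul_index n q \<Longrightarrow> z S = \<zero>) \<Longrightarrow> kpair q M c z = \<zero>\<^bsub>M\<^esub>"
  unfolding kpair_def using c by (intro M.add.finprod_one_eqI) auto

lemma kpair_add:
  assumes "\<And>S. z S \<in> carrier R" "\<And>S. z' S \<in> carrier R"
  shows "kpair q M c (\<lambda>S. z S \<oplus> z' S) = kpair q M c z \<oplus>\<^bsub>M\<^esub> kpair q M c z'"
proof -
  have "kpair q M c (\<lambda>S. z S \<oplus> z' S) = (\<Oplus>\<^bsub>M\<^esub>S\<in>koszul_index n q. z S \<odot>\<^bsub>M\<^esub> c S \<oplus>\<^bsub>M\<^esub> z' S \<odot>\<^bsub>M\<^esub> c S)"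
    unfolding kpair_def using assms c by (intro M.finsum_cong') (auto simp: M.smult_l_distr)
  also have "\<dots> = kpair q M c z \<oplus>\<^bsub>M\<^esub> kpair q M c z'"
    unfolding kpair_def using assms c by (intro M.finsum_addf) auto
  finally show ?thesis .
qed

lemma kpair_smult:
  assumes "a \<in> carrier R" "\<And>S. z S \<in> carrier R"
  shows "kpair q M c (\<lambda>S. a \<otimes> z S) = a \<odot>\<^bsub>M\<^esub> kpair q M c z"
proof -
  have "a \<odot>\<^bsub>M\<^esub> kpair q M c z = (\<Oplus>\<^bsub>M\<^esub>S\<in>koszul_index n q. a \<odot>\<^bsub>M\<^esub> (z S \<odot>\<^bsub>M\<^esub> c S))"
    unfolding kpair_def using assms c by (intro M.finsum_smult_ldistr) auto
  also have "\<dots> = kpair q M c (\<lambda>S. a \<otimes> z S)"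
    unfolding kpair_def using assms c by (intro M.finsum_cong') (auto simp: M.smult_assoc1)
  finally show ?thesis by simp
qed

lemma kpair_piece:
  assumes "\<And>S. S \<in> koszul_index n q \<Longrightarrow> c S \<in> piece M (k + wt S)"
    and "\<And>S. S \<in> koszul_index n q \<Longrightarrow> z S \<in> int_piece R A (j - (k + wt S))"
  shows "kpair q M c z \<in> piece M j"
  unfolding kpair_def
proof (rule M.finsum_mem)
  show "z S \<odot>\<^bsub>M\<^esub> c S \<in> piece M j" if "S \<in> koszul_index n q" for S
    using smult_piece[OF M assms(2,1), OF that that] by simp
qed (use piece_rules[OF M] in auto)

end

lemma koszul_index_remove: "T \<in> koszul_index n (Suc q) \<Longrightarrow> i \<in> T \<Longrightarrow> T - {i} \<in> koszul_index n q"
  using finite_subset[of T "{..<n}"] by (auto simp: koszul_index_def)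

lemma koszul_index_remove_card:
  assumes "S \<in> koszul_index n q" "i \<in> S"
  shows "S - {i} \<subseteq> {..<n}" "Suc (card (S - {i})) = q"
  using assms finite_subset[of S "{..<n}"] card_Suc_Diff1[of S i] by (auto simp: koszul_index_def)

lemma koszul_index_sub: "T \<in> koszul_index n q \<Longrightarrow> T \<subseteq> {..<n}"
  by (simp add: koszul_index_def)

lemma kdual_zero: "kdual (\<lambda>_. \<zero>) U = \<zero>"
  unfolding kdual_def by (intro add.finprod_one_eqI) auto

lemma kdual_add:
  assumes "\<And>S. z S \<in> carrier R" "\<And>S. z' S \<in> carrier R"
  shows "kdual (\<lambda>S. z S \<oplus> z' S) U = kdual z U \<oplus> kdual z' U"
proof -
  have "kdual (\<lambda>S. z S \<oplus> z' S) U = (\<Oplus>i\<in>{..<n} - U. kx i (insert i U) \<otimes> z (insert i U) \<oplus> kx i (insert i U) \<otimes> z' (insert i U))"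
    unfolding kdual_def using assms by (intro finsum_cong') (auto simp: r_distr)
  also have "\<dots> = kdual z U \<oplus> kdual z' U"
    unfolding kdual_def using assms by (intro finsum_addf) auto
  finally show ?thesis .
qed

lemma kdual_smult:
  assumes "a \<in> carrier R" "\<And>S. z S \<in> carrier R"
  shows "kdual (\<lambda>S. a \<otimes> z S) U = a \<otimes> kdual z U"
proof -
  have "a \<otimes> kdual z U = (\<Oplus>i\<in>{..<n} - U. a \<otimes> (kx i (insert i U) \<otimes> z (insert i U)))"
    unfolding kdual_def using assms by (intro finsum_rdistr) auto
  also have "\<dots> = kdual (\<lambda>S. a \<otimes> z S) U"
    unfolding kdual_def using assms by (intro finsum_cong') (auto simp: m_lcomm)
  finally show ?thesis by simp
qed

lemma kdual_piece:
  assumes "U \<subseteq> {..<n}" "\<And>i. i \<in> {..<n} - U \<Longrightarrow> z (insert i U) \<in> int_piece R A (j - (k + wt (insert i U)))"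
  shows "kdual z U \<in> int_piece R A (j - (k + wt U))"
  unfolding kdual_def
proof (rule finsum_mem)
  fix i assume i: "i \<in> {..<n} - U"
  have "wt (insert i U) = int (d i) + wt (insert i U - {i})" by (rule wt_remove[OF RR_graded]) (use i assms(1) in auto)
  then have w: "wt (insert i U) = int (d i) + wt U" using i by simp
  have "kx i (insert i U) \<otimes> z (insert i U) \<in> int_piece R A (int (d i) + (j - (k + wt (insert i U))))"
    by (rule int_piece_rules(3)) (use i assms kx_degree in auto)
  moreover have "int (d i) + (j - (k + wt (insert i U))) = j - (k + wt U)" using w by simp
  ultimately show "kx i (insert i U) \<otimes> z (insert i U) \<in> int_piece R A (j - (k + wt U))" by simp
qed (use int_piece_rules int_piece_sub in auto)

text \<open>The homotopy writes \<open>x i\<close> times \<open>c\<close> as the sum of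
  \<open>kd\<close> applied to \<open>kh c\<close> and \<open>kh\<close> applied to
  \<open>kd c\<close>. The cycle \<open>z\<close> pairs to zero with the first summand by
  adjunction, and \<open>a\<close> kills the second.\<close>

lemma cycle_annihilated:
  assumes M: "gm M" and c: "\<And>S. S \<in> koszul_index n q \<Longrightarrow> c S \<in> carrier M"
    and z: "\<And>S. z S \<in> carrier R" "\<And>U. U \<subseteq> {..<n} \<Longrightarrow> Suc (card U) = q \<Longrightarrow> kdual z U = \<zero>"
    and a: "a \<in> carrier R" "\<And>T. T \<in> koszul_index n (Suc q) \<Longrightarrow> a \<odot>\<^bsub>M\<^esub> kd M c T = \<zero>\<^bsub>M\<^esub>"
    and i: "i < n"
  shows "(a \<otimes> x i) \<odot>\<^bsub>M\<^esub> kpair q M c z = \<zero>\<^bsub>M\<^esub>"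
proof -
  interpret M: module R M using gm_module[OF M] .
  have ins: "insert i S \<in> koszul_index n (Suc q)" if "S \<in> koszul_index n q" "i \<notin> S" for S
    using that i finite_subset[of S "{..<n}"] by (auto simp: koszul_index_def)
  have rem: "insert i S - {j} \<in> koszul_index n q" if "S \<in> koszul_index n q" "i \<notin> S" "j \<in> insert i S" for S j
    using ins[OF that(1,2)] that(3) finite_subset[of "insert i S" "{..<n}"] by (auto simp: koszul_index_def)
  have kdc: "kd M c T \<in> carrier M" if "T \<in> koszul_index n (Suc q)" for T
    using kd_closed[OF M koszul_index_sub[OF that]] c koszul_index_remove[OF that] by blast
  have hc: "kh M i c U \<in> carrier M" if "U \<subseteq> {..<n}" "Suc (card U) = q" for U
    using that i c[of "insert i U"] finite_subset[of U "{..<n}"] by (auto simp: kh_def[OF M] koszul_index_def)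
  have hkd: "kh M i (kd M c) S \<in> carrier M" "a \<odot>\<^bsub>M\<^esub> kh M i (kd M c) S = \<zero>\<^bsub>M\<^esub>"
    if "S \<in> koszul_index n q" for S
    using ins[OF that] kdc a by (auto simp: kh_def[OF M] M.smult_r_minus)
  have khc: "kd M (kh M i c) S \<in> carrier M" if "S \<in> koszul_index n q" for S
    using kd_closed[OF M koszul_index_sub[OF that]] hc koszul_index_remove_card[OF that] by blast
  have "kpair q M (kd M (kh M i c)) z = \<zero>\<^bsub>M\<^esub>"
  proof -
    have "kpair q M (kd M (kh M i c)) z = (\<Oplus>\<^bsub>M\<^esub>U\<in>{U. U \<subseteq> {..<n} \<and> Suc (card U) = q}. kdual z U \<odot>\<^bsub>M\<^esub> kh M i c U)"
      unfolding kpair_def by (rule kdual_adjoint[OF M z(1) hc])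
    also have "\<dots> = \<zero>\<^bsub>M\<^esub>" using z(2) hc by (intro M.add.finprod_one_eqI) auto
    finally show ?thesis .
  qed
  moreover have "x i \<odot>\<^bsub>M\<^esub> kpair q M c z = kpair q M (kd M (kh M i c)) z \<oplus>\<^bsub>M\<^esub> kpair q M (kh M i (kd M c)) z"
  proof -
    have "x i \<odot>\<^bsub>M\<^esub> kpair q M c z = kpair q M c (\<lambda>S. x i \<otimes> z S)"
      using kpair_smult[OF M, where a = "x i" and c = c and q = q and z = z] c i z by simp
    also have "\<dots> = (\<Oplus>\<^bsub>M\<^esub>S\<in>koszul_index n q. z S \<odot>\<^bsub>M\<^esub> kd M (kh M i c) S \<oplus>\<^bsub>M\<^esub> z S \<odot>\<^bsub>M\<^esub> kh M i (kd M c) S)"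
      unfolding kpair_def
    proof (rule M.finsum_cong'[OF refl])
      fix S assume S: "S \<in> koszul_index n q"
      have "(x i \<otimes> z S) \<odot>\<^bsub>M\<^esub> c S = z S \<odot>\<^bsub>M\<^esub> (x i \<odot>\<^bsub>M\<^esub> c S)"
        using i z c[OF S] by (simp add: m_comm[of "x i"] M.smult_assoc1)
      also have "x i \<odot>\<^bsub>M\<^esub> c S = kd M (kh M i c) S \<oplus>\<^bsub>M\<^esub> kh M i (kd M c) S"
      proof (rule kh_homotopy[where c = c, OF M _ i c[OF S], symmetric])
        show "S \<subseteq> {..<n}" using S by (simp add: koszul_index_def)
        show "c (insert i S - {j}) \<in> carrier M" if "i \<notin> S" "j \<in> S" for j
          using c[OF rem[OF S that(1)]] that(2) by simp
      qed
      finally show "(x i \<otimes> z S) \<odot>\<^bsub>M\<^esub> c S = z S \<odot>\<^bsub>M\<^esub> kd M (kh M i c) S \<oplus>\<^bsub>M\<^esub> z S \<odot>\<^bsub>M\<^esub> kh M i (kd M c) S"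
        using z hkd[OF S] khc[OF S] by (simp add: M.smult_r_distr)
    qed (use z hkd khc in auto)
    also have "\<dots> = kpair q M (kd M (kh M i c)) z \<oplus>\<^bsub>M\<^esub> kpair q M (kh M i (kd M c)) z"
      unfolding kpair_def using z hkd khc by (intro M.finsum_addf) auto
    finally show ?thesis .
  qed
  moreover have kc: "kpair q M (kh M i (kd M c)) z \<in> carrier M" by (rule kpair_closed[OF M]) (use hkd z in auto)
  ultimately have "x i \<odot>\<^bsub>M\<^esub> kpair q M c z = kpair q M (kh M i (kd M c)) z" by simp
  then have "(a \<otimes> x i) \<odot>\<^bsub>M\<^esub> kpair q M c z = a \<odot>\<^bsub>M\<^esub> kpair q M (kh M i (kd M c)) z"
    using a i kpair_closed[OF M c z(1)] by (simp add: M.smult_assoc1)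
  also have "\<dots> = kpair q M (kh M i (kd M c)) (\<lambda>S. a \<otimes> z S)"
    using kpair_smult[OF M, where a = a and c = "kh M i (kd M c)" and q = q and z = z] hkd a z by simp
  also have "\<dots> = \<zero>\<^bsub>M\<^esub>"
    unfolding kpair_def
  proof (rule M.add.finprod_one_eqI)
    fix S assume S: "S \<in> koszul_index n q"
    have "(a \<otimes> z S) \<odot>\<^bsub>M\<^esub> kh M i (kd M c) S = z S \<odot>\<^bsub>M\<^esub> (a \<odot>\<^bsub>M\<^esub> kh M i (kd M c) S)"
      using a z hkd(1)[OF S] by (simp add: m_comm[of a] M.smult_assoc1)
    then show "(a \<otimes> z S) \<odot>\<^bsub>M\<^esub> kh M i (kd M c) S = \<zero>\<^bsub>M\<^esub>" using hkd(2)[OF S] z by simp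
  qed
  finally show ?thesis .
qed

text \<open>The coefficients of the linear system solved here are the Koszul boundaries \<open>kdual z\<close> with \<open>z\<close> of
  large degree: there the consistency condition holds because the cycles are generated in bounded degrees
  and the parameters act as zero on Koszul cohomology.\<close>

lemma injective_koszul_acyclic:
  fixes E N :: "('a, 'c) graded_module"
  assumes E: "graded_injective R A E" and N: "gm N" "\<epsilon> \<in> graded_hom R RR N" "inj_on \<epsilon> (carrier R)"
    and c: "\<And>S. S \<in> koszul_index n q \<Longrightarrow> c S \<in> piece E (k + wt S)"
    and dc: "\<And>T. T \<in> koszul_index n (Suc q) \<Longrightarrow> kd E c T \<in> tors E"
  shows "\<exists>b. (\<forall>U. U \<subseteq> {..<n} \<longrightarrow> Suc (card U) = q \<longrightarrow> b U \<in> piece E (k + wt U)) \<and>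
    (\<forall>S\<in>koszul_index n q. c S \<ominus>\<^bsub>E\<^esub> kd E b S \<in> tors E)"
proof -
  have gE: "gm E" using E by (simp add: graded_injective_def)
  interpret E: module R E using gm_module[OF gE] .
  interpret ED: decomposed_group E "piece E" using gm_decomp[OF gE] .
  let ?G = "koszul_index n q" and ?F = "{U. U \<subseteq> {..<n} \<and> Suc (card U) = q}"
  have cc: "c S \<in> carrier E" if "S \<in> ?G" for S using c[OF that] by auto
  have FG: "insert i U \<in> ?G" if "U \<in> ?F" "i \<in> {..<n} - U" for U i
    using that finite_subset[of U "{..<n}"] by (auto simp: koszul_index_def)
  \<comment> \<open>The chains over \<open>R\<close> of degree \<open>j\<close>, graded so that
    their pairing with \<open>c\<close> lands in degree \<open>j\<close> of
    \<open>E\<close>.\<close>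
  define Z where "Z j = {z. \<forall>S. z S \<in> (if S \<in> ?G then int_piece R A (j - (k + wt S)) else {\<zero>})}" for j
  have Zfam: "graded_family ?G (\<lambda>S. k + wt S) Z"
    unfolding graded_family_def
  proof (intro conjI allI ballI)
    show "(\<lambda>S. a \<otimes> z S) \<in> Z (int i + j)" if "a \<in> A i" "z \<in> Z j" for a i z j
      unfolding Z_def
    proof (intro CollectI allI)
      have zS: "z S \<in> (if S \<in> ?G then int_piece R A (j - (k + wt S)) else {\<zero>})" for S
        using that(2) unfolding Z_def by blast
      show "a \<otimes> z S \<in> (if S \<in> ?G then int_piece R A (int i + j - (k + wt S)) else {\<zero>})" for S
        using zS[of S] int_piece_rules(3)[of a "int i" "z S" "j - (k + wt S)"] that(1) A_carrier[OF that(1)]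
        by (auto simp: add_diff_eq split: if_splits)
    qed
    show "(\<lambda>S. z S \<oplus> z' S) \<in> Z j" if "z \<in> Z j" "z' \<in> Z j" for z z' j
      unfolding Z_def
    proof (intro CollectI allI)
      fix S
      have "z S \<in> (if S \<in> ?G then int_piece R A (j - (k + wt S)) else {\<zero>})"
        "z' S \<in> (if S \<in> ?G then int_piece R A (j - (k + wt S)) else {\<zero>})"
        using that unfolding Z_def by blast+
      then show "z S \<oplus> z' S \<in> (if S \<in> ?G then int_piece R A (j - (k + wt S)) else {\<zero>})"
        using int_piece_rules(2)[of "z S" "j - (k + wt S)" "z' S"] by (auto split: if_splits)
    qed
  qed (auto simp: Z_def int_piece_rules(1))
  note Zd = graded_familyD[OF Zfam]
  \<comment> \<open>The cycles among them. They form a graded submodule of a finite free module, so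
    \<open>graded_family_generated\<close> bounds the degrees of generators.\<close>
  define C where "C j = {z \<in> Z j. \<forall>U\<in>?F. kdual z U = \<zero>}" for j
  have Cfam: "graded_family ?G (\<lambda>S. k + wt S) C"
  proof -
    have "z S \<in> (if S \<in> ?G then int_piece R A (j - (k + wt S)) else {\<zero>})" if "z \<in> C j" for z j S
      using that unfolding C_def Z_def by blast
    moreover have "(\<lambda>_. \<zero>) \<in> C j" for j using Zd(3) by (simp add: C_def kdual_zero)
    moreover have "(\<lambda>S. z S \<oplus> z' S) \<in> C j" if "z \<in> C j" "z' \<in> C j" for z z' j
      using that Zd(4)[of z j z'] Zd(6)[of z j] Zd(6)[of z' j] by (simp add: C_def kdual_add)
    moreover have "(\<lambda>S. a \<otimes> z S) \<in> C (int i + j)" if "a \<in> A i" "z \<in> C j" for a i z j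
      using that Zd(5)[of a i z j] Zd(6)[of z j] A_carrier[of a i] by (simp add: C_def kdual_smult)
    ultimately show ?thesis unfolding graded_family_def by blast
  qed
  obtain D where D: "\<And>j W. (\<lambda>_. \<zero>) \<in> W \<Longrightarrow> (\<forall>u\<in>W. \<forall>v\<in>W. (\<lambda>T. u T \<oplus> v T) \<in> W) \<Longrightarrow>
    (\<forall>l i a u. l \<le> D \<longrightarrow> int i + l = j \<longrightarrow> a \<in> A i \<longrightarrow> u \<in> C l \<longrightarrow> (\<lambda>T. a \<otimes> u T) \<in> W) \<Longrightarrow> C j \<subseteq> W"
    using graded_family_generated[OF noetherian finite_koszul_index Cfam] by blast
  \<comment> \<open>One power of \<mm> for all values of \<open>kd E c\<close>: there are finitely
    many index sets and each value is torsion.\<close>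
  obtain t1 where t1: "\<And>a T. a \<in> ideal_power R \<mm> t1 \<Longrightarrow> T \<in> koszul_index n (Suc q) \<Longrightarrow> a \<odot>\<^bsub>E\<^esub> kd E c T = \<zero>\<^bsub>E\<^esub>"
  proof -
    have "kd E c ` koszul_index n (Suc q) \<subseteq> tors E" using dc by (rule image_subsetI)
    from finite_torsion[OF gE _ this] show thesis using that by auto
  qed
  obtain t0 where t0: "ideal_power R \<mm> t0 \<subseteq> Idl (x ` {..<n})" using m_power_parameters by blast
  \<comment> \<open>Scalars of degree at least \<open>N0\<close> lie in a product of two powers of
    \<mm>: the first kills \<open>kd E c\<close>, the second lies in the ideal of the
    parameters.\<close>
  obtain N0 where N0: "\<And>j. N0 \<le> j \<Longrightarrow> A j \<subseteq> ideal_power R \<mm> (t1 + t0)" using degree_m_power by blast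
  let ?v = "kpair q E c"
  \<comment> \<open>A product of \<open>a\<close> from the first power with \<open>y\<close> from
    the second is handled by writing \<open>y\<close> through the parameters and applying
    \<open>cycle_annihilated\<close> to each.\<close>
  have kill: "b \<odot>\<^bsub>E\<^esub> ?v z = \<zero>\<^bsub>E\<^esub>" if z: "z \<in> C l" and b: "b \<in> ideal_power R \<mm> (t1 + t0)" for b z l
  proof -
    have zc: "z S \<in> carrier R" for S using Zd(6)[of z l] z by (simp add: C_def)
    have vc: "?v z \<in> carrier E" by (rule kpair_closed[OF gE cc zc])
    have p1c: "a \<in> carrier R" if "a \<in> ideal_power R \<mm> t1" for a
      using additive_subgroupD(1)[OF is_abelian_group ideal.axioms(1)[OF ideal_power_ideal[OF m_ideal]]] that by blast
    have "ideal_prod R (ideal_power R \<mm> t1) (ideal_power R \<mm> t0) \<subseteq> {a \<in> carrier R. a \<odot>\<^bsub>E\<^esub> ?v z = \<zero>\<^bsub>E\<^esub>}"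
    proof (rule ideal_prod_subset[OF annihilator_ideal[OF E.module_axioms vc]])
      fix a y assume a: "a \<in> ideal_power R \<mm> t1" and y: "y \<in> ideal_power R \<mm> t0"
      have ac: "a \<in> carrier R" using p1c a .
      have avc: "a \<odot>\<^bsub>E\<^esub> ?v z \<in> carrier E" using ac vc by simp
      have "Idl (x ` {..<n}) \<subseteq> {y \<in> carrier R. y \<odot>\<^bsub>E\<^esub> (a \<odot>\<^bsub>E\<^esub> ?v z) = \<zero>\<^bsub>E\<^esub>}"
      proof (rule genideal_minimal[OF annihilator_ideal[OF E.module_axioms avc]])
        show "x ` {..<n} \<subseteq> {y \<in> carrier R. y \<odot>\<^bsub>E\<^esub> (a \<odot>\<^bsub>E\<^esub> ?v z) = \<zero>\<^bsub>E\<^esub>}"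
        proof (rule image_subsetI, intro CollectI conjI)
          fix i assume "i \<in> {..<n}"
          then have i: "i < n" by simp
          then show "x i \<in> carrier R" by simp
          have "(a \<otimes> x i) \<odot>\<^bsub>E\<^esub> ?v z = \<zero>\<^bsub>E\<^esub>"
            by (rule cycle_annihilated[OF gE cc zc _ ac t1[OF a] i]) (use z in \<open>auto simp: C_def\<close>)
          then show "x i \<odot>\<^bsub>E\<^esub> (a \<odot>\<^bsub>E\<^esub> ?v z) = \<zero>\<^bsub>E\<^esub>"
            using ac vc i by (simp add: m_comm[of a "x i"] flip: E.smult_assoc1)
        qed
      qed
      then have "y \<in> carrier R" "y \<odot>\<^bsub>E\<^esub> (a \<odot>\<^bsub>E\<^esub> ?v z) = \<zero>\<^bsub>E\<^esub>" using t0 y by auto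
      then show "a \<otimes> y \<in> {a \<in> carrier R. a \<odot>\<^bsub>E\<^esub> ?v z = \<zero>\<^bsub>E\<^esub>}"
        using ac vc by (simp add: m_comm[of a y] E.smult_assoc1)
    qed
    then show ?thesis using b ideal_power_add[OF m_ideal] by auto
  qed
  \<comment> \<open>A cycle of degree at least \<open>int N0 + D\<close> is a sum of multiples of
    cycles of degree at most \<open>D\<close>, so all coefficients have degree at least
    \<open>N0\<close>.\<close>
  define N1 where "N1 = int N0 + D"
  have consistent: "?v z = \<zero>\<^bsub>E\<^esub>" if z: "z \<in> C j" and j: "N1 \<le> j" for z j
  proof -
    define W where "W = {z. (\<forall>S. z S \<in> carrier R) \<and> ?v z = \<zero>\<^bsub>E\<^esub>}"
    have "C j \<subseteq> W"
    proof (rule D)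
      show "(\<lambda>_. \<zero>) \<in> W" using kpair_zero[OF gE cc] by (simp add: W_def)
      show "\<forall>u\<in>W. \<forall>v\<in>W. (\<lambda>T. u T \<oplus> v T) \<in> W" using kpair_add[OF gE cc] by (simp add: W_def)
      show "\<forall>l i a u. l \<le> D \<longrightarrow> int i + l = j \<longrightarrow> a \<in> A i \<longrightarrow> u \<in> C l \<longrightarrow> (\<lambda>T. a \<otimes> u T) \<in> W"
      proof (intro allI impI)
        fix l i a u assume h: "l \<le> D" "int i + l = j" "a \<in> A i" "u \<in> C l"
        have uc: "u S \<in> carrier R" for S using Zd(6)[of u l] h(4) by (simp add: C_def)
        have "N0 \<le> i" using h j by (simp add: N1_def)
        then have "a \<odot>\<^bsub>E\<^esub> ?v u = \<zero>\<^bsub>E\<^esub>" using kill[OF h(4)] N0 h(3) by blast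
        then show "(\<lambda>T. a \<otimes> u T) \<in> W"
          using kpair_smult[OF gE cc A_carrier[OF h(3)] uc] uc A_carrier[OF h(3)] by (simp add: W_def)
      qed
    qed
    then show ?thesis using z by (auto simp: W_def)
  qed
  \<comment> \<open>The unknowns are the values of \<open>b\<close>; each chain of degree at least
    \<open>N1\<close> demands that it pair with \<open>kd E b\<close> as it does with
    \<open>c\<close>. Lower degrees carry only the trivial equation, which keeps the system closed
    under addition and scalars.\<close>
  define Q where "Q j = (if j < N1 then {(\<lambda>_. \<zero>, \<zero>\<^bsub>E\<^esub>)} else {(kdual z, ?v z) | z. z \<in> Z j})" for j
  have Q0: "(\<lambda>_. \<zero>, \<zero>\<^bsub>E\<^esub>) \<in> Q j" for j
  proof (cases "j < N1")
    case False
    have "kdual (\<lambda>_. \<zero>) = (\<lambda>_. \<zero>)" "?v (\<lambda>_. \<zero>) = \<zero>\<^bsub>E\<^esub>" using kdual_zero kpair_zero[OF gE cc] by auto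
    then have "(\<lambda>_. \<zero>, \<zero>\<^bsub>E\<^esub>) \<in> {(kdual z, ?v z) | z. z \<in> Z j}" using Zd(3)[of j] by force
    then show ?thesis using False by (simp add: Q_def)
  qed (simp add: Q_def)
  have QE: "(u = (\<lambda>_. \<zero>) \<and> w = \<zero>\<^bsub>E\<^esub> \<and> j < N1) \<or> (\<exists>z \<in> Z j. u = kdual z \<and> w = ?v z \<and> N1 \<le> j)" if "(u, w) \<in> Q j" for u w j
    using that by (auto simp: Q_def split: if_splits)
  have QI: "(kdual z, ?v z) \<in> Q j" if "z \<in> Z j" "N1 \<le> j" for z j using that by (auto simp: Q_def)
  have "\<exists>b. (\<forall>U\<in>?F. b U \<in> piece E (k + wt U)) \<and>
    (\<forall>j u w. (u, w) \<in> Q j \<longrightarrow> finsum E (\<lambda>U. u U \<odot>\<^bsub>E\<^esub> b U) ?F = w)"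
  proof (rule injective_linear_system[OF E N])
    show "(\<forall>U\<in>?F. u U \<in> int_piece R A (j - (k + wt U))) \<and> w \<in> piece E j" if uw: "(u, w) \<in> Q j" for u w j
      using QE[OF uw]
    proof (elim disjE conjE bexE)
      assume "u = (\<lambda>_. \<zero>)" "w = \<zero>\<^bsub>E\<^esub>"
      then show ?thesis using int_piece_rules(1) ED.D_rules(2) by simp
    next
      fix z assume z: "z \<in> Z j" "u = kdual z" "w = ?v z"
      have "kdual z U \<in> int_piece R A (j - (k + wt U))" if "U \<in> ?F" for U
        by (rule kdual_piece) (use that Zd(1)[OF z(1) FG] in auto)
      moreover have "?v z \<in> piece E j" by (rule kpair_piece[OF gE cc c Zd(1)[OF z(1)]])
      ultimately show ?thesis using z by simp
    qed
    show "(\<lambda>T. u T \<oplus> u' T, w \<oplus>\<^bsub>E\<^esub> w') \<in> Q j" if uw: "(u, w) \<in> Q j" and uw': "(u', w') \<in> Q j" for u w u' w' j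
    proof (cases "j < N1")
      case True then show ?thesis using QE[OF uw] QE[OF uw'] Q0 by auto
    next
      case False
      then obtain z z' where z: "z \<in> Z j" "u = kdual z" "w = ?v z" and z': "z' \<in> Z j" "u' = kdual z'" "w' = ?v z'"
        using QE[OF uw] QE[OF uw'] by auto
      have "kdual (\<lambda>S. z S \<oplus> z' S) = (\<lambda>U. u U \<oplus> u' U)" "?v (\<lambda>S. z S \<oplus> z' S) = w \<oplus>\<^bsub>E\<^esub> w'"
        using kdual_add Zd(6)[OF z(1)] Zd(6)[OF z'(1)] kpair_add[OF gE cc] z(2,3) z'(2,3) by auto
      then show ?thesis using QI[OF Zd(4)[OF z(1) z'(1)]] False by simp
    qed
    show "(\<lambda>T. a \<otimes> u T, a \<odot>\<^bsub>E\<^esub> w) \<in> Q (int i + j)" if a: "a \<in> A i" and uw: "(u, w) \<in> Q j" for a i u w j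
      using QE[OF uw]
    proof (elim disjE conjE bexE)
      assume "u = (\<lambda>_. \<zero>)" "w = \<zero>\<^bsub>E\<^esub>"
      then show ?thesis using Q0 A_carrier[OF a] by simp
    next
      fix z assume z: "z \<in> Z j" "u = kdual z" "w = ?v z" "N1 \<le> j"
      have "kdual (\<lambda>S. a \<otimes> z S) = (\<lambda>U. a \<otimes> u U)" "?v (\<lambda>S. a \<otimes> z S) = a \<odot>\<^bsub>E\<^esub> w"
        using kdual_smult[OF A_carrier[OF a]] Zd(6)[OF z(1)] kpair_smult[OF gE cc A_carrier[OF a]] z(2,3) by auto
      then show ?thesis using QI[OF Zd(5)[OF a z(1)]] z(4) by simp
    qed
    show "w = \<zero>\<^bsub>E\<^esub>" if uw: "(u, w) \<in> Q j" and u: "\<forall>U\<in>?F. u U = \<zero>" for u w j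
      using QE[OF uw] u consistent by (auto simp: C_def)
  qed (use Q0 in auto)
  then obtain b where b: "\<And>U. U \<in> ?F \<Longrightarrow> b U \<in> piece E (k + wt U)"
    "\<And>j u w. (u, w) \<in> Q j \<Longrightarrow> finsum E (\<lambda>U. u U \<odot>\<^bsub>E\<^esub> b U) ?F = w" by blast
  have bc: "b U \<in> carrier E" if "U \<subseteq> {..<n}" "Suc (card U) = q" for U using b(1)[of U] that by auto
  have kdb: "kd E b S \<in> carrier E" if "S \<in> ?G" for S
    using kd_closed[OF gE koszul_index_sub[OF that]] bc koszul_index_remove_card[OF that] by blast
  have "c S \<ominus>\<^bsub>E\<^esub> kd E b S \<in> tors E" if S: "S \<in> ?G" for S
  proof -
    \<comment> \<open>The bound is the one at which the chain with single entry \<open>a\<close> at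
      \<open>S\<close> reaches degree \<open>N1\<close> and hence occurs among the
      equations.\<close>
    have "a \<odot>\<^bsub>E\<^esub> (c S \<ominus>\<^bsub>E\<^esub> kd E b S) = \<zero>\<^bsub>E\<^esub>" if j: "nat (N1 - (k + wt S)) \<le> j" and a: "a \<in> A j" for j a
    proof -
      \<comment> \<open>Pairing with this chain extracts the value at \<open>S\<close>, multiplied
        by \<open>a\<close>.\<close>
      define z where "z S' = (if S' = S then a else \<zero>)" for S'
      have zZ: "z \<in> Z (int j + (k + wt S))" using a S int_piece_rules(1) by (simp add: Z_def z_def)
      have zc: "z S' \<in> carrier R" for S' using A_carrier[OF a] by (simp add: z_def)
      have pz: "kpair q E f z = a \<odot>\<^bsub>E\<^esub> f S" if f: "\<And>S. S \<in> ?G \<Longrightarrow> f S \<in> carrier E" for f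
      proof -
        have "kpair q E f z = (\<Oplus>\<^bsub>E\<^esub>S'\<in>?G. if S = S' then a \<odot>\<^bsub>E\<^esub> f S' else \<zero>\<^bsub>E\<^esub>)"
          unfolding kpair_def using f A_carrier[OF a] by (intro E.finsum_cong') (auto simp: z_def)
        also have "\<dots> = a \<odot>\<^bsub>E\<^esub> f S"
          using S f A_carrier[OF a] by (intro E.finsum_singleton) auto
        finally show ?thesis .
      qed
      have "finsum E (\<lambda>U. kdual z U \<odot>\<^bsub>E\<^esub> b U) ?F = ?v z" using b(2)[OF QI[OF zZ]] j by simp
      also have "finsum E (\<lambda>U. kdual z U \<odot>\<^bsub>E\<^esub> b U) ?F = kpair q E (kd E b) z"
        unfolding kpair_def by (rule kdual_adjoint[OF gE zc bc, symmetric])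
      finally have "a \<odot>\<^bsub>E\<^esub> kd E b S = a \<odot>\<^bsub>E\<^esub> c S" using pz[OF kdb] pz[OF cc] by simp
      then show ?thesis
        using A_carrier[OF a] cc[OF S] kdb[OF S] by (simp add: a_minus_def E.smult_r_distr E.smult_r_minus E.r_neg)
    qed
    then show ?thesis using cc[OF S] kdb[OF S] by (auto simp: tors_def)
  qed
  then show ?thesis using b(1) by blast
qed

end

section \<open>The total complex of a resolution\<close>

locale koszul_resolution = koszul_parameters R A \<mm> n x d
  for R :: "('a, 'm) ring_scheme" (structure) and A \<mm> n x d +
  fixes I :: "nat \<Rightarrow> ('a, 'c) graded_module" and \<delta> :: "nat \<Rightarrow> 'c \<Rightarrow> 'c" and \<epsilon> :: "'a \<Rightarrow> 'c"
  assumes d_pos: "\<And>i. i < n \<Longrightarrow> 0 < d i"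
    and resolution: "graded_injective_resolution R A (regular_module R A) \<epsilon> I \<delta>"
begin

section \<open>Exactness of the resolution, degree by degree\<close>

lemma I_injective: "graded_injective R A (I p)"
  using resolution by (simp add: graded_injective_resolution_def)

lemma I_graded: "gm (I p)"
  using I_injective by (simp add: graded_injective_def)

lemma \<epsilon>_hom: "\<epsilon> \<in> graded_hom R RR (I 0)" and \<epsilon>_inj: "inj_on \<epsilon> (carrier R)"
  and \<delta>_hom: "\<delta> p \<in> graded_hom R (I p) (I (Suc p))"
  using resolution by (auto simp: graded_injective_resolution_def)

interpretation I: module R "I p" for p by (rule gm_module[OF I_graded])
interpretation ID: decomposed_group "I p" "piece (I p)" for p by (rule gm_decomp[OF I_graded])

lemmas \<delta>_rules = graded_homD[OF \<delta>_hom]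
lemmas \<epsilon>_rules = graded_homD[OF \<epsilon>_hom, simplified]

lemma \<delta>_zero [simp]: "\<delta> p \<zero>\<^bsub>I p\<^esub> = \<zero>\<^bsub>I (Suc p)\<^esub>"
  by (rule additive_zero[OF gm_abelian[OF I_graded] gm_abelian[OF I_graded] \<delta>_rules(2,3)])

lemma \<delta>_neg: "v \<in> carrier (I p) \<Longrightarrow> \<delta> p (\<ominus>\<^bsub>I p\<^esub> v) = \<ominus>\<^bsub>I (Suc p)\<^esub> \<delta> p v"
  by (rule additive_neg[OF gm_abelian[OF I_graded] gm_abelian[OF I_graded] \<delta>_rules(2,3)])

lemma \<epsilon>_zero [simp]: "\<epsilon> \<zero> = \<zero>\<^bsub>I 0\<^esub>"
  using additive_zero[OF RR_abelian_group gm_abelian[OF I_graded] graded_homD(2,3)[OF \<epsilon>_hom]] by simp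

lemma exact: "v \<in> carrier (I (Suc p)) \<Longrightarrow> \<delta> (Suc p) v = \<zero>\<^bsub>I (Suc (Suc p))\<^esub> \<Longrightarrow> v \<in> \<delta> p ` carrier (I p)"
  and \<delta>_\<delta>: "u \<in> carrier (I p) \<Longrightarrow> \<delta> (Suc p) (\<delta> p u) = \<zero>\<^bsub>I (Suc (Suc p))\<^esub>"
proof -
  have e: "\<delta> p ` carrier (I p) = {v \<in> carrier (I (Suc p)). \<delta> (Suc p) v = \<zero>\<^bsub>I (Suc (Suc p))\<^esub>}"
    using resolution by (simp add: graded_injective_resolution_def cocycles_def)
  show "v \<in> carrier (I (Suc p)) \<Longrightarrow> \<delta> (Suc p) v = \<zero>\<^bsub>I (Suc (Suc p))\<^esub> \<Longrightarrow> v \<in> \<delta> p ` carrier (I p)"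
    unfolding e by simp
  assume "u \<in> carrier (I p)"
  then have "\<delta> p u \<in> {v \<in> carrier (I (Suc p)). \<delta> (Suc p) v = \<zero>\<^bsub>I (Suc (Suc p))\<^esub>}" unfolding e[symmetric] by simp
  then show "\<delta> (Suc p) (\<delta> p u) = \<zero>\<^bsub>I (Suc (Suc p))\<^esub>" by simp
qed

lemma exact_0: "v \<in> carrier (I 0) \<Longrightarrow> \<delta> 0 v = \<zero>\<^bsub>I (Suc 0)\<^esub> \<Longrightarrow> v \<in> \<epsilon> ` carrier R"
  and \<delta>_\<epsilon>: "a \<in> carrier R \<Longrightarrow> \<delta> 0 (\<epsilon> a) = \<zero>\<^bsub>I (Suc 0)\<^esub>"
proof -
  have e: "\<epsilon> ` carrier R = {v \<in> carrier (I 0). \<delta> 0 v = \<zero>\<^bsub>I (Suc 0)\<^esub>}"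
    using resolution by (simp add: graded_injective_resolution_def cocycles_def)
  show "v \<in> carrier (I 0) \<Longrightarrow> \<delta> 0 v = \<zero>\<^bsub>I (Suc 0)\<^esub> \<Longrightarrow> v \<in> \<epsilon> ` carrier R" unfolding e by simp
  assume "a \<in> carrier R"
  then have "\<epsilon> a \<in> {v \<in> carrier (I 0). \<delta> 0 v = \<zero>\<^bsub>I (Suc 0)\<^esub>}" unfolding e[symmetric] by simp
  then show "\<delta> 0 (\<epsilon> a) = \<zero>\<^bsub>I (Suc 0)\<^esub>" by simp
qed

text \<open>Any preimage can be replaced by its component of degree \<open>j\<close>, because
  \<delta> commutes with taking components.\<close>

lemma graded_exact:
  assumes "v \<in> piece (I (Suc p)) j" "\<delta> (Suc p) v = \<zero>\<^bsub>I (Suc (Suc p))\<^esub>"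
  shows "\<exists>u \<in> piece (I p) j. \<delta> p u = v"
proof -
  obtain u where u: "u \<in> carrier (I p)" "v = \<delta> p u" using exact[of v p] assms by auto
  have "dcomp (I (Suc p)) j v = \<delta> p (dcomp (I p) j u)"
    unfolding u(2) by (rule dcomp_hom[OF I_graded I_graded \<delta>_hom u(1)])
  then show ?thesis using ID.hcomp_homogeneous[OF assms(1), of j] ID.hcomp_props(1)[OF u(1)] by auto
qed

lemma graded_exact_0:
  assumes "v \<in> piece (I 0) j" "\<delta> 0 v = \<zero>\<^bsub>I (Suc 0)\<^esub>"
  shows "\<exists>a \<in> int_piece R A j. \<epsilon> a = v"
proof -
  obtain a where a: "a \<in> carrier R" "v = \<epsilon> a" using exact_0[of v] assms by auto
  have "dcomp (I 0) j v = \<epsilon> (dcomp RR j a)"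
    unfolding a(2) by (rule dcomp_hom[OF RR_graded I_graded \<epsilon>_hom]) (use a in simp)
  then show ?thesis using ID.hcomp_homogeneous[OF assms(1), of j] dcomp_RR_mem(1)[OF a(1)] by auto
qed

text \<open>Total degrees are integers, so that \<open>m - 1\<close> and \<open>m - 1 - 1\<close>
  need no case distinction: a negative total degree has no cells.\<close>

definition cell :: "int \<Rightarrow> nat \<Rightarrow> nat set \<Rightarrow> bool" where
  "cell m p T \<longleftrightarrow> T \<subseteq> {..<n} \<and> int p + int (card T) = m"

text \<open>The part of degree 0 of the total complex of the double complex with rows \<open>K(x, I p)\<close>, with entries in \<open>U p\<close>.
  Only the values at the cells of total degree \<open>m\<close> matter.\<close>

definition Tot :: "(nat \<Rightarrow> 'c set) \<Rightarrow> int \<Rightarrow> (nat \<Rightarrow> nat set \<Rightarrow> 'c) set" where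
  "Tot U m = {c. \<forall>p T. cell m p T \<longrightarrow> c p T \<in> U p \<and> c p T \<in> piece (I p) (wt T)}"

abbreviation "CI \<equiv> \<lambda>p. carrier (I p)"
abbreviation "TI \<equiv> \<lambda>p. tors (I p)"

text \<open>The sign with which \<delta> enters the total differential, so that it anticommutes with
  the Koszul differential.\<close>

definition psgn :: "nat \<Rightarrow> nat set \<Rightarrow> 'c \<Rightarrow> 'c" where
  "psgn p T v = (if even (card T) then v else \<ominus>\<^bsub>I p\<^esub> v)"

definition dl :: "(nat \<Rightarrow> nat set \<Rightarrow> 'c) \<Rightarrow> nat \<Rightarrow> nat set \<Rightarrow> 'c" where
  "dl c p T = (case p of 0 \<Rightarrow> \<zero>\<^bsub>I 0\<^esub> | Suc p' \<Rightarrow> psgn (Suc p') T (\<delta> p' (c p' T)))"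

definition TD :: "(nat \<Rightarrow> nat set \<Rightarrow> 'c) \<Rightarrow> nat \<Rightarrow> nat set \<Rightarrow> 'c" where
  "TD c p T = kd (I p) (c p) T \<oplus>\<^bsub>I p\<^esub> dl c p T"

section \<open>Rules for the total differential\<close>

lemma TotD: "c \<in> Tot U m \<Longrightarrow> cell m p T \<Longrightarrow> c p T \<in> U p"
  "c \<in> Tot U m \<Longrightarrow> cell m p T \<Longrightarrow> c p T \<in> piece (I p) (wt T)"
  "c \<in> Tot U m \<Longrightarrow> cell m p T \<Longrightarrow> c p T \<in> carrier (I p)"
  unfolding Tot_def using ID.D_carrier by blast+

lemma Tot_tors_carrier: "c \<in> Tot TI m \<Longrightarrow> c \<in> Tot CI m"
  unfolding Tot_def using ID.D_carrier by blast

lemma cell_sub: "cell m p T \<Longrightarrow> T \<subseteq> {..<n}" and cell_finite: "cell m p T \<Longrightarrow> finite T"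
  by (auto simp: cell_def finite_subset)

lemma cell_remove:
  assumes "cell (m + 1) p T" "i \<in> T" shows "cell m p (T - {i})"
proof -
  have "card T = Suc (card (T - {i}))" using card_Suc_Diff1[OF cell_finite[OF assms(1)] assms(2)] by simp
  then show ?thesis using assms by (auto simp: cell_def)
qed

lemma cell_Suc: "cell (m + 1) (Suc p) T \<longleftrightarrow> cell m p T"
  by (auto simp: cell_def)

lemma cell_Suc': "cell m (Suc p) T \<longleftrightarrow> cell (m - 1) p T"
  by (auto simp: cell_def)

lemma psgn_rules:
  assumes "v \<in> carrier (I p)"
  shows "psgn p T v \<in> carrier (I p)" "psgn p T (psgn p T v) = v"
    "w \<in> carrier (I p) \<Longrightarrow> psgn p T (v \<oplus>\<^bsub>I p\<^esub> w) = psgn p T v \<oplus>\<^bsub>I p\<^esub> psgn p T w"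
    "psgn p T (\<ominus>\<^bsub>I p\<^esub> v) = \<ominus>\<^bsub>I p\<^esub> psgn p T v"
    "a \<in> carrier R \<Longrightarrow> psgn p T (a \<odot>\<^bsub>I p\<^esub> v) = a \<odot>\<^bsub>I p\<^esub> psgn p T v"
    "\<delta> p (psgn p T v) = psgn (Suc p) T (\<delta> p v)"
    "psgn p T v = \<zero>\<^bsub>I p\<^esub> \<longleftrightarrow> v = \<zero>\<^bsub>I p\<^esub>"
proof -
  have "\<ominus>\<^bsub>I p\<^esub> v = \<zero>\<^bsub>I p\<^esub> \<longleftrightarrow> v = \<zero>\<^bsub>I p\<^esub>"
  proof
    assume "\<ominus>\<^bsub>I p\<^esub> v = \<zero>\<^bsub>I p\<^esub>"
    then show "v = \<zero>\<^bsub>I p\<^esub>" using I.r_neg[OF assms] assms by simp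
  qed (simp add: a_inv_def)
  then show "psgn p T v = \<zero>\<^bsub>I p\<^esub> \<longleftrightarrow> v = \<zero>\<^bsub>I p\<^esub>" by (simp add: psgn_def)
qed (use assms in \<open>auto simp: psgn_def I.minus_add I.smult_r_minus \<delta>_neg\<close>)

lemma psgn_zero [simp]: "psgn p T \<zero>\<^bsub>I p\<^esub> = \<zero>\<^bsub>I p\<^esub>"
  using psgn_rules(7)[of "\<zero>\<^bsub>I p\<^esub>"] by simp

lemma psgn_piece: "v \<in> piece (I p) j \<Longrightarrow> psgn p T v \<in> piece (I p) j"
  and psgn_tors: "v \<in> TI p \<Longrightarrow> psgn p T v \<in> TI p"
  using ID.D_rules(4) tors_neg[OF I_graded] by (auto simp: psgn_def)

lemma kd_row_closed:
  assumes "c \<in> Tot CI m" "cell (m + 1) p T" shows "kd (I p) (c p) T \<in> carrier (I p)"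
  by (rule kd_closed[OF I_graded cell_sub[OF assms(2)]]) (use TotD(3)[OF assms(1)] cell_remove[OF assms(2)] in auto)

lemma dl_closed:
  assumes "c \<in> Tot CI m" "cell (m + 1) p T" shows "dl c p T \<in> carrier (I p)"
proof (cases p)
  case (Suc p')
  then have "c p' T \<in> carrier (I p')" using TotD(3)[OF assms(1)] assms(2) cell_Suc by simp
  then show ?thesis using Suc psgn_rules(1)[OF \<delta>_rules(1)] by (simp add: dl_def)
qed (simp add: dl_def)

lemma TD_Tot:
  assumes "c \<in> Tot CI m" shows "TD c \<in> Tot CI (m + 1)"
  unfolding Tot_def
proof (intro CollectI allI impI conjI)
  fix p T assume cell: "cell (m + 1) p T"
  have "kd (I p) (c p) T \<in> piece (I p) (0 + wt T)"
    by (rule kd_piece[OF I_graded cell_sub[OF cell]]) (use TotD(2)[OF assms] cell_remove[OF cell] in simp)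
  moreover have "dl c p T \<in> piece (I p) (wt T)"
  proof (cases p)
    case (Suc p')
    then have "c p' T \<in> piece (I p') (wt T)" using TotD(2)[OF assms] cell cell_Suc by simp
    then show ?thesis using Suc psgn_piece[OF \<delta>_rules(5)] by (simp add: dl_def)
  qed (use ID.D_rules(2) in \<open>simp add: dl_def\<close>)
  ultimately show "TD c p T \<in> piece (I p) (wt T)" using ID.D_rules(3) by (simp add: TD_def)
  then show "TD c p T \<in> carrier (I p)" by simp
qed

lemma TD_Tot_tors:
  assumes "c \<in> Tot TI m" shows "TD c \<in> Tot TI (m + 1)"
  unfolding Tot_def
proof (intro CollectI allI impI conjI)
  fix p T assume cell: "cell (m + 1) p T"
  have "kd (I p) (c p) T \<in> TI p"
    by (rule kd_tors[OF I_graded cell_sub[OF cell]]) (use TotD(1)[OF assms] cell_remove[OF cell] in simp)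
  moreover have "dl c p T \<in> TI p"
  proof (cases p)
    case (Suc p')
    then have "c p' T \<in> TI p'" using TotD(1)[OF assms] cell cell_Suc by simp
    then show ?thesis using Suc psgn_tors[OF tors_hom[OF I_graded I_graded \<delta>_hom]] by (simp add: dl_def)
  qed (use tors_zero[OF I_graded] in \<open>simp add: dl_def\<close>)
  ultimately show "TD c p T \<in> TI p" using tors_add[OF I_graded] by (simp add: TD_def)
  show "TD c p T \<in> piece (I p) (wt T)" using TotD(2)[OF TD_Tot[OF Tot_tors_carrier[OF assms]] cell] .
qed

lemma TD_closed: "c \<in> Tot CI m \<Longrightarrow> cell (m + 1) p T \<Longrightarrow> TD c p T \<in> carrier (I p)"
  using TotD(1)[OF TD_Tot] .

lemma TD_cong:
  assumes c: "c \<in> Tot CI m" and eq: "\<And>p T. cell m p T \<Longrightarrow> c p T = c' p T" and cell: "cell (m + 1) p T"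
  shows "TD c p T = TD c' p T"
proof -
  have "kd (I p) (c p) T = kd (I p) (c' p) T"
    by (rule kd_cong[OF I_graded cell_sub[OF cell]]) (use TotD(3)[OF c] eq cell_remove[OF cell] in auto)
  moreover have "dl c p T = dl c' p T" using eq cell cell_Suc by (cases p) (auto simp: dl_def)
  ultimately show ?thesis by (simp add: TD_def)
qed

lemma TD_add:
  assumes c: "c \<in> Tot CI m" "c' \<in> Tot CI m" and cell: "cell (m + 1) p T"
  shows "TD (\<lambda>p T. c p T \<oplus>\<^bsub>I p\<^esub> c' p T) p T = TD c p T \<oplus>\<^bsub>I p\<^esub> TD c' p T"
proof -
  note closed = kd_row_closed[OF c(1) cell] kd_row_closed[OF c(2) cell] dl_closed[OF c(1) cell] dl_closed[OF c(2) cell]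
  have "kd (I p) (\<lambda>T. c p T \<oplus>\<^bsub>I p\<^esub> c' p T) T = kd (I p) (c p) T \<oplus>\<^bsub>I p\<^esub> kd (I p) (c' p) T"
    by (rule kd_add[OF I_graded cell_sub[OF cell]]) (use TotD(3) c cell_remove[OF cell] in auto)
  moreover have "dl (\<lambda>p T. c p T \<oplus>\<^bsub>I p\<^esub> c' p T) p T = dl c p T \<oplus>\<^bsub>I p\<^esub> dl c' p T"
  proof (cases p)
    case (Suc p')
    then have "c p' T \<in> carrier (I p')" "c' p' T \<in> carrier (I p')" using TotD(3) c cell cell_Suc by auto
    then show ?thesis using Suc psgn_rules(3)[OF \<delta>_rules(1) \<delta>_rules(1)] by (simp add: dl_def \<delta>_rules(3))
  qed (simp add: dl_def)
  ultimately show ?thesis using closed by (simp add: TD_def I.a_ac)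
qed

lemma TD_smult:
  assumes c: "c \<in> Tot CI m" and a: "a \<in> carrier R" and cell: "cell (m + 1) p T"
  shows "TD (\<lambda>p T. a \<odot>\<^bsub>I p\<^esub> c p T) p T = a \<odot>\<^bsub>I p\<^esub> TD c p T"
proof -
  have "kd (I p) (\<lambda>T. a \<odot>\<^bsub>I p\<^esub> c p T) T = a \<odot>\<^bsub>I p\<^esub> kd (I p) (c p) T"
    by (rule kd_smult[OF I_graded cell_sub[OF cell] a]) (use TotD(3)[OF c] cell_remove[OF cell] in auto)
  moreover have "dl (\<lambda>p T. a \<odot>\<^bsub>I p\<^esub> c p T) p T = a \<odot>\<^bsub>I p\<^esub> dl c p T"
  proof (cases p)
    case (Suc p')
    then have "c p' T \<in> carrier (I p')" using TotD(3) c cell cell_Suc by auto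
    then show ?thesis using Suc a psgn_rules(5)[OF \<delta>_rules(1)] by (simp add: dl_def \<delta>_rules(4))
  qed (use a in \<open>simp add: dl_def\<close>)
  ultimately show ?thesis
    using a kd_row_closed[OF c cell] dl_closed[OF c cell] by (simp add: TD_def I.smult_r_distr)
qed

lemma Tot_smult: 
  assumes "a \<in> A 0"
  shows "c \<in> Tot CI m \<Longrightarrow> (\<lambda>p T. a \<odot>\<^bsub>I p\<^esub> c p T) \<in> Tot CI m"
    and "c \<in> Tot TI m \<Longrightarrow> (\<lambda>p T. a \<odot>\<^bsub>I p\<^esub> c p T) \<in> Tot TI m"
  using smult_A_piece[OF I_graded assms] tors_smult[OF I_graded A_carrier[OF assms]] A_carrier[OF assms]
  unfolding Tot_def by auto

lemma Tot_add:
  shows "c \<in> Tot CI m \<Longrightarrow> c' \<in> Tot CI m \<Longrightarrow> (\<lambda>p T. c p T \<oplus>\<^bsub>I p\<^esub> c' p T) \<in> Tot CI m"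
    and "c \<in> Tot TI m \<Longrightarrow> c' \<in> Tot TI m \<Longrightarrow> (\<lambda>p T. c p T \<oplus>\<^bsub>I p\<^esub> c' p T) \<in> Tot TI m"
  using ID.D_rules(3) tors_add[OF I_graded] unfolding Tot_def by auto

lemma Tot_minus:
  shows "c \<in> Tot CI m \<Longrightarrow> c' \<in> Tot CI m \<Longrightarrow> (\<lambda>p T. c p T \<ominus>\<^bsub>I p\<^esub> c' p T) \<in> Tot CI m"
    and "c \<in> Tot TI m \<Longrightarrow> c' \<in> Tot TI m \<Longrightarrow> (\<lambda>p T. c p T \<ominus>\<^bsub>I p\<^esub> c' p T) \<in> Tot TI m"
  using ID.D_rules(5) tors_rules(5)[OF I_graded I_graded] unfolding Tot_def by auto

lemma TD_minus:
  assumes c: "c \<in> Tot CI m" "c' \<in> Tot CI m" and cell: "cell (m + 1) p T"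
  shows "TD (\<lambda>p T. c p T \<ominus>\<^bsub>I p\<^esub> c' p T) p T = TD c p T \<ominus>\<^bsub>I p\<^esub> TD c' p T"
proof -
  have "\<ominus> \<one> \<in> A 0" using one_degree_0 RD.D_rules(4) by blast
  note neg = Tot_smult(1)[OF this c(2)]
  have m1: "(\<ominus> \<one>) \<odot>\<^bsub>I p\<^esub> v = \<ominus>\<^bsub>I p\<^esub> v" if "v \<in> carrier (I p)" for v p using that by (simp add: I.smult_l_minus)
  have "TD (\<lambda>p T. c p T \<ominus>\<^bsub>I p\<^esub> c' p T) p T = TD (\<lambda>p T. c p T \<oplus>\<^bsub>I p\<^esub> (\<ominus> \<one>) \<odot>\<^bsub>I p\<^esub> c' p T) p T"
    by (rule TD_cong[OF Tot_minus(1)[OF c] _ cell]) (use TotD(3)[OF c(2)] m1 in \<open>simp add: a_minus_def\<close>)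
  also have "\<dots> = TD c p T \<oplus>\<^bsub>I p\<^esub> (\<ominus> \<one>) \<odot>\<^bsub>I p\<^esub> TD c' p T"
    using TD_add[OF c(1) neg cell] TD_smult[OF c(2) _ cell, of "\<ominus> \<one>"] by simp
  finally show ?thesis using m1[OF TD_closed[OF c(2) cell]] by (simp add: a_minus_def)
qed

text \<open>Each of the two differentials squares to zero, and the mixed terms cancel: removing an
  element flips the parity of the index set, so \<open>kd\<close> and \<open>dl\<close>
  anticommute.\<close>

lemma TD_TD:
  assumes c: "c \<in> Tot CI m" and cell: "cell (m + 1 + 1) p T"
  shows "TD (TD c) p T = \<zero>\<^bsub>I p\<^esub>"
proof -
  have cr: "cell (m + 1) p (T - {i})" if "i \<in> T" for i by (rule cell_remove[OF cell that])
  have crr: "cell m p (T - {i} - {j})" if "i \<in> T" "j \<in> T" "i \<noteq> j" for i j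
    by (rule cell_remove[OF cr[OF that(1)]]) (use that in auto)
  have kk: "kd (I p) (kd (I p) (c p)) T = \<zero>\<^bsub>I p\<^esub>"
    by (rule kd_kd[OF I_graded cell_sub[OF cell]]) (use TotD(3)[OF c crr] in auto)
  have "kd (I p) (TD c p) T = kd (I p) (\<lambda>T. kd (I p) (c p) T \<oplus>\<^bsub>I p\<^esub> dl c p T) T"
    by (simp add: TD_def[abs_def])
  also have "\<dots> = kd (I p) (kd (I p) (c p)) T \<oplus>\<^bsub>I p\<^esub> kd (I p) (dl c p) T"
    by (rule kd_add[OF I_graded cell_sub[OF cell]]) (rule kd_row_closed[OF c cr] dl_closed[OF c cr], assumption)+
  finally have 1: "kd (I p) (TD c p) T = kd (I p) (dl c p) T"
    using kk kd_closed[OF I_graded cell_sub[OF cell], of "dl c p" p] dl_closed[OF c cr] by simp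
  show ?thesis
  proof (cases p)
    case 0
    have "kd (I p) (dl c p) T = \<zero>\<^bsub>I p\<^esub>"
      by (rule kd_zero[OF I_graded cell_sub[OF cell]]) (simp add: 0 dl_def)
    then show ?thesis using 1 0 by (simp add: TD_def dl_def)
  next
    case (Suc p')
    have cell': "cell (m + 1) p' T" using cell unfolding Suc cell_Suc .
    have cpc: "c p' (T - {i}) \<in> carrier (I p')" if "i \<in> T" for i
      by (rule TotD(3)[OF c cell_remove[OF cell' that]])
    have \<delta>c: "\<delta> p' (c p' (T - {i})) \<in> carrier (I p)" if "i \<in> T" for i
      using \<delta>_rules(1)[OF cpc[OF that]] Suc by simp
    have ev: "even (card (T - {i})) \<longleftrightarrow> odd (card T)" if "i \<in> T" for i
      using card_Suc_Diff1[OF cell_finite[OF cell] that] by (metis even_Suc)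
    have hom: "\<delta> p' (kd (I p') (c p') T) = kd (I p) (\<lambda>T. \<delta> p' (c p' T)) T"
      using kd_hom[OF I_graded I_graded \<delta>_hom cell_sub[OF cell], of "c p'"] cpc Suc by simp
    have kc: "kd (I p) (\<lambda>T. \<delta> p' (c p' T)) T \<in> carrier (I p)"
      by (rule kd_closed[OF I_graded cell_sub[OF cell]]) (rule \<delta>c)
    \<comment> \<open>All sets \<open>T - {i}\<close> have the parity opposite to that of
      \<open>T\<close>, so their sign is one common scalar that leaves the sum.\<close>
    have "kd (I p) (dl c p) T = kd (I p) (\<lambda>U. (if even (card T) then \<ominus> \<one> else \<one>) \<odot>\<^bsub>I p\<^esub> \<delta> p' (c p' U)) T"
    proof (rule kd_cong[OF I_graded cell_sub[OF cell]])
      fix i assume i: "i \<in> T"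
      show "dl c p (T - {i}) \<in> carrier (I p)" by (rule dl_closed[OF c cr[OF i]])
      show "dl c p (T - {i}) = (if even (card T) then \<ominus> \<one> else \<one>) \<odot>\<^bsub>I p\<^esub> \<delta> p' (c p' (T - {i}))"
        using ev[OF i] \<delta>c[OF i] by (auto simp: dl_def Suc psgn_def I.smult_l_minus)
    qed
    also have "\<dots> = (if even (card T) then \<ominus> \<one> else \<one>) \<odot>\<^bsub>I p\<^esub> kd (I p) (\<lambda>T. \<delta> p' (c p' T)) T"
      by (rule kd_smult[OF I_graded cell_sub[OF cell]]) (auto intro: \<delta>c)
    also have "\<dots> = \<ominus>\<^bsub>I p\<^esub> psgn p T (kd (I p) (\<lambda>T. \<delta> p' (c p' T)) T)"
      using kc by (simp add: psgn_def I.smult_l_minus)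
    finally have 2: "kd (I p) (dl c p) T = \<ominus>\<^bsub>I p\<^esub> psgn p T (kd (I p) (\<lambda>T. \<delta> p' (c p' T)) T)" .
    have "\<delta> p' (dl c p' T) = \<zero>\<^bsub>I p\<^esub>"
    proof (cases p')
      case (Suc p'')
      have "c p'' T \<in> carrier (I p'')" using TotD(3)[OF c] cell' cell_Suc Suc by simp
      then show ?thesis using Suc \<open>p = Suc p'\<close> \<delta>_\<delta> psgn_rules(6)[OF \<delta>_rules(1)] by (simp add: dl_def)
    qed (simp add: dl_def Suc)
    then have "\<delta> p' (TD c p' T) = kd (I p) (\<lambda>T. \<delta> p' (c p' T)) T"
      unfolding TD_def using \<delta>_rules(3)[OF kd_row_closed[OF c cell'] dl_closed[OF c cell']] hom kc Suc by simp
    then show ?thesis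
      unfolding TD_def[of "TD c"] 1 2 using Suc kc psgn_rules(1)[OF kc] by (simp add: dl_def I.l_neg)
  qed
qed

section \<open>Clearing total cochains row by row\<close>

lemma Tot_zero: "(\<lambda>p _. \<zero>\<^bsub>I p\<^esub>) \<in> Tot CI m" "(\<lambda>p _. \<zero>\<^bsub>I p\<^esub>) \<in> Tot TI m"
  using ID.D_rules(2) tors_zero[OF I_graded] unfolding Tot_def by auto

lemma TD_zero: "cell m p T \<Longrightarrow> TD (\<lambda>p _. \<zero>\<^bsub>I p\<^esub>) p T = \<zero>\<^bsub>I p\<^esub>"
  using kd_zero[OF I_graded, of T "\<lambda>_. \<zero>\<^bsub>I p\<^esub>" p] by (cases p) (auto simp: TD_def dl_def cell_def)

text \<open>The sign \<open>psgn\<close> is its own inverse and so cancels the one in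
  \<open>dl\<close>. Row \<open>p\<close> of the differential changes in an uncontrolled way, which
  is harmless when rows are cleared from large \<open>p\<close> downwards.\<close>

lemma TD_update:
  assumes U: "U = CI \<or> U = TI" and b: "b \<in> Tot U (m - 1)"
    and w: "\<And>T. cell m (Suc p) T \<Longrightarrow> w T \<in> U p \<and> w T \<in> piece (I p) (wt T)"
  defines "b' \<equiv> b(p := \<lambda>T. b p T \<oplus>\<^bsub>I p\<^esub> psgn p T (w T))"
  shows "b' \<in> Tot U (m - 1)"
    and "\<And>T. cell m (Suc p) T \<Longrightarrow> TD b' (Suc p) T = TD b (Suc p) T \<oplus>\<^bsub>I (Suc p)\<^esub> \<delta> p (w T)"
    and "\<And>p' T. p' \<noteq> p \<Longrightarrow> p' \<noteq> Suc p \<Longrightarrow> TD b' p' T = TD b p' T"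
proof -
  have bC: "b \<in> Tot CI (m - 1)" using U b Tot_tors_carrier by blast
  show "b' \<in> Tot U (m - 1)"
    unfolding Tot_def
  proof (intro CollectI allI impI)
    fix q T assume cell: "cell (m - 1) q T"
    show "b' q T \<in> U q \<and> b' q T \<in> piece (I q) (wt T)"
    proof (cases "q = p")
      case True
      have w': "w T \<in> U p" "w T \<in> piece (I p) (wt T)" using w[of T] cell True cell_Suc' by auto
      have b': "b p T \<in> U p" "b p T \<in> piece (I p) (wt T)" using TotD(1,2)[OF b cell] True by auto
      have "b p T \<oplus>\<^bsub>I p\<^esub> psgn p T (w T) \<in> U p"
        using U
      proof
        assume "U = CI" then show ?thesis using w' b' psgn_rules(1) by simp
      next
        assume "U = TI" then show ?thesis using w' b' psgn_tors tors_add[OF I_graded] by simp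
      qed
      then show ?thesis using True w' b' psgn_piece ID.D_rules(3) by (simp add: b'_def)
    qed (use TotD(1,2)[OF b cell] in \<open>simp add: b'_def\<close>)
  qed
  show "TD b' (Suc p) T = TD b (Suc p) T \<oplus>\<^bsub>I (Suc p)\<^esub> \<delta> p (w T)" if cell: "cell m (Suc p) T" for T
  proof -
    have c1: "cell (m - 1) p T" using cell cell_Suc' by simp
    have wc: "w T \<in> carrier (I p)" by (rule ID.D_carrier[OF conjunct2[OF w[OF cell]]])
    have bc: "b p T \<in> carrier (I p)" using TotD(3)[OF bC c1] .
    have cell1: "cell (m - 1 + 1) (Suc p) T" using cell by simp
    have "dl b' (Suc p) T = dl b (Suc p) T \<oplus>\<^bsub>I (Suc p)\<^esub> \<delta> p (w T)"
      using wc bc \<delta>_rules(1)[of _ p] psgn_rules(1)[OF wc] psgn_rules(3)[OF \<delta>_rules(1)[OF bc] psgn_rules(1)[OF \<delta>_rules(1)[OF wc]]]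
        psgn_rules(6)[OF wc] psgn_rules(2)[OF \<delta>_rules(1)[OF wc]]
      by (simp add: dl_def b'_def \<delta>_rules(3))
    then show ?thesis
      using kd_row_closed[OF bC cell1] dl_closed[OF bC cell1] \<delta>_rules(1)[OF wc]
      by (simp add: TD_def b'_def I.a_assoc)
  qed
  show "TD b' p' T = TD b p' T" if "p' \<noteq> p" "p' \<noteq> Suc p" for p' T
    using that by (cases p') (auto simp: TD_def dl_def b'_def)
qed

text \<open>At \<open>T\<close> in row \<open>Suc p\<close> the Koszul part only sees
  \<open>c (Suc p)\<close>. Once that is zero, what remains of the differential is \<delta> up to
  sign.\<close>

lemma TD_peel:
  assumes c: "c \<in> Tot CI m" and cell: "cell m p T" and TD: "TD c (Suc p) T = \<zero>\<^bsub>I (Suc p)\<^esub>"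
    and next_row: "\<And>i. i \<in> T \<Longrightarrow> c (Suc p) (T - {i}) = \<zero>\<^bsub>I (Suc p)\<^esub>"
  shows "\<delta> p (c p T) = \<zero>\<^bsub>I (Suc p)\<^esub>"
proof -
  have cc: "c p T \<in> carrier (I p)" using TotD(3)[OF c cell] .
  have "kd (I (Suc p)) (c (Suc p)) T = \<zero>\<^bsub>I (Suc p)\<^esub>"
    by (rule kd_zero[OF I_graded cell_sub[OF cell]]) (rule next_row)
  then have "psgn (Suc p) T (\<delta> p (c p T)) = \<zero>\<^bsub>I (Suc p)\<^esub>"
    using TD psgn_rules(1)[OF \<delta>_rules(1)[OF cc]] by (simp add: TD_def dl_def)
  then show ?thesis using psgn_rules(7)[OF \<delta>_rules(1)[OF cc]] by simp
qed

lemma TD_residual: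
  assumes c: "c \<in> Tot CI m" and b: "b \<in> Tot CI (m - 1)"
  shows "(\<lambda>p T. c p T \<ominus>\<^bsub>I p\<^esub> TD b p T) \<in> Tot CI m"
    and "\<And>p T. cell (m + 1) p T \<Longrightarrow> TD (\<lambda>p T. c p T \<ominus>\<^bsub>I p\<^esub> TD b p T) p T = TD c p T"
proof -
  have Tb: "TD b \<in> Tot CI m" using TD_Tot[OF b] by simp
  show "(\<lambda>p T. c p T \<ominus>\<^bsub>I p\<^esub> TD b p T) \<in> Tot CI m" by (rule Tot_minus(1)[OF c Tb])
  show "TD (\<lambda>p T. c p T \<ominus>\<^bsub>I p\<^esub> TD b p T) p T = TD c p T" if cell: "cell (m + 1) p T" for p T
    using TD_minus[OF c Tb cell] TD_TD[OF b, of p T] TD_closed[OF c cell] cell by (simp add: a_minus_def)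
qed

text \<open>Since \<delta> is exact in positive positions, the residual can be removed row by row
  from large \<open>p\<close> downwards; what is left in row 0 is a cocycle and comes from
  \<open>R\<close>. Row 0 of \<open>TD c\<close> is left free because the lemma also serves cochains
  whose differential is the image of a Koszul cochain of \<open>R\<close>.\<close>

lemma Tot_resolution:
  assumes c: "c \<in> Tot CI m" and TDc: "\<And>p T. cell (m + 1) (Suc p) T \<Longrightarrow> TD c (Suc p) T = \<zero>\<^bsub>I (Suc p)\<^esub>"
  shows "\<exists>b\<in>Tot CI (m - 1). (\<forall>p T. cell m (Suc p) T \<longrightarrow> c (Suc p) T = TD b (Suc p) T) \<and>
    (\<forall>T. cell m 0 T \<longrightarrow> (\<exists>a\<in>int_piece R A (wt T). c 0 T \<ominus>\<^bsub>I 0\<^esub> TD b 0 T = \<epsilon> a))"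
proof -
  \<comment> \<open>The inequality says that the rows above \<open>m - k\<close> are already
    matched. For \<open>k = 0\<close> there are no cells there.\<close>
  have "\<exists>b\<in>Tot CI (m - 1). \<forall>p T. cell m (Suc p) T \<longrightarrow> m < int (Suc p) + int k \<longrightarrow> c (Suc p) T = TD b (Suc p) T" for k
  proof (induction k)
    case 0
    then show ?case using Tot_zero(1) by (intro bexI[of _ "\<lambda>p _. \<zero>\<^bsub>I p\<^esub>"]) (auto simp: cell_def)
  next
    case (Suc k)
    then obtain b where b: "b \<in> Tot CI (m - 1)"
      and bk: "\<And>p T. cell m (Suc p) T \<Longrightarrow> m < int (Suc p) + int k \<Longrightarrow> c (Suc p) T = TD b (Suc p) T" by blast
    show ?case
    proof (cases "1 \<le> m - int k")
      case False
      then show ?thesis using b bk by (intro bexI[of _ b]) auto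
    next
      case True
      \<comment> \<open>Thus \<open>Suc p = m - k\<close> is the next row to be matched, and the
        correction is made in row \<open>p\<close>.\<close>
      define p where "p = nat (m - int k - 1)"
      have p: "int (Suc p) = m - int k" using True by (simp add: p_def)
      let ?r = "\<lambda>p T. c p T \<ominus>\<^bsub>I p\<^esub> TD b p T"
      note r = TD_residual[OF c b]
      have "\<exists>w\<in>piece (I p) (wt T). \<delta> p w = ?r (Suc p) T" if cell: "cell m (Suc p) T" for T
      proof (rule graded_exact[OF TotD(2)[OF r(1) cell]])
        have cell1: "cell (m + 1) (Suc (Suc p)) T" using cell cell_Suc by simp
        have "?r (Suc (Suc p)) (T - {i}) = \<zero>\<^bsub>I (Suc (Suc p))\<^esub>" if "i \<in> T" for i
        proof -
          have ci: "cell m (Suc (Suc p)) (T - {i})" by (rule cell_remove[OF cell1 that])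
          then show ?thesis using bk[OF ci] p TotD(3)[OF c ci] by (simp add: a_minus_def I.r_neg)
        qed
        then show "\<delta> (Suc p) (?r (Suc p) T) = \<zero>\<^bsub>I (Suc (Suc p))\<^esub>"
          using TD_peel[OF r(1) cell] r(2)[OF cell1] TDc[OF cell1] by simp
      qed
      then obtain w where w: "\<And>T. cell m (Suc p) T \<Longrightarrow> w T \<in> piece (I p) (wt T)"
        "\<And>T. cell m (Suc p) T \<Longrightarrow> \<delta> p (w T) = ?r (Suc p) T" by metis
      have w': "w T \<in> CI p \<and> w T \<in> piece (I p) (wt T)" if "cell m (Suc p) T" for T using w(1)[OF that] by auto
      note upd = TD_update[where U = CI, OF disjI1[OF refl] b w']
      have "c (Suc q) T = TD (b(p := \<lambda>T. b p T \<oplus>\<^bsub>I p\<^esub> psgn p T (w T))) (Suc q) T"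
        if cell: "cell m (Suc q) T" and q: "m < int (Suc q) + int (Suc k)" for q T
      proof (cases "q = p")
        case True
        have "TD b (Suc p) T \<in> carrier (I (Suc p))" using TD_closed[OF b, of "Suc p" T] cell True by simp
        then show ?thesis
          using upd(2)[of T] w(2)[of T] cell True TotD(3)[OF c cell] by (simp add: I.add_diff_cancel)
      next
        case False
        then have "p < q" using q p by linarith
        then show ?thesis using upd(3)[of "Suc q" T] bk[OF cell] p by simp
      qed
      then show ?thesis using upd(1) by blast
    qed
  qed
  from this[of "nat m"] obtain b where b: "b \<in> Tot CI (m - 1)"
    and bk: "\<And>p T. cell m (Suc p) T \<Longrightarrow> c (Suc p) T = TD b (Suc p) T" by force
  let ?r = "\<lambda>p T. c p T \<ominus>\<^bsub>I p\<^esub> TD b p T"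
  note r = TD_residual[OF c b]
  have "\<exists>a\<in>int_piece R A (wt T). \<epsilon> a = ?r 0 T" if cell: "cell m 0 T" for T
  proof (rule graded_exact_0[OF TotD(2)[OF r(1) cell]])
    have cell1: "cell (m + 1) (Suc 0) T" using cell cell_Suc by simp
    have "?r (Suc 0) (T - {i}) = \<zero>\<^bsub>I (Suc 0)\<^esub>" if "i \<in> T" for i
    proof -
      have ci: "cell m (Suc 0) (T - {i})" by (rule cell_remove[OF cell1 that])
      then show ?thesis using bk[OF ci] TotD(3)[OF c ci] by (simp add: a_minus_def I.r_neg)
    qed
    then show "\<delta> 0 (?r 0 T) = \<zero>\<^bsub>I (Suc 0)\<^esub>"
      using TD_peel[OF r(1) cell] r(2)[OF cell1] TDc[OF cell1] by simp
  qed
  then show ?thesis using b bk by (intro bexI[of _ b]) (metis+)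
qed

text \<open>At a nonempty \<open>T\<close> the residual is a torsion cocycle of degree
  \<open>wt T > 0\<close>, where \<open>van\<close> makes it a coboundary. Clearing by increasing
  size of \<open>T\<close> makes \<open>TD_peel\<close> applicable. That \<open>b\<close> vanishes
  at the empty set is kept so that subtracting \<open>TD b\<close> preserves a class prescribed
  there.\<close>

lemma Tot_degree_0:
  assumes van: "\<And>p j v. p < n \<Longrightarrow> 0 < j \<Longrightarrow> v \<in> TI p \<Longrightarrow> v \<in> piece (I p) j \<Longrightarrow> \<delta> p v = \<zero>\<^bsub>I (Suc p)\<^esub> \<Longrightarrow>
      (p = 0 \<longrightarrow> v = \<zero>\<^bsub>I p\<^esub>) \<and> (\<forall>p'. p = Suc p' \<longrightarrow> (\<exists>u\<in>TI p'. u \<in> piece (I p') j \<and> \<delta> p' u = v))"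
    and m: "m \<le> int n" and c: "c \<in> Tot TI m"
    and TDc: "\<And>p T. cell (m + 1) p T \<Longrightarrow> TD c p T = \<zero>\<^bsub>I p\<^esub>"
    and c0: "\<And>p. cell m p {} \<Longrightarrow> c p {} = \<zero>\<^bsub>I p\<^esub>"
  shows "\<exists>b\<in>Tot TI (m - 1). (\<forall>p. cell (m - 1) p {} \<longrightarrow> b p {} = \<zero>\<^bsub>I p\<^esub>) \<and>
    (\<forall>p T. cell m p T \<longrightarrow> c p T = TD b p T)"
proof -
  have "\<exists>b\<in>Tot TI (m - 1). (\<forall>p. cell (m - 1) p {} \<longrightarrow> b p {} = \<zero>\<^bsub>I p\<^esub>) \<and>
    (\<forall>p T. cell m p T \<longrightarrow> card T \<le> s \<longrightarrow> c p T = TD b p T)" for s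
  proof (induction s)
    case 0
    have "c p T = TD (\<lambda>p _. \<zero>\<^bsub>I p\<^esub>) p T" if cell: "cell m p T" "card T \<le> 0" for p T
      using that cell_finite[OF that(1)] c0 TD_zero[OF that(1)] by auto
    then show ?case using Tot_zero(2) by (intro bexI[of _ "\<lambda>p _. \<zero>\<^bsub>I p\<^esub>"]) auto
  next
    case (Suc s)
    then obtain b where b: "b \<in> Tot TI (m - 1)" and b0: "\<And>p. cell (m - 1) p {} \<Longrightarrow> b p {} = \<zero>\<^bsub>I p\<^esub>"
      and bk: "\<And>p T. cell m p T \<Longrightarrow> card T \<le> s \<Longrightarrow> c p T = TD b p T" by blast
    note bC = Tot_tors_carrier[OF b] and cC = Tot_tors_carrier[OF c]
    let ?r = "\<lambda>p T. c p T \<ominus>\<^bsub>I p\<^esub> TD b p T"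
    note r = TD_residual[OF cC bC]
    have rt: "?r \<in> Tot TI m" using Tot_minus(2)[OF c, of "TD b"] TD_Tot_tors[OF b] by simp
    have rv: "(p = 0 \<longrightarrow> ?r p T = \<zero>\<^bsub>I p\<^esub>) \<and> (\<forall>p'. p = Suc p' \<longrightarrow> (\<exists>u\<in>TI p'. u \<in> piece (I p') (wt T) \<and> \<delta> p' u = ?r p T))"
      if cell: "cell m p T" and s: "card T = Suc s" for p T
    proof (rule van[OF _ _ TotD(1,2)[OF rt cell]])
      \<comment> \<open>From \<open>p + card T = m \<le> n\<close> with \<open>T\<close>
        nonempty.\<close>
      show "p < n" using cell s m by (simp add: cell_def)
      obtain i where i: "i \<in> T" using s by fastforce
      then have "0 < d i" "d i \<le> (\<Sum>i\<in>T. d i)"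
        using cell_sub[OF cell] d_pos cell_finite[OF cell] by (auto intro: member_le_sum)
      then have "0 < (\<Sum>i\<in>T. d i)" by linarith
      then show "0 < wt T" unfolding wt_def by presburger
      have cell1: "cell (m + 1) (Suc p) T" using cell cell_Suc by simp
      have "?r (Suc p) (T - {i}) = \<zero>\<^bsub>I (Suc p)\<^esub>" if "i \<in> T" for i
      proof -
        have ci: "cell m (Suc p) (T - {i})" by (rule cell_remove[OF cell1 that])
        then show ?thesis using bk[OF ci] TotD(3)[OF cC ci] s that cell_finite[OF cell]
          by (simp add: a_minus_def I.r_neg)
      qed
      then show "\<delta> p (?r p T) = \<zero>\<^bsub>I (Suc p)\<^esub>"
        using TD_peel[OF r(1) cell] r(2)[OF cell1] TDc[OF cell1] by simp
    qed
    have req: "c p T = TD b p T" if "cell m p T" "?r p T = \<zero>\<^bsub>I p\<^esub>" for p T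
      using that I.minus_eq_zero_iff[OF TotD(3)[OF cC that(1)], of "TD b p T"] TD_closed[OF bC, of p T] by simp
    show ?case
    proof (cases "1 \<le> m - int (Suc s)")
      case False
      have "c p T = TD b p T" if cell: "cell m p T" and s: "card T \<le> Suc s" for p T
      proof (cases "card T = Suc s")
        case True
        then have "p = 0" using False cell by (simp add: cell_def)
        then show ?thesis using rv[OF cell True] req[OF cell] by blast
      qed (use bk[OF cell] s in simp)
      then show ?thesis using b b0 by (intro bexI[of _ b]) blast+
    next
      case True
      define p where "p = nat (m - int (Suc s) - 1)"
      have p: "int (Suc p) = m - int (Suc s)" using True by (simp add: p_def)
      have cs: "card T = Suc s" if "cell m (Suc p) T" for T using that p unfolding cell_def by linarith
      have "\<exists>u. u \<in> TI p \<and> u \<in> piece (I p) (wt T) \<and> \<delta> p u = ?r (Suc p) T" if cell: "cell m (Suc p) T" for T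
        using rv[OF cell cs[OF cell]] by blast
      then obtain w where w: "\<And>T. cell m (Suc p) T \<Longrightarrow> w T \<in> TI p \<and> w T \<in> piece (I p) (wt T)"
        "\<And>T. cell m (Suc p) T \<Longrightarrow> \<delta> p (w T) = ?r (Suc p) T" by metis
      let ?b = "b(p := \<lambda>T. b p T \<oplus>\<^bsub>I p\<^esub> psgn p T (w T))"
      note upd = TD_update[where U = TI, OF disjI2[OF refl] b w(1)]
      have "c q T = TD ?b q T" if cell: "cell m q T" and s: "card T \<le> Suc s" for q T
      proof (cases "q = Suc p")
        case True
        have "TD b (Suc p) T \<in> carrier (I (Suc p))" using TD_closed[OF bC, of "Suc p" T] cell True by simp
        then show ?thesis
          using upd(2)[of T] w(2)[of T] cell True TotD(3)[OF cC cell] by (simp add: I.add_diff_cancel)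
      next
        case False
        have "int q = m - int (card T)" using cell by (simp add: cell_def)
        then have "Suc p < q" using False s p by linarith
        moreover from this have "card T \<le> s" using p cell unfolding cell_def by linarith
        ultimately show ?thesis using upd(3)[of q T] bk[OF cell] by simp
      qed
      moreover have "?b q {} = \<zero>\<^bsub>I q\<^esub>" if cell: "cell (m - 1) q {}" for q
      proof -
        \<comment> \<open>Here \<open>q = m - 1\<close>, whereas \<open>p = m - s - 2\<close>: the
          row that is changed has its relevant cells at sets of size \<open>Suc s\<close>.\<close>
        have "q \<noteq> p" using p cell unfolding cell_def by auto
        then show ?thesis using b0[OF cell] by simp
      qed
      ultimately show ?thesis using upd(1) by blast
    qed
  qed
  from this[of n] obtain b where "b \<in> Tot TI (m - 1)" "\<forall>p. cell (m - 1) p {} \<longrightarrow> b p {} = \<zero>\<^bsub>I p\<^esub>"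
    "\<And>p T. cell m p T \<Longrightarrow> card T \<le> n \<Longrightarrow> c p T = TD b p T" by blast
  moreover have "card T \<le> n" if "cell m p T" for p T
    using card_mono[of "{..<n}" T] cell_sub[OF that] by simp
  ultimately show ?thesis by blast
qed

text \<open>Rows are treated by increasing \<open>p\<close>. The \<delta>-part of the differential
  of the residual in row \<open>k\<close> comes from row \<open>k - 1\<close>, which is torsion
  already, so its Koszul part is torsion too and \<open>injective_koszul_acyclic\<close> applies
  within the row.\<close>

lemma Tot_torsion:
  assumes c: "c \<in> Tot CI m" and TDc: "\<And>p T. cell (m + 1) p T \<Longrightarrow> TD c p T \<in> TI p"
  shows "\<exists>b\<in>Tot CI (m - 1). \<forall>p T. cell m p T \<longrightarrow> c p T \<ominus>\<^bsub>I p\<^esub> TD b p T \<in> TI p"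
proof -
  have "\<exists>b\<in>Tot CI (m - 1). \<forall>p T. cell m p T \<longrightarrow> p < k \<longrightarrow> c p T \<ominus>\<^bsub>I p\<^esub> TD b p T \<in> TI p" for k
  proof (induction k)
    case 0
    then show ?case using Tot_zero(1) by blast
  next
    case (Suc k)
    then obtain b where b: "b \<in> Tot CI (m - 1)"
      and bk: "\<And>p T. cell m p T \<Longrightarrow> p < k \<Longrightarrow> c p T \<ominus>\<^bsub>I p\<^esub> TD b p T \<in> TI p" by blast
    let ?r = "\<lambda>p T. c p T \<ominus>\<^bsub>I p\<^esub> TD b p T"
    note r = TD_residual[OF c b]
    show ?case
    proof (cases "int k \<le> m")
      case False
      then have "p < k" if "cell m p T" for p T using that by (simp add: cell_def)
      then show ?thesis using b bk by blast
    next
      case True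
      \<comment> \<open>The size of the index sets in row \<open>k\<close>, that is, the Koszul
        degree there.\<close>
      define q where "q = nat (m - int k)"
      have q: "S \<in> koszul_index n q \<longleftrightarrow> cell m k S" for S using True by (auto simp: q_def koszul_index_def cell_def)
      have q1: "S \<in> koszul_index n (Suc q) \<longleftrightarrow> cell (m + 1) k S" for S
        using True by (auto simp: q_def koszul_index_def cell_def)
      have qU: "U \<subseteq> {..<n} \<and> Suc (card U) = q \<longleftrightarrow> cell (m - 1) k U" for U
        using True by (auto simp: q_def cell_def)
      have "\<exists>b'. (\<forall>U. U \<subseteq> {..<n} \<longrightarrow> Suc (card U) = q \<longrightarrow> b' U \<in> piece (I k) (0 + wt U)) \<and>
        (\<forall>S\<in>koszul_index n q. ?r k S \<ominus>\<^bsub>I k\<^esub> kd (I k) b' S \<in> TI k)"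
      proof (rule injective_koszul_acyclic[OF I_injective I_graded \<epsilon>_hom \<epsilon>_inj])
        show "?r k S \<in> piece (I k) (0 + wt S)" if "S \<in> koszul_index n q" for S
          using TotD(2)[OF r(1)] that q by simp
        show "kd (I k) (?r k) T \<in> TI k" if "T \<in> koszul_index n (Suc q)" for T
        proof -
          have cell: "cell (m + 1) k T" using that q1 by simp
          have "dl ?r k T \<in> TI k"
          proof (cases k)
            case (Suc k')
            have "?r k' T \<in> TI k'" using bk[of k' T] cell cell_Suc Suc by simp
            then show ?thesis using Suc psgn_tors[OF tors_hom[OF I_graded I_graded \<delta>_hom]] by (simp add: dl_def)
          qed (use tors_zero[OF I_graded] in \<open>simp add: dl_def\<close>)
          moreover have "TD ?r k T \<in> TI k" using r(2)[OF cell] TDc[OF cell] by simp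
          moreover have "kd (I k) (?r k) T = TD ?r k T \<ominus>\<^bsub>I k\<^esub> dl ?r k T"
            using kd_row_closed[OF r(1) cell] dl_closed[OF r(1) cell] by (simp add: TD_def a_minus_def I.a_assoc I.r_neg)
          ultimately show ?thesis using tors_rules(5)[OF I_graded I_graded, of "TD ?r k T" k "dl ?r k T"] by simp
        qed
      qed
      then obtain b' where b': "\<And>U. cell (m - 1) k U \<Longrightarrow> b' U \<in> piece (I k) (wt U)"
        "\<And>S. cell m k S \<Longrightarrow> ?r k S \<ominus>\<^bsub>I k\<^esub> kd (I k) b' S \<in> TI k" using q qU by (metis add_0)
      let ?b = "b(k := \<lambda>T. b k T \<oplus>\<^bsub>I k\<^esub> b' T)"
      have bT: "?b \<in> Tot CI (m - 1)"
        unfolding Tot_def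
      proof (intro CollectI allI impI)
        fix p T assume cell: "cell (m - 1) p T"
        have "?b p T \<in> piece (I p) (wt T)"
          using TotD(2)[OF b cell] b'(1)[of T] cell ID.D_rules(3) by (cases "p = k") auto
        then show "?b p T \<in> carrier (I p) \<and> ?b p T \<in> piece (I p) (wt T)" using ID.D_carrier by blast
      qed
      have "c p T \<ominus>\<^bsub>I p\<^esub> TD ?b p T \<in> TI p" if cell: "cell m p T" and p: "p < Suc k" for p T
      proof (cases "p = k")
        case True
        have cell1: "cell (m - 1 + 1) k T" using cell True by simp
        have bc: "b k (T - {i}) \<in> carrier (I k)" "b' (T - {i}) \<in> carrier (I k)" if "i \<in> T" for i
          using TotD(3)[OF b cell_remove[OF cell1 that]] b'(1)[OF cell_remove[OF cell1 that]] by auto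
        have kb': "kd (I k) b' T \<in> carrier (I k)"
          by (rule kd_closed[OF I_graded cell_sub[OF cell]]) (rule bc(2))
        note cl = kd_row_closed[OF b cell1] dl_closed[OF b cell1]
        have "TD ?b k T = TD b k T \<oplus>\<^bsub>I k\<^esub> kd (I k) b' T"
        proof -
          have "kd (I k) (\<lambda>T. b k T \<oplus>\<^bsub>I k\<^esub> b' T) T = kd (I k) (b k) T \<oplus>\<^bsub>I k\<^esub> kd (I k) b' T"
            by (rule kd_add[OF I_graded cell_sub[OF cell]]) (use bc in auto)
          moreover have "dl ?b k T = dl b k T" by (cases k) (auto simp: dl_def)
          ultimately show ?thesis using cl kb' by (simp add: TD_def I.a_ac)
        qed
        then have "c k T \<ominus>\<^bsub>I k\<^esub> TD ?b k T = ?r k T \<ominus>\<^bsub>I k\<^esub> kd (I k) b' T"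
          using TotD(3)[OF c cell] True cl kb' by (simp add: TD_def a_minus_def I.minus_add I.a_assoc)
        then show ?thesis using b'(2)[of T] cell True by simp
      next
        case False
        \<comment> \<open>Changing row \<open>k\<close> of \<open>b\<close> affects the total
          differential in rows \<open>k\<close> and \<open>Suc k\<close> only, so the rows below
          stay torsion.\<close>
        then have "TD ?b p T = TD b p T" using p by (cases p) (auto simp: TD_def dl_def)
        then show ?thesis using bk[OF cell] p False by simp
      qed
      then show ?thesis using bT by blast
    qed
  qed
  from this[of "Suc (nat m)"] obtain b where "b \<in> Tot CI (m - 1)"
    "\<And>p T. cell m p T \<Longrightarrow> p < Suc (nat m) \<Longrightarrow> c p T \<ominus>\<^bsub>I p\<^esub> TD b p T \<in> TI p" by blast
  moreover have "p < Suc (nat m)" if "cell m p T" for p T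
    using that by (auto simp: cell_def)
  ultimately show ?thesis by blast
qed

end

section \<open>Comparison of Koszul and local cohomology in degree 0\<close>

context koszul_resolution begin

interpretation I: module R "I p" for p by (rule gm_module[OF I_graded])
interpretation ID: decomposed_group "I p" "piece (I p)" for p by (rule gm_decomp[OF I_graded])

text \<open>The comparison map from the Koszul complex of \<open>R\<close> to the total complex,
  induced by \<epsilon> and concentrated in row 0.\<close>

definition emb :: "(nat set \<Rightarrow> 'a) \<Rightarrow> nat \<Rightarrow> nat set \<Rightarrow> 'c" where
  "emb z p T = (if p = 0 then \<epsilon> (z T) else \<zero>\<^bsub>I p\<^esub>)"

text \<open>Degree 0 of the Koszul complex of \<open>R\<close>, with arbitrary values off the cells;
  restriction to \<open>extensional\<close> functions is postponed to the final comparison.\<close>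

definition koszul_piece :: "int \<Rightarrow> (nat set \<Rightarrow> 'a) set" where
  "koszul_piece m = {z. \<forall>T. cell m 0 T \<longrightarrow> z T \<in> int_piece R A (wt T)}"

lemma koszul_pieceD:
  assumes "z \<in> koszul_piece m" "cell m 0 T" shows "z T \<in> int_piece R A (wt T)" "z T \<in> carrier R"
  using assms int_pieceD unfolding koszul_piece_def by blast+

lemma emb_Tot: "z \<in> koszul_piece m \<Longrightarrow> emb z \<in> Tot CI m"
  unfolding Tot_def emb_def
  using \<epsilon>_rules(5)[OF koszul_pieceD(1)] \<epsilon>_rules(1)[OF koszul_pieceD(2)] ID.D_rules(2) by auto

lemma kd_koszul_closed:
  assumes z: "z \<in> koszul_piece m" and cell: "cell (m + 1) 0 T"
  shows "kd RR z T \<in> carrier R"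
  using kd_closed[OF RR_graded cell_sub[OF cell], of z] koszul_pieceD(2)[OF z cell_remove[OF cell]] by simp

lemma TD_emb:
  assumes z: "z \<in> koszul_piece m" and cell: "cell (m + 1) p T"
  shows "TD (emb z) p T = (if p = 0 then \<epsilon> (kd RR z T) else \<zero>\<^bsub>I p\<^esub>)"
proof (cases p)
  case 0
  have zc: "z (T - {i}) \<in> carrier R" if "i \<in> T" for i
    using koszul_pieceD(2)[OF z] cell_remove[OF cell that] 0 by simp
  have "\<epsilon> (kd RR z T) = kd (I 0) (\<lambda>T. \<epsilon> (z T)) T"
    by (rule kd_hom[OF RR_graded I_graded \<epsilon>_hom cell_sub[OF cell]]) (use zc in simp)
  moreover have "emb z 0 = (\<lambda>T. \<epsilon> (z T))" by (simp add: emb_def fun_eq_iff)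
  moreover have "\<epsilon> (kd RR z T) \<in> carrier (I 0)" using \<epsilon>_rules(1) kd_koszul_closed[OF z] cell 0 by simp
  ultimately show ?thesis using 0 by (simp add: TD_def dl_def)
next
  case (Suc p')
  have "kd (I p) (emb z p) T = \<zero>\<^bsub>I p\<^esub>"
    by (rule kd_zero[OF I_graded cell_sub[OF cell]]) (simp add: emb_def Suc)
  moreover have "\<delta> p' (emb z p' T) = \<zero>\<^bsub>I p\<^esub>"
    using \<delta>_\<epsilon>[OF koszul_pieceD(2)[OF z, of T]] cell Suc cell_Suc by (cases p') (auto simp: emb_def)
  ultimately show ?thesis using Suc by (simp add: TD_def dl_def)
qed

text \<open>An element of \<open>I r\<close> placed at the empty index set, the position of local
  cohomology itself.\<close>

definition single :: "nat \<Rightarrow> 'c \<Rightarrow> nat \<Rightarrow> nat set \<Rightarrow> 'c" where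
  "single r g p T = (if p = r \<and> T = {} then g else \<zero>\<^bsub>I p\<^esub>)"

lemma wt_empty [simp]: "wt {} = 0"
  by (simp add: wt_def)

lemma single_Tot: "g \<in> TI r \<Longrightarrow> g \<in> piece (I r) 0 \<Longrightarrow> single r g \<in> Tot TI m"
  unfolding Tot_def single_def using ID.D_rules(2) tors_zero[OF I_graded] by auto

lemma TD_empty: "c r {} \<in> carrier (I r) \<Longrightarrow> TD c (Suc r) {} = \<delta> r (c r {})" "TD c 0 {} = \<zero>\<^bsub>I 0\<^esub>"
  using \<delta>_rules(1)[of "c r {}" r] by (simp_all add: TD_def dl_def kd_def psgn_def)

text \<open>The isomorphism is a zigzag: \<open>emb\<close> sends the Koszul complex of
  \<open>R\<close> to the total complex of \<open>I\<close>, the torsion total complex includes into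
  the latter, and evaluation at the empty index set leads to local cohomology. The inclusion is
  inverted on cohomology only, so a relation with witnesses \<open>c\<close> and \<open>e\<close> is
  used instead of a map.\<close>

definition corresponds :: "nat \<Rightarrow> (nat set \<Rightarrow> 'a) \<Rightarrow> 'c \<Rightarrow> bool" where
  "corresponds r z g \<longleftrightarrow> (\<exists>c\<in>Tot TI (int r). (\<forall>p T. cell (int r + 1) p T \<longrightarrow> TD c p T = \<zero>\<^bsub>I p\<^esub>) \<and> c r {} = g \<and>
    (\<exists>e\<in>Tot CI (int r - 1). \<forall>p T. cell (int r) p T \<longrightarrow> emb z p T = c p T \<oplus>\<^bsub>I p\<^esub> TD e p T))"

definition torsion_cocycle :: "nat \<Rightarrow> 'c \<Rightarrow> bool" where
  "torsion_cocycle r g \<longleftrightarrow> g \<in> TI r \<and> g \<in> piece (I r) 0 \<and> \<delta> r g = \<zero>\<^bsub>I (Suc r)\<^esub>"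

text \<open>The preimage is required to have degree 0 as well; for \<open>g\<close> of degree 0 this
  is no restriction, by \<open>GB_homogeneous\<close>.\<close>

definition torsion_coboundary :: "nat \<Rightarrow> 'c \<Rightarrow> bool" where
  "torsion_coboundary r g \<longleftrightarrow> (r = 0 \<longrightarrow> g = \<zero>\<^bsub>I r\<^esub>) \<and> (\<forall>q. r = Suc q \<longrightarrow> (\<exists>u\<in>TI q. u \<in> piece (I q) 0 \<and> g = \<delta> q u))"

definition koszul_cocycle :: "nat \<Rightarrow> (nat set \<Rightarrow> 'a) \<Rightarrow> bool" where
  "koszul_cocycle r z \<longleftrightarrow> z \<in> koszul_piece (int r) \<and> (\<forall>T. cell (int r + 1) 0 T \<longrightarrow> kd RR z T = \<zero>)"

text \<open>For \<open>r = 0\<close> the only cell is the empty set, over which \<open>kd\<close> is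
  an empty sum, so the condition becomes that \<open>z\<close> vanishes there.\<close>

definition koszul_coboundary :: "nat \<Rightarrow> (nat set \<Rightarrow> 'a) \<Rightarrow> bool" where
  "koszul_coboundary r z \<longleftrightarrow> (\<exists>y\<in>koszul_piece (int r - 1). \<forall>T. cell (int r) 0 T \<longrightarrow> z T = kd RR y T)"

lemma cell_r: "cell (int r) r {}" "cell (int r + 1) (Suc r) {}"
  by (auto simp: cell_def)

lemma corresponds_torsion_cocycle: assumes "corresponds r z g" shows "torsion_cocycle r g"
proof -
  obtain c where c: "c \<in> Tot TI (int r)" "\<And>p T. cell (int r + 1) p T \<Longrightarrow> TD c p T = \<zero>\<^bsub>I p\<^esub>" "c r {} = g"
    using assms unfolding corresponds_def by blast
  show ?thesis
    using TotD[OF c(1) cell_r(1)] c(2)[OF cell_r(2)] TD_empty(1)[of c r] c(3) by (simp add: torsion_cocycle_def)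
qed

text \<open>\<open>emb z\<close> is a total cocycle, so \<open>Tot_torsion\<close> moves it by a
  coboundary into the torsion total complex; \<open>g\<close> is its value at the empty set.\<close>

lemma corresponds_left: assumes z: "koszul_cocycle r z" shows "\<exists>g. corresponds r z g"
proof -
  have zp: "z \<in> koszul_piece (int r)" using z by (simp add: koszul_cocycle_def)
  note eT = emb_Tot[OF zp]
  have Tz: "TD (emb z) p T = \<zero>\<^bsub>I p\<^esub>" if "cell (int r + 1) p T" for p T
    using TD_emb[OF zp that] z that by (auto simp: koszul_cocycle_def)
  obtain e where e: "e \<in> Tot CI (int r - 1)" "\<And>p T. cell (int r) p T \<Longrightarrow> emb z p T \<ominus>\<^bsub>I p\<^esub> TD e p T \<in> TI p"
    using Tot_torsion[OF eT] Tz tors_zero[OF I_graded] by metis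
  let ?c = "\<lambda>p T. emb z p T \<ominus>\<^bsub>I p\<^esub> TD e p T"
  note res = TD_residual[OF eT e(1)]
  have "?c \<in> Tot TI (int r)" using e(2) TotD(2)[OF res(1)] unfolding Tot_def by blast
  moreover have "emb z p T = ?c p T \<oplus>\<^bsub>I p\<^esub> TD e p T" if cell: "cell (int r) p T" for p T
    using TotD(3)[OF eT cell] TD_closed[OF e(1), of p T] cell by (simp add: a_minus_def I.a_assoc I.l_neg)
  moreover have "TD ?c p T = \<zero>\<^bsub>I p\<^esub>" if "cell (int r + 1) p T" for p T using res(2)[OF that] Tz[OF that] by simp
  ultimately show ?thesis using e(1) unfolding corresponds_def by blast
qed

lemma Tot_resolve_emb:
  assumes c: "c \<in> Tot CI m" and TDc: "\<And>p T. cell (m + 1) (Suc p) T \<Longrightarrow> TD c (Suc p) T = \<zero>\<^bsub>I (Suc p)\<^esub>"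
  shows "\<exists>b\<in>Tot CI (m - 1). \<exists>z\<in>koszul_piece m. \<forall>p T. cell m p T \<longrightarrow> c p T \<ominus>\<^bsub>I p\<^esub> TD b p T = emb z p T"
proof -
  obtain b where b: "b \<in> Tot CI (m - 1)" "\<And>p T. cell m (Suc p) T \<Longrightarrow> c (Suc p) T = TD b (Suc p) T"
    "\<And>T. cell m 0 T \<Longrightarrow> \<exists>a\<in>int_piece R A (wt T). c 0 T \<ominus>\<^bsub>I 0\<^esub> TD b 0 T = \<epsilon> a"
    using Tot_resolution[OF c TDc] by blast
  then obtain z where z: "\<And>T. cell m 0 T \<Longrightarrow> z T \<in> int_piece R A (wt T)"
    "\<And>T. cell m 0 T \<Longrightarrow> c 0 T \<ominus>\<^bsub>I 0\<^esub> TD b 0 T = \<epsilon> (z T)" by metis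
  have "c p T \<ominus>\<^bsub>I p\<^esub> TD b p T = emb z p T" if cell: "cell m p T" for p T
  proof (cases p)
    case (Suc q)
    then show ?thesis using b(2)[of q T] TotD(3)[OF c cell] cell by (simp add: emb_def a_minus_def I.r_neg)
  qed (use z cell in \<open>simp add: emb_def\<close>)
  moreover have "z \<in> koszul_piece m" using z(1) by (simp add: koszul_piece_def)
  ultimately show ?thesis using b(1) by blast
qed

lemma kd_zero_of_emb:
  assumes z: "z \<in> koszul_piece m" and cell: "cell (m + 1) 0 T" and "TD (emb z) 0 T = \<zero>\<^bsub>I 0\<^esub>"
  shows "kd RR z T = \<zero>"
proof -
  have "\<epsilon> (kd RR z T) = \<epsilon> \<zero>" using TD_emb[OF z cell] assms(3) by simp
  then show ?thesis using \<epsilon>_inj kd_koszul_closed[OF z cell] by (metis inj_onD zero_closed)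
qed

text \<open>If \<open>z\<close> is a coboundary, then \<open>c\<close> is the differential of a
  total cochain over \<open>I\<close>. By \<open>Tot_torsion\<close> that cochain becomes torsion
  after subtracting a coboundary, which leaves its differential unchanged; its value at the empty
  set is the required preimage of \<open>g\<close>.\<close>

lemma corresponds_bd1:
  assumes "corresponds r z g" "koszul_coboundary r z" shows "torsion_coboundary r g"
proof -
  obtain c e where c: "c \<in> Tot TI (int r)" "c r {} = g" and e: "e \<in> Tot CI (int r - 1)"
    and ce: "\<And>p T. cell (int r) p T \<Longrightarrow> emb z p T = c p T \<oplus>\<^bsub>I p\<^esub> TD e p T"
    using assms(1) unfolding corresponds_def by blast
  obtain y where y: "y \<in> koszul_piece (int r - 1)" "\<And>T. cell (int r) 0 T \<Longrightarrow> z T = kd RR y T"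
    using assms(2) unfolding koszul_coboundary_def by blast
  note yT = emb_Tot[OF y(1)]
  let ?e = "\<lambda>p T. emb y p T \<ominus>\<^bsub>I p\<^esub> e p T"
  have eT: "?e \<in> Tot CI (int r - 1)" by (rule Tot_minus(1)[OF yT e])
  have TDe: "TD ?e p T = c p T" if cell: "cell (int r) p T" for p T
  proof -
    have cell1: "cell (int r - 1 + 1) p T" using cell by simp
    have cc: "c p T \<in> carrier (I p)" using TotD(3)[OF Tot_tors_carrier[OF c(1)] cell] .
    have ec: "TD e p T \<in> carrier (I p)" by (rule TD_closed[OF e cell1])
    have "TD (emb y) p T = emb z p T" using TD_emb[OF y(1) cell1] y(2)[of T] cell by (auto simp: emb_def)
    then have "TD ?e p T = emb z p T \<ominus>\<^bsub>I p\<^esub> TD e p T" using TD_minus[OF yT e cell1] by simp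
    also have "\<dots> = c p T" using ce[OF cell] cc ec by (simp add: a_minus_def I.a_assoc I.r_neg)
    finally show ?thesis .
  qed
  obtain b where b: "b \<in> Tot CI (int r - 1 - 1)"
    "\<And>p T. cell (int r - 1) p T \<Longrightarrow> ?e p T \<ominus>\<^bsub>I p\<^esub> TD b p T \<in> TI p"
    using Tot_torsion[OF eT] TDe TotD(1)[OF c(1)] by force
  let ?u = "\<lambda>p T. ?e p T \<ominus>\<^bsub>I p\<^esub> TD b p T"
  note res = TD_residual[OF eT b(1)]
  have g: "g = TD ?u r {}" using res(2)[of r "{}"] TDe[OF cell_r(1)] c(2) cell_r(1) by simp
  show ?thesis
    unfolding torsion_coboundary_def
  proof (intro conjI allI impI)
    show "g = \<zero>\<^bsub>I r\<^esub>" if "r = 0" using g TD_empty(2) that by simp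
    show "\<exists>u\<in>TI q. u \<in> piece (I q) 0 \<and> g = \<delta> q u" if "r = Suc q" for q
    proof -
      have cell: "cell (int r - 1) q {}" using that by (simp add: cell_def)
      show ?thesis
        using b(2)[OF cell] TotD(2,3)[OF res(1) cell] g TD_empty(1)[of ?u q] that by auto
    qed
  qed
qed

context
  assumes van: "\<And>p j v. p < n \<Longrightarrow> 0 < j \<Longrightarrow> v \<in> TI p \<Longrightarrow> v \<in> piece (I p) j \<Longrightarrow> \<delta> p v = \<zero>\<^bsub>I (Suc p)\<^esub> \<Longrightarrow>
      (p = 0 \<longrightarrow> v = \<zero>\<^bsub>I p\<^esub>) \<and> (\<forall>p'. p = Suc p' \<longrightarrow> (\<exists>u\<in>TI p'. u \<in> piece (I p') j \<and> \<delta> p' u = v))"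
begin

text \<open>\<open>g\<close> placed at the empty set need not be a total cocycle, but its
  differential vanishes at the empty set. \<open>Tot_degree_0\<close> writes that differential as
  \<open>TD b\<close> with \<open>b\<close> zero at the empty set, so subtracting \<open>b\<close>
  gives a torsion cocycle still showing \<open>g\<close> there, and the resolution brings it back to
  \<open>R\<close>.\<close>

lemma corresponds_right:
  assumes r: "r < n" and g: "torsion_cocycle r g" shows "\<exists>z. koszul_cocycle r z \<and> corresponds r z g"
proof -
  have gp: "g \<in> TI r" "g \<in> piece (I r) 0" "\<delta> r g = \<zero>\<^bsub>I (Suc r)\<^esub>" using g by (auto simp: torsion_cocycle_def)
  note sT = single_Tot[OF gp(1,2), of "int r"]
  note sC = Tot_tors_carrier[OF sT]
  have "\<exists>b\<in>Tot TI (int r + 1 - 1). (\<forall>p. cell (int r + 1 - 1) p {} \<longrightarrow> b p {} = \<zero>\<^bsub>I p\<^esub>) \<and>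
    (\<forall>p T. cell (int r + 1) p T \<longrightarrow> TD (single r g) p T = TD b p T)"
  proof (rule Tot_degree_0[OF van])
    \<comment> \<open>The obstruction lies in total degree \<open>r + 1\<close>, so
      \<open>r < n\<close> is exactly what \<open>Tot_degree_0\<close> asks for.\<close>
    show "int r + 1 \<le> int n" using r by simp
    show "TD (single r g) \<in> Tot TI (int r + 1)" by (rule TD_Tot_tors[OF sT])
    show "TD (TD (single r g)) p T = \<zero>\<^bsub>I p\<^esub>" if "cell (int r + 1 + 1) p T" for p T by (rule TD_TD[OF sC that])
    show "TD (single r g) p {} = \<zero>\<^bsub>I p\<^esub>" if "cell (int r + 1) p {}" for p
    proof -
      have "p = Suc r" using that by (simp add: cell_def)
      then show ?thesis using TD_empty(1)[of "single r g" r] gp ID.D_carrier[OF gp(2)] by (simp add: single_def)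
    qed
  qed
  then obtain b where b: "b \<in> Tot TI (int r)" "b r {} = \<zero>\<^bsub>I r\<^esub>"
    "\<And>p T. cell (int r + 1) p T \<Longrightarrow> TD (single r g) p T = TD b p T" using cell_r(1) by auto
  let ?c = "\<lambda>p T. single r g p T \<ominus>\<^bsub>I p\<^esub> b p T"
  have cT: "?c \<in> Tot TI (int r)" by (rule Tot_minus(2)[OF sT b(1)])
  note cC = Tot_tors_carrier[OF cT]
  have cz: "TD ?c p T = \<zero>\<^bsub>I p\<^esub>" if cell: "cell (int r + 1) p T" for p T
    using TD_minus[OF sC Tot_tors_carrier[OF b(1)] cell] b(3)[OF cell] TD_closed[OF sC cell]
    by (simp add: a_minus_def I.r_neg)
  have cg: "?c r {} = g" using b(2) ID.D_carrier[OF gp(2)] by (simp add: single_def a_minus_def)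
  obtain e z where e: "e \<in> Tot CI (int r - 1)" and z: "z \<in> koszul_piece (int r)"
    "\<And>p T. cell (int r) p T \<Longrightarrow> ?c p T \<ominus>\<^bsub>I p\<^esub> TD e p T = emb z p T"
    using Tot_resolve_emb[OF cC] cz by blast
  note res = TD_residual[OF cC e]
  have "kd RR z T = \<zero>" if cell: "cell (int r + 1) 0 T" for T
  proof (rule kd_zero_of_emb[OF z(1) cell])
    have "TD (emb z) 0 T = TD (\<lambda>p T. ?c p T \<ominus>\<^bsub>I p\<^esub> TD e p T) 0 T"
      by (rule TD_cong[OF emb_Tot[OF z(1)] _ cell]) (simp add: z(2))
    then show "TD (emb z) 0 T = \<zero>\<^bsub>I 0\<^esub>" using res(2)[OF cell] cz[OF cell] by simp
  qed
  then have zc: "koszul_cocycle r z" using z(1) by (simp add: koszul_cocycle_def)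
  have "\<ominus> \<one> \<in> A 0" using one_degree_0 RD.D_rules(4) by blast
  note neg = Tot_smult(1)[OF this e]
  have "emb z p T = ?c p T \<oplus>\<^bsub>I p\<^esub> TD (\<lambda>p T. (\<ominus> \<one>) \<odot>\<^bsub>I p\<^esub> e p T) p T" if cell: "cell (int r) p T" for p T
  proof -
    have cell1: "cell (int r - 1 + 1) p T" using cell by simp
    show ?thesis
      using TD_smult[OF e _ cell1, of "\<ominus> \<one>"] z(2)[OF cell] TD_closed[OF e cell1]
      by (simp add: a_minus_def I.smult_l_minus)
  qed
  then have "corresponds r z g" using cT cz cg neg unfolding corresponds_def by blast
  then show ?thesis using zc by blast
qed

text \<open>Subtracting a coboundary makes \<open>c\<close> vanish at the empty set, and
  \<open>Tot_degree_0\<close> makes the rest a coboundary too. Hence \<open>emb z\<close> is the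
  differential of a total cochain, which the resolution replaces by some \<open>emb y\<close>;
  injectivity of \<epsilon> then gives the equation over \<open>R\<close>.\<close>

lemma corresponds_bd2:
  assumes r: "r < n" and "corresponds r z g" "torsion_coboundary r g" and zp: "z \<in> koszul_piece (int r)" shows "koszul_coboundary r z"
proof -
  obtain c e where c: "c \<in> Tot TI (int r)" "c r {} = g" "\<And>p T. cell (int r + 1) p T \<Longrightarrow> TD c p T = \<zero>\<^bsub>I p\<^esub>"
    and e: "e \<in> Tot CI (int r - 1)"
    and ce: "\<And>p T. cell (int r) p T \<Longrightarrow> emb z p T = c p T \<oplus>\<^bsub>I p\<^esub> TD e p T"
    using assms(2) unfolding corresponds_def by blast
  note cC = Tot_tors_carrier[OF c(1)]
  \<comment> \<open>For \<open>r = 0\<close> the class \<open>g\<close> is zero and so is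
    \<open>s\<close>; otherwise \<open>s\<close> is the given preimage of \<open>g\<close> placed at
    the empty set.\<close>
  obtain s where s: "s \<in> Tot TI (int r - 1)" "TD s r {} = g"
  proof (cases r)
    case 0
    then have "TD (\<lambda>p _. \<zero>\<^bsub>I p\<^esub>) r {} = g" using TD_empty(2) assms(3) by (simp add: torsion_coboundary_def)
    then show thesis using that Tot_zero(2) by blast
  next
    case (Suc q)
    then obtain u where u: "u \<in> TI q" "u \<in> piece (I q) 0" "g = \<delta> q u" using assms(3) by (auto simp: torsion_coboundary_def)
    have "TD (single q u) r {} = g" using TD_empty(1)[of "single q u" q] ID.D_carrier[OF u(2)] u(3) Suc by (simp add: single_def)
    then show thesis using that single_Tot[OF u(1,2)] by blast
  qed
  note sC = Tot_tors_carrier[OF s(1)]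
  note res = TD_residual[OF cC sC]
  let ?c = "\<lambda>p T. c p T \<ominus>\<^bsub>I p\<^esub> TD s p T"
  have "\<exists>b\<in>Tot TI (int r - 1). (\<forall>p. cell (int r - 1) p {} \<longrightarrow> b p {} = \<zero>\<^bsub>I p\<^esub>) \<and>
    (\<forall>p T. cell (int r) p T \<longrightarrow> ?c p T = TD b p T)"
  proof (rule Tot_degree_0[OF van])
    show "int r \<le> int n" using r by simp
    show "?c \<in> Tot TI (int r)" using Tot_minus(2)[OF c(1), of "TD s"] TD_Tot_tors[OF s(1)] by simp
    show "TD ?c p T = \<zero>\<^bsub>I p\<^esub>" if "cell (int r + 1) p T" for p T using res(2)[OF that] c(3)[OF that] by simp
    show "?c p {} = \<zero>\<^bsub>I p\<^esub>" if "cell (int r) p {}" for p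
    proof -
      have "p = r" using that by (simp add: cell_def)
      then show ?thesis using s(2) c(2) TotD(3)[OF cC cell_r(1)] by (simp add: a_minus_def I.r_neg)
    qed
  qed
  then obtain b where b: "b \<in> Tot TI (int r - 1)" "\<And>p T. cell (int r) p T \<Longrightarrow> ?c p T = TD b p T" by blast
  note bC = Tot_tors_carrier[OF b(1)]
  \<comment> \<open>Its three terms account for what \<open>Tot_degree_0\<close> gave, for the
    coboundary subtracted before, and for the one in \<open>corresponds\<close>; together their
    differential is \<open>emb z\<close>.\<close>
  let ?f = "\<lambda>p T. (b p T \<oplus>\<^bsub>I p\<^esub> s p T) \<oplus>\<^bsub>I p\<^esub> e p T"
  note bs = Tot_add(1)[OF bC sC]
  have fT: "?f \<in> Tot CI (int r - 1)" by (rule Tot_add(1)[OF bs e])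
  have TDf: "TD ?f p T = emb z p T" if cell: "cell (int r) p T" for p T
  proof -
    have cell1: "cell (int r - 1 + 1) p T" using cell by simp
    have cl: "TD s p T \<in> carrier (I p)" "TD e p T \<in> carrier (I p)" "c p T \<in> carrier (I p)"
      using TD_closed[OF sC cell1] TD_closed[OF e cell1] TotD(3)[OF cC cell] by auto
    have "TD ?f p T = (?c p T \<oplus>\<^bsub>I p\<^esub> TD s p T) \<oplus>\<^bsub>I p\<^esub> TD e p T"
      using TD_add[OF bs e cell1] TD_add[OF bC sC cell1] b(2)[OF cell] by simp
    also have "\<dots> = c p T \<oplus>\<^bsub>I p\<^esub> TD e p T" using cl by (simp add: a_minus_def I.a_assoc I.l_neg)
    finally show ?thesis using ce[OF cell] by simp
  qed
  have "\<exists>b\<in>Tot CI (int r - 1 - 1). \<exists>y\<in>koszul_piece (int r - 1). \<forall>p T. cell (int r - 1) p T \<longrightarrow> ?f p T \<ominus>\<^bsub>I p\<^esub> TD b p T = emb y p T"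
    by (rule Tot_resolve_emb[OF fT]) (use TDf in \<open>simp add: emb_def\<close>)
  then obtain b' y where b': "b' \<in> Tot CI (int r - 1 - 1)" and y: "y \<in> koszul_piece (int r - 1)"
    "\<And>p T. cell (int r - 1) p T \<Longrightarrow> ?f p T \<ominus>\<^bsub>I p\<^esub> TD b' p T = emb y p T" by blast
  have "z T = kd RR y T" if cell: "cell (int r) 0 T" for T
  proof -
    have cell1: "cell (int r - 1 + 1) 0 T" using cell by simp
    have "\<epsilon> (kd RR y T) = TD (emb y) 0 T" using TD_emb[OF y(1) cell1] by simp
    also have "\<dots> = TD (\<lambda>p T. ?f p T \<ominus>\<^bsub>I p\<^esub> TD b' p T) 0 T"
      by (rule TD_cong[OF emb_Tot[OF y(1)] _ cell1]) (simp add: y(2))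
    also have "\<dots> = \<epsilon> (z T)" using TD_residual(2)[OF fT b' cell1] TDf[OF cell] by (simp add: emb_def)
    finally show ?thesis
      using \<epsilon>_inj kd_koszul_closed[OF y(1) cell1] koszul_pieceD(2)[OF zp cell] by (metis inj_onD)
  qed
  then show ?thesis using y(1) unfolding koszul_coboundary_def by blast
qed

end

text \<open>\<open>z'\<close> is constrained on the cells only, because operations of the Koszul
  module restrict to the index sets. With \<open>a = \<one>\<close> the lemma replaces
  \<open>z\<close> by its restriction.\<close>

lemma corresponds_smult:
  assumes a: "a \<in> A 0" and "corresponds r z g" and z: "z \<in> koszul_piece (int r)"
    and z': "\<And>T. cell (int r) 0 T \<Longrightarrow> z' T = a \<otimes> z T"
  shows "corresponds r z' (a \<odot>\<^bsub>I r\<^esub> g)"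
proof -
  obtain c e where c: "c \<in> Tot TI (int r)" "c r {} = g" "\<And>p T. cell (int r + 1) p T \<Longrightarrow> TD c p T = \<zero>\<^bsub>I p\<^esub>"
    and e: "e \<in> Tot CI (int r - 1)"
    and ce: "\<And>p T. cell (int r) p T \<Longrightarrow> emb z p T = c p T \<oplus>\<^bsub>I p\<^esub> TD e p T"
    using assms(2) unfolding corresponds_def by blast
  note cC = Tot_tors_carrier[OF c(1)] and ac = A_carrier[OF a]
  have "TD (\<lambda>p T. a \<odot>\<^bsub>I p\<^esub> c p T) p T = \<zero>\<^bsub>I p\<^esub>" if cell: "cell (int r + 1) p T" for p T
    using TD_smult[OF cC ac cell] c(3)[OF cell] ac by simp
  moreover have "emb z' p T = a \<odot>\<^bsub>I p\<^esub> c p T \<oplus>\<^bsub>I p\<^esub> TD (\<lambda>p T. a \<odot>\<^bsub>I p\<^esub> e p T) p T" if cell: "cell (int r) p T" for p T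
  proof -
    have cell1: "cell (int r - 1 + 1) p T" using cell by simp
    have "emb z' p T = a \<odot>\<^bsub>I p\<^esub> emb z p T"
      using z' \<epsilon>_rules(4)[OF ac koszul_pieceD(2)[OF z]] cell ac by (auto simp: emb_def)
    then show ?thesis
      using ce[OF cell] TD_smult[OF e ac cell1] TotD(3)[OF cC cell] TD_closed[OF e cell1] ac by (simp add: I.smult_r_distr)
  qed
  ultimately show ?thesis
    unfolding corresponds_def using Tot_smult(2)[OF a c(1)] Tot_smult(1)[OF a e] c(2)
    by (intro bexI[of _ "\<lambda>p T. a \<odot>\<^bsub>I p\<^esub> c p T"] conjI bexI[of _ "\<lambda>p T. a \<odot>\<^bsub>I p\<^esub> e p T"]) auto
qed

lemma corresponds_add:
  assumes "corresponds r z g" "corresponds r w h" and z: "z \<in> koszul_piece (int r)" and w: "w \<in> koszul_piece (int r)"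
    and z': "\<And>T. cell (int r) 0 T \<Longrightarrow> z' T = z T \<oplus> w T"
  shows "corresponds r z' (g \<oplus>\<^bsub>I r\<^esub> h)"
proof -
  obtain c e where c: "c \<in> Tot TI (int r)" "c r {} = g" "\<And>p T. cell (int r + 1) p T \<Longrightarrow> TD c p T = \<zero>\<^bsub>I p\<^esub>"
    and e: "e \<in> Tot CI (int r - 1)"
    and ce: "\<And>p T. cell (int r) p T \<Longrightarrow> emb z p T = c p T \<oplus>\<^bsub>I p\<^esub> TD e p T"
    using assms(1) unfolding corresponds_def by blast
  obtain c' e' where c': "c' \<in> Tot TI (int r)" "c' r {} = h" "\<And>p T. cell (int r + 1) p T \<Longrightarrow> TD c' p T = \<zero>\<^bsub>I p\<^esub>"
    and e': "e' \<in> Tot CI (int r - 1)"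
    and ce': "\<And>p T. cell (int r) p T \<Longrightarrow> emb w p T = c' p T \<oplus>\<^bsub>I p\<^esub> TD e' p T"
    using assms(2) unfolding corresponds_def by blast
  note cC = Tot_tors_carrier[OF c(1)] and cC' = Tot_tors_carrier[OF c'(1)]
  have "TD (\<lambda>p T. c p T \<oplus>\<^bsub>I p\<^esub> c' p T) p T = \<zero>\<^bsub>I p\<^esub>" if cell: "cell (int r + 1) p T" for p T
    using TD_add[OF cC cC' cell] c(3)[OF cell] c'(3)[OF cell] by simp
  moreover have "emb z' p T = (c p T \<oplus>\<^bsub>I p\<^esub> c' p T) \<oplus>\<^bsub>I p\<^esub> TD (\<lambda>p T. e p T \<oplus>\<^bsub>I p\<^esub> e' p T) p T" if cell: "cell (int r) p T" for p T
  proof -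
    have cell1: "cell (int r - 1 + 1) p T" using cell by simp
    have "emb z' p T = emb z p T \<oplus>\<^bsub>I p\<^esub> emb w p T"
      using z' \<epsilon>_rules(3)[OF koszul_pieceD(2)[OF z] koszul_pieceD(2)[OF w]] cell by (auto simp: emb_def)
    then show ?thesis
      using ce[OF cell] ce'[OF cell] TD_add[OF e e' cell1] TotD(3)[OF cC cell] TotD(3)[OF cC' cell]
        TD_closed[OF e cell1] TD_closed[OF e' cell1] by (simp add: I.a_ac)
  qed
  ultimately show ?thesis
    unfolding corresponds_def using Tot_add(2)[OF c(1) c'(1)] Tot_add(1)[OF e e'] c(2) c'(2)
    by (intro bexI[of _ "\<lambda>p T. c p T \<oplus>\<^bsub>I p\<^esub> c' p T"] conjI bexI[of _ "\<lambda>p T. e p T \<oplus>\<^bsub>I p\<^esub> e' p T"]) auto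
qed

end

section \<open>Quotient modules\<close>

lemma module_record_cong:
  assumes M: "module R M" and eq: "carrier N = carrier M" "add N = add M" "zero N = zero M" "smult N = smult M"
  shows "module R N"
proof -
  interpret M: module R M by fact
  show ?thesis
  proof (rule moduleI[OF M.R.is_cring])
    show "abelian_group N"
    proof (rule abelian_groupI)
      show "\<exists>v\<in>carrier N. v \<oplus>\<^bsub>N\<^esub> u = \<zero>\<^bsub>N\<^esub>" if "u \<in> carrier N" for u
        using that M.l_neg[of u] unfolding eq by (intro bexI[of _ "\<ominus>\<^bsub>M\<^esub> u"]) simp_all
    qed (simp_all add: eq M.a_ac)
  qed (simp_all add: eq M.smult_l_distr M.smult_r_distr M.smult_assoc1)
qed

text \<open>Negation is multiplication by the scalar \<open>- 1\<close>.\<close>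

lemma submoduleI_smult:
  assumes M: "module R M" and "H \<subseteq> carrier M" "\<zero>\<^bsub>M\<^esub> \<in> H" "\<And>u v. u \<in> H \<Longrightarrow> v \<in> H \<Longrightarrow> u \<oplus>\<^bsub>M\<^esub> v \<in> H"
    and sm: "\<And>a v. a \<in> carrier R \<Longrightarrow> v \<in> H \<Longrightarrow> a \<odot>\<^bsub>M\<^esub> v \<in> H"
  shows "submodule H R M"
proof -
  interpret M: module R M by fact
  have "\<ominus>\<^bsub>M\<^esub> v \<in> H" if "v \<in> H" for v
  proof -
    have "v \<in> carrier M" using that assms(2) by blast
    then show ?thesis using sm[of "\<ominus>\<^bsub>R\<^esub> \<one>\<^bsub>R\<^esub>", OF _ that] by (simp add: M.smult_l_minus)
  qed
  then show ?thesis using assms by (intro M.submoduleI) auto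
qed

lemma graded_submodule_module:
  assumes "module R M" "submodule S R M"
  shows "module R (graded_submodule M S)"
  by (rule module_record_cong[OF submodule.submodule_is_module[OF assms(2,1)]]) (simp_all add: graded_submodule_def)

lemma quotient_module_simps:
  fixes N :: "('a, 'b) graded_module"
  assumes N: "module R N" and B: "submodule B R N"
  shows "carrier (quotient_module N B) = (\<lambda>v. B +>\<^bsub>N\<^esub> v) ` carrier N"
    and "\<zero>\<^bsub>quotient_module N B\<^esub> = B +>\<^bsub>N\<^esub> \<zero>\<^bsub>N\<^esub>"
    and "\<And>u v. u \<in> carrier N \<Longrightarrow> v \<in> carrier N \<Longrightarrow>
      (B +>\<^bsub>N\<^esub> u) \<oplus>\<^bsub>quotient_module N B\<^esub> (B +>\<^bsub>N\<^esub> v) = B +>\<^bsub>N\<^esub> (u \<oplus>\<^bsub>N\<^esub> v)"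
    and "\<And>a v. a \<in> carrier R \<Longrightarrow> v \<in> carrier N \<Longrightarrow>
      a \<odot>\<^bsub>quotient_module N B\<^esub> (B +>\<^bsub>N\<^esub> v) = B +>\<^bsub>N\<^esub> (a \<odot>\<^bsub>N\<^esub> v)"
    and "\<And>u v. u \<in> carrier N \<Longrightarrow> v \<in> carrier N \<Longrightarrow> B +>\<^bsub>N\<^esub> u = B +>\<^bsub>N\<^esub> v \<longleftrightarrow> u \<ominus>\<^bsub>N\<^esub> v \<in> B"
proof -
  interpret N: module R N by fact
  have sub: "additive_subgroup B N" using submodule.axioms(1)[OF B] by (simp add: additive_subgroup_def)
  note Br = additive_subgroupD[OF N.abelian_group_axioms sub]
  interpret B: abelian_subgroup B N by (rule abelian_subgroupI3[OF sub N.abelian_group_axioms])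
  show "carrier (quotient_module N B) = (\<lambda>v. B +>\<^bsub>N\<^esub> v) ` carrier N"
    by (auto simp: quotient_module_def A_RCOSETS_def')
  show "\<zero>\<^bsub>quotient_module N B\<^esub> = B +>\<^bsub>N\<^esub> \<zero>\<^bsub>N\<^esub>"
    using B.a_rcos_const[OF Br(2)] by (simp add: quotient_module_def)
  show "(B +>\<^bsub>N\<^esub> u) \<oplus>\<^bsub>quotient_module N B\<^esub> (B +>\<^bsub>N\<^esub> v) = B +>\<^bsub>N\<^esub> (u \<oplus>\<^bsub>N\<^esub> v)"
    if "u \<in> carrier N" "v \<in> carrier N" for u v
    using B.a_rcos_sum[OF that] by (simp add: quotient_module_def)
  show eq: "B +>\<^bsub>N\<^esub> u = B +>\<^bsub>N\<^esub> v \<longleftrightarrow> u \<ominus>\<^bsub>N\<^esub> v \<in> B" if uv: "u \<in> carrier N" "v \<in> carrier N" for u v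
  proof
    assume "B +>\<^bsub>N\<^esub> u = B +>\<^bsub>N\<^esub> v"
    then have "u \<in> B +>\<^bsub>N\<^esub> v" using B.a_rcos_self[OF uv(1)] by simp
    then show "u \<ominus>\<^bsub>N\<^esub> v \<in> B" using B.a_rcos_module_imp[OF uv(2)] by (simp add: a_minus_def)
  next
    assume "u \<ominus>\<^bsub>N\<^esub> v \<in> B"
    then have "u \<in> B +>\<^bsub>N\<^esub> v" using B.a_rcos_module_rev[OF uv(2,1)] by (simp add: a_minus_def)
    then show "B +>\<^bsub>N\<^esub> u = B +>\<^bsub>N\<^esub> v" using B.a_repr_independence'[OF _ uv(2)] by simp
  qed
  show "a \<odot>\<^bsub>quotient_module N B\<^esub> (B +>\<^bsub>N\<^esub> v) = B +>\<^bsub>N\<^esub> (a \<odot>\<^bsub>N\<^esub> v)"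
    if a: "a \<in> carrier R" and v: "v \<in> carrier N" for a v
  proof -
    \<comment> \<open>\<open>B\<close> is closed under scalars, so all members of the union defining
      scalar multiplication are the same coset.\<close>
    have "B +>\<^bsub>N\<^esub> (a \<odot>\<^bsub>N\<^esub> w) = B +>\<^bsub>N\<^esub> (a \<odot>\<^bsub>N\<^esub> v)" if w: "w \<in> B +>\<^bsub>N\<^esub> v" for w
    proof -
      have wc: "w \<in> carrier N" using B.a_elemrcos_carrier[OF v w] .
      have "w \<oplus>\<^bsub>N\<^esub> \<ominus>\<^bsub>N\<^esub> v \<in> B" using B.a_rcos_module_imp[OF v w] .
      then have "a \<odot>\<^bsub>N\<^esub> (w \<oplus>\<^bsub>N\<^esub> \<ominus>\<^bsub>N\<^esub> v) \<in> B" by (rule submodule.smult_closed[OF B a])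
      then have "a \<odot>\<^bsub>N\<^esub> w \<ominus>\<^bsub>N\<^esub> a \<odot>\<^bsub>N\<^esub> v \<in> B"
        using a v wc by (simp add: N.smult_r_distr N.smult_r_minus a_minus_def)
      then show ?thesis using eq a v wc by simp
    qed
    then have "(\<Union>w\<in>B +>\<^bsub>N\<^esub> v. B +>\<^bsub>N\<^esub> (a \<odot>\<^bsub>N\<^esub> w)) = (\<Union>w\<in>B +>\<^bsub>N\<^esub> v. B +>\<^bsub>N\<^esub> (a \<odot>\<^bsub>N\<^esub> v))"
      by (rule SUP_cong[OF refl])
    also have "\<dots> = B +>\<^bsub>N\<^esub> (a \<odot>\<^bsub>N\<^esub> v)" using B.a_rcos_self[OF v] by blast
    finally show ?thesis by (simp add: quotient_module_def)
  qed
qed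

section \<open>Degree 0 parts of quotients as vector spaces\<close>

lemma algebra_scalars:
  fixes R :: "('k, 'a, 'm) module_scheme"
  assumes "algebra K R"
  shows "\<And>c. c \<in> carrier K \<Longrightarrow> c \<odot>\<^bsub>R\<^esub> \<one>\<^bsub>R\<^esub> \<in> carrier R"
    and "\<And>c c'. c \<in> carrier K \<Longrightarrow> c' \<in> carrier K \<Longrightarrow> (c \<oplus>\<^bsub>K\<^esub> c') \<odot>\<^bsub>R\<^esub> \<one>\<^bsub>R\<^esub> = c \<odot>\<^bsub>R\<^esub> \<one>\<^bsub>R\<^esub> \<oplus>\<^bsub>R\<^esub> c' \<odot>\<^bsub>R\<^esub> \<one>\<^bsub>R\<^esub>"
    and "\<And>c c'. c \<in> carrier K \<Longrightarrow> c' \<in> carrier K \<Longrightarrow> (c \<otimes>\<^bsub>K\<^esub> c') \<odot>\<^bsub>R\<^esub> \<one>\<^bsub>R\<^esub> = (c \<odot>\<^bsub>R\<^esub> \<one>\<^bsub>R\<^esub>) \<otimes>\<^bsub>R\<^esub> (c' \<odot>\<^bsub>R\<^esub> \<one>\<^bsub>R\<^esub>)"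
    and "\<one>\<^bsub>K\<^esub> \<odot>\<^bsub>R\<^esub> \<one>\<^bsub>R\<^esub> = \<one>\<^bsub>R\<^esub>" "\<zero>\<^bsub>K\<^esub> \<odot>\<^bsub>R\<^esub> \<one>\<^bsub>R\<^esub> = \<zero>\<^bsub>R\<^esub>"
proof -
  interpret algebra K R by fact
  show "(c \<otimes>\<^bsub>K\<^esub> c') \<odot>\<^bsub>R\<^esub> \<one>\<^bsub>R\<^esub> = (c \<odot>\<^bsub>R\<^esub> \<one>\<^bsub>R\<^esub>) \<otimes>\<^bsub>R\<^esub> (c' \<odot>\<^bsub>R\<^esub> \<one>\<^bsub>R\<^esub>)"
    if "c \<in> carrier K" "c' \<in> carrier K" for c c'
    using that smult_assoc2[of c "\<one>\<^bsub>R\<^esub>" "c' \<odot>\<^bsub>R\<^esub> \<one>\<^bsub>R\<^esub>"] by (simp add: smult_assoc1)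
  show "\<And>c. c \<in> carrier K \<Longrightarrow> c \<odot>\<^bsub>R\<^esub> \<one>\<^bsub>R\<^esub> \<in> carrier R"
    "\<And>c c'. c \<in> carrier K \<Longrightarrow> c' \<in> carrier K \<Longrightarrow> (c \<oplus>\<^bsub>K\<^esub> c') \<odot>\<^bsub>R\<^esub> \<one>\<^bsub>R\<^esub> = c \<odot>\<^bsub>R\<^esub> \<one>\<^bsub>R\<^esub> \<oplus>\<^bsub>R\<^esub> c' \<odot>\<^bsub>R\<^esub> \<one>\<^bsub>R\<^esub>"
    "\<one>\<^bsub>K\<^esub> \<odot>\<^bsub>R\<^esub> \<one>\<^bsub>R\<^esub> = \<one>\<^bsub>R\<^esub>" "\<zero>\<^bsub>K\<^esub> \<odot>\<^bsub>R\<^esub> \<one>\<^bsub>R\<^esub> = \<zero>\<^bsub>R\<^esub>"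
    by (simp_all add: smult_l_distr)
qed

lemma degree_part_module:
  fixes R :: "('k, 'a, 'm) module_scheme" and N :: "('a, 'b) graded_module"
  assumes alg: "algebra K R" and N: "module R N" and B: "submodule B R N"
    and P: "piece N 0 \<subseteq> carrier N" "\<zero>\<^bsub>N\<^esub> \<in> piece N 0"
      "\<And>u v. u \<in> piece N 0 \<Longrightarrow> v \<in> piece N 0 \<Longrightarrow> u \<oplus>\<^bsub>N\<^esub> v \<in> piece N 0"
      "\<And>v. v \<in> piece N 0 \<Longrightarrow> \<ominus>\<^bsub>N\<^esub> v \<in> piece N 0"
      "\<And>c v. c \<in> carrier K \<Longrightarrow> v \<in> piece N 0 \<Longrightarrow> (c \<odot>\<^bsub>R\<^esub> \<one>\<^bsub>R\<^esub>) \<odot>\<^bsub>N\<^esub> v \<in> piece N 0"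
  shows "module K (degree_part R (quotient_module N B) 0)" (is "module K ?V")
proof -
  interpret N: module R N by fact
  note q = quotient_module_simps[OF N B]
  let ?q = "\<lambda>v. B +>\<^bsub>N\<^esub> v"
  have Pc: "v \<in> carrier N" if "v \<in> piece N 0" for v using P(1) that by blast
  have V: "carrier ?V = ?q ` piece N 0" "\<zero>\<^bsub>?V\<^esub> = ?q \<zero>\<^bsub>N\<^esub>"
    "add ?V = add (quotient_module N B)" "\<And>c v. c \<odot>\<^bsub>?V\<^esub> v = (c \<odot>\<^bsub>R\<^esub> \<one>\<^bsub>R\<^esub>) \<odot>\<^bsub>quotient_module N B\<^esub> v"
    using q(2) by (simp_all add: degree_part_def quotient_module_def)
  have add: "?q u \<oplus>\<^bsub>?V\<^esub> ?q v = ?q (u \<oplus>\<^bsub>N\<^esub> v)" if "u \<in> piece N 0" "v \<in> piece N 0" for u v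
    unfolding V using q(3) Pc that by simp
  have sm: "c \<odot>\<^bsub>?V\<^esub> ?q v = ?q ((c \<odot>\<^bsub>R\<^esub> \<one>\<^bsub>R\<^esub>) \<odot>\<^bsub>N\<^esub> v)" if "c \<in> carrier K" "v \<in> piece N 0" for c v
    unfolding V using q(4) Pc algebra_scalars(1)[OF alg] that by simp
  have ab: "abelian_group ?V"
  proof (rule abelian_groupI)
    fix u v w assume "u \<in> carrier ?V" "v \<in> carrier ?V" "w \<in> carrier ?V"
    then show "u \<oplus>\<^bsub>?V\<^esub> v \<oplus>\<^bsub>?V\<^esub> w = u \<oplus>\<^bsub>?V\<^esub> (v \<oplus>\<^bsub>?V\<^esub> w)"
      using P(3) Pc add unfolding V(1) by (auto simp: N.a_assoc)
  next
    fix u assume "u \<in> carrier ?V"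
    then obtain u' where u': "u' \<in> piece N 0" "u = ?q u'" unfolding V(1) by blast
    show "\<exists>v\<in>carrier ?V. v \<oplus>\<^bsub>?V\<^esub> u = \<zero>\<^bsub>?V\<^esub>"
      using u' P(4)[OF u'(1)] add[OF P(4)[OF u'(1)] u'(1)] N.l_neg[OF Pc[OF u'(1)]]
      unfolding V(1,2) by (intro bexI[of _ "?q (\<ominus>\<^bsub>N\<^esub> u')"]) auto
    show "\<zero>\<^bsub>?V\<^esub> \<oplus>\<^bsub>?V\<^esub> u = u" using u' add[OF P(2) u'(1)] Pc unfolding V(2) by simp
    fix v assume "v \<in> carrier ?V"
    then obtain v' where v': "v' \<in> piece N 0" "v = ?q v'" unfolding V(1) by blast
    show "u \<oplus>\<^bsub>?V\<^esub> v \<in> carrier ?V" using u' v' add P(3) unfolding V(1) by simp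
    show "u \<oplus>\<^bsub>?V\<^esub> v = v \<oplus>\<^bsub>?V\<^esub> u" using u' v' add Pc by (simp add: N.a_comm)
  qed (use P(2) V in simp)
  show ?thesis
  proof (rule moduleI[OF _ ab])
    interpret algebra K R by fact
    show "cring K" by (rule R_cring)
    note s = algebra_scalars[OF alg]
    have VE: "\<exists>v'\<in>piece N 0. v = ?q v'" if "v \<in> carrier ?V" for v using that unfolding V(1) by blast
    show "c \<odot>\<^bsub>?V\<^esub> v \<in> carrier ?V" if c: "c \<in> carrier K" and v: "v \<in> carrier ?V" for c v
    proof -
      obtain v' where v': "v' \<in> piece N 0" "v = ?q v'" using VE[OF v] by blast
      show ?thesis using sm[OF c v'(1)] v' P(5)[OF c v'(1)] unfolding V(1) by simp
    qed
    show "\<one>\<^bsub>K\<^esub> \<odot>\<^bsub>?V\<^esub> v = v" if v: "v \<in> carrier ?V" for v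
    proof -
      obtain v' where v': "v' \<in> piece N 0" "v = ?q v'" using VE[OF v] by blast
      then show ?thesis using sm[OF _ v'(1), of "\<one>\<^bsub>K\<^esub>"] Pc s(4) by simp
    qed
    show "(c \<oplus>\<^bsub>K\<^esub> c') \<odot>\<^bsub>?V\<^esub> v = c \<odot>\<^bsub>?V\<^esub> v \<oplus>\<^bsub>?V\<^esub> c' \<odot>\<^bsub>?V\<^esub> v"
      if c: "c \<in> carrier K" and c': "c' \<in> carrier K" and v: "v \<in> carrier ?V" for c c' v
    proof -
      obtain v' where v': "v' \<in> piece N 0" "v = ?q v'" using VE[OF v] by blast
      show ?thesis
        using sm[OF _ v'(1)] add[OF P(5)[OF c v'(1)] P(5)[OF c' v'(1)]] v'(2) c c' s(1,2) Pc[OF v'(1)]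
        by (simp add: N.smult_l_distr)
    qed
    show "(c \<otimes>\<^bsub>K\<^esub> c') \<odot>\<^bsub>?V\<^esub> v = c \<odot>\<^bsub>?V\<^esub> (c' \<odot>\<^bsub>?V\<^esub> v)"
      if c: "c \<in> carrier K" and c': "c' \<in> carrier K" and v: "v \<in> carrier ?V" for c c' v
    proof -
      obtain v' where v': "v' \<in> piece N 0" "v = ?q v'" using VE[OF v] by blast
      show ?thesis
        using sm[OF _ v'(1)] sm[OF c P(5)[OF c' v'(1)]] v'(2) c c' s(1,3) Pc[OF v'(1)]
        by (simp add: N.smult_assoc1)
    qed
    show "c \<odot>\<^bsub>?V\<^esub> (v \<oplus>\<^bsub>?V\<^esub> w) = c \<odot>\<^bsub>?V\<^esub> v \<oplus>\<^bsub>?V\<^esub> c \<odot>\<^bsub>?V\<^esub> w"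
      if c: "c \<in> carrier K" and v: "v \<in> carrier ?V" and w: "w \<in> carrier ?V" for c v w
    proof -
      obtain v' where v': "v' \<in> piece N 0" "v = ?q v'" using VE[OF v] by blast
      obtain w' where w': "w' \<in> piece N 0" "w = ?q w'" using VE[OF w] by blast
      show ?thesis
        using sm[OF c v'(1)] sm[OF c w'(1)] sm[OF c P(3)[OF v'(1) w'(1)]] add[OF v'(1) w'(1)]
          add[OF P(5)[OF c v'(1)] P(5)[OF c w'(1)]] v'(2) w'(2) c s(1) Pc[OF v'(1)] Pc[OF w'(1)]
        by (simp add: N.smult_r_distr)
    qed
  qed
qed

text \<open>The relation \<rho> is linear and total on both sides. Applied to differences,
  \<open>bd\<close> says that cosets agree on one side exactly when they agree on the other, which
  gives well-definedness and injectivity together; \<open>right\<close> gives surjectivity.\<close>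

lemma quotient_isomorphism:
  fixes R :: "('k, 'a, 'm) module_scheme" and N :: "('a, 'b) graded_module" and N' :: "('a, 'c) graded_module"
  assumes alg: "algebra K R" and N: "module R N" "submodule B R N" and N': "module R N'" "submodule B' R N'"
    and P: "piece N 0 \<subseteq> carrier N" "\<zero>\<^bsub>N\<^esub> \<in> piece N 0"
      "\<And>u v. u \<in> piece N 0 \<Longrightarrow> v \<in> piece N 0 \<Longrightarrow> u \<oplus>\<^bsub>N\<^esub> v \<in> piece N 0"
      "\<And>c v. c \<in> carrier K \<Longrightarrow> v \<in> piece N 0 \<Longrightarrow> (c \<odot>\<^bsub>R\<^esub> \<one>\<^bsub>R\<^esub>) \<odot>\<^bsub>N\<^esub> v \<in> piece N 0"
    and P': "piece N' 0 \<subseteq> carrier N'" "\<zero>\<^bsub>N'\<^esub> \<in> piece N' 0"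
      "\<And>u v. u \<in> piece N' 0 \<Longrightarrow> v \<in> piece N' 0 \<Longrightarrow> u \<oplus>\<^bsub>N'\<^esub> v \<in> piece N' 0"
      "\<And>c v. c \<in> carrier K \<Longrightarrow> v \<in> piece N' 0 \<Longrightarrow> (c \<odot>\<^bsub>R\<^esub> \<one>\<^bsub>R\<^esub>) \<odot>\<^bsub>N'\<^esub> v \<in> piece N' 0"
    and left: "\<And>z. z \<in> piece N 0 \<Longrightarrow> \<exists>g\<in>piece N' 0. \<rho> z g"
    and right: "\<And>g. g \<in> piece N' 0 \<Longrightarrow> \<exists>z\<in>piece N 0. \<rho> z g"
    and radd: "\<And>z g w h. z \<in> piece N 0 \<Longrightarrow> g \<in> piece N' 0 \<Longrightarrow> w \<in> piece N 0 \<Longrightarrow> h \<in> piece N' 0 \<Longrightarrow>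
      \<rho> z g \<Longrightarrow> \<rho> w h \<Longrightarrow> \<rho> (z \<oplus>\<^bsub>N\<^esub> w) (g \<oplus>\<^bsub>N'\<^esub> h)"
    and rsm: "\<And>c z g. c \<in> carrier K \<Longrightarrow> z \<in> piece N 0 \<Longrightarrow> g \<in> piece N' 0 \<Longrightarrow> \<rho> z g \<Longrightarrow>
      \<rho> ((c \<odot>\<^bsub>R\<^esub> \<one>\<^bsub>R\<^esub>) \<odot>\<^bsub>N\<^esub> z) ((c \<odot>\<^bsub>R\<^esub> \<one>\<^bsub>R\<^esub>) \<odot>\<^bsub>N'\<^esub> g)"
    and bd: "\<And>z g. z \<in> piece N 0 \<Longrightarrow> g \<in> piece N' 0 \<Longrightarrow> \<rho> z g \<Longrightarrow> z \<in> B \<longleftrightarrow> g \<in> B'"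
  shows "module_isomorphic K (degree_part R (quotient_module N B) 0) (degree_part R (quotient_module N' B') 0)"
    (is "module_isomorphic K ?V ?V'")
proof -
  interpret alg: algebra K R by fact
  interpret N: module R N by (rule N(1))
  interpret N': module R N' by (rule N'(1))
  let ?q = "\<lambda>v. B +>\<^bsub>N\<^esub> v" and ?q' = "\<lambda>v. B' +>\<^bsub>N'\<^esub> v"
  note q = quotient_module_simps[OF N] and q' = quotient_module_simps[OF N'] and s = algebra_scalars[OF alg]
  have Pc: "v \<in> carrier N" if "v \<in> piece N 0" for v using P(1) that by blast
  have Pc': "v \<in> carrier N'" if "v \<in> piece N' 0" for v using P'(1) that by blast
  \<comment> \<open>Written through a scalar of \<open>K\<close>, negation is covered by
    \<open>P(4)\<close>, \<open>P'(4)\<close> and \<open>rsm\<close>.\<close>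
  have m1: "(\<ominus>\<^bsub>K\<^esub> \<one>\<^bsub>K\<^esub>) \<odot>\<^bsub>R\<^esub> \<one>\<^bsub>R\<^esub> = \<ominus>\<^bsub>R\<^esub> \<one>\<^bsub>R\<^esub>" using s(4) by (simp add: alg.smult_l_minus)
  have neg: "\<ominus>\<^bsub>N\<^esub> v = ((\<ominus>\<^bsub>K\<^esub> \<one>\<^bsub>K\<^esub>) \<odot>\<^bsub>R\<^esub> \<one>\<^bsub>R\<^esub>) \<odot>\<^bsub>N\<^esub> v" if "v \<in> piece N 0" for v
    unfolding m1 using Pc[OF that] by (simp add: N.smult_l_minus)
  have neg': "\<ominus>\<^bsub>N'\<^esub> v = ((\<ominus>\<^bsub>K\<^esub> \<one>\<^bsub>K\<^esub>) \<odot>\<^bsub>R\<^esub> \<one>\<^bsub>R\<^esub>) \<odot>\<^bsub>N'\<^esub> v" if "v \<in> piece N' 0" for v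
    unfolding m1 using Pc'[OF that] by (simp add: N'.smult_l_minus)
  have Pn: "\<ominus>\<^bsub>N\<^esub> v \<in> piece N 0" if "v \<in> piece N 0" for v unfolding neg[OF that] by (rule P(4)) (use that in auto)
  have Pn': "\<ominus>\<^bsub>N'\<^esub> v \<in> piece N' 0" if "v \<in> piece N' 0" for v unfolding neg'[OF that] by (rule P'(4)) (use that in auto)
  have rminus: "\<rho> (z \<ominus>\<^bsub>N\<^esub> w) (g \<ominus>\<^bsub>N'\<^esub> h)"
    if "z \<in> piece N 0" "g \<in> piece N' 0" "w \<in> piece N 0" "h \<in> piece N' 0" "\<rho> z g" "\<rho> w h" for z g w h
  proof -
    have "\<rho> (\<ominus>\<^bsub>N\<^esub> w) (\<ominus>\<^bsub>N'\<^esub> h)" unfolding neg[OF that(3)] neg'[OF that(4)] by (rule rsm) (use that in auto)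
    then show ?thesis unfolding a_minus_def using that Pn Pn' by (intro radd) auto
  qed
  have V: "carrier ?V = ?q ` piece N 0" "add ?V = add (quotient_module N B)"
    "\<And>c v. c \<odot>\<^bsub>?V\<^esub> v = (c \<odot>\<^bsub>R\<^esub> \<one>\<^bsub>R\<^esub>) \<odot>\<^bsub>quotient_module N B\<^esub> v"
    by (simp_all add: degree_part_def quotient_module_def)
  have V': "carrier ?V' = ?q' ` piece N' 0" "add ?V' = add (quotient_module N' B')"
    "\<And>c v. c \<odot>\<^bsub>?V'\<^esub> v = (c \<odot>\<^bsub>R\<^esub> \<one>\<^bsub>R\<^esub>) \<odot>\<^bsub>quotient_module N' B'\<^esub> v"
    by (simp_all add: degree_part_def quotient_module_def)
  \<comment> \<open>The choice of representatives and of related elements is absorbed by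
    \<open>THE\<close>; \<open>eq\<close> shows that the coset does not depend on it.\<close>
  define \<psi> where "\<psi> V = (THE W. \<exists>z\<in>piece N 0. \<exists>g\<in>piece N' 0. \<rho> z g \<and> V = ?q z \<and> W = ?q' g)" for V
  have eq: "?q z = ?q w \<longleftrightarrow> ?q' g = ?q' h"
    if h: "z \<in> piece N 0" "g \<in> piece N' 0" "w \<in> piece N 0" "h \<in> piece N' 0" "\<rho> z g" "\<rho> w h" for z g w h
  proof -
    have "z \<ominus>\<^bsub>N\<^esub> w \<in> piece N 0" "g \<ominus>\<^bsub>N'\<^esub> h \<in> piece N' 0"
      using h P(3) P'(3) Pn Pn' by (auto simp: a_minus_def)
    from bd[OF this rminus[OF h]] show ?thesis using q(5) q'(5) Pc Pc' h by simp
  qed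
  have \<psi>: "\<psi> (?q z) = ?q' g" if h: "z \<in> piece N 0" "g \<in> piece N' 0" "\<rho> z g" for z g
    unfolding \<psi>_def
  proof (rule the_equality)
    show "\<exists>w\<in>piece N 0. \<exists>h\<in>piece N' 0. \<rho> w h \<and> ?q z = ?q w \<and> ?q' g = ?q' h" using h by blast
    show "W = ?q' g" if "\<exists>w\<in>piece N 0. \<exists>h\<in>piece N' 0. \<rho> w h \<and> ?q z = ?q w \<and> W = ?q' h" for W
      using that eq h by metis
  qed
  have "bij_betw \<psi> (?q ` piece N 0) (?q' ` piece N' 0)"
  proof (rule bij_betw_imageI[OF inj_onI equalityI[OF subsetI subsetI]])
    fix V W assume "V \<in> ?q ` piece N 0" "W \<in> ?q ` piece N 0" and e: "\<psi> V = \<psi> W"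
    then obtain z w where z: "z \<in> piece N 0" "V = ?q z" and w: "w \<in> piece N 0" "W = ?q w" by blast
    obtain g h where "g \<in> piece N' 0" "\<rho> z g" "h \<in> piece N' 0" "\<rho> w h" using left z(1) w(1) by metis
    then show "V = W" using \<psi> eq z w e by metis
  next
    fix V assume "V \<in> \<psi> ` (?q ` piece N 0)"
    then obtain z where z: "z \<in> piece N 0" "V = \<psi> (?q z)" by blast
    then obtain g where "g \<in> piece N' 0" "\<rho> z g" using left by blast
    then show "V \<in> ?q' ` piece N' 0" using \<psi> z by auto
  next
    fix V assume "V \<in> ?q' ` piece N' 0"
    then obtain g where g: "g \<in> piece N' 0" "V = ?q' g" by blast
    then obtain z where "z \<in> piece N 0" "\<rho> z g" using right by blast
    then have "V = \<psi> (?q z)" "?q z \<in> ?q ` piece N 0" using \<psi> g by auto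
    then show "V \<in> \<psi> ` (?q ` piece N 0)" by (rule image_eqI)
  qed
  then have "bij_betw \<psi> (carrier ?V) (carrier ?V')" unfolding V(1) V'(1) .
  moreover have "\<psi> (u \<oplus>\<^bsub>?V\<^esub> v) = \<psi> u \<oplus>\<^bsub>?V'\<^esub> \<psi> v" if uv: "u \<in> carrier ?V" "v \<in> carrier ?V" for u v
  proof -
    obtain z w where z: "z \<in> piece N 0" "u = ?q z" and w: "w \<in> piece N 0" "v = ?q w" using uv unfolding V(1) by blast
    obtain g h where g: "g \<in> piece N' 0" "\<rho> z g" and h: "h \<in> piece N' 0" "\<rho> w h" using left z(1) w(1) by metis
    have "u \<oplus>\<^bsub>?V\<^esub> v = ?q (z \<oplus>\<^bsub>N\<^esub> w)" unfolding V(2) using q(3) Pc z w by simp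
    moreover have "\<psi> u \<oplus>\<^bsub>?V'\<^esub> \<psi> v = ?q' (g \<oplus>\<^bsub>N'\<^esub> h)" unfolding V'(2) using q'(3) Pc' g h \<psi> z w by simp
    ultimately show ?thesis using \<psi>[OF P(3)[OF z(1) w(1)] P'(3)[OF g(1) h(1)] radd[OF z(1) g(1) w(1) h(1) g(2) h(2)]] by simp
  qed
  moreover have "\<psi> (c \<odot>\<^bsub>?V\<^esub> u) = c \<odot>\<^bsub>?V'\<^esub> \<psi> u" if c: "c \<in> carrier K" and u: "u \<in> carrier ?V" for c u
  proof -
    obtain z where z: "z \<in> piece N 0" "u = ?q z" using u unfolding V(1) by blast
    obtain g where g: "g \<in> piece N' 0" "\<rho> z g" using left z(1) by blast
    have "c \<odot>\<^bsub>?V\<^esub> u = ?q ((c \<odot>\<^bsub>R\<^esub> \<one>\<^bsub>R\<^esub>) \<odot>\<^bsub>N\<^esub> z)" unfolding V(3) using q(4) Pc z s(1)[OF c] by simp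
    moreover have "c \<odot>\<^bsub>?V'\<^esub> \<psi> u = ?q' ((c \<odot>\<^bsub>R\<^esub> \<one>\<^bsub>R\<^esub>) \<odot>\<^bsub>N'\<^esub> g)" unfolding V'(3) using q'(4) Pc' g \<psi> z s(1)[OF c] by simp
    ultimately show ?thesis using \<psi>[OF P(4)[OF c z(1)] P'(4)[OF c g(1)] rsm[OF c z(1) g]] by simp
  qed
  moreover have "module K ?V" by (rule degree_part_module[OF alg N P(1-3) Pn P(4)])
  moreover have "module K ?V'" by (rule degree_part_module[OF alg N' P'(1-3) Pn' P'(4)])
  ultimately show ?thesis unfolding module_isomorphic_def by blast
qed

section \<open>The isomorphism\<close>

lemma koszul_module_simps [simp]:
  "carrier (koszul_module R A n d q) = (\<Pi>\<^sub>E S \<in> koszul_index n q. carrier R)"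
  "zero (koszul_module R A n d q) = (\<lambda>S \<in> koszul_index n q. \<zero>\<^bsub>R\<^esub>)"
  "z \<oplus>\<^bsub>koszul_module R A n d q\<^esub> w = (\<lambda>S \<in> koszul_index n q. z S \<oplus>\<^bsub>R\<^esub> w S)"
  "a \<odot>\<^bsub>koszul_module R A n d q\<^esub> z = (\<lambda>S \<in> koszul_index n q. a \<otimes>\<^bsub>R\<^esub> z S)"
  "piece (koszul_module R A n d q) j = (\<Pi>\<^sub>E S \<in> koszul_index n q. int_piece R A (int (\<Sum>i\<in>S. d i) + j))"
  by (simp_all add: koszul_module_def)

lemma graded_submodule_simps [simp]:
  "carrier (graded_submodule M S) = S" "zero (graded_submodule M S) = zero M"
  "add (graded_submodule M S) = add M" "smult (graded_submodule M S) = smult M"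
  "piece (graded_submodule M S) j = piece M j \<inter> S"
  by (simp_all add: graded_submodule_def)

lemma (in graded_ring) koszul_module_module: "module R (koszul_module R A n d q)"
proof (rule moduleI[OF is_cring])
  let ?M = "koszul_module R A n d q"
  have eqI: "z = w" if "z \<in> extensional (koszul_index n q)" "w \<in> extensional (koszul_index n q)"
    "\<And>S. S \<in> koszul_index n q \<Longrightarrow> z S = w S" for z w :: "nat set \<Rightarrow> 'a"
    using that by (rule extensionalityI)
  show "abelian_group ?M"
  proof (rule abelian_groupI)
    show "\<exists>w\<in>carrier ?M. w \<oplus>\<^bsub>?M\<^esub> z = \<zero>\<^bsub>?M\<^esub>" if "z \<in> carrier ?M" for z
    proof (rule bexI[of _ "\<lambda>S\<in>koszul_index n q. \<ominus> z S"])
      show "(\<lambda>S\<in>koszul_index n q. \<ominus> z S) \<oplus>\<^bsub>?M\<^esub> z = \<zero>\<^bsub>?M\<^esub>"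
        using that l_neg by (intro eqI) (auto simp: PiE_iff)
    qed (use that in auto)
    show "\<zero>\<^bsub>?M\<^esub> \<oplus>\<^bsub>?M\<^esub> z = z" if "z \<in> carrier ?M" for z
      using that by (intro eqI) (auto simp: PiE_iff)
    show "z \<oplus>\<^bsub>?M\<^esub> w = w \<oplus>\<^bsub>?M\<^esub> z" if "z \<in> carrier ?M" "w \<in> carrier ?M" for z w
      using that a_comm by (intro eqI) (auto simp: PiE_iff)
    show "z \<oplus>\<^bsub>?M\<^esub> w \<oplus>\<^bsub>?M\<^esub> v = z \<oplus>\<^bsub>?M\<^esub> (w \<oplus>\<^bsub>?M\<^esub> v)" if "z \<in> carrier ?M" "w \<in> carrier ?M" "v \<in> carrier ?M" for z w v
      using that a_assoc by (intro eqI) (auto simp: PiE_iff)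
  qed auto
  show "(a \<oplus> b) \<odot>\<^bsub>?M\<^esub> z = a \<odot>\<^bsub>?M\<^esub> z \<oplus>\<^bsub>?M\<^esub> b \<odot>\<^bsub>?M\<^esub> z"
    if "a \<in> carrier R" "b \<in> carrier R" "z \<in> carrier ?M" for a b z
    using that l_distr by (intro eqI) (auto simp: PiE_iff)
  show "a \<odot>\<^bsub>?M\<^esub> (z \<oplus>\<^bsub>?M\<^esub> w) = a \<odot>\<^bsub>?M\<^esub> z \<oplus>\<^bsub>?M\<^esub> a \<odot>\<^bsub>?M\<^esub> w"
    if "a \<in> carrier R" "z \<in> carrier ?M" "w \<in> carrier ?M" for a z w
    using that r_distr by (intro eqI) (auto simp: PiE_iff)
  show "(a \<otimes> b) \<odot>\<^bsub>?M\<^esub> z = a \<odot>\<^bsub>?M\<^esub> (b \<odot>\<^bsub>?M\<^esub> z)"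
    if "a \<in> carrier R" "b \<in> carrier R" "z \<in> carrier ?M" for a b z
    using that m_assoc by (intro eqI) (auto simp: PiE_iff)
  show "\<one> \<odot>\<^bsub>?M\<^esub> z = z" if "z \<in> carrier ?M" for z
    using that by (intro eqI) (auto simp: PiE_iff)
qed auto

context koszul_resolution begin

interpretation I: module R "I p" for p by (rule gm_module[OF I_graded])
interpretation ID: decomposed_group "I p" "piece (I p)" for p by (rule gm_decomp[OF I_graded])

abbreviation "KM \<equiv> koszul_module R A n d"
abbreviation "KZ \<equiv> cocycles KM (koszul_diff R n x)"
abbreviation "KB \<equiv> coboundaries KM (koszul_diff R n x)"
abbreviation "KN \<equiv> \<lambda>r. graded_submodule (KM r) (KZ r)"

abbreviation "GM \<equiv> \<lambda>p. torsion_functor R \<mm> (I p)"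
abbreviation "GZ \<equiv> cocycles GM \<delta>"
abbreviation "GB \<equiv> coboundaries GM \<delta>"
abbreviation "GN \<equiv> \<lambda>r. graded_submodule (GM r) (GZ r)"

section \<open>The Koszul side\<close>

lemma cell_index: "cell (int r) 0 T \<longleftrightarrow> T \<in> koszul_index n r"
  and cell_index_Suc: "cell (int r + 1) 0 T \<longleftrightarrow> T \<in> koszul_index n (Suc r)"
  by (auto simp: cell_def koszul_index_def)

text \<open>The sign moves from the product to the coefficient, which makes the rules for
  \<open>kd\<close> available for the given cocomplex.\<close>

lemma koszul_diff_kd:
  assumes z: "z \<in> carrier (KM q)"
  shows "koszul_diff R n x q z = (\<lambda>T \<in> koszul_index n (Suc q). kd RR z T)"
  unfolding koszul_diff_def
proof (rule restrict_ext)
  fix T assume T: "T \<in> koszul_index n (Suc q)"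
  have c: "i < n" "z (T - {i}) \<in> carrier R" if "i \<in> T" for i
    using koszul_index_sub[OF T] koszul_index_remove[OF T that] z that by (auto simp: PiE_iff)
  show "(\<Oplus>i\<in>T. if even (card {j \<in> T. j < i}) then x i \<otimes> z (T - {i}) else \<ominus> (x i \<otimes> z (T - {i}))) = kd RR z T"
    unfolding kd_def regular_module_finsum
    by (rule finsum_cong'[OF refl]) (use c in \<open>auto simp: kx_def pos_def l_minus\<close>)
qed

lemma KZ_mem: "z \<in> KZ r \<longleftrightarrow> z \<in> carrier (KM r) \<and> (\<forall>T\<in>koszul_index n (Suc r). kd RR z T = \<zero>)"
  unfolding cocycles_def using koszul_diff_kd[of z r] by (auto simp: fun_eq_iff restrict_def)

lemma KM_kd:
  assumes T: "T \<in> koszul_index n (Suc r)" and z: "z \<in> carrier (KM r)"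
  shows "kd RR z T \<in> carrier R"
    and "w \<in> carrier (KM r) \<Longrightarrow> kd RR (z \<oplus>\<^bsub>KM r\<^esub> w) T = kd RR z T \<oplus> kd RR w T"
    and "a \<in> carrier R \<Longrightarrow> kd RR (a \<odot>\<^bsub>KM r\<^esub> z) T = a \<otimes> kd RR z T"
proof -
  have i: "T - {i} \<in> koszul_index n r" if "i \<in> T" for i using koszul_index_remove[OF T that] .
  note sub = koszul_index_sub[OF T]
  have zc: "z (T - {i}) \<in> carrier RR" if "i \<in> T" for i using z i[OF that] by auto
  show "kd RR z T \<in> carrier R" using kd_closed[OF RR_graded sub, of z] zc by simp
  show "kd RR (z \<oplus>\<^bsub>KM r\<^esub> w) T = kd RR z T \<oplus> kd RR w T" if w: "w \<in> carrier (KM r)"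
  proof -
    have wc: "w (T - {i}) \<in> carrier RR" if "i \<in> T" for i using w i[OF that] by auto
    have "kd RR (z \<oplus>\<^bsub>KM r\<^esub> w) T = kd RR (\<lambda>T. z T \<oplus>\<^bsub>RR\<^esub> w T) T"
      by (rule kd_cong[OF RR_graded sub]) (use zc wc i in auto)
    then show ?thesis using kd_add[OF RR_graded sub, of z w] zc wc by simp
  qed
  show "kd RR (a \<odot>\<^bsub>KM r\<^esub> z) T = a \<otimes> kd RR z T" if a: "a \<in> carrier R"
  proof -
    have "kd RR (a \<odot>\<^bsub>KM r\<^esub> z) T = kd RR (\<lambda>T. a \<odot>\<^bsub>RR\<^esub> z T) T"
      by (rule kd_cong[OF RR_graded sub]) (use zc a i in auto)
    then show ?thesis using kd_smult[OF RR_graded sub a, of z] zc by simp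
  qed
qed

lemma KZ_submodule: "submodule (KZ r) R (KM r)"
proof (rule submoduleI_smult[OF koszul_module_module])
  interpret M: module R "KM r" by (rule koszul_module_module)
  show "KZ r \<subseteq> carrier (KM r)" by (auto simp: cocycles_def)
  have "kd RR \<zero>\<^bsub>KM r\<^esub> T = \<zero>" if "T \<in> koszul_index n (Suc r)" for T
    using kd_zero[OF RR_graded koszul_index_sub[OF that], of "\<zero>\<^bsub>KM r\<^esub>"] koszul_index_remove[OF that] by simp
  then show "\<zero>\<^bsub>KM r\<^esub> \<in> KZ r" unfolding KZ_mem using M.M.zero_closed by blast
  show "z \<oplus>\<^bsub>KM r\<^esub> w \<in> KZ r" if "z \<in> KZ r" "w \<in> KZ r" for z w
    using that KM_kd(2)[of _ r z w] M.M.a_closed[of z w] unfolding KZ_mem by simp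
  show "a \<odot>\<^bsub>KM r\<^esub> z \<in> KZ r" if "a \<in> carrier R" "z \<in> KZ r" for a z
    using that KM_kd(3)[of _ r z a] M.smult_closed[of a z] unfolding KZ_mem by simp
qed

lemma KN_module: "module R (KN r)"
  by (rule graded_submodule_module[OF koszul_module_module KZ_submodule])

lemma KB_Suc: "KB (Suc q) = (\<lambda>y. \<lambda>T \<in> koszul_index n (Suc q). kd RR y T) ` carrier (KM q)"
  unfolding coboundaries.simps using koszul_diff_kd[of _ q] by (rule image_cong[OF refl])

lemma KB_submodule: "submodule (KB r) R (KN r)"
proof (rule submoduleI_smult[OF KN_module])
  interpret N: module R "KN r" by (rule KN_module)
  have "KB r \<subseteq> KZ r \<and> \<zero>\<^bsub>KN r\<^esub> \<in> KB r \<and> (\<forall>u\<in>KB r. \<forall>v\<in>KB r. u \<oplus>\<^bsub>KN r\<^esub> v \<in> KB r) \<and>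
    (\<forall>a\<in>carrier R. \<forall>v\<in>KB r. a \<odot>\<^bsub>KN r\<^esub> v \<in> KB r)"
  proof (cases r)
    case 0
    have B: "KB r = {\<zero>\<^bsub>KN r\<^esub>}" using 0 by (simp only: coboundaries.simps graded_submodule_simps)
    have "\<zero>\<^bsub>KN r\<^esub> \<in> KZ r" using N.M.zero_closed by (simp only: graded_submodule_simps)
    then show ?thesis
      unfolding B using N.M.l_zero[OF N.M.zero_closed] N.smult_r_null
      by (intro conjI ballI; (elim singletonE)?; simp only: singleton_iff insert_subset empty_subsetI simp_thms)
  next
    case (Suc q)
    interpret M: module R "KM q" by (rule koszul_module_module)
    let ?D = "\<lambda>y. \<lambda>T \<in> koszul_index n (Suc q). kd RR y T"
    have D: "?D y \<in> KZ r" if y: "y \<in> carrier (KM q)" for y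
      unfolding KZ_mem
    proof (intro conjI ballI)
      show "?D y \<in> carrier (KM r)" using KM_kd(1)[OF _ y] Suc by auto
      fix T assume T: "T \<in> koszul_index n (Suc r)"
      have i: "T - {i} \<in> koszul_index n (Suc q)" if "i \<in> T" for i using koszul_index_remove[OF T that] Suc by simp
      have ij: "y (T - {i} - {j}) \<in> carrier RR" if "i \<in> T" "j \<in> T" "i \<noteq> j" for i j
        using y koszul_index_remove[OF i[OF that(1)], of j] that by auto
      have "kd RR (?D y) T = kd RR (kd RR y) T"
        by (rule kd_cong[OF RR_graded koszul_index_sub[OF T]]) (use i KM_kd(1)[OF _ y] in auto)
      then show "kd RR (?D y) T = \<zero>" using kd_kd[OF RR_graded koszul_index_sub[OF T], of y] ij by simp
    qed
    have add: "?D y \<oplus>\<^bsub>KM r\<^esub> ?D w = ?D (y \<oplus>\<^bsub>KM q\<^esub> w)" if "y \<in> carrier (KM q)" "w \<in> carrier (KM q)" for y w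
      using KM_kd(2)[OF _ that] Suc by (auto simp: fun_eq_iff simp del: koszul_module_simps(3)) (auto simp: restrict_def)
    have sm: "a \<odot>\<^bsub>KM r\<^esub> ?D y = ?D (a \<odot>\<^bsub>KM q\<^esub> y)" if "a \<in> carrier R" "y \<in> carrier (KM q)" for a y
      using KM_kd(3)[OF _ that(2,1)] Suc by (auto simp: fun_eq_iff simp del: koszul_module_simps(4)) (auto simp: restrict_def)
    have zero: "\<zero>\<^bsub>KM r\<^esub> = ?D \<zero>\<^bsub>KM q\<^esub>"
    proof -
      have "kd RR \<zero>\<^bsub>KM q\<^esub> T = \<zero>" if "T \<in> koszul_index n (Suc q)" for T
        using kd_zero[OF RR_graded koszul_index_sub[OF that], of "\<zero>\<^bsub>KM q\<^esub>"] koszul_index_remove[OF that] by simp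
      then show ?thesis using Suc by (auto simp: restrict_def fun_eq_iff)
    qed
    show ?thesis
      unfolding Suc KB_Suc
    proof (intro conjI ballI)
      show "?D ` carrier (KM q) \<subseteq> KZ (Suc q)" using D Suc by blast
      show "\<zero>\<^bsub>KN (Suc q)\<^esub> \<in> ?D ` carrier (KM q)" 
        unfolding graded_submodule_simps zero[unfolded Suc] by (rule imageI[OF M.M.zero_closed])
      show "u \<oplus>\<^bsub>KN (Suc q)\<^esub> v \<in> ?D ` carrier (KM q)" if uv: "u \<in> ?D ` carrier (KM q)" "v \<in> ?D ` carrier (KM q)" for u v
      proof -
        obtain y w where y: "y \<in> carrier (KM q)" "u = ?D y" and w: "w \<in> carrier (KM q)" "v = ?D w" using uv by blast
        have "u \<oplus>\<^bsub>KN (Suc q)\<^esub> v = ?D (y \<oplus>\<^bsub>KM q\<^esub> w)" unfolding graded_submodule_simps using add[OF y(1) w(1)] y w Suc by simp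
        then show ?thesis using M.M.a_closed[OF y(1) w(1)] by (rule image_eqI)
      qed
      show "a \<odot>\<^bsub>KN (Suc q)\<^esub> v \<in> ?D ` carrier (KM q)" if a: "a \<in> carrier R" and v: "v \<in> ?D ` carrier (KM q)" for a v
      proof -
        obtain y where y: "y \<in> carrier (KM q)" "v = ?D y" using v by blast
        have "a \<odot>\<^bsub>KN (Suc q)\<^esub> v = ?D (a \<odot>\<^bsub>KM q\<^esub> y)" unfolding graded_submodule_simps using sm[OF a y(1)] y Suc by simp
        then show ?thesis using M.smult_closed[OF a y(1)] by (rule image_eqI)
      qed
    qed
  qed
  then show "KB r \<subseteq> carrier (KN r)" "\<zero>\<^bsub>KN r\<^esub> \<in> KB r" "\<And>u v. u \<in> KB r \<Longrightarrow> v \<in> KB r \<Longrightarrow> u \<oplus>\<^bsub>KN r\<^esub> v \<in> KB r"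
    "\<And>a v. a \<in> carrier R \<Longrightarrow> v \<in> KB r \<Longrightarrow> a \<odot>\<^bsub>KN r\<^esub> v \<in> KB r"
    by simp_all
qed

lemma KN_piece: "z \<in> piece (KN r) 0 \<longleftrightarrow> z \<in> extensional (koszul_index n r) \<and> koszul_cocycle r z"
proof -
  have "z \<in> piece (KM r) 0 \<longleftrightarrow> z \<in> extensional (koszul_index n r) \<and> z \<in> koszul_piece (int r)"
    by (auto simp: PiE_iff koszul_piece_def cell_index wt_def)
  moreover have "z \<in> carrier (KM r)" if "z \<in> extensional (koszul_index n r)" "z \<in> koszul_piece (int r)"
    using that koszul_pieceD(2)[OF that(2)] by (auto simp: PiE_iff cell_index)
  ultimately show ?thesis by (auto simp: koszul_cocycle_def KZ_mem cell_index_Suc simp del: koszul_module_simps)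
qed

text \<open>A preimage in \<open>KB\<close> has arbitrary entries. Taking of each entry at
  \<open>U\<close> the component of degree \<open>wt U\<close> gives a preimage of degree 0, since
  the differential respects degrees and \<open>z\<close> has degree 0.\<close>

lemma KB_koszul_coboundary:
  assumes z: "z \<in> piece (KN r) 0" shows "z \<in> KB r \<longleftrightarrow> koszul_coboundary r z"
proof -
  have ze: "z \<in> extensional (koszul_index n r)" and zp: "z \<in> koszul_piece (int r)"
    using z unfolding KN_piece koszul_cocycle_def by auto
  show ?thesis
  proof (cases r)
    case 0
    have "koszul_coboundary r z \<longleftrightarrow> (\<forall>T. cell 0 0 T \<longrightarrow> z T = \<zero>)"
    proof -
      have "kd RR y T = \<zero>" if "cell 0 0 T" for y T
      proof -
        have "T = {}" using that cell_finite[OF that] by (simp add: cell_def)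
        then show ?thesis by (simp add: kd_def)
      qed
      moreover have "(\<lambda>_. \<zero>) \<in> koszul_piece (int r - 1)" using int_piece_rules(1) by (simp add: koszul_piece_def)
      ultimately show ?thesis using 0 by (auto simp: koszul_coboundary_def)
    qed
    also have "\<dots> \<longleftrightarrow> z = (\<lambda>S\<in>koszul_index n 0. \<zero>)"
      using cell_index[of 0] ze 0 by (auto simp: fun_eq_iff restrict_def extensional_def)
    finally show ?thesis using 0 by simp
  next
    case (Suc q)
    have i1: "int r - 1 = int q" using Suc by simp
    show ?thesis
    proof
      assume "z \<in> KB r"
      then obtain y where y: "y \<in> carrier (KM q)" "z = (\<lambda>T \<in> koszul_index n (Suc q). kd RR y T)"
        unfolding Suc KB_Suc by blast
      let ?y = "\<lambda>U. dcomp RR (wt U) (y U)"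
      have yc: "y U \<in> carrier R" if "U \<in> koszul_index n q" for U using y(1) that by auto
      have "?y \<in> koszul_piece (int r - 1)"
        unfolding i1 koszul_piece_def cell_index using dcomp_RR_mem(1)[OF yc] by simp
      moreover have "z T = kd RR ?y T" if T: "T \<in> koszul_index n (Suc q)" for T
      proof -
        interpret RR: decomposed_group RR "piece RR" using gm_decomp RR_graded .
        have rem: "T - {i} \<in> koszul_index n q" if "i \<in> T" for i by (rule koszul_index_remove[OF T that])
        have kc: "kx i T \<otimes> y (T - {i}) \<in> carrier R" if "i \<in> T" for i
          using koszul_index_sub[OF T] that yc[OF rem[OF that]] by auto
        have "dcomp RR (wt T) (kd RR y T) = finsum RR (\<lambda>i. dcomp RR (wt T) (kx i T \<odot>\<^bsub>RR\<^esub> y (T - {i}))) T"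
          unfolding kd_def
          by (rule additive_finsum[OF RR_abelian_group RR_abelian_group _ RR.hcomp_add]) (use kc RR.hcomp_closed in auto)
        also have "\<dots> = kd RR ?y T"
          unfolding kd_def
        proof (rule RR.finsum_cong'[OF refl])
          show "(\<lambda>i. kx i T \<odot>\<^bsub>RR\<^esub> ?y (T - {i})) \<in> T \<rightarrow> carrier RR"
            using koszul_index_sub[OF T] dcomp_RR_mem(2)[OF yc[OF rem]] by auto
          fix i assume i: "i \<in> T"
          then have "i < n" using koszul_index_sub[OF T] by auto
          then show "dcomp RR (wt T) (kx i T \<odot>\<^bsub>RR\<^esub> y (T - {i})) = kx i T \<odot>\<^bsub>RR\<^esub> ?y (T - {i})"
            using dcomp_smult[OF RR_graded kx_degree[of i T], of "y (T - {i})" "wt (T - {i})"] yc[OF rem[OF i]]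
              wt_remove[OF RR_graded koszul_index_sub[OF T] i] by simp
        qed
        finally have "dcomp RR (wt T) (kd RR y T) = kd RR ?y T" .
        moreover have "kd RR y T = z T" using y(2) T by simp
        moreover have "dcomp RR (wt T) (z T) = z T"
          using RR.hcomp_homogeneous[of "z T" "wt T" "wt T"] koszul_pieceD(1)[OF zp] T Suc cell_index[of r T] by simp
        ultimately show ?thesis by simp
      qed
      ultimately show "koszul_coboundary r z" unfolding koszul_coboundary_def cell_index using Suc by blast
    next
      assume "koszul_coboundary r z"
      then obtain y where y: "y \<in> koszul_piece (int q)" "\<And>T. T \<in> koszul_index n (Suc q) \<Longrightarrow> z T = kd RR y T"
        unfolding koszul_coboundary_def cell_index i1 using Suc by blast
      \<comment> \<open>Off the index set \<open>y\<close> is arbitrary, while elements of the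
        carrier must be \<open>undefined\<close> there; \<open>kd\<close> reads values on the index
        set only.\<close>
      let ?y = "restrict y (koszul_index n q)"
      have yc: "y U \<in> carrier R" if "U \<in> koszul_index n q" for U
        using koszul_pieceD(2)[OF y(1)] that cell_index by blast
      have "kd RR y T = kd RR ?y T" if T: "T \<in> koszul_index n (Suc q)" for T
        by (rule kd_cong[OF RR_graded koszul_index_sub[OF T]]) (use yc koszul_index_remove[OF T] in auto)
      then have "z = (\<lambda>T \<in> koszul_index n (Suc q). kd RR ?y T)"
        using y(2) ze Suc by (auto simp: fun_eq_iff restrict_def extensional_def)
      moreover have "?y \<in> carrier (KM q)" using yc by auto
      ultimately show "z \<in> KB r" unfolding Suc KB_Suc by (rule image_eqI)
    qed
  qed
qed

section \<open>The local cohomology side\<close>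

lemma GM_simps: "GM p = graded_submodule (I p) (TI p)"
  unfolding torsion_functor_def tors_eq[OF I_graded] ..

lemma GZ_eq: "GZ r = {v \<in> TI r. \<delta> r v = \<zero>\<^bsub>I (Suc r)\<^esub>}"
  unfolding cocycles_def GM_simps by simp

lemma GB_0: "GB 0 = {\<zero>\<^bsub>I 0\<^esub>}" and GB_Suc: "GB (Suc q) = \<delta> q ` TI q"
  unfolding coboundaries.simps GM_simps by simp_all

lemma GN_simps:
  "carrier (GN r) = GZ r" "zero (GN r) = zero (I r)" "add (GN r) = add (I r)" "smult (GN r) = smult (I r)"
  "piece (GN r) j = piece (I r) j \<inter> GZ r"
  unfolding GM_simps using GZ_eq[of r] by (auto simp: GM_simps)

lemma GN_module: "module R (GN r)"
proof -
  have "submodule (GZ r) R (I r)"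
  proof (rule submoduleI_smult[OF I.module_axioms])
    show "GZ r \<subseteq> carrier (I r)" unfolding GZ_eq by (auto intro: tors_carrier)
    show "\<zero>\<^bsub>I r\<^esub> \<in> GZ r" using tors_zero[OF I_graded] unfolding GZ_eq by simp
    show "u \<oplus>\<^bsub>I r\<^esub> v \<in> GZ r" if "u \<in> GZ r" "v \<in> GZ r" for u v
      using that tors_add[OF I_graded] \<delta>_rules(3)[of u r v] tors_carrier[of u "I r"] tors_carrier[of v "I r"] unfolding GZ_eq by simp
    show "a \<odot>\<^bsub>I r\<^esub> v \<in> GZ r" if "a \<in> carrier R" "v \<in> GZ r" for a v
      using that tors_smult[OF I_graded] \<delta>_rules(4)[of a v r] tors_carrier[of v "I r"] unfolding GZ_eq by simp
  qed
  from graded_submodule_module[OF I.module_axioms this] show ?thesis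
    by (rule module_record_cong) (simp_all only: graded_submodule_simps GM_simps)
qed

lemma GB_submodule: "submodule (GB r) R (GN r)"
proof (rule submoduleI_smult[OF GN_module], unfold GN_simps)
  have "GB r \<subseteq> GZ r \<and> \<zero>\<^bsub>I r\<^esub> \<in> GB r \<and> (\<forall>u\<in>GB r. \<forall>v\<in>GB r. u \<oplus>\<^bsub>I r\<^esub> v \<in> GB r) \<and>
    (\<forall>a\<in>carrier R. \<forall>v\<in>GB r. a \<odot>\<^bsub>I r\<^esub> v \<in> GB r)"
  proof (cases r)
    case 0
    then show ?thesis unfolding 0 GB_0 GZ_eq using tors_zero[OF I_graded] by auto
  next
    case (Suc q)
    show ?thesis
      unfolding Suc GB_Suc
    proof (intro conjI ballI)
      show "\<delta> q ` TI q \<subseteq> GZ (Suc q)"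
        unfolding GZ_eq using tors_hom[OF I_graded I_graded \<delta>_hom] \<delta>_\<delta> tors_carrier[of _ "I q"] by blast
      show "\<zero>\<^bsub>I (Suc q)\<^esub> \<in> \<delta> q ` TI q" using \<delta>_zero tors_zero[OF I_graded] by (metis image_eqI)
      show "u \<oplus>\<^bsub>I (Suc q)\<^esub> v \<in> \<delta> q ` TI q" if uv: "u \<in> \<delta> q ` TI q" "v \<in> \<delta> q ` TI q" for u v
      proof -
        obtain u' v' where u: "u' \<in> TI q" "u = \<delta> q u'" and v: "v' \<in> TI q" "v = \<delta> q v'" using uv by blast
        have "u \<oplus>\<^bsub>I (Suc q)\<^esub> v = \<delta> q (u' \<oplus>\<^bsub>I q\<^esub> v')"
          using \<delta>_rules(3)[OF tors_carrier[OF u(1)] tors_carrier[OF v(1)]] u v by simp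
        then show ?thesis using tors_add[OF I_graded u(1) v(1)] by (rule image_eqI)
      qed
      show "a \<odot>\<^bsub>I (Suc q)\<^esub> v \<in> \<delta> q ` TI q" if a: "a \<in> carrier R" and vv: "v \<in> \<delta> q ` TI q" for a v
      proof -
        obtain v' where v: "v' \<in> TI q" "v = \<delta> q v'" using vv by blast
        have "a \<odot>\<^bsub>I (Suc q)\<^esub> v = \<delta> q (a \<odot>\<^bsub>I q\<^esub> v')" using \<delta>_rules(4)[OF a tors_carrier[OF v(1)]] v by simp
        then show ?thesis using tors_smult[OF I_graded a v(1)] by (rule image_eqI)
      qed
    qed
  qed
  then show "GB r \<subseteq> GZ r" "\<zero>\<^bsub>I r\<^esub> \<in> GB r" "\<And>u v. u \<in> GB r \<Longrightarrow> v \<in> GB r \<Longrightarrow> u \<oplus>\<^bsub>I r\<^esub> v \<in> GB r"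
    "\<And>a v. a \<in> carrier R \<Longrightarrow> v \<in> GB r \<Longrightarrow> a \<odot>\<^bsub>I r\<^esub> v \<in> GB r"
    by simp_all
qed

lemma GN_piece: "g \<in> piece (GN r) 0 \<longleftrightarrow> torsion_cocycle r g"
  unfolding GN_simps unfolding GZ_eq torsion_cocycle_def by auto

text \<open>A preimage is replaced by its component of degree \<open>j\<close>, which is still
  torsion by \<open>tors_dcomp\<close>.\<close>

lemma GB_homogeneous:
  assumes g: "g \<in> piece (I r) j"
  shows "g \<in> GB r \<longleftrightarrow> (r = 0 \<longrightarrow> g = \<zero>\<^bsub>I r\<^esub>) \<and> (\<forall>q. r = Suc q \<longrightarrow> (\<exists>u\<in>TI q. u \<in> piece (I q) j \<and> g = \<delta> q u))"
proof (cases r)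
  case 0 then show ?thesis unfolding 0 GB_0 by simp
next
  case (Suc q)
  have "\<exists>u'\<in>TI q. u' \<in> piece (I q) j \<and> g = \<delta> q u'" if u: "u \<in> TI q" "g = \<delta> q u" for u
  proof -
    have "dcomp (I (Suc q)) j (\<delta> q u) = \<delta> q (dcomp (I q) j u)"
      by (rule dcomp_hom[OF I_graded I_graded \<delta>_hom tors_carrier[OF u(1)]])
    moreover have "dcomp (I (Suc q)) j g = g" using ID.hcomp_homogeneous[OF g, of j] Suc by simp
    ultimately show ?thesis
      using u tors_dcomp[OF I_graded u(1), of j] ID.hcomp_props(1)[OF tors_carrier[OF u(1)], of j] by metis
  qed
  then show ?thesis unfolding Suc GB_Suc by blast
qed

lemma GB_torsion_coboundary: "torsion_cocycle r g \<Longrightarrow> g \<in> GB r \<longleftrightarrow> torsion_coboundary r g"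
  using GB_homogeneous[of g r 0] unfolding torsion_coboundary_def torsion_cocycle_def by blast

lemma local_cohomology_GN: "local_cohomology R \<mm> I \<delta> r = quotient_module (GN r) (GB r)"
  by (simp add: local_cohomology_def cohomology_def)

text \<open>Inverses are defined relative to a carrier, so the difference in the record of cocycles
  has to be identified with that in \<open>I r\<close>.\<close>

lemma GN_minus:
  assumes "u \<in> GZ r" "v \<in> GZ r" shows "u \<ominus>\<^bsub>GN r\<^esub> v = u \<ominus>\<^bsub>I r\<^esub> v"
proof (rule additive_minus[where h = "\<lambda>v. v", OF _ I.abelian_group_axioms])
  show "abelian_group (GN r)" using GN_module[of r] by (simp add: module_def)
  show "(\<lambda>v. v) \<in> carrier (GN r) \<rightarrow> carrier (I r)" using tors_carrier unfolding GN_simps GZ_eq by auto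
qed (use assms in \<open>simp_all only: GN_simps\<close>)

text \<open>By concentration in degree 0, the coset of \<open>v\<close> is also that of some
  \<open>w\<close> of degree 0. Then \<open>v - w\<close> is a coboundary, its component in degree
  \<open>j > 0\<close> is \<open>v\<close>, and components of coboundaries are coboundaries.\<close>

lemma vanishing:
  assumes conc: "carrier (local_cohomology R \<mm> I \<delta> p) = piece (local_cohomology R \<mm> I \<delta> p) 0"
    and j: "0 < j" and v: "v \<in> TI p" "v \<in> piece (I p) j" "\<delta> p v = \<zero>\<^bsub>I (Suc p)\<^esub>"
  shows "(p = 0 \<longrightarrow> v = \<zero>\<^bsub>I p\<^esub>) \<and> (\<forall>p'. p = Suc p' \<longrightarrow> (\<exists>u\<in>TI p'. u \<in> piece (I p') j \<and> \<delta> p' u = v))"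
proof -
  note q = quotient_module_simps[OF GN_module[of p] GB_submodule[of p]]
  have vZ: "v \<in> GZ p" using v by (simp add: GZ_eq)
  have "GB p +>\<^bsub>GN p\<^esub> v \<in> carrier (local_cohomology R \<mm> I \<delta> p)"
    unfolding local_cohomology_GN q(1) GN_simps(1) using vZ by (rule imageI)
  then have "GB p +>\<^bsub>GN p\<^esub> v \<in> (\<lambda>w. GB p +>\<^bsub>GN p\<^esub> w) ` piece (GN p) 0"
    unfolding conc unfolding local_cohomology_GN quotient_module_def by simp
  then obtain w where w: "w \<in> piece (GN p) 0" "GB p +>\<^bsub>GN p\<^esub> v = GB p +>\<^bsub>GN p\<^esub> w" by blast
  have wZ: "w \<in> GZ p" and wp: "w \<in> piece (I p) 0" using w(1) unfolding GN_simps by auto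
  have vw: "v \<ominus>\<^bsub>I p\<^esub> w \<in> GB p"
    using q(5)[of v w] w(2) vZ wZ GN_minus[OF vZ wZ] unfolding GN_simps by simp
  have vc: "v \<in> carrier (I p)" and wc: "w \<in> carrier (I p)" using v(2) wp by auto
  have nz: "\<ominus>\<^bsub>I p\<^esub> \<zero>\<^bsub>I p\<^esub> = \<zero>\<^bsub>I p\<^esub>" by (simp add: a_inv_def)
  have comp: "dcomp (I p) j (v \<ominus>\<^bsub>I p\<^esub> w) = v"
    unfolding a_minus_def
    using vc wc v(2) nz wp j ID.hcomp_homogeneous[OF v(2), of j] ID.hcomp_homogeneous[OF wp, of j]
    by (simp add: ID.hcomp_add ID.hcomp_neg)
  have "v \<in> GB p"
  proof (cases p)
    case 0
    then have "v \<ominus>\<^bsub>I p\<^esub> w = \<zero>\<^bsub>I p\<^esub>" using vw GB_0 by simp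
    then show ?thesis using comp 0 GB_0 by simp
  next
    case (Suc p')
    then obtain u where u: "u \<in> TI p'" "v \<ominus>\<^bsub>I p\<^esub> w = \<delta> p' u" using vw GB_Suc by auto
    have "v = \<delta> p' (dcomp (I p') j u)"
      using comp dcomp_hom[OF I_graded I_graded \<delta>_hom tors_carrier[OF u(1)], of j] u(2) Suc by simp
    then show ?thesis using tors_dcomp[OF I_graded u(1)] Suc GB_Suc by auto
  qed
  then show ?thesis using GB_homogeneous[OF v(2)] by metis
qed

end

theorem theorem4p12:
  fixes K :: "('k, 'p) ring_scheme"
    and R :: "('k, 'a, 'm) module_scheme"
    and A :: "nat \<Rightarrow> 'a set"
    and \<mm> :: "'a set"
    and n :: nat
    and \<epsilon> :: "'a \<Rightarrow> 'c"
    and I :: "nat \<Rightarrow> ('a, 'c) graded_module"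
    and \<delta> :: "nat \<Rightarrow> 'c \<Rightarrow> 'c"
  assumes "field K"
    and "algebra K R"
    and "nat_graded_ring R A"
    and "bij_betw (\<lambda>c. c \<odot>\<^bsub>R\<^esub> \<one>\<^bsub>R\<^esub>) (carrier K) (A 0)"
    and "noetherian_ring R"
    and "maximalideal \<mm> R" and "homogeneous_ideal R A \<mm>"
    and "krull_dim R = enat n"
    and "graded_injective_resolution R A (regular_module R A) \<epsilon> I \<delta>"
    and "\<forall>r<n. carrier (local_cohomology R \<mm> I \<delta> r) = piece (local_cohomology R \<mm> I \<delta> r) 0"
  shows "\<forall>r<n. \<forall>x d. homogeneous_sop R A \<mm> n x d \<longrightarrow>
    module_isomorphic K
      (degree_part R (koszul_cohomology R A n x d r) 0)
      (restrict_scalars R (local_cohomology R \<mm> I \<delta> r))"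
proof (intro allI impI)
  fix r x d assume r: "r < n" and sop: "homogeneous_sop R A \<mm> n x d"
  interpret K: field K by fact
  note s = algebra_scalars[OF assms(2)]
  have A0: "c \<odot>\<^bsub>R\<^esub> \<one>\<^bsub>R\<^esub> \<in> A 0" if "c \<in> carrier K" for c
    using assms(4) that by (auto simp: bij_betw_def)
  have cr: "cring R" using assms(3) by (simp add: nat_graded_ring_def)
  interpret graded_ring R A
    by (intro graded_ring.intro graded_ring_axioms.intro cr assms(3)) (use A0[OF K.one_closed] s(4) in simp)
  \<comment> \<open>A nonzero element of \<open>A 0\<close> is a nonzero scalar of the field
    \<open>K\<close> times \<one>, and the inverse scalar inverts it.\<close>
  have units: "a \<in> Units R" if a: "a \<in> A 0" "a \<noteq> \<zero>\<^bsub>R\<^esub>" for a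
  proof -
    obtain c where c: "c \<in> carrier K" "a = c \<odot>\<^bsub>R\<^esub> \<one>\<^bsub>R\<^esub>" using assms(4) a(1) by (auto simp: bij_betw_def)
    then have "c \<noteq> \<zero>\<^bsub>K\<^esub>" using a(2) s(5) by auto
    then have cU: "c \<in> Units K" using c(1) K.field_Units by simp
    have "(inv\<^bsub>K\<^esub> c) \<odot>\<^bsub>R\<^esub> \<one>\<^bsub>R\<^esub> \<otimes>\<^bsub>R\<^esub> a = \<one>\<^bsub>R\<^esub>"
      using s(3)[of "inv\<^bsub>K\<^esub> c" c] s(4) c cU by simp
    moreover have "(inv\<^bsub>K\<^esub> c) \<odot>\<^bsub>R\<^esub> \<one>\<^bsub>R\<^esub> \<in> carrier R" using s(1) cU by simp
    ultimately show ?thesis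
      using A_carrier[OF a(1)] m_comm[of a "(inv\<^bsub>K\<^esub> c) \<odot>\<^bsub>R\<^esub> \<one>\<^bsub>R\<^esub>"]
      unfolding Units_def by (intro CollectI conjI bexI[of _ "(inv\<^bsub>K\<^esub> c) \<odot>\<^bsub>R\<^esub> \<one>\<^bsub>R\<^esub>"]) simp_all
  qed
  have "graded_local_ring R A \<mm>"
    by (intro graded_local_ring.intro graded_local_ring_axioms.intro graded_ring_axioms assms(5-7) units)
  moreover have "koszul R A n x d"
    using sop by (intro koszul.intro koszul_axioms.intro graded_ring_axioms) (simp add: homogeneous_sop_def)
  ultimately have "koszul_parameters R A \<mm> n x d"
    using sop by (intro koszul_parameters.intro koszul_parameters_axioms.intro) (simp_all add: homogeneous_sop_def)
  then interpret koszul_resolution R A \<mm> n x d I \<delta> \<epsilon>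
    using sop assms(9) by (intro koszul_resolution.intro koszul_resolution_axioms.intro) (simp_all add: homogeneous_sop_def)
  note van = vanishing[OF assms(10)[rule_format]]
  let ?N = "KN r" and ?N' = "GN r"
  note KNm = KN_module[of r] and GNm = GN_module[of r]
  interpret N: module R ?N by (rule KNm)
  interpret N': module R ?N' by (rule GNm)
  have ap: "a \<odot>\<^bsub>?N\<^esub> z \<in> piece ?N 0" if a: "a \<in> A 0" and z: "z \<in> piece ?N 0" for a z
  proof -
    have "a \<odot>\<^bsub>KM r\<^esub> z \<in> piece (KM r) 0"
      using z int_piece_rules(3)[of a 0] a int_piece_int[of 0] by (fastforce simp: PiE_iff)
    then show ?thesis using N.smult_closed[OF A_carrier[OF a], of z] z by simp
  qed
  have ap': "a \<odot>\<^bsub>?N'\<^esub> g \<in> piece ?N' 0" if a: "a \<in> A 0" and g: "g \<in> piece ?N' 0" for a g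
    using N'.smult_closed[OF A_carrier[OF a], of g] smult_A_piece[OF I_graded a, of g r 0] g unfolding GN_simps by simp
  have zr: "z \<in> koszul_piece (int r)" if "z \<in> piece ?N 0" for z using that unfolding KN_piece koszul_cocycle_def by simp
  have "module_isomorphic K (degree_part R (quotient_module ?N (KB r)) 0) (degree_part R (quotient_module ?N' (GB r)) 0)"
  proof (rule quotient_isomorphism[where \<rho> = "corresponds r", OF assms(2) KNm KB_submodule GNm GB_submodule])
    show "piece ?N 0 \<subseteq> carrier ?N" by simp
    show "\<zero>\<^bsub>?N\<^esub> \<in> piece ?N 0" using N.M.zero_closed int_piece_rules(1) by simp
    show "u \<oplus>\<^bsub>?N\<^esub> v \<in> piece ?N 0" if "u \<in> piece ?N 0" "v \<in> piece ?N 0" for u v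
      using that N.M.a_closed[of u v] int_piece_rules(2) by (auto simp: PiE_iff)
    show "(c \<odot>\<^bsub>R\<^esub> \<one>\<^bsub>R\<^esub>) \<odot>\<^bsub>?N\<^esub> v \<in> piece ?N 0" if "c \<in> carrier K" "v \<in> piece ?N 0" for c v
      by (rule ap[OF A0[OF that(1)] that(2)])
    show "piece ?N' 0 \<subseteq> carrier ?N'" unfolding GN_simps by simp
    show "\<zero>\<^bsub>?N'\<^esub> \<in> piece ?N' 0" using N'.M.zero_closed piece_rules(2)[OF I_graded] unfolding GN_simps by simp
    show "u \<oplus>\<^bsub>?N'\<^esub> v \<in> piece ?N' 0" if "u \<in> piece ?N' 0" "v \<in> piece ?N' 0" for u v
      using that N'.M.a_closed[of u v] piece_rules(3)[OF I_graded] unfolding GN_simps by simp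
    show "(c \<odot>\<^bsub>R\<^esub> \<one>\<^bsub>R\<^esub>) \<odot>\<^bsub>?N'\<^esub> v \<in> piece ?N' 0" if "c \<in> carrier K" "v \<in> piece ?N' 0" for c v
      by (rule ap'[OF A0[OF that(1)] that(2)])
    show "\<exists>g\<in>piece ?N' 0. corresponds r z g" if "z \<in> piece ?N 0" for z
    proof -
      obtain g where g: "corresponds r z g" using corresponds_left \<open>z \<in> piece ?N 0\<close> unfolding KN_piece by blast
      then show ?thesis using corresponds_torsion_cocycle by (intro bexI[of _ g]) (simp_all only: GN_piece)
    qed
    show "\<exists>z\<in>piece ?N 0. corresponds r z g" if "g \<in> piece ?N' 0" for g
    proof -
      have "torsion_cocycle r g" using that unfolding GN_piece .
      then obtain z where z: "koszul_cocycle r z" "corresponds r z g" using corresponds_right[OF van r] by blast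
      \<comment> \<open>\<open>corresponds_right\<close> leaves \<open>z\<close> arbitrary off the
        index set, while elements of the Koszul module must be \<open>extensional\<close>.\<close>
      let ?z = "restrict z (koszul_index n r)"
      have zp: "z \<in> koszul_piece (int r)" using z(1) by (simp add: koszul_cocycle_def)
      have zc: "z S \<in> carrier RR" if "S \<in> koszul_index n r" for S
        using koszul_pieceD(2)[OF zp] that cell_index by simp
      have "kd RR ?z T = \<zero>\<^bsub>R\<^esub>" if T: "T \<in> koszul_index n (Suc r)" for T
      proof -
        have "kd RR ?z T = kd RR z T"
          by (rule kd_cong[OF RR_graded koszul_index_sub[OF T]]) (use zc koszul_index_remove[OF T] in auto)
        then show ?thesis using z(1) T by (simp add: koszul_cocycle_def cell_index_Suc)
      qed
      then have "koszul_cocycle r ?z" using zp by (simp add: koszul_cocycle_def koszul_piece_def cell_index cell_index_Suc)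
      moreover have "\<one>\<^bsub>R\<^esub> \<odot>\<^bsub>I r\<^esub> g = g"
        using \<open>torsion_cocycle r g\<close> piece_sub[OF I_graded, of g r 0] module.smult_one[OF gm_module[OF I_graded]] by (simp add: torsion_cocycle_def)
      then have "corresponds r ?z g"
        using corresponds_smult[OF one_degree_0 z(2) zp, of ?z] zc cell_index[of r] by simp
      moreover have "?z \<in> extensional (koszul_index n r)" by simp
      ultimately show ?thesis by (intro bexI[of _ ?z]) (simp_all only: KN_piece simp_thms)
    qed
    show "corresponds r (z \<oplus>\<^bsub>?N\<^esub> w) (g \<oplus>\<^bsub>?N'\<^esub> h)" if "z \<in> piece ?N 0" "w \<in> piece ?N 0" "corresponds r z g" "corresponds r w h" for z g w h
      using corresponds_add[OF that(3,4) zr[OF that(1)] zr[OF that(2)], of "z \<oplus>\<^bsub>?N\<^esub> w"] cell_index[of r] unfolding GN_simps by simp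
    show "corresponds r ((c \<odot>\<^bsub>R\<^esub> \<one>\<^bsub>R\<^esub>) \<odot>\<^bsub>?N\<^esub> z) ((c \<odot>\<^bsub>R\<^esub> \<one>\<^bsub>R\<^esub>) \<odot>\<^bsub>?N'\<^esub> g)" if "c \<in> carrier K" "z \<in> piece ?N 0" "corresponds r z g" for c z g
      using corresponds_smult[OF A0[OF that(1)] that(3) zr[OF that(2)], of "(c \<odot>\<^bsub>R\<^esub> \<one>\<^bsub>R\<^esub>) \<odot>\<^bsub>?N\<^esub> z"] cell_index[of r] unfolding GN_simps by simp
    show "z \<in> KB r \<longleftrightarrow> g \<in> GB r" if "z \<in> piece ?N 0" "g \<in> piece ?N' 0" "corresponds r z g" for z g
      using KB_koszul_coboundary[OF that(1)] GB_torsion_coboundary[of r g] corresponds_bd1[OF that(3)] corresponds_bd2[OF van r that(3) _ zr[OF that(1)]] that(2)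
      unfolding GN_piece by blast
  qed
  \<comment> \<open>By hypothesis all of local cohomology is its degree 0 part, so the two vector
    spaces are the same record.\<close>
  moreover have "restrict_scalars R (local_cohomology R \<mm> I \<delta> r) = degree_part R (local_cohomology R \<mm> I \<delta> r) 0"
    using assms(10) r by (simp add: restrict_scalars_def degree_part_def)
  ultimately show "module_isomorphic K (degree_part R (koszul_cohomology R A n x d r) 0) (restrict_scalars R (local_cohomology R \<mm> I \<delta> r))"
    unfolding local_cohomology_GN koszul_cohomology_def cohomology_def by simp
qed

end
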